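(* Let $Q$ be an acyclic affine quiver, $\mathbf{F}_q$ a finite field, and let $f\in\mathbf{H}_{Q,\mathbf{F}_q,\mathcal R}$ be a regular cuspidal function. Then the comultiplication $\Delta(f)\in\mathbf{H}_{Q,\mathbf{F}_q}\otimes\mathbf{H}_{Q,\mathbf{F}_q}$ is the sum of its primitive part $f\otimes1+1\otimes f$ and of terms of the form $c\,[I]\otimes[P]$ with $c\in\mathbf{C}$, $I$ a preinjective representation and $P$ a preprojective representation of $Q$ over $\mathbf{F}_q$.
   Context: Hall algebra. Let $Q=(I,\Omega)$ be a finite quiver and $\nu=\sqrt q$. On $\mathbf{Z}^I$ the Euler form is $\langle \mathbf d,\mathbf d'\rangle=\sum_{i\in I} d_id'_i-\sum_{\alpha:i\to j}d_id'_j$ and its symmetrization is $(\mathbf d,\mathbf d')=\langle\mathbf d,\mathbf d'\rangle+\langle\mathbf d',\mathbf d\rangle$. Representations are finite dimensional over $\mathbf{F}_q$; write $a_M=|\mathrm{Aut}(M)|$ and let $F^R_{M,N}$ be the number of subrepresentations $X\subset R$ with $X\simeq N$, $R/X\simeq M$. The Hall algebra $\mathbf{H}_{Q,\mathbf{F}_q}=\bigoplus_{[M]}\mathbf{C}[M]$ ($[M]$ over isomorphism classes) has multiplication $[M]\star[N]=\nu^{\langle \dim M,\dim N\rangle}\sum_{[R]}F^R_{M,N}[R]$, unit $1=[0]$, and comultiplication $\Delta([R])=\sum_{[U],[V]}\nu^{\langle \dim U,\dim V\rangle}F^R_{U,V}\frac{a_Ua_V}{a_R}[U]\otimes[V]$.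 Affine quivers. An affine quiver is a quiver whose underlying graph is an extended Dynkin diagram; it is acyclic if it has no oriented cycles. $\delta\in\mathbf{N}^I$ is the indivisible positive generator of the kernel of $(-,-)$. For $Q$ acyclic affine, an indecomposable representation $M$ is preprojective, regular or preinjective according to whether $\langle\delta,\dim M\rangle$ is $<0$, $=0$ or $>0$; a general representation is preprojective (resp. regular, preinjective) if all its indecomposable direct summands are. Regular Hall algebra. $\mathbf{H}_{Q,\mathbf{F}_q,\mathcal R}$ is the span of the $[M]$ with $M$ regular; $\Delta_{\mathcal R}$ is $\Delta$ restricted to $\mathbf{H}_{Q,\mathbf{F}_q,\mathcal R}$, keeping only the terms $[U]\otimes[V]$ with $U$ and $V$ both regular. A function $f\in\mathbf{H}_{Q,\mathbf{F}_q,\mathcal R}$ is regular cuspidal if $\Delta_{\mathcal R}(f)=f\otimes1+1\otimes f$. *)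

theory Defs
  imports
    "Jordan_Normal_Form.VS_Connect"
    "HOL-Algebra.AbelCoset"
    "HOL-Library.Poly_Mapping"
    Complex_Main
begin

section \<open>Quivers, Euler form, affine quivers\<close>

text \<open>The vertex set and the arrow set of a finite quiver are the finite types \<open>'i\<close> and \<open>'e\<close>.
  Loops and multiple arrows are allowed.\<close>

record ('i, 'e) quiver =
  src :: "'e \<Rightarrow> 'i"
  tgt :: "'e \<Rightarrow> 'i"

definition euler_form ::
    "('i::finite, 'e::finite) quiver \<Rightarrow> ('i \<Rightarrow> int) \<Rightarrow> ('i \<Rightarrow> int) \<Rightarrow> int" where
  "euler_form Q d d' =
     (\<Sum>i\<in>UNIV. d i * d' i) - (\<Sum>a\<in>UNIV. d (src Q a) * d' (tgt Q a))"

definition sym_euler_form ::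
    "('i::finite, 'e::finite) quiver \<Rightarrow> ('i \<Rightarrow> int) \<Rightarrow> ('i \<Rightarrow> int) \<Rightarrow> int" where
  "sym_euler_form Q d d' = euler_form Q d d' + euler_form Q d' d"

definition acyclic_quiver :: "('i, 'e) quiver \<Rightarrow> bool" where
  "acyclic_quiver Q \<longleftrightarrow> acyclic (range (\<lambda>a. (src Q a, tgt Q a)))"

text \<open>An undirected multigraph on the vertices \<open>0, \<dots>, N - 1\<close> is a pair of \<open>N\<close> and its multiset of
  edges, an edge being the set of its end points (a loop is a singleton). In \<open>A n\<close>, the case
  \<open>n = 0\<close> is one vertex with a loop and \<open>n = 1\<close> is a double edge. The three diagrams of type
  \<open>E\<close> are stars with centre \<open>0\<close> and arms of lengths \<open>2, 2, 2\<close>, \<open>3, 3, 1\<close> and \<open>5, 2, 1\<close>.\<close>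

inductive_set extended_dynkin :: "(nat \<times> nat set multiset) set" where
  A: "(n + 1, {# {k, (k + 1) mod (n + 1)}. k \<in># mset [0..<n + 1] #}) \<in> extended_dynkin"
| D: "n \<ge> 4 \<Longrightarrow>
      (n + 1, {# {0, 2}, {1, 2} #} + {# {k, k + 1}. k \<in># mset [2..<n - 2] #}
               + {# {n - 2, n - 1}, {n - 2, n} #}) \<in> extended_dynkin"
| E6: "(7, {# {0, 1}, {1, 2}, {0, 3}, {3, 4}, {0, 5}, {5, 6} #}) \<in> extended_dynkin"
| E7: "(8, {# {0, 1}, {1, 2}, {2, 3}, {0, 4}, {4, 5}, {5, 6}, {0, 7} #}) \<in> extended_dynkin"
| E8: "(9, {# {0, 1}, {1, 2}, {2, 3}, {3, 4}, {4, 5}, {0, 6}, {6, 7}, {0, 8} #}) \<in> extended_dynkin"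

definition affine_quiver :: "('i::finite, 'e::finite) quiver \<Rightarrow> bool" where
  "affine_quiver Q \<longleftrightarrow>
     (\<exists>N E \<phi>. (N, E) \<in> extended_dynkin \<and> bij_betw \<phi> (UNIV :: 'i set) {..<N} \<and>
        {# {\<phi> (src Q a), \<phi> (tgt Q a)}. a \<in># mset_set (UNIV :: 'e set) #} = E)"

definition delta :: "('i::finite, 'e::finite) quiver \<Rightarrow> 'i \<Rightarrow> int" where
  "delta Q = (THE d. (\<forall>i. d i \<ge> 0) \<and> Gcd (range d) = 1 \<and>
     {x. \<forall>y. sym_euler_form Q x y = 0} = range (\<lambda>n i. n * d i))"


section \<open>Representations\<close>

text \<open>General linear representations, used to state what it means for a subrepresentation or a
  quotient to be isomorphic to a given representation. Scalars range over the field type \<open>'k\<close>.\<close>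

record ('i, 'e, 'k, 'v) linrep =
  space :: "'i \<Rightarrow> ('k, 'v) module"
  act :: "'e \<Rightarrow> 'v \<Rightarrow> 'v"

definition rep_isos :: "('i, 'e) quiver \<Rightarrow> ('i, 'e, 'k::field, 'v) linrep \<Rightarrow>
    ('i, 'e, 'k, 'w) linrep \<Rightarrow> ('i \<Rightarrow> 'v \<Rightarrow> 'w) set" where
  "rep_isos Q M N =
     {\<phi>. (\<forall>i. \<phi> i \<in> extensional (carrier (space M i)) \<and>
              \<phi> i \<in> LinearCombinations.module_hom class_ring (space M i) (space N i) \<and>
              bij_betw (\<phi> i) (carrier (space M i)) (carrier (space N i))) \<and>
         (\<forall>a. \<forall>v\<in>carrier (space M (src Q a)).
              \<phi> (tgt Q a) (act M a v) = act N a (\<phi> (src Q a) v))}"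

definition isomorphic_reps :: "('i, 'e) quiver \<Rightarrow> ('i, 'e, 'k::field, 'v) linrep \<Rightarrow>
    ('i, 'e, 'k, 'w) linrep \<Rightarrow> bool" where
  "isomorphic_reps Q M N \<longleftrightarrow> rep_isos Q M N \<noteq> {}"

definition subrep :: "('i, 'e) quiver \<Rightarrow> ('i, 'e, 'k::field, 'v) linrep \<Rightarrow> ('i \<Rightarrow> 'v set) \<Rightarrow> bool" where
  "subrep Q R X \<longleftrightarrow> (\<forall>i. VectorSpace.subspace class_ring (X i) (space R i)) \<and>
                    (\<forall>a. act R a ` X (src Q a) \<subseteq> X (tgt Q a))"

definition sub_linrep :: "('i, 'e, 'k, 'v) linrep \<Rightarrow> ('i \<Rightarrow> 'v set) \<Rightarrow> ('i, 'e, 'k, 'v) linrep" where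
  "sub_linrep R X = \<lparr>space = (\<lambda>i. (space R i)\<lparr>carrier := X i\<rparr>), act = act R\<rparr>"

text \<open>The elements of \<open>R / X\<close> are the cosets of \<open>X\<close>; scalars and arrows act on representatives.
  The multiplicative fields of a \<open>module\<close> record play no role.\<close>

definition quotient_space :: "('k, 'v) module \<Rightarrow> 'v set \<Rightarrow> ('k, 'v set) module" where
  "quotient_space V W =
     \<lparr>carrier = a_rcosets\<^bsub>V\<^esub> W, mult = undefined, one = undefined,
      zero = W, add = set_add V, smult = (\<lambda>c S. \<Union>s\<in>S. W +>\<^bsub>V\<^esub> (c \<odot>\<^bsub>V\<^esub> s))\<rparr>"

definition quotient_linrep :: "('i, 'e) quiver \<Rightarrow> ('i, 'e, 'k, 'v) linrep \<Rightarrow> ('i \<Rightarrow> 'v set) \<Rightarrow>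
    ('i, 'e, 'k, 'v set) linrep" where
  "quotient_linrep Q R X =
     \<lparr>space = (\<lambda>i. quotient_space (space R i) (X i)),
      act = (\<lambda>a S. \<Union>s\<in>S. X (tgt Q a) +>\<^bsub>space R (tgt Q a)\<^esub> act R a s)\<rparr>"

text \<open>Finite dimensional representations are taken up to a choice of bases: vertex \<open>i\<close> carries
  \<open>'k ^ rdim i\<close> and arrow \<open>a\<close> the linear map with matrix \<open>rmat a\<close>. Every finite dimensional
  representation is isomorphic to one of these, so they give all isomorphism classes.\<close>

record ('i, 'e, 'k) rep =
  rdim :: "'i \<Rightarrow> nat"
  rmat :: "'e \<Rightarrow> 'k mat"

definition is_rep :: "('i, 'e) quiver \<Rightarrow> ('i, 'e, 'k) rep \<Rightarrow> bool" where
  "is_rep Q M \<longleftrightarrow> (\<forall>a. rmat M a \<in> carrier_mat (rdim M (tgt Q a)) (rdim M (src Q a)))"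

definition linrep_of :: "('i, 'e, 'k::field) rep \<Rightarrow> ('i, 'e, 'k, 'k vec) linrep" where
  "linrep_of M = \<lparr>space = (\<lambda>i. module_vec TYPE('k) (rdim M i)), act = (\<lambda>a v. rmat M a *\<^sub>v v)\<rparr>"

abbreviation rep_iso :: "('i, 'e) quiver \<Rightarrow> ('i, 'e, 'k::field) rep \<Rightarrow> ('i, 'e, 'k) rep \<Rightarrow> bool" where
  "rep_iso Q M N \<equiv> isomorphic_reps Q (linrep_of M) (linrep_of N)"

definition dim_vector :: "('i, 'e, 'k) rep \<Rightarrow> 'i \<Rightarrow> int" where
  "dim_vector M i = int (rdim M i)"

definition zero_rep :: "('i, 'e, 'k::field) rep" where
  "zero_rep = \<lparr>rdim = (\<lambda>_. 0), rmat = (\<lambda>_. 0\<^sub>m 0 0)\<rparr>"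

definition is_zero_rep :: "('i, 'e, 'k) rep \<Rightarrow> bool" where
  "is_zero_rep M \<longleftrightarrow> (\<forall>i. rdim M i = 0)"

definition rep_sum :: "('i, 'e) quiver \<Rightarrow> ('i, 'e, 'k::field) rep \<Rightarrow> ('i, 'e, 'k) rep \<Rightarrow>
    ('i, 'e, 'k) rep" where
  "rep_sum Q M N =
     \<lparr>rdim = (\<lambda>i. rdim M i + rdim N i),
      rmat = (\<lambda>a. four_block_mat
        (rmat M a) (0\<^sub>m (rdim M (tgt Q a)) (rdim N (src Q a)))
        (0\<^sub>m (rdim N (tgt Q a)) (rdim M (src Q a))) (rmat N a))\<rparr>"

definition indecomposable :: "('i, 'e) quiver \<Rightarrow> ('i, 'e, 'k::field) rep \<Rightarrow> bool" where
  "indecomposable Q M \<longleftrightarrow> is_rep Q M \<and> \<not> is_zero_rep M \<and>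
     (\<forall>A B. is_rep Q A \<and> is_rep Q B \<and> rep_iso Q M (rep_sum Q A B) \<longrightarrow>
            is_zero_rep A \<or> is_zero_rep B)"

definition direct_summand :: "('i, 'e) quiver \<Rightarrow> ('i, 'e, 'k::field) rep \<Rightarrow> ('i, 'e, 'k) rep \<Rightarrow> bool" where
  "direct_summand Q N M \<longleftrightarrow>
     is_rep Q N \<and> (\<exists>N'. is_rep Q N' \<and> rep_iso Q M (rep_sum Q N N'))"

definition defect :: "('i::finite, 'e::finite) quiver \<Rightarrow> ('i, 'e, 'k) rep \<Rightarrow> int" where
  "defect Q M = euler_form Q (delta Q) (dim_vector M)"

definition preprojective :: "('i::finite, 'e::finite) quiver \<Rightarrow> ('i, 'e, 'k::field) rep \<Rightarrow> bool" where
  "preprojective Q M \<longleftrightarrow> is_rep Q M \<and>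
     (\<forall>N. indecomposable Q N \<and> direct_summand Q N M \<longrightarrow> defect Q N < 0)"

definition regular :: "('i::finite, 'e::finite) quiver \<Rightarrow> ('i, 'e, 'k::field) rep \<Rightarrow> bool" where
  "regular Q M \<longleftrightarrow> is_rep Q M \<and>
     (\<forall>N. indecomposable Q N \<and> direct_summand Q N M \<longrightarrow> defect Q N = 0)"

definition preinjective :: "('i::finite, 'e::finite) quiver \<Rightarrow> ('i, 'e, 'k::field) rep \<Rightarrow> bool" where
  "preinjective Q M \<longleftrightarrow> is_rep Q M \<and>
     (\<forall>N. indecomposable Q N \<and> direct_summand Q N M \<longrightarrow> defect Q N > 0)"


section \<open>The Hall algebra\<close>

definition iso_class :: "('i, 'e) quiver \<Rightarrow> ('i, 'e, 'k::field) rep \<Rightarrow> ('i, 'e, 'k) rep set" where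
  "iso_class Q M = {N. is_rep Q N \<and> rep_iso Q M N}"

definition iso_classes :: "('i, 'e) quiver \<Rightarrow> ('i, 'e, 'k::field) rep set set" where
  "iso_classes Q = iso_class Q ` {M. is_rep Q M}"

definition regular_classes :: "('i::finite, 'e::finite) quiver \<Rightarrow> ('i, 'e, 'k::field) rep set set" where
  "regular_classes Q = iso_class Q ` {M. regular Q M}"

definition representative :: "('i, 'e, 'k) rep set \<Rightarrow> ('i, 'e, 'k) rep" where
  "representative C = (SOME M. M \<in> C)"

definition aut_count :: "('i, 'e) quiver \<Rightarrow> ('i, 'e, 'k::field) rep \<Rightarrow> nat" where
  "aut_count Q M = card (rep_isos Q (linrep_of M) (linrep_of M))"

text \<open>\<open>hall_number Q R M N\<close> is \<open>F\<^sup>R\<^sub>M\<^sub>,\<^sub>N\<close>: the subrepresentation is \<open>N\<close>, the quotient is \<open>M\<close>.\<close>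

definition hall_number :: "('i, 'e) quiver \<Rightarrow> ('i, 'e, 'k::field) rep \<Rightarrow> ('i, 'e, 'k) rep \<Rightarrow>
    ('i, 'e, 'k) rep \<Rightarrow> nat" where
  "hall_number Q R M N = card {X. subrep Q (linrep_of R) X \<and>
     isomorphic_reps Q (sub_linrep (linrep_of R) X) (linrep_of N) \<and>
     isomorphic_reps Q (quotient_linrep Q (linrep_of R) X) (linrep_of M)}"

text \<open>An element of the Hall algebra is a formal complex linear combination of isomorphism classes,
  and the tensor square has the basis \<open>[U] \<otimes> [V]\<close>, encoded as the pair \<open>([U], [V])\<close>. The types
  below admit arbitrary sets of representations as keys; the Hall algebra and its regular part
  consist of the elements whose keys are classes (of regular representations).\<close>

type_synonym ('i, 'e, 'k) hall = "('i, 'e, 'k) rep set \<Rightarrow>\<^sub>0 complex"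
type_synonym ('i, 'e, 'k) hall_tensor = "('i, 'e, 'k) rep set \<times> ('i, 'e, 'k) rep set \<Rightarrow>\<^sub>0 complex"

definition hall_basis :: "('i, 'e) quiver \<Rightarrow> ('i, 'e, 'k::field) rep \<Rightarrow> ('i, 'e, 'k) hall" where
  "hall_basis Q M = Poly_Mapping.single (iso_class Q M) 1"

definition hall_one :: "('i, 'e) quiver \<Rightarrow> ('i, 'e, 'k::field) hall" where
  "hall_one Q = hall_basis Q zero_rep"

definition hall_scale :: "complex \<Rightarrow> ('a \<Rightarrow>\<^sub>0 complex) \<Rightarrow> 'a \<Rightarrow>\<^sub>0 complex" where
  "hall_scale c f = Poly_Mapping.map (\<lambda>z. c * z) f"

definition hall_tensor :: "('a \<Rightarrow>\<^sub>0 complex) \<Rightarrow> ('b \<Rightarrow>\<^sub>0 complex) \<Rightarrow> 'a \<times> 'b \<Rightarrow>\<^sub>0 complex"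
    (infixr \<open>\<otimes>\<^sub>H\<close> 72) where
  "f \<otimes>\<^sub>H g = (\<Sum>x\<in>Poly_Mapping.keys f. \<Sum>y\<in>Poly_Mapping.keys g.
     Poly_Mapping.single (x, y) (Poly_Mapping.lookup f x * Poly_Mapping.lookup g y))"

definition hall_regular :: "('i::finite, 'e::finite) quiver \<Rightarrow> ('i, 'e, 'k::field) hall set" where
  "hall_regular Q = {f. Poly_Mapping.keys f \<subseteq> regular_classes Q}"

definition hall_nu :: "'k itself \<Rightarrow> complex" where
  "hall_nu _ = complex_of_real (sqrt (real (card (UNIV :: 'k set))))"

text \<open>The sum over all \<open>[U], [V]\<close> is restricted to the pairs with non-zero Hall number, a finite
  set by \<open>finite_hall_pairs\<close> below.\<close>

definition hall_pairs :: "('i, 'e) quiver \<Rightarrow> ('i, 'e, 'k::field) rep \<Rightarrow>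
    (('i, 'e, 'k) rep set \<times> ('i, 'e, 'k) rep set) set" where
  "hall_pairs Q R = {(U, V). U \<in> iso_classes Q \<and> V \<in> iso_classes Q \<and>
     hall_number Q R (representative U) (representative V) \<noteq> 0}"

definition hall_comult_rep :: "('i::finite, 'e::finite) quiver \<Rightarrow> ('i, 'e, 'k::{field,finite}) rep \<Rightarrow>
    ('i, 'e, 'k) hall_tensor" where
  "hall_comult_rep Q R = (\<Sum>(U, V)\<in>hall_pairs Q R.
     let M = representative U; N = representative V in
     Poly_Mapping.single (U, V)
       (hall_nu TYPE('k) powi euler_form Q (dim_vector M) (dim_vector N)
         * of_nat (hall_number Q R M N)
         * (of_nat (aut_count Q M) * of_nat (aut_count Q N) / of_nat (aut_count Q R))))"

definition hall_comult :: "('i::finite, 'e::finite) quiver \<Rightarrow> ('i, 'e, 'k::{field,finite}) hall \<Rightarrow>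
    ('i, 'e, 'k) hall_tensor" where
  "hall_comult Q f = (\<Sum>C\<in>Poly_Mapping.keys f.
     hall_scale (Poly_Mapping.lookup f C) (hall_comult_rep Q (representative C)))"

definition hall_comult_regular :: "('i::finite, 'e::finite) quiver \<Rightarrow>
    ('i, 'e, 'k::{field,finite}) hall \<Rightarrow> ('i, 'e, 'k) hall_tensor" where
  "hall_comult_regular Q f =
     (\<Sum>x \<in> Poly_Mapping.keys (hall_comult Q f) \<inter> regular_classes Q \<times> regular_classes Q.
        Poly_Mapping.single x (Poly_Mapping.lookup (hall_comult Q f) x))"

definition regular_cuspidal :: "('i::finite, 'e::finite) quiver \<Rightarrow>
    ('i, 'e, 'k::{field,finite}) hall \<Rightarrow> bool" where
  "regular_cuspidal Q f \<longleftrightarrow> f \<in> hall_regular Q \<and>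
     hall_comult_regular Q f = f \<otimes>\<^sub>H hall_one Q + hall_one Q \<otimes>\<^sub>H f"


subsection \<open>The sum in the comultiplication is finite\<close>

definition closed_linrep :: "('i, 'e) quiver \<Rightarrow> ('i, 'e, 'k::field, 'v) linrep \<Rightarrow> bool" where
  "closed_linrep Q A \<longleftrightarrow>
     (\<forall>i. \<forall>x\<in>carrier (space A i). \<forall>y\<in>carrier (space A i). x \<oplus>\<^bsub>space A i\<^esub> y \<in> carrier (space A i)) \<and>
     (\<forall>i c. \<forall>x\<in>carrier (space A i). c \<odot>\<^bsub>space A i\<^esub> x \<in> carrier (space A i)) \<and>
     (\<forall>a. \<forall>x\<in>carrier (space A (src Q a)). act A a x \<in> carrier (space A (tgt Q a)))"

lemma isomorphic_reps_euclid:
  assumes A: "closed_linrep Q A" and 1: "isomorphic_reps Q A B" and 2: "isomorphic_reps Q A C"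
  shows "isomorphic_reps Q B C"
proof -
  obtain \<phi> where \<phi>: "\<phi> \<in> rep_isos Q A B" using 1 by (auto simp: isomorphic_reps_def)
  obtain \<psi> where \<psi>: "\<psi> \<in> rep_isos Q A C" using 2 by (auto simp: isomorphic_reps_def)
  define g where "g i = inv_into (carrier (space A i)) (\<phi> i)" for i
  define \<chi> where "\<chi> i = restrict (\<psi> i \<circ> g i) (carrier (space B i))" for i
  have bij: "bij_betw (\<phi> i) (carrier (space A i)) (carrier (space B i))" for i
    using \<phi> by (auto simp: rep_isos_def)
  have gbij: "bij_betw (g i) (carrier (space B i)) (carrier (space A i))" for i
    unfolding g_def by (rule bij_betw_inv_into[OF bij])
  have gin: "g i x \<in> carrier (space A i)" if "x \<in> carrier (space B i)" for i x
    using gbij that by (auto simp: bij_betw_def)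
  have \<phi>g: "\<phi> i (g i x) = x" if "x \<in> carrier (space B i)" for i x
    using bij[of i] that by (simp add: g_def bij_betw_inv_into_right)
  have g\<phi>: "g i (\<phi> i x) = x" if "x \<in> carrier (space A i)" for i x
    using bij[of i] that by (simp add: g_def bij_betw_inv_into_left)
  have \<phi>in: "\<phi> i x \<in> carrier (space B i)" if "x \<in> carrier (space A i)" for i x
    using bij[of i] that by (auto simp: bij_betw_def)
  have \<phi>h: "\<phi> i \<in> LinearCombinations.module_hom class_ring (space A i) (space B i)" for i
    using \<phi> by (auto simp: rep_isos_def)
  have \<psi>h: "\<psi> i \<in> LinearCombinations.module_hom class_ring (space A i) (space C i)" for i
    using \<psi> by (auto simp: rep_isos_def)
  have addA: "x \<oplus>\<^bsub>space A i\<^esub> y \<in> carrier (space A i)"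
    if "x \<in> carrier (space A i)" "y \<in> carrier (space A i)" for i x y
    using A that by (auto simp: closed_linrep_def)
  have smA: "c \<odot>\<^bsub>space A i\<^esub> x \<in> carrier (space A i)" if "x \<in> carrier (space A i)" for i c x
    using A that by (auto simp: closed_linrep_def)
  have actA: "act A a x \<in> carrier (space A (tgt Q a))" if "x \<in> carrier (space A (src Q a))" for a x
    using A that by (auto simp: closed_linrep_def)
  have addB: "x \<oplus>\<^bsub>space B i\<^esub> y = \<phi> i (g i x \<oplus>\<^bsub>space A i\<^esub> g i y)"
    if "x \<in> carrier (space B i)" "y \<in> carrier (space B i)" for i x y
    using LinearCombinations.module_hom_add[OF \<phi>h gin[OF that(1)] gin[OF that(2)]] that by (simp add: \<phi>g)
  have smB: "c \<odot>\<^bsub>space B i\<^esub> x = \<phi> i (c \<odot>\<^bsub>space A i\<^esub> g i x)"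
    if "x \<in> carrier (space B i)" for i c x
    using LinearCombinations.module_hom_smult[OF \<phi>h _ gin[OF that], of c] that by (simp add: \<phi>g)
  have actB: "act B a x = \<phi> (tgt Q a) (act A a (g (src Q a) x))"
    if "x \<in> carrier (space B (src Q a))" for a x
  proof -
    have "\<phi> (tgt Q a) (act A a (g (src Q a) x)) = act B a (\<phi> (src Q a) (g (src Q a) x))"
      using \<phi> gin[OF that] unfolding rep_isos_def by blast
    then show ?thesis using that by (simp add: \<phi>g)
  qed
  have "\<chi> \<in> rep_isos Q B C"
    unfolding rep_isos_def
  proof (intro CollectI conjI allI ballI)
    fix i
    show "\<chi> i \<in> extensional (carrier (space B i))" by (simp add: \<chi>_def)
    have "bij_betw (\<psi> i \<circ> g i) (carrier (space B i)) (carrier (space C i))"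
      using gbij[of i] \<psi> by (intro bij_betw_trans) (auto simp: rep_isos_def)
    then show "bij_betw (\<chi> i) (carrier (space B i)) (carrier (space C i))"
      by (rule bij_betw_cong[THEN iffD1, rotated]) (simp add: \<chi>_def)
    show "\<chi> i \<in> LinearCombinations.module_hom class_ring (space B i) (space C i)"
      unfolding LinearCombinations.module_hom_def
      using LinearCombinations.module_hom_closed[OF \<psi>h[of i]] LinearCombinations.module_hom_add[OF \<psi>h[of i]] LinearCombinations.module_hom_smult[OF \<psi>h[of i]]
      by (auto simp: \<chi>_def addB smB g\<phi> \<phi>in addA smA gin)
  next
    fix a v assume v: "v \<in> carrier (space B (src Q a))"
    have "\<psi> (tgt Q a) (act A a (g (src Q a) v)) = act C a (\<psi> (src Q a) (g (src Q a) v))"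
      using \<psi> gin[OF v] unfolding rep_isos_def by blast
    then show "\<chi> (tgt Q a) (act B a v) = act C a (\<chi> (src Q a) v)"
      using v gin[OF v] actA[OF gin[OF v]] by (simp add: \<chi>_def actB g\<phi> \<phi>in)
  qed
  then show ?thesis by (auto simp: isomorphic_reps_def)
qed

lemma isomorphic_reps_refl:
  assumes "closed_linrep Q A"
  shows "isomorphic_reps Q A A"
proof -
  have "(\<lambda>i. restrict id (carrier (space A i))) \<in> rep_isos Q A A"
    using assms
    by (auto simp: rep_isos_def closed_linrep_def LinearCombinations.module_hom_def bij_betw_def inj_on_def)
  then show ?thesis by (auto simp: isomorphic_reps_def)
qed

lemma closed_linrep_of:
  assumes "is_rep Q M"
  shows "closed_linrep Q (linrep_of M)"
proof -
  have "rmat M a \<in> carrier_mat (rdim M (tgt Q a)) (rdim M (src Q a))" for a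
    using assms by (auto simp: is_rep_def)
  then show ?thesis
    by (auto simp: closed_linrep_def linrep_of_def module_vec_simps intro!: mult_mat_vec_carrier)
qed

lemma iso_class_eqI:
  assumes "is_rep Q M" "is_rep Q N" "rep_iso Q M N"
  shows "iso_class Q M = iso_class Q N"
  using assms isomorphic_reps_euclid closed_linrep_of isomorphic_reps_refl
  unfolding iso_class_def by blast

lemma iso_class_representative:
  assumes "C \<in> iso_classes Q"
  shows "is_rep Q (representative C)" "iso_class Q (representative C) = C"
proof -
  obtain M where M: "is_rep Q M" "C = iso_class Q M" using assms by (auto simp: iso_classes_def)
  then have "M \<in> C" by (auto simp: iso_class_def isomorphic_reps_refl closed_linrep_of)
  then have "representative C \<in> C" unfolding representative_def by (rule someI)
  then have *: "is_rep Q (representative C)" "rep_iso Q M (representative C)"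
    using M(2) by (auto simp: iso_class_def)
  show "is_rep Q (representative C)" by fact
  show "iso_class Q (representative C) = C" using iso_class_eqI[OF M(1) *] M(2) by simp
qed

lemma closed_sub_linrep:
  assumes "subrep Q R X"
  shows "closed_linrep Q (sub_linrep R X)"
proof -
  have sm: "LinearCombinations.submodule class_ring (X i) (space R i)" for i
    using assms by (auto simp: subrep_def VectorSpace.subspace_def)
  have "act R a x \<in> X (tgt Q a)" if "x \<in> X (src Q a)" for a x
    using assms that unfolding subrep_def by blast
  then show ?thesis
    using LinearCombinations.submodule.m_closed[OF sm] LinearCombinations.submodule.smult_closed[OF sm]
    by (auto simp: closed_linrep_def sub_linrep_def)
qed

lemma closed_quotient_linrep:
  fixes R :: "('i, 'e, 'k::field) rep"
  assumes R: "is_rep Q R" and X: "subrep Q (linrep_of R) X"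
  shows "closed_linrep Q (quotient_linrep Q (linrep_of R) X)"
proof -
  let ?V = "\<lambda>i. module_vec TYPE('k) (rdim R i)"
  let ?A = "\<lambda>a. rmat R a"
  have sm: "LinearCombinations.submodule class_ring (X i) (?V i)" for i
    using X by (auto simp: subrep_def VectorSpace.subspace_def linrep_of_def)
  have Xsub: "X i \<subseteq> carrier_vec (rdim R i)" for i
    using LinearCombinations.submodule.subset[OF sm] by (simp add: module_vec_simps)
  have Xadd: "x + y \<in> X i" if "x \<in> X i" "y \<in> X i" for i x y
    using LinearCombinations.submodule.m_closed[OF sm that] by (simp add: module_vec_simps)
  have Xsm: "c \<cdot>\<^sub>v x \<in> X i" if "x \<in> X i" for i x c
    using LinearCombinations.submodule.smult_closed[OF sm _ that] by (simp add: module_vec_simps)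
  have X0: "0\<^sub>v (rdim R i) \<in> X i" for i
    using LinearCombinations.submodule.zero_closed[OF sm, of i] by (simp add: module_vec_simps)
  have Xneg: "- x \<in> X i" if "x \<in> X i" for i x
  proof -
    have "- x = (-1) \<cdot>\<^sub>v x" by auto
    then show ?thesis using Xsm[OF that] by metis
  qed
  have Xact: "?A a *\<^sub>v x \<in> X (tgt Q a)" if "x \<in> X (src Q a)" for a x
    using X that by (auto simp: subrep_def linrep_of_def)
  have Am: "?A a \<in> carrier_mat (rdim R (tgt Q a)) (rdim R (src Q a))" for a
    using R by (auto simp: is_rep_def)
  have cos: "X i +>\<^bsub>?V i\<^esub> v = {x + v | x. x \<in> X i}" for i v
    by (auto simp: a_r_coset_def r_coset_def module_vec_simps)
  have rcos: "a_rcosets\<^bsub>?V i\<^esub> (X i) = {{x + v | x. x \<in> X i} | v. v \<in> carrier_vec (rdim R i)}" for i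
    by (auto simp: A_RCOSETS_def RCOSETS_def r_coset_def module_vec_simps)
  have eqI: "{x + v | x. x \<in> X i} = {x + w | x. x \<in> X i}"
    if "v \<in> carrier_vec (rdim R i)" "w \<in> carrier_vec (rdim R i)" "z \<in> X i" "v = z + w" for i v w z
  proof -
    have zc: "z \<in> carrier_vec (rdim R i)" using Xsub that by auto
    have "x + v = (x + z) + w" if "x \<in> X i" for x
      using Xsub[of i] \<open>x \<in> X i\<close> zc \<open>w \<in> _\<close> \<open>v = z + w\<close> by (subst assoc_add_vec) auto
    moreover have "x + w = (x + - z) + v" if "x \<in> X i" for x
    proof -
      have "x \<in> carrier_vec (rdim R i)" using Xsub that by auto
      then show ?thesis using zc \<open>w \<in> _\<close> \<open>v = z + w\<close> by (intro eq_vecI) auto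
    qed
    ultimately show ?thesis using Xadd Xneg \<open>z \<in> X i\<close> by blast
  qed
  have add: "{x + v | x. x \<in> X i} <+>\<^bsub>?V i\<^esub> {x + w | x. x \<in> X i} = {x + (v + w) | x. x \<in> X i}"
    if v: "v \<in> carrier_vec (rdim R i)" and w: "w \<in> carrier_vec (rdim R i)" for i v w
  proof -
    have *: "(x + v) + (y + w) = (x + y) + (v + w)" if "x \<in> X i" "y \<in> X i" for x y
    proof -
      have "x \<in> carrier_vec (rdim R i)" "y \<in> carrier_vec (rdim R i)" using Xsub that by auto
      then show ?thesis using v w by (intro eq_vecI) auto
    qed
    have **: "x + (v + w) = (x + v) + (0\<^sub>v (rdim R i) + w)" if "x \<in> X i" for x
    proof -
      have "x \<in> carrier_vec (rdim R i)" using Xsub that by auto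
      then show ?thesis using v w by (intro eq_vecI) auto
    qed
    have sa: "S <+>\<^bsub>?V i\<^esub> T = {s + t | s t. s \<in> S \<and> t \<in> T}" for S T
      by (auto simp: set_add_def set_mult_def module_vec_simps)
    show ?thesis
      unfolding sa
    proof (intro equalityI subsetI)
      fix z assume "z \<in> {s + t | s t. s \<in> {x + v | x. x \<in> X i} \<and> t \<in> {x + w | x. x \<in> X i}}"
      then obtain x y where "x \<in> X i" "y \<in> X i" "z = (x + v) + (y + w)" by blast
      then have "z = (x + y) + (v + w)" "x + y \<in> X i" using * Xadd by auto
      then show "z \<in> {x + (v + w) | x. x \<in> X i}" by blast
    next
      fix z assume "z \<in> {x + (v + w) | x. x \<in> X i}"
      then obtain x where x: "x \<in> X i" "z = x + (v + w)" by blast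
      then have "z = (x + v) + (0\<^sub>v (rdim R i) + w)" using ** by simp
      then show "z \<in> {s + t | s t. s \<in> {x + v | x. x \<in> X i} \<and> t \<in> {x + w | x. x \<in> X i}}"
        using x X0[of i] by blast
    qed
  qed
  have un: "(\<Union>s\<in>{x + v | x. x \<in> X i}. {x + h s | x. x \<in> X j}) = {x + h v | x. x \<in> X j}"
    if v: "v \<in> carrier_vec (rdim R i)" and hc: "\<And>s. s \<in> carrier_vec (rdim R i) \<Longrightarrow> h s \<in> carrier_vec (rdim R j)"
      and hx: "\<And>x. x \<in> X i \<Longrightarrow> \<exists>z\<in>X j. h (x + v) = z + h v" for i j v and h :: "'k vec \<Rightarrow> 'k vec"
  proof -
    have cst: "{y + h (x + v) | y. y \<in> X j} = {y + h v | y. y \<in> X j}" if x: "x \<in> X i" for x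
    proof -
      obtain z where "z \<in> X j" "h (x + v) = z + h v" using hx[OF x] by auto
      moreover have "h (x + v) \<in> carrier_vec (rdim R j)" "h v \<in> carrier_vec (rdim R j)"
        using hc v x Xsub[of i] by auto
      ultimately show ?thesis using eqI by blast
    qed
    have "(\<Union>s\<in>{x + v | x. x \<in> X i}. {x + h s | x. x \<in> X j})
        = (\<Union>s\<in>{x + v | x. x \<in> X i}. {x + h v | x. x \<in> X j})"
    proof (rule SUP_cong[OF refl])
      fix s assume "s \<in> {x + v | x. x \<in> X i}"
      then obtain x where "x \<in> X i" "s = x + v" by blast
      then show "{x + h s | x. x \<in> X j} = {x + h v | x. x \<in> X j}"
        using cst by simp
    qed
    also have "\<dots> = {x + h v | x. x \<in> X j}" using X0 by blast
    finally show ?thesis .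
  qed
  have sm: "(\<Union>s\<in>{x + v | x. x \<in> X i}. {x + c \<cdot>\<^sub>v s | x. x \<in> X i}) = {x + c \<cdot>\<^sub>v v | x. x \<in> X i}"
    if v: "v \<in> carrier_vec (rdim R i)" for i v c
  proof (rule un[OF v])
    fix x assume x: "x \<in> X i"
    then have "x \<in> carrier_vec (rdim R i)" using Xsub by auto
    then show "\<exists>z\<in>X i. c \<cdot>\<^sub>v (x + v) = z + c \<cdot>\<^sub>v v"
      using v x by (auto intro!: bexI[OF _ Xsm[OF x]] simp: smult_add_distrib_vec)
  qed auto
  have ac: "(\<Union>s\<in>{x + v | x. x \<in> X (src Q a)}. {x + ?A a *\<^sub>v s | x. x \<in> X (tgt Q a)})
       = {x + ?A a *\<^sub>v v | x. x \<in> X (tgt Q a)}"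
    if v: "v \<in> carrier_vec (rdim R (src Q a))" for a v
  proof (rule un[OF v])
    fix x assume x: "x \<in> X (src Q a)"
    then have "x \<in> carrier_vec (rdim R (src Q a))" using Xsub by auto
    then show "\<exists>z\<in>X (tgt Q a). ?A a *\<^sub>v (x + v) = z + ?A a *\<^sub>v v"
      using v x Am[of a] by (auto intro!: bexI[OF _ Xact[OF x]] simp: mult_add_distrib_mat_vec)
  qed (use Am in \<open>auto intro: mult_mat_vec_carrier\<close>)
  show ?thesis
    unfolding closed_linrep_def
  proof (intro conjI allI ballI)
    fix i S T
    assume "S \<in> carrier (space (quotient_linrep Q (linrep_of R) X) i)"
      "T \<in> carrier (space (quotient_linrep Q (linrep_of R) X) i)"
    then obtain v w where "v \<in> carrier_vec (rdim R i)" "w \<in> carrier_vec (rdim R i)"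
      "S = {x + v | x. x \<in> X i}" "T = {x + w | x. x \<in> X i}"
      by (auto simp: quotient_linrep_def quotient_space_def linrep_of_def rcos)
    then show "S \<oplus>\<^bsub>space (quotient_linrep Q (linrep_of R) X) i\<^esub> T
       \<in> carrier (space (quotient_linrep Q (linrep_of R) X) i)"
      using add_carrier_vec by (fastforce simp: quotient_linrep_def quotient_space_def linrep_of_def rcos add)
  next
    fix i c S
    assume "S \<in> carrier (space (quotient_linrep Q (linrep_of R) X) i)"
    then obtain v where "v \<in> carrier_vec (rdim R i)" "S = {x + v | x. x \<in> X i}"
      by (auto simp: quotient_linrep_def quotient_space_def linrep_of_def rcos)
    then show "c \<odot>\<^bsub>space (quotient_linrep Q (linrep_of R) X) i\<^esub> S
       \<in> carrier (space (quotient_linrep Q (linrep_of R) X) i)"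
      using sm[of v i c] smult_carrier_vec
      by (auto simp: quotient_linrep_def quotient_space_def linrep_of_def rcos cos module_vec_simps)
  next
    fix a S
    assume "S \<in> carrier (space (quotient_linrep Q (linrep_of R) X) (src Q a))"
    then obtain v where "v \<in> carrier_vec (rdim R (src Q a))" "S = {x + v | x. x \<in> X (src Q a)}"
      by (auto simp: quotient_linrep_def quotient_space_def linrep_of_def rcos)
    then show "act (quotient_linrep Q (linrep_of R) X) a S
       \<in> carrier (space (quotient_linrep Q (linrep_of R) X) (tgt Q a))"
      using ac[of v a] mult_mat_vec_carrier[OF Am]
      by (auto simp: quotient_linrep_def quotient_space_def linrep_of_def rcos cos)
  qed
qed

lemma finite_subreps:
  fixes R :: "('i::finite, 'e, 'k::{field,finite}) rep"
  shows "finite {X. subrep Q (linrep_of R) X}"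
proof (rule finite_subset)
  have "X i \<subseteq> carrier_vec (rdim R i)" if "subrep Q (linrep_of R) X" for X i
  proof -
    have "LinearCombinations.submodule class_ring (X i) (module_vec TYPE('k) (rdim R i))"
      using that by (simp add: subrep_def VectorSpace.subspace_def linrep_of_def)
    then show ?thesis
      using LinearCombinations.submodule.subset by (fastforce simp: module_vec_simps)
  qed
  then show "{X. subrep Q (linrep_of R) X} \<subseteq> (\<Pi>\<^sub>E i\<in>UNIV. Pow (carrier_vec (rdim R i)))"
    by (auto simp: PiE_UNIV_domain)
  have "finite (carrier_vec n :: 'k vec set)" for n
  proof (rule finite_subset)
    show "(carrier_vec n :: 'k vec set) \<subseteq> vec_of_list ` {xs. set xs \<subseteq> UNIV \<and> length xs = n}"
    proof
      fix v :: "'k vec" assume "v \<in> carrier_vec n"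
      then have "v = vec_of_list (list_of_vec v)" "length (list_of_vec v) = n"
        by (auto simp: vec_list)
      then show "v \<in> vec_of_list ` {xs. set xs \<subseteq> UNIV \<and> length xs = n}" by blast
    qed
    show "finite (vec_of_list ` {xs :: 'k list. set xs \<subseteq> UNIV \<and> length xs = n})"
      by (intro finite_imageI finite_lists_length_eq) simp
  qed
  then show "finite (\<Pi>\<^sub>E i\<in>(UNIV :: 'i set). Pow (carrier_vec (rdim R i) :: 'k vec set))"
    by (intro finite_PiE) auto
qed

lemma finite_hall_pairs:
  fixes R :: "('i::finite, 'e, 'k::{field,finite}) rep"
  assumes R: "is_rep Q R"
  shows "finite (hall_pairs Q R)"
proof -
  let ?R = "linrep_of R"
  let ?P = "\<lambda>X (U, V). U \<in> iso_classes Q \<and> V \<in> iso_classes Q \<and>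
     isomorphic_reps Q (sub_linrep ?R X) (linrep_of (representative V)) \<and>
     isomorphic_reps Q (quotient_linrep Q ?R X) (linrep_of (representative U))"
  have sub: "hall_pairs Q R \<subseteq> (\<Union>X\<in>{X. subrep Q ?R X}. {p. ?P X p})"
  proof
    fix p assume "p \<in> hall_pairs Q R"
    moreover obtain U V where p: "p = (U, V)" by force
    ultimately have UV: "U \<in> iso_classes Q" "V \<in> iso_classes Q"
      "hall_number Q R (representative U) (representative V) \<noteq> 0"
      by (auto simp: hall_pairs_def)
    have "{X. subrep Q ?R X \<and>
        isomorphic_reps Q (sub_linrep ?R X) (linrep_of (representative V)) \<and>
        isomorphic_reps Q (quotient_linrep Q ?R X) (linrep_of (representative U))} \<noteq> {}"
      using UV(3) unfolding hall_number_def by (metis card.empty)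
    then show "p \<in> (\<Union>X\<in>{X. subrep Q ?R X}. {p. ?P X p})" using UV p by auto
  qed
  have fin: "finite {p. ?P X p}" if "X \<in> {X. subrep Q ?R X}" for X
  proof -
    have X: "subrep Q ?R X" using that by (rule CollectD)
    have uniq: "p = p'" if "p \<in> {p. ?P X p}" "p' \<in> {p. ?P X p}" for p p'
    proof -
      obtain U V U' V' where p: "p = (U, V)" "p' = (U', V')" by (metis surj_pair)
      have c: "U \<in> iso_classes Q" "V \<in> iso_classes Q" "U' \<in> iso_classes Q" "V' \<in> iso_classes Q"
        using that p by auto
      have "rep_iso Q (representative V) (representative V')"
        using that p isomorphic_reps_euclid[OF closed_sub_linrep[OF X]] by auto
      then have "V = V'" using c iso_class_eqI iso_class_representative by metis
      moreover have "rep_iso Q (representative U) (representative U')"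
        using that p isomorphic_reps_euclid[OF closed_quotient_linrep[OF R X]] by auto
      then have "U = U'" using c iso_class_eqI iso_class_representative by metis
      ultimately show ?thesis using p by simp
    qed
    show ?thesis
    proof (cases "{p. ?P X p} = {}")
      case False
      then have "\<exists>p. p \<in> {p. ?P X p}" unfolding ex_in_conv .
      then obtain p where p: "p \<in> {p. ?P X p}" by (rule exE)
      have "{p. ?P X p} \<subseteq> {p}"
      proof (rule subsetI)
        fix p' assume "p' \<in> {p. ?P X p}"
        then have "p' = p" using p by (rule uniq)
        then show "p' \<in> {p}" by simp
      qed
      then show ?thesis by (rule finite_subset) simp
    next
      case True
      show ?thesis unfolding True by (rule finite.emptyI)
    qed
  qed
  show ?thesis by (rule finite_subset[OF sub finite_UN_I[OF finite_subreps fin]])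
qed

end

theory Submission
  imports Defs "HOL-Library.Function_Algebras" "HOL-Library.Cardinality"
begin

text \<open>A regular representation is one all of whose quotients have defect \<open>\<ge> 0\<close> and all of whose
  subrepresentations have defect \<open>\<le> 0\<close>. So if \<open>[U] \<otimes> [V]\<close> occurs in \<open>\<Delta>(f)\<close> with \<open>f\<close> regular,
  then \<open>U\<close> is an extension of a regular \<open>A\<close> by a preinjective \<open>B\<close>, and this extension splits.
  Since \<open>U\<close> is the only extension of \<open>A\<close> by \<open>B\<close>, coassociativity, evaluated at
  \<open>[A] \<otimes> [B] \<otimes> [V]\<close>, expresses the coefficient of \<open>[U] \<otimes> [V]\<close> by coefficients of terms
  \<open>[A] \<otimes> [K]\<close>. In these \<open>K\<close> is regular because \<open>A\<close> is, so they vanish by cuspidality unless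
  \<open>A\<close> or \<open>B\<close> is zero. Hence \<open>U\<close> is regular or preinjective, dually \<open>V\<close> is regular or
  preprojective, and the defect excludes the mixed cases.

  The one deep ingredient is \<open>Ext\<^sup>1(X, Y) = 0\<close> whenever \<open>X\<close> is torsion free and \<open>Y\<close> is torsion
  for one of the two torsion pairs given by the defect. It is obtained without
  Auslander--Reiten theory, from the Euler form, bricks and the orbits of the Coxeter
  transformation on the roots.\<close>

section \<open>The Euler form of an affine quiver\<close>

text \<open>Vanishing of extensions is decided by dimension vectors alone. Path algebras are
  hereditary, so \<open><dim X, dim Y>\<close> is dim Hom - dim Ext^1, and a pair with Hom = 0 and
  Ext^1 /= 0 has a negative Euler form. The inverse Coxeter transformation preserves the form and
  the defect. It moves a non-negative root of positive defect through non-negative roots until it is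
  the dimension vector of the injective at some vertex; pairing with that vector reads off one
  coordinate of the other root, which stays non-negative because its defect is not positive. So
  vectors are reflected, never representations.

  The finite field shapes two points. The endomorphism ring of a brick may be larger than the base
  field, so a rigid brick is shown to be a root by a divisibility argument. And dimensions are found
  by counting elements, which treats vertex spaces and spaces of families of maps alike.

  The powers of \<nu> and the automorphism counts are divided out of the coefficients of
  \<Delta>(f); coassociativity is then exactly associativity of Hall numbers.\<close>

lemma euler_form_add_left: "euler_form Q (x + y) z = euler_form Q x z + euler_form Q y z"
  by (simp add: euler_form_def sum.distrib algebra_simps)

lemma euler_form_add_right: "euler_form Q z (x + y) = euler_form Q z x + euler_form Q z y"
  by (simp add: euler_form_def sum.distrib algebra_simps)

lemma euler_form_scale_left: "euler_form Q (\<lambda>i. k * x i) z = k * euler_form Q x z"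
  by (simp add: euler_form_def sum_distrib_left algebra_simps)

lemma euler_form_scale_right: "euler_form Q z (\<lambda>i. k * x i) = k * euler_form Q z x"
  by (simp add: euler_form_def sum_distrib_left algebra_simps)

lemma euler_form_diff_left: "euler_form Q (x - y) z = euler_form Q x z - euler_form Q y z"
  using euler_form_add_left[of Q "x - y" y z] by simp

lemma euler_form_diff_right: "euler_form Q z (x - y) = euler_form Q z x - euler_form Q z y"
  using euler_form_add_right[of Q z "x - y" y] by simp

lemma euler_form_zero [simp]: "euler_form Q (\<lambda>i. 0) z = 0" "euler_form Q z (\<lambda>i. 0) = 0"
  by (simp_all add: euler_form_def)

lemma euler_form_sum_left: "finite S \<Longrightarrow> euler_form Q (\<lambda>i. \<Sum>s\<in>S. f s i) z = (\<Sum>s\<in>S. euler_form Q (f s) z)"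
proof (induction S rule: finite_induct)
  case (insert s S)
  have "(\<lambda>i. \<Sum>s\<in>insert s S. f s i) = f s + (\<lambda>i. \<Sum>s\<in>S. f s i)"
    using insert by (auto simp: fun_eq_iff)
  then show ?case using insert by (simp add: euler_form_add_left)
qed simp

lemma euler_form_sum_right: "finite S \<Longrightarrow> euler_form Q z (\<lambda>i. \<Sum>s\<in>S. f s i) = (\<Sum>s\<in>S. euler_form Q z (f s))"
proof (induction S rule: finite_induct)
  case (insert s S)
  have "(\<lambda>i. \<Sum>s\<in>insert s S. f s i) = f s + (\<lambda>i. \<Sum>s\<in>S. f s i)"
    using insert by (auto simp: fun_eq_iff)
  then show ?case using insert by (simp add: euler_form_add_right)
qed simp

lemma sum_fibres:
  fixes f :: "'e::finite \<Rightarrow> 'c::comm_monoid_add" and g :: "'e \<Rightarrow> 'i::finite"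
  shows "(\<Sum>a\<in>UNIV. f a) = (\<Sum>j\<in>UNIV. \<Sum>a | g a = j. f a)"
  using sum.group[of "UNIV :: 'e set" "UNIV :: 'i set" g f] by simp

definition evec :: "'i \<Rightarrow> 'i \<Rightarrow> int" where "evec j = (\<lambda>i. if i = j then 1 else 0)"

lemma euler_form_evec_right: "euler_form Q x (evec j) = x j - (\<Sum>a | tgt Q a = j. x (src Q a))"
proof -
  have "(\<Sum>a\<in>UNIV. x (src Q a) * evec j (tgt Q a)) = (\<Sum>a | tgt Q a = j. x (src Q a))"
    unfolding evec_def by (simp add: if_distrib sum.If_cases cong: if_cong)
  moreover have "(\<Sum>i\<in>UNIV. x i * evec j i) = x j"
    unfolding evec_def by (simp add: if_distrib cong: if_cong)
  ultimately show ?thesis by (simp add: euler_form_def)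
qed

lemma euler_form_evec_left: "euler_form Q (evec j) x = x j - (\<Sum>a | src Q a = j. x (tgt Q a))"
proof -
  have "(\<Sum>a\<in>UNIV. evec j (src Q a) * x (tgt Q a)) = (\<Sum>a | src Q a = j. x (tgt Q a))"
    unfolding evec_def by (simp add: if_distrib[of "\<lambda>z. z * _"] sum.If_cases cong: if_cong)
  moreover have "(\<Sum>i\<in>UNIV. evec j i * x i) = x j"
    unfolding evec_def by (simp add: if_distrib[of "\<lambda>z. z * _"] cong: if_cong)
  ultimately show ?thesis by (simp add: euler_form_def)
qed

lemma euler_form_expand_left: "euler_form Q x y = (\<Sum>i\<in>UNIV. x i * euler_form Q (evec i) y)"
proof -
  have "x = (\<lambda>j. \<Sum>i\<in>UNIV. x i * evec i j)"
    by (simp add: fun_eq_iff evec_def if_distrib cong: if_cong)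
  then have "euler_form Q x y = euler_form Q (\<lambda>j. \<Sum>i\<in>UNIV. x i * evec i j) y" by simp
  also have "\<dots> = (\<Sum>i\<in>UNIV. x i * euler_form Q (evec i) y)"
    by (simp add: euler_form_sum_left euler_form_scale_left)
  finally show ?thesis .
qed

lemma euler_form_expand_right: "euler_form Q x y = (\<Sum>i\<in>UNIV. y i * euler_form Q x (evec i))"
proof -
  have "y = (\<lambda>j. \<Sum>i\<in>UNIV. y i * evec i j)"
    by (simp add: fun_eq_iff evec_def if_distrib cong: if_cong)
  then have "euler_form Q x y = euler_form Q x (\<lambda>j. \<Sum>i\<in>UNIV. y i * evec i j)" by simp
  also have "\<dots> = (\<Sum>i\<in>UNIV. y i * euler_form Q x (evec i))"
    by (simp add: euler_form_sum_right euler_form_scale_right)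
  finally show ?thesis .
qed

section \<open>Opposite quivers and recursion along the arrows\<close>

definition op_quiver :: "('i, 'e) quiver \<Rightarrow> ('i, 'e) quiver" where
  "op_quiver Q = \<lparr>src = tgt Q, tgt = src Q\<rparr>"

lemma euler_form_op [simp]: "euler_form (op_quiver Q) x y = euler_form Q y x"
  by (simp add: euler_form_def op_quiver_def mult.commute)

lemma acyclic_op: "acyclic_quiver Q \<Longrightarrow> acyclic_quiver (op_quiver Q)"
proof -
  have "range (\<lambda>a. (src (op_quiver Q) a, tgt (op_quiver Q) a)) = (range (\<lambda>a. (src Q a, tgt Q a)))\<inverse>"
    by (auto simp: op_quiver_def)
  then show "acyclic_quiver Q \<Longrightarrow> acyclic_quiver (op_quiver Q)"
    by (simp add: acyclic_quiver_def acyclic_converse)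
qed

lemma acyclic_no_loop: "acyclic_quiver Q \<Longrightarrow> src Q a \<noteq> tgt Q a"
  unfolding acyclic_quiver_def acyclic_def by (auto dest: spec[of _ "tgt Q a"] intro: r_into_trancl)

lemma wf_arrows:
  fixes Q :: "('i::finite, 'e::finite) quiver"
  assumes "acyclic_quiver Q"
  shows "wf (range (\<lambda>a. (src Q a, tgt Q a)))"
  using assms by (intro finite_acyclic_wf) (auto simp: acyclic_quiver_def)

text \<open>Well-founded recursion: the value at \<open>j\<close> refers only to the sources of the
  arrows into \<open>j\<close>, which precede \<open>j\<close> when there are no oriented
  cycles.\<close>

lemma acyclic_solve:
  fixes Q :: "('i::finite, 'e::finite) quiver" and g :: "'i \<Rightarrow> int"
  assumes "acyclic_quiver Q"
  shows "\<exists>u. \<forall>j. u j = g j + (\<Sum>a | tgt Q a = j. u (src Q a))"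
proof -
  let ?r = "range (\<lambda>a. (src Q a, tgt Q a))"
  let ?H = "\<lambda>f j. g j + (\<Sum>a | tgt Q a = j. f (src Q a))"
  have "wfrec ?r ?H j = ?H (wfrec ?r ?H) j" for j
  proof -
    have "(\<Sum>a | tgt Q a = j. cut (wfrec ?r ?H) ?r j (src Q a)) = (\<Sum>a | tgt Q a = j. wfrec ?r ?H (src Q a))"
      by (intro sum.cong refl cut_apply) auto
    then show ?thesis by (subst wfrec[OF wf_arrows[OF assms]]) simp
  qed
  then show ?thesis by blast
qed

text \<open>The inverse Coxeter transformation: the recursion solves
  \<open>\<langle>cox x, y\<rangle> = - \<langle>y, x\<rangle>\<close>, and has a solution as there are no oriented cycles.\<close>

definition cox :: "('i::finite, 'e::finite) quiver \<Rightarrow> ('i \<Rightarrow> int) \<Rightarrow> 'i \<Rightarrow> int" where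
  "cox Q x = (SOME u. \<forall>j. u j = - euler_form Q (evec j) x + (\<Sum>a | tgt Q a = j. u (src Q a)))"

lemma cox_eq:
  assumes "acyclic_quiver Q"
  shows "cox Q x j = - euler_form Q (evec j) x + (\<Sum>a | tgt Q a = j. cox Q x (src Q a))"
proof -
  have "\<forall>j. cox Q x j = - euler_form Q (evec j) x + (\<Sum>a | tgt Q a = j. cox Q x (src Q a))"
    unfolding cox_def by (rule someI_ex[OF acyclic_solve[OF assms, of "\<lambda>j. - euler_form Q (evec j) x"]])
  then show ?thesis ..
qed

lemma euler_form_cox:
  assumes "acyclic_quiver Q"
  shows "euler_form Q (cox Q x) y = - euler_form Q y x"
proof -
  have "euler_form Q (cox Q x) (evec j) = - euler_form Q (evec j) x" for j
    using cox_eq[OF assms, of x j] by (simp add: euler_form_evec_right)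
  then show ?thesis
    unfolding euler_form_expand_right[of Q "cox Q x" y] euler_form_expand_left[of Q y x]
    by (simp add: sum_negf)
qed

lemma euler_form_cox_cox:
  "acyclic_quiver Q \<Longrightarrow> euler_form Q (cox Q x) (cox Q y) = euler_form Q x y"
  by (simp add: euler_form_cox)

text \<open>Along the arrows the form is unitriangular, hence non-degenerate: pairing with
  \<open>evec j\<close> recovers \<open>x j\<close> from the values of \<open>x\<close> at the
  predecessors of \<open>j\<close>.\<close>

lemma euler_form_left_eqI:
  fixes Q :: "('i::finite, 'e::finite) quiver"
  assumes Q: "acyclic_quiver Q" and eq: "\<And>y. euler_form Q x y = euler_form Q x' y"
  shows "x = x'"
proof
  fix j
  show "x j = x' j"
    using wf_arrows[OF Q]
  proof (induction j rule: wf_induct_rule)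
    case (less j)
    have "(\<Sum>a | tgt Q a = j. x (src Q a)) = (\<Sum>a | tgt Q a = j. x' (src Q a))"
      using less by (intro sum.cong) auto
    then show ?case using eq[of "evec j"] by (simp add: euler_form_evec_right)
  qed
qed

lemma cox_eqI: "acyclic_quiver Q \<Longrightarrow> (\<And>y. euler_form Q u y = - euler_form Q y x) \<Longrightarrow> cox Q x = u"
  by (rule euler_form_left_eqI) (auto simp: euler_form_cox)

lemma cox_add: "acyclic_quiver Q \<Longrightarrow> cox Q (x + y) = cox Q x + cox Q y"
  by (rule cox_eqI) (auto simp: euler_form_cox euler_form_add_left euler_form_add_right)

lemma cox_sum:
  assumes Q: "acyclic_quiver Q" and "finite S"
  shows "cox Q (\<lambda>i. \<Sum>s\<in>S. f s i) = (\<lambda>i. \<Sum>s\<in>S. cox Q (f s) i)"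
  using assms by (intro cox_eqI) (auto simp: euler_form_cox euler_form_sum_left euler_form_sum_right sum_negf)

text \<open>The numerical facts on which everything later rests. The radical vector is a parameter
  \<open>d\<close>, so that the opposite quiver is an instance with the same vector.
  \<open>bounded\<close> says that the real roots fall into finitely many classes modulo
  \<open>d\<close>.\<close>

locale affine_form =
  fixes Q :: "('i::finite, 'e::finite) quiver" and d :: "'i \<Rightarrow> int"
  assumes acyclic: "acyclic_quiver Q"
    and d_pos: "\<And>i. d i > 0"
    and d_rad: "\<And>x. euler_form Q d x + euler_form Q x d = 0"
    and psd: "\<And>x. euler_form Q x x \<ge> 0"
    and isotropic: "\<And>x. euler_form Q x x = 0 \<Longrightarrow> \<exists>m. x = (\<lambda>i. m * d i)"
    and bounded: "\<exists>K. \<forall>x. euler_form Q x x = 1 \<longrightarrow> (\<exists>m. \<forall>i. \<bar>x i - m * d i\<bar> \<le> K)"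
begin

text \<open>Reversing the arrows swaps the arguments of the form and changes the sign of the defect;
  this reduces the numerical case \<open>t = 0\<close> to \<open>t = 1\<close>.\<close>

lemma affine_form_op: "affine_form (op_quiver Q) d"
  using acyclic_op[OF acyclic] d_pos d_rad psd isotropic bounded
  by unfold_locales (auto simp: add.commute)

lemma d_rad': "euler_form Q x d = - euler_form Q d x"
  using d_rad[of x] by simp

lemma cox_d: "cox Q d = d"
  by (rule cox_eqI[OF acyclic]) (simp add: d_rad')

lemma defect_d [simp]: "euler_form Q d d = 0"
  using d_rad[of d] by simp

lemma defect_cox: "euler_form Q d (cox Q x) = euler_form Q d x"
  using euler_form_cox_cox[OF acyclic, of d x] cox_d by simp

lemma euler_form_evec_evec: "euler_form Q (evec j) (evec j) = 1"
  unfolding euler_form_evec_right using acyclic_no_loop[OF acyclic]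
  by (auto simp: evec_def intro!: sum.neutral)

text \<open>The positive part \<open>p\<close> and the negative part \<open>n\<close> have disjoint
  supports, so the mixed terms only increase the form: \<open>q(p) + q(n) \<le> 1\<close>. If both
  parts are non-zero, each has a zero entry and is no multiple of the everywhere positive
  \<open>d\<close>, so both values are at least 1.\<close>

lemma root_sign:
  assumes x: "euler_form Q x x = 1"
  shows "(\<forall>i. x i \<ge> 0) \<or> (\<forall>i. x i \<le> 0)"
proof (rule ccontr)
  assume "\<not> ?thesis"
  then obtain i j where ij: "x i < 0" "x j > 0" by (meson not_le)
  define p where "p = (\<lambda>i. max (x i) 0)"
  define n where "n = (\<lambda>i. max (- x i) 0)"
  have pn: "p k \<ge> 0" "n k \<ge> 0" "p k * n k = 0" for k by (auto simp: p_def n_def max_def)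
  have "x = p - n" by (auto simp: p_def n_def fun_eq_iff max_def)
  then have "euler_form Q x x = euler_form Q p p + euler_form Q n n - euler_form Q p n - euler_form Q n p"
    by (simp add: euler_form_diff_left euler_form_diff_right)
  moreover have "euler_form Q p n \<le> 0" "euler_form Q n p \<le> 0"
    using pn by (auto simp: euler_form_def sum_nonneg mult.commute)
  moreover have "euler_form Q p p \<noteq> 0"
  proof
    assume "euler_form Q p p = 0"
    then obtain m where m: "p = (\<lambda>i. m * d i)" using isotropic by blast
    have "p i = 0" "p j > 0" using ij by (auto simp: p_def)
    then show False using m d_pos[of i] d_pos[of j] by auto
  qed
  moreover have "euler_form Q n n \<noteq> 0"
  proof
    assume "euler_form Q n n = 0"
    then obtain m where m: "n = (\<lambda>i. m * d i)" using isotropic by blast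
    have "n j = 0" "n i > 0" using ij by (auto simp: n_def)
    then show False using m d_pos[of i] d_pos[of j] by auto
  qed
  ultimately show False using x psd[of p] psd[of n] by linarith
qed

text \<open>\<open>cox\<close> is a product of simple reflections, one at each vertex in an order
  compatible with the arrows. A positive root leaves the cone only by being reflected at the vertex
  of a simple root. Tracing this back, the original vector is that of the injective at this vertex,
  the one that pairs with \<open>x\<close> to \<open>x j\<close>.\<close>

lemma cox_nonneg_or_injective:
  assumes y: "euler_form Q y y = 1" "\<And>i. y i \<ge> 0"
  shows "(\<forall>i. cox Q y i \<ge> 0) \<or> (\<exists>j. \<forall>x. euler_form Q x y = x j)"
proof -
  define u where "u = cox Q y"
  have u: "u j = - y j + (\<Sum>a | src Q a = j. y (tgt Q a)) + (\<Sum>a | tgt Q a = j. u (src Q a))" for j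
    unfolding u_def using cox_eq[OF acyclic, of y j] by (simp add: euler_form_evec_left)
  \<comment> \<open>\<open>v S\<close> is \<open>y\<close> after the reflections at the vertices of
    \<open>S\<close>. Sets closed under predecessors (\<open>pc\<close>) are the stages of an
    admissible order of reflections; a maximal stage that is still non-negative is examined.\<close>
  define v where "v S = (\<lambda>i. if i \<in> S then u i else y i)" for S
  define pc where "pc S \<longleftrightarrow> (\<forall>a. tgt Q a \<in> S \<longrightarrow> src Q a \<in> S)" for S
  define \<S> where "\<S> = {S. pc S \<and> euler_form Q (v S) (v S) = 1 \<and> (\<forall>i. v S i \<ge> 0)}"
  have "{} \<in> \<S>" using y by (auto simp: \<S>_def pc_def v_def)
  then obtain S where S: "S \<in> \<S>" and max: "\<And>T. T \<in> \<S> \<Longrightarrow> S \<subseteq> T \<Longrightarrow> T = S"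
    using finite_has_maximal2[of \<S> "{}"] by (metis finite)
  show ?thesis
  proof (cases "S = UNIV")
    case True
    then show ?thesis using S by (auto simp: \<S>_def v_def u_def)
  next
    case False
    then obtain j0 where "j0 \<in> - S" by auto
    then obtain j where "j \<in> - S" and
      jm: "\<And>i. (i, j) \<in> range (\<lambda>a. (src Q a, tgt Q a)) \<Longrightarrow> i \<notin> - S"
      using wfE_min[OF wf_arrows[OF acyclic]] by metis
    then have j: "j \<notin> S" and jmin: "\<And>a. tgt Q a = j \<Longrightarrow> src Q a \<in> S" by auto
    let ?T = "insert j S"
    have pcS: "pc S" using S by (simp add: \<S>_def)
    have pcT: "pc ?T" using pcS jmin by (auto simp: pc_def)
    have succ: "tgt Q a \<notin> ?T" if "src Q a = j" for a
      using pcS j that acyclic_no_loop[OF acyclic, of a] by (auto simp: pc_def)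
    \<comment> \<open>The step from \<open>S\<close> to \<open>insert j S\<close> is the simple
      reflection at \<open>j\<close>: it adds \<open>t\<close> times the simple root, where
      \<open>t\<close> is minus the symmetric pairing with it, so the form keeps the value
      1.\<close>
    define t where "t = u j - y j"
    have vT: "v ?T = v S + (\<lambda>i. t * evec j i)"
      using j by (auto simp: v_def fun_eq_iff t_def evec_def)
    have "(\<Sum>a | src Q a = j. v S (tgt Q a)) = (\<Sum>a | src Q a = j. y (tgt Q a))"
      using succ by (intro sum.cong) (auto simp: v_def)
    moreover have "(\<Sum>a | tgt Q a = j. v S (src Q a)) = (\<Sum>a | tgt Q a = j. u (src Q a))"
      using jmin by (intro sum.cong) (auto simp: v_def)
    ultimately have t: "euler_form Q (v S) (evec j) + euler_form Q (evec j) (v S) = - t"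
      using j u[of j] by (simp add: euler_form_evec_left euler_form_evec_right t_def) (simp add: v_def)
    have "euler_form Q (v ?T) (v ?T) = euler_form Q (v S) (v S)
       + t * (euler_form Q (v S) (evec j) + euler_form Q (evec j) (v S)) + t * t"
      by (simp add: vT euler_form_add_left euler_form_add_right euler_form_scale_left
          euler_form_scale_right euler_form_evec_evec algebra_simps)
    then have qT: "euler_form Q (v ?T) (v ?T) = 1" using S t by (simp add: \<S>_def)
    have "?T \<notin> \<S>" using max[of ?T] j by auto
    then have "\<not> (\<forall>i. v ?T i \<ge> 0)" using pcT qT by (simp add: \<S>_def)
    \<comment> \<open>A root has one sign, so a single negative entry makes all of
      \<open>v ?T\<close> non-positive. It differs from the non-negative \<open>v S\<close> only at
      \<open>j\<close>, hence \<open>v S\<close> is concentrated at \<open>j\<close>.\<close>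
    then have neg: "v ?T i \<le> 0" for i using root_sign[OF qT] by auto
    have zero: "v S i = 0" if "i \<noteq> j" for i
    proof -
      have "v S i = v ?T i" using that by (simp add: v_def)
      moreover have "v S i \<ge> 0" using S by (simp add: \<S>_def)
      ultimately show ?thesis using neg[of i] by linarith
    qed
    have "v S = (\<lambda>i. y j * evec j i)"
    proof
      fix i
      show "v S i = y j * evec j i"
        using zero[of i] j by (cases "i = j") (simp_all add: evec_def, simp add: v_def)
    qed
    then have "euler_form Q (v S) (v S) = y j * y j"
      by (simp add: euler_form_scale_left euler_form_scale_right euler_form_evec_evec)
    then have yj: "y j = 1" using S y(2)[of j] by (auto simp: \<S>_def zmult_eq_1_iff)
    \<comment> \<open>The three cases are the vertices already reflected, the vertex
      \<open>j\<close>, and the vertices still to come.\<close>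
    have *: "euler_form Q (evec i) y = evec j i" for i
    proof -
      consider "i \<in> S" | "i = j" | "i \<notin> S" "i \<noteq> j" by blast
      then show ?thesis
      proof cases
        case 1
        have "u (src Q a) = 0" if "tgt Q a = i" for a
          using zero[of "src Q a"] pcS that 1 j by (auto simp: pc_def v_def split: if_splits)
        moreover have "u i = 0" using zero[of i] 1 j by (auto simp: v_def split: if_splits)
        ultimately show ?thesis
          unfolding euler_form_evec_left using u[of i] 1 j by (auto simp: evec_def)
      next
        case 2
        have "y (tgt Q a) = 0" if "src Q a = j" for a
          using zero[of "tgt Q a"] succ[OF that] by (auto simp: v_def)
        then show ?thesis unfolding euler_form_evec_left using yj 2 by (simp add: evec_def)
      next
        case 3
        have "y (tgt Q a) = 0" if "src Q a = i" for a
        proof -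
          have "tgt Q a \<notin> S" "tgt Q a \<noteq> j" using pcS jmin[of a] that 3 by (auto simp: pc_def)
          then show ?thesis using zero[of "tgt Q a"] by (simp add: v_def)
        qed
        moreover have "y i = 0" using zero[of i] 3 by (auto simp: v_def)
        ultimately show ?thesis unfolding euler_form_evec_left using 3 by (simp add: evec_def)
      qed
    qed
    have "euler_form Q x y = x j" for x
      unfolding euler_form_expand_left[of Q x y] *
      by (simp add: evec_def if_distrib cong: if_cong)
    then show ?thesis by blast
  qed
qed

text \<open>Modulo \<open>d\<close> the orbit takes finitely many values, so two of its members
  differ by \<open>k * d\<close>. The sum \<open>z\<close> over that period satisfies
  \<open>cox z = z + k * d\<close>, and pairing this with \<open>z\<close> gives
  \<open>2 * q(z) + k * <d, z> = 0\<close> with \<open><d, z> > 0\<close>. Hence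
  \<open>k < 0\<close>: every period subtracts a positive multiple of \<open>d\<close>, which no
  non-negative orbit survives.\<close>

lemma cox_orbit_leaves_cone:
  assumes y: "euler_form Q y y = 1" and \<theta>: "euler_form Q d y > 0"
  shows "\<exists>m i. (cox Q ^^ m) y i < 0"
proof (rule ccontr)
  assume "\<not> ?thesis"
  then have nonneg: "(cox Q ^^ m) y i \<ge> 0" for m i by (simp add: not_less)
  let ?y = "\<lambda>m. (cox Q ^^ m) y"
  have q: "euler_form Q (?y m) (?y m) = 1" for m
    by (induction m) (simp_all add: y euler_form_cox_cox[OF acyclic])
  have th: "euler_form Q d (?y m) = euler_form Q d y" for m
    by (induction m) (simp_all add: defect_cox)
  obtain K where K: "\<And>x. euler_form Q x x = 1 \<Longrightarrow> \<exists>m. \<forall>i. \<bar>x i - m * d i\<bar> \<le> K"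
    using bounded by blast
  define c where "c m = (SOME c. \<forall>i. \<bar>?y m i - c * d i\<bar> \<le> K)" for m
  have c: "\<bar>?y m i - c m * d i\<bar> \<le> K" for m i
  proof -
    have "\<forall>i. \<bar>?y m i - c m * d i\<bar> \<le> K" unfolding c_def by (rule someI_ex[OF K[OF q]])
    then show ?thesis ..
  qed
  define r where "r m = (\<lambda>i. ?y m i - c m * d i)" for m
  have "r m i \<in> {-K..K}" for m i using c[of m i] unfolding r_def atLeastAtMost_iff by linarith
  then have "range r \<subseteq> (\<Pi>\<^sub>E i\<in>UNIV. {-K..K})" by (auto simp: PiE_UNIV_domain)
  then have "finite (range r)" by (rule finite_subset) (auto intro: finite_PiE)
  then have "\<not> inj r" using finite_imageD[of r UNIV] by auto
  then obtain a b where "a \<noteq> b" "r a = r b" by (auto simp: inj_def)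
  then have "(a < b \<and> r a = r b) \<or> (b < a \<and> r b = r a)" by auto
  then obtain m1 m2 where m: "m1 < m2" "r m1 = r m2" by blast
  define k where "k = c m2 - c m1"
  have shift: "?y m2 = ?y m1 + (\<lambda>i. k * d i)"
  \<comment> \<open>Equal remainders \<open>r m1 = r m2\<close> mean that the two members differ by
    the difference of the subtracted multiples of \<open>d\<close>.\<close>
  proof
    fix i
    have "r m1 i = r m2 i" using m by simp
    then show "?y m2 i = (?y m1 + (\<lambda>i. k * d i)) i" by (simp add: r_def k_def algebra_simps)
  qed
  define z where "z = (\<lambda>i. \<Sum>m\<in>{m1..<m2}. ?y m i)"
  have "cox Q z i = z i + k * d i" for i
  proof -
    have "cox Q z i = (\<Sum>m\<in>{m1..<m2}. ?y (Suc m) i)"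
      unfolding z_def by (subst cox_sum[OF acyclic]) auto
    also have "\<dots> = (\<Sum>m\<in>{Suc m1..<Suc m2}. ?y m i)" by (rule sum.shift_bounds_Suc_ivl[symmetric])
    also have "\<dots> = (\<Sum>m\<in>{m1..<m2}. ?y m i) + ?y m2 i - ?y m1 i"
      using m(1) by (simp add: sum.atLeast_Suc_lessThan[of m1 m2 "\<lambda>m. ?y m i"])
    finally show ?thesis by (simp add: z_def shift)
  qed
  then have cz: "cox Q z = z + (\<lambda>i. k * d i)" by (simp add: fun_eq_iff)
  have kz: "2 * euler_form Q z z + k * euler_form Q d z = 0"
    using euler_form_cox[OF acyclic, of z z]
    by (simp add: cz euler_form_add_left euler_form_scale_left)
  have "euler_form Q d z = (m2 - m1) * euler_form Q d y"
    unfolding z_def using m(1) by (simp add: euler_form_sum_right th)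
  then have dz: "euler_form Q d z > 0" using \<theta> m(1) by simp
  have "k \<le> 0" using kz psd[of z] dz by (smt (verit) mult_pos_pos)
  moreover have "k \<noteq> 0"
  proof
    assume "k = 0"
    then have "euler_form Q z z = 0" using kz by simp
    then obtain w where "z = (\<lambda>i. w * d i)" using isotropic by blast
    then show False using dz by (simp add: euler_form_scale_right)
  qed
  ultimately have k: "k < 0" by simp
  have iter: "(cox Q ^^ (n * (m2 - m1))) (?y m1) = ?y m1 + (\<lambda>i. int n * k * d i)" for n
  proof (induction n)
    case (Suc n)
    have cadd: "(cox Q ^^ N) (x + (\<lambda>i. e * d i)) = (cox Q ^^ N) x + (\<lambda>i. e * d i)" for N x e
    proof (induction N)
      case (Suc N)
      have ed: "cox Q (\<lambda>i. e * d i) = (\<lambda>i. e * d i)"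
        by (rule cox_eqI[OF acyclic]) (simp add: euler_form_scale_left euler_form_scale_right d_rad')
      show ?case unfolding funpow.simps comp_apply Suc.IH cox_add[OF acyclic] ed ..
    qed simp
    have "(cox Q ^^ (m2 - m1)) (?y m1) = (cox Q ^^ (m2 - m1 + m1)) y"
      unfolding funpow_add comp_apply ..
    then have y2: "(cox Q ^^ (m2 - m1)) (?y m1) = ?y m2" using m(1) by simp
    have "(cox Q ^^ (Suc n * (m2 - m1))) (?y m1)
        = (cox Q ^^ (m2 - m1)) ((cox Q ^^ (n * (m2 - m1))) (?y m1))"
      unfolding mult_Suc funpow_add comp_apply ..
    also have "\<dots> = ?y m2 + (\<lambda>i. int n * k * d i)"
      unfolding Suc.IH cadd y2 ..
    also have "\<dots> = ?y m1 + (\<lambda>i. int (Suc n) * k * d i)"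
      unfolding shift by (simp add: fun_eq_iff algebra_simps)
    finally show ?case .
  qed (simp add: fun_eq_iff)
  \<comment> \<open>Any vertex will do; the step only uses that there is one.\<close>
  obtain i :: 'i where True by blast
  \<comment> \<open>Each period lowers the entry at \<open>i\<close> by at least 1, so this many
    periods make it negative.\<close>
  define n where "n = nat (?y m1 i) + 1"
  have "int n * k * d i \<le> - int n"
  proof -
    have "0 < (- k) * d i" using k d_pos[of i] by (intro mult_pos_pos) auto
    then have "1 \<le> (- k) * d i" by linarith
    then have "int n * 1 \<le> int n * ((- k) * d i)" by (intro mult_left_mono) auto
    then show ?thesis by simp
  qed
  moreover have "?y m1 i < int n" by (simp add: n_def)
  ultimately have "((cox Q ^^ (n * (m2 - m1))) (?y m1)) i < 0" using iter[of n] by simp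
  then have "(cox Q ^^ (n * (m2 - m1) + m1)) y i < 0" unfolding funpow_add comp_apply .
  then show False using nonneg[of "n * (m2 - m1) + m1" i] by linarith
qed

text \<open>Apply \<open>cox\<close> to both arguments, which preserves the pairing, until
  \<open>y\<close> is about to leave the cone. It is then the vector of an injective at some
  \<open>j\<close>, and the pairing is the \<open>j\<close>-th entry of the image of
  \<open>x\<close>.\<close>

lemma euler_form_nonneg_aux:
  assumes x: "euler_form Q x x = 1" "\<And>i. x i \<ge> 0" "euler_form Q d x \<le> 0"
    and y: "euler_form Q y y = 1" "\<And>i. y i \<ge> 0" "euler_form Q d y > 0"
  shows "euler_form Q x y \<ge> 0"
proof -
  let ?c = "\<lambda>m z. (cox Q ^^ m) z"
  have inv: "euler_form Q (?c m z) (?c m w) = euler_form Q z w" for m z w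
    by (induction m) (simp_all add: euler_form_cox_cox[OF acyclic])
  have th: "euler_form Q d (?c m z) = euler_form Q d z" for m z
    by (induction m) (simp_all add: defect_cox)
  have xnn: "?c m x i \<ge> 0" for m i
  proof (induction m arbitrary: i)
    case (Suc m)
    \<comment> \<open>The orbit of \<open>x\<close> could leave the cone only from the vector of an
      injective, whose defect is an entry of \<open>d\<close> and so positive; but the defect is
      constant on the orbit and not positive for \<open>x\<close>.\<close>
    have "\<nexists>j. \<forall>z. euler_form Q z (?c m x) = z j"
    proof
      assume "\<exists>j. \<forall>z. euler_form Q z (?c m x) = z j"
      then obtain j where "euler_form Q d (?c m x) = d j" by blast
      then show False using th[of m x] x(3) d_pos[of j] by simp
    qed
    moreover have "euler_form Q (?c m x) (?c m x) = 1" using inv[of m x x] x(1) by simp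
    note cox_nonneg_or_injective[OF this Suc.IH]
    ultimately show ?case unfolding funpow.simps comp_apply by (metis (full_types))
  qed (use x in simp)
  define m where "m = (LEAST m. \<exists>i. ?c m y i < 0)"
  have ex: "\<exists>m i. ?c m y i < 0" using cox_orbit_leaves_cone[OF y(1,3)] .
  then have m: "\<exists>i. ?c m y i < 0" unfolding m_def by (rule LeastI_ex)
  have "m \<noteq> 0"
  proof
    assume "m = 0"
    with m obtain i where "y i < 0" by auto
    then show False using y(2)[of i] by simp
  qed
  then obtain m' where m': "m = Suc m'" using not0_implies_Suc by blast
  have "m' < m" using m' by simp
  then have "\<not> (\<exists>i. ?c m' y i < 0)" unfolding m_def by (rule not_less_Least)
  then have nn: "?c m' y i \<ge> 0" for i by (simp add: not_less)
  have "\<not> (\<forall>i. cox Q (?c m' y) i \<ge> 0)"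
    using m unfolding m' by (simp add: not_le)
  moreover have "euler_form Q (?c m' y) (?c m' y) = 1" using inv[of m' y y] y(1) by simp
  note cox_nonneg_or_injective[OF this nn]
  ultimately have "\<exists>j. \<forall>z. euler_form Q z (?c m' y) = z j" by (elim disjE) simp_all
  then obtain j where "\<forall>z. euler_form Q z (?c m' y) = z j" ..
  then show ?thesis using inv[of m' x y] xnn[of m' j] by simp
qed

text \<open>Covers the possible dimension vectors of the two bricks in a minimal counterexample. An
  isotropic vector is a non-negative multiple of \<open>d\<close>, against which the form is the
  defect up to sign; the remaining case is that of two real roots.\<close>

lemma euler_form_nonneg:
  assumes x: "euler_form Q x x \<le> 1" "\<And>i. x i \<ge> 0" "x \<noteq> (\<lambda>i. 0)"
    and y: "euler_form Q y y \<le> 1" "\<And>i. y i \<ge> 0" "y \<noteq> (\<lambda>i. 0)"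
    and t: "t = 0 \<or> t = 1" "euler_form Q d x < t" "t \<le> euler_form Q d y"
  shows "euler_form Q x y \<ge> 0"
proof -
  have mult: "m \<ge> 0" if "0 \<le> m * d i" for m i
    using that d_pos[of i] by (simp add: zero_le_mult_iff)
  consider "euler_form Q x x = 0" | "euler_form Q y y = 0" | "euler_form Q x x = 1" "euler_form Q y y = 1"
    using x(1) y(1) psd[of x] psd[of y] by linarith
  then show ?thesis
  proof cases
    case 1
    then obtain m where m: "x = (\<lambda>i. m * d i)" using isotropic by blast
    then have "euler_form Q x y = m * euler_form Q d y" "euler_form Q d x = 0" "m \<ge> 0"
      \<comment> \<open>\<open>undefined\<close> stands for an arbitrary vertex: one entry
        determines the sign of \<open>m\<close>.\<close>
      using mult[OF x(2)[of undefined, unfolded m]] unfolding m by (simp_all only: euler_form_scale_left euler_form_scale_right defect_d mult_zero_right)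
    then show ?thesis using t by (auto intro: mult_nonneg_nonneg)
  next
    case 2
    then obtain m where m: "y = (\<lambda>i. m * d i)" using isotropic by blast
    then have "euler_form Q x y = - m * euler_form Q d x" "euler_form Q d y = 0" "m \<ge> 0"
      using mult[OF y(2)[of undefined, unfolded m]] unfolding m
      by (simp_all only: euler_form_scale_right defect_d mult_zero_right d_rad'[of x] mult_minus_left mult_minus_right)
    moreover have "m * euler_form Q d x \<le> 0"
      using t \<open>euler_form Q d y = 0\<close> \<open>m \<ge> 0\<close> by (intro mult_nonneg_nonpos) auto
    ultimately show ?thesis by linarith
  next
    case 3
    show ?thesis
    proof (cases "t = 1")
      case True
      then show ?thesis using euler_form_nonneg_aux[OF 3(1) x(2) _ 3(2) y(2)] t by simp
    next
      case False
      then have "t = 0" using t by simp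
      \<comment> \<open>On the opposite quiver the defects change sign, so the two roots exchange
        their roles.\<close>
      then show ?thesis
        using affine_form.euler_form_nonneg_aux[OF affine_form_op, of y x] 3 x(2) y(2) t
        by (simp add: d_rad'[of x] d_rad'[of y])
    qed
  qed
qed

end

section \<open>The quadratic form of a harmonic weight as a sum of squares\<close>

lemma tits_form_squares:
  fixes Q :: "('i::finite, 'e::finite) quiver" and d x :: "'i \<Rightarrow> int"
  assumes d_pos: "\<And>i. d i > 0"
    and harmonic: "\<And>i. 2 * d i = (\<Sum>a | src Q a = i. d (tgt Q a)) + (\<Sum>a | tgt Q a = i. d (src Q a))"
  shows "2 * real_of_int (euler_form Q x x) =
     (\<Sum>a\<in>UNIV. real_of_int (d (src Q a) * d (tgt Q a)) *
        (x (src Q a) / d (src Q a) - x (tgt Q a) / d (tgt Q a))\<^sup>2)"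
proof -
  have dnz: "real_of_int (d i) \<noteq> 0" for i using d_pos[of i] by simp
  have "real_of_int (d (src Q a) * d (tgt Q a)) * (x (src Q a) / d (src Q a) - x (tgt Q a) / d (tgt Q a))\<^sup>2
     = (x (src Q a))\<^sup>2 / d (src Q a) * d (tgt Q a) + (x (tgt Q a))\<^sup>2 / d (tgt Q a) * d (src Q a)
       - 2 * (x (src Q a) * x (tgt Q a))" (is "?l a = ?r a") for a
    using dnz[of "src Q a"] dnz[of "tgt Q a"] by (simp add: field_simps power2_eq_square)
  then have "(\<Sum>a\<in>UNIV. ?l a) = (\<Sum>a\<in>UNIV. ?r a)" by (rule sum.cong[OF refl])
  also have "\<dots> = (\<Sum>a\<in>UNIV. (x (src Q a))\<^sup>2 / d (src Q a) * d (tgt Q a))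
      + (\<Sum>a\<in>UNIV. (x (tgt Q a))\<^sup>2 / d (tgt Q a) * d (src Q a))
      - 2 * (\<Sum>a\<in>UNIV. x (src Q a) * x (tgt Q a))"
    by (simp add: sum.distrib sum_subtractf sum_distrib_left)
  also have "(\<Sum>a\<in>UNIV. (x (src Q a))\<^sup>2 / d (src Q a) * d (tgt Q a))
      = (\<Sum>i\<in>UNIV. (x i)\<^sup>2 / d i * (\<Sum>a | src Q a = i. d (tgt Q a)))"
    unfolding sum_fibres[where g = "src Q"] of_int_sum sum_distrib_left
    by (intro sum.cong refl) simp
  also have "(\<Sum>a\<in>UNIV. (x (tgt Q a))\<^sup>2 / d (tgt Q a) * d (src Q a))
      = (\<Sum>i\<in>UNIV. (x i)\<^sup>2 / d i * (\<Sum>a | tgt Q a = i. d (src Q a)))"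
    unfolding sum_fibres[where g = "tgt Q"] of_int_sum sum_distrib_left
    by (intro sum.cong refl) simp
  \<comment> \<open>Collected at a vertex, the square terms carry the sum of the neighbouring
    weights, which harmonicity turns into \<open>2 * d i\<close>.\<close>
  also have "(\<Sum>i\<in>UNIV. (x i)\<^sup>2 / d i * (\<Sum>a | src Q a = i. d (tgt Q a)))
      + (\<Sum>i\<in>UNIV. (x i)\<^sup>2 / d i * (\<Sum>a | tgt Q a = i. d (src Q a)))
      = (\<Sum>i\<in>UNIV. (x i)\<^sup>2 / d i * (2 * d i))"
    unfolding sum.distrib[symmetric] distrib_left[symmetric] of_int_add[symmetric] harmonic[symmetric]
    by simp
  also have "\<dots> = (\<Sum>i\<in>UNIV. 2 * real_of_int ((x i)\<^sup>2))"
    using dnz by (intro sum.cong refl) simp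
  finally show ?thesis
    by (simp add: euler_form_def sum_distrib_left power2_eq_square)
qed

text \<open>All properties are read off from the sum of squares. If the form vanishes, the ratios
  \<open>x i / d i\<close> agree along every arrow and so everywhere; if it is 1, they vary by a
  bounded amount along every arrow. The vertex \<open>i0\<close> with \<open>d i0 = 1\<close> turns
  the common ratio into the integer \<open>x i0\<close>.\<close>

lemma affine_formI:
  fixes Q :: "('i::finite, 'e::finite) quiver" and d :: "'i \<Rightarrow> int"
  assumes acyclic: "acyclic_quiver Q" and d_pos: "\<And>i. d i > 0" and i0: "d i0 = 1"
    and harmonic: "\<And>i. 2 * d i = (\<Sum>a | src Q a = i. d (tgt Q a)) + (\<Sum>a | tgt Q a = i. d (src Q a))"
    and conn: "\<And>P i. P i0 \<Longrightarrow> (\<And>a. P (src Q a) \<longleftrightarrow> P (tgt Q a)) \<Longrightarrow> P i"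
  shows "affine_form Q d"
proof
  note sq = tits_form_squares[OF d_pos harmonic]
  let ?w = "\<lambda>a. real_of_int (d (src Q a) * d (tgt Q a))"
  let ?D = "\<lambda>x a. real_of_int (x (src Q a)) / d (src Q a) - x (tgt Q a) / d (tgt Q a)"
  have dnz: "real_of_int (d i) > 0" for i using d_pos[of i] by simp
  have w: "?w a \<ge> 1" for a
  proof -
    have "d (src Q a) * d (tgt Q a) > 0" using d_pos by (intro mult_pos_pos)
    then show ?thesis by linarith
  qed
  have nn: "0 \<le> ?w a * (?D x a)\<^sup>2" for x a using w[of a] by (intro mult_nonneg_nonneg) auto
  show "acyclic_quiver Q" by fact
  show "d i > 0" for i by fact
  show "euler_form Q d x + euler_form Q x d = 0" for x
  proof -
    have "euler_form Q d x + euler_form Q x d =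
      (\<Sum>i\<in>UNIV. x i * (euler_form Q d (evec i) + euler_form Q (evec i) d))"
      unfolding euler_form_expand_right[of Q d x] euler_form_expand_left[of Q x d]
      by (simp add: sum.distrib distrib_left)
    also have "\<dots> = 0"
    proof (intro sum.neutral ballI)
      fix i
      have "euler_form Q d (evec i) + euler_form Q (evec i) d = 0"
        unfolding euler_form_evec_left euler_form_evec_right using harmonic[of i] by simp
      then show "x i * (euler_form Q d (evec i) + euler_form Q (evec i) d) = 0" by simp
    qed
    finally show ?thesis .
  qed
  show "euler_form Q x x \<ge> 0" for x
  proof -
    have "0 \<le> 2 * real_of_int (euler_form Q x x)" unfolding sq by (intro sum_nonneg nn)
    then show ?thesis by simp
  qed
  show "\<exists>m. x = (\<lambda>i. m * d i)" if "euler_form Q x x = 0" for x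
  proof -
    have s0: "(\<Sum>a\<in>UNIV. ?w a * (?D x a)\<^sup>2) = 0" using sq[of x] that by simp
    have z: "?w a * (?D x a)\<^sup>2 = 0" for a by (rule sum_nonneg_0[OF finite nn s0 UNIV_I])
    have "?D x a = 0" for a
    proof -
      from z[of a] have "?w a = 0 \<or> (?D x a)\<^sup>2 = 0" by (rule mult_eq_0_iff[THEN iffD1])
      moreover have "?w a \<noteq> 0" using w[of a] by linarith
      ultimately have "(?D x a)\<^sup>2 = 0" by argo
      then show ?thesis by (simp only: zero_eq_power2)
    qed
    then have eq: "x (src Q a) / d (src Q a) = x (tgt Q a) / d (tgt Q a)" for a by simp
    have xi: "x i / d i = x i0" for i
      by (rule conn[of "\<lambda>i. x i / d i = x i0"]) (auto simp: i0 eq)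
    have "real_of_int (x i) = x i0 * d i" for i using xi[of i] dnz[of i] by (simp add: field_simps)
    then have "x i = x i0 * d i" for i by (metis of_int_eq_iff of_int_mult)
    then have "x = (\<lambda>i. x i0 * d i)" by (rule ext)
    then show ?thesis by (rule exI[of _ "x i0"])
  qed
  show "\<exists>K. \<forall>x. euler_form Q x x = 1 \<longrightarrow> (\<exists>m. \<forall>i. \<bar>x i - m * d i\<bar> \<le> K)"
  proof -
    have D: "\<bar>?D x a\<bar> \<le> 2" if "euler_form Q x x = 1" for x a
    proof -
      have "(?D x a)\<^sup>2 \<le> ?w a * (?D x a)\<^sup>2"
        using mult_right_mono[OF w[of a], of "(?D x a)\<^sup>2"] by simp
      also have "\<dots> \<le> (\<Sum>a\<in>UNIV. ?w a * (?D x a)\<^sup>2)" by (rule member_le_sum[OF UNIV_I nn finite])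
      also have "\<dots> = 2" using sq[of x] that by simp
      \<comment> \<open>The sum of squares equals 2 and all weights are at least 1. The cruder bound
        4 avoids a square root.\<close>
      finally have "(?D x a)\<^sup>2 \<le> 2\<^sup>2" by simp
      then show ?thesis using abs_le_square_iff[of "?D x a" 2] by simp
    qed
    let ?P = "\<lambda>i. \<exists>K. \<forall>x. euler_form Q x x = 1 \<longrightarrow> \<bar>x i / d i - x i0\<bar> \<le> K"
    have "?P i" for i
    proof (rule conn[of ?P])
      show "?P i0" by (rule exI[of _ 0]) (simp add: i0)
    next
      fix a
      have step: "?P j" if "?P i" "\<And>x. euler_form Q x x = 1 \<Longrightarrow> \<bar>x i / d i - x j / d j\<bar> \<le> 2" for i j
      proof -
        obtain K where K: "\<And>x. euler_form Q x x = 1 \<Longrightarrow> \<bar>x i / d i - x i0\<bar> \<le> K" using \<open>?P i\<close> by blast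
        have "\<bar>x j / d j - x i0\<bar> \<le> K + 2" if "euler_form Q x x = 1" for x
          using K[OF that] \<open>\<And>x. euler_form Q x x = 1 \<Longrightarrow> \<bar>x i / d i - x j / d j\<bar> \<le> 2\<close>[OF that]
          by linarith
        then show ?thesis by blast
      qed
      show "?P (src Q a) \<longleftrightarrow> ?P (tgt Q a)"
        by (rule iffI; erule step) (use D[of _ a] in \<open>auto simp: abs_minus_commute\<close>)
    qed
    then obtain K where K: "\<And>i x. euler_form Q x x = 1 \<Longrightarrow> \<bar>x i / d i - x i0\<bar> \<le> K i" by metis
    \<comment> \<open>One integer bound for all vertices: a sum of non-negative terms dominates each
      of them.\<close>
    define M where "M = (\<Sum>i\<in>UNIV. \<lceil>\<bar>K i\<bar> * d i\<rceil>)"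
    have "\<bar>x i - x i0 * d i\<bar> \<le> M" if "euler_form Q x x = 1" for x i
    proof -
      have "real_of_int \<bar>x i - x i0 * d i\<bar> = \<bar>x i / d i - x i0\<bar> * d i"
        using dnz[of i] by (simp add: abs_mult_pos[symmetric] field_simps flip: abs_mult_pos)
      also have "\<dots> \<le> \<bar>K i\<bar> * d i" using K[OF that, of i] dnz[of i] by (intro mult_right_mono) auto
      also have "\<dots> \<le> \<lceil>\<bar>K i\<bar> * d i\<rceil>" by (rule le_of_int_ceiling)
      finally have "\<bar>x i - x i0 * d i\<bar> \<le> \<lceil>\<bar>K i\<bar> * d i\<rceil>" by linarith
      also have "\<dots> \<le> M" unfolding M_def
      proof (rule member_le_sum)
        fix j
        have "0 \<le> \<bar>K j\<bar> * d j" using dnz[of j] by (intro mult_nonneg_nonneg) auto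
        then show "0 \<le> \<lceil>\<bar>K j\<bar> * d j\<rceil>" by linarith
      qed auto
      finally show ?thesis .
    qed
    then show ?thesis by blast
  qed
qed

text \<open>The entry 1 makes \<open>d\<close> indivisible. Any other candidate lies in the radical,
  so it is \<open>n * d\<close>; its greatest common divisor forces \<open>n\<close> to divide 1,
  and its sign leaves \<open>n = 1\<close>.\<close>

lemma (in affine_form) delta_eq:
  assumes i0: "d i0 = 1"
  shows "delta Q = d"
  unfolding delta_def
proof (rule the_equality)
  have rad: "{x. \<forall>y. sym_euler_form Q x y = 0} = range (\<lambda>n i. n * d i)"
  proof (intro equalityI subsetI)
    fix x assume "x \<in> {x. \<forall>y. sym_euler_form Q x y = 0}"
    then have "sym_euler_form Q x x = 0" by simp
    then have "euler_form Q x x = 0" by (simp add: sym_euler_form_def)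
    then show "x \<in> range (\<lambda>n i. n * d i)" using isotropic[of x] by blast
  next
    fix x assume "x \<in> range (\<lambda>n i. n * d i)"
    then obtain n where x: "x = (\<lambda>i. n * d i)" by blast
    have "sym_euler_form Q x y = n * (euler_form Q d y + euler_form Q y d)" for y
      by (simp add: x sym_euler_form_def euler_form_scale_left euler_form_scale_right distrib_left)
    then show "x \<in> {x. \<forall>y. sym_euler_form Q x y = 0}" using d_rad by simp
  qed
  have "Gcd (range d) dvd d i0" by (rule Gcd_dvd) simp
  then have "Gcd (range d) = 1" using i0 by simp
  then show "(\<forall>i. 0 \<le> d i) \<and> Gcd (range d) = 1 \<and>
      {x. \<forall>y. sym_euler_form Q x y = 0} = range (\<lambda>n i. n * d i)"
    using rad d_pos by (simp add: less_imp_le)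
  fix d' assume d': "(\<forall>i. 0 \<le> d' i) \<and> Gcd (range d') = 1 \<and>
      {x. \<forall>y. sym_euler_form Q x y = 0} = range (\<lambda>n i. n * d' i)"
  have "d' \<in> range (\<lambda>n i. n * d' i)" by (rule image_eqI[of _ _ 1]) auto
  then have "d' \<in> range (\<lambda>n i. n * d i)" using rad d' by simp
  then obtain n where n: "d' = (\<lambda>i. n * d i)" by blast
  have "n dvd Gcd (range d')" by (rule Gcd_greatest) (auto simp: n)
  then have "n dvd 1" using d' by simp
  moreover have "0 \<le> d' i0" using d' by blast
  then have "n \<ge> 0" using i0 by (simp add: n)
  ultimately have "n = 1" by simp
  then show "d' = d" using n by simp
qed

section \<open>Harmonic weights on the extended Dynkin diagrams\<close>

definition edge_weight :: "(nat \<Rightarrow> int) \<Rightarrow> nat \<Rightarrow> nat set \<Rightarrow> int" where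
  "edge_weight f v e = (if v \<in> e then sum f e - f v else 0)"

text \<open>A connected graph on \<open>{..<N}\<close> with a positive weight \<open>f\<close> that is harmonic, twice each weight being
  the sum of the neighbouring ones: the certificate that the graph is extended Dynkin, with
  \<open>\<delta> = f\<close>.\<close>

definition harmonic_diagram :: "nat \<Rightarrow> nat set multiset \<Rightarrow> (nat \<Rightarrow> int) \<Rightarrow> nat \<Rightarrow> bool" where
  "harmonic_diagram N E f v0 \<longleftrightarrow> v0 < N \<and> f v0 = 1 \<and> (\<forall>v<N. f v > 0) \<and>
     (\<forall>v<N. 2 * f v = (\<Sum>e\<in>#E. edge_weight f v e)) \<and>
     (\<forall>P. P v0 \<longrightarrow> (\<forall>e\<in>#E. \<forall>u\<in>e. \<forall>w\<in>e. P u \<longrightarrow> P w) \<longrightarrow> (\<forall>v<N. P v))"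

lemma edge_weight_pair:
  "u \<noteq> w \<Longrightarrow> edge_weight f v {u, w} = (if v = u then f w else 0) + (if v = w then f u else 0)"
  by (auto simp: edge_weight_def)

lemma sum_mset_upt: "(\<Sum>e\<in>#{# g k. k \<in># mset [m..<n] #}. h e) = (\<Sum>k=m..<n. h (g k))"
  by (simp add: sum_unfold_sum_mset image_mset.compositionality comp_def)

lemma harmonic_A:
  assumes "n \<ge> 1"
  shows "harmonic_diagram (n + 1) {# {k, (k + 1) mod (n + 1)}. k \<in># mset [0..<n + 1] #} (\<lambda>_. 1) 0"
  unfolding harmonic_diagram_def
proof (intro conjI allI impI)
  fix v assume v: "v < n + 1"
  have "(\<Sum>e\<in>#{# {k, (k + 1) mod (n + 1)}. k \<in># mset [0..<n + 1] #}. edge_weight (\<lambda>_. 1) v e)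
    = (\<Sum>k=0..<n + 1. edge_weight (\<lambda>_. 1) v {k, (k + 1) mod (n + 1)})"
    by (rule sum_mset_upt)
  also have "\<dots> = (\<Sum>k=0..<n + 1. (if v = k then 1 else 0) + (if v = (k + 1) mod (n + 1) then 1 else 0))"
  proof (intro sum.cong refl)
    fix k assume "k \<in> {0..<n + 1}"
    then have "k \<noteq> (k + 1) mod (n + 1)" using assms by (cases "k = n") auto
    then show "edge_weight (\<lambda>_. 1) v {k, (k + 1) mod (n + 1)} =
      (if v = k then 1 else 0) + (if v = (k + 1) mod (n + 1) then 1 else 0)"
      by (rule edge_weight_pair)
  qed
  also have "\<dots> = 1 + (\<Sum>k=0..<n + 1. if v = (k + 1) mod (n + 1) then 1 else 0)"
    using v by (simp add: sum.distrib del: sum.op_ivl_Suc)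
  also have "(\<Sum>k=0..<n + 1. if v = (k + 1) mod (n + 1) then 1 else 0)
      = (\<Sum>k=0..<n. if v = (k + 1) mod (n + 1) then 1 else 0) + (if v = 0 then 1 else (0::int))"
    by simp
  \<comment> \<open>For \<open>k < n\<close> the second end point is \<open>k + 1\<close>, so only
    \<open>k = v - 1\<close> contributes. At \<open>v = 0\<close> the truncated \<open>v - 1\<close>
    is 0 as well, which the inner conditional corrects; the closing edge \<open>k = n\<close> has
    been split off before.\<close>
  also have "(\<Sum>k=0..<n. if v = (k + 1) mod (n + 1) then 1 else (0::int)) = (\<Sum>k=0..<n. if k = v - 1 then (if v = 0 then 0 else 1) else 0)"
    by (intro sum.cong refl) auto
  also have "\<dots> = (if v = 0 then 0 else 1)" using v by auto
  finally show "2 * (1::int) = (\<Sum>e\<in>#{# {k, (k + 1) mod (n + 1)}. k \<in># mset [0..<n + 1] #}. edge_weight (\<lambda>_. 1) v e)"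
    by (cases "v = 0") auto
next
  fix P v
  assume P: "P 0" and cl: "\<forall>e\<in>#{# {k, (k + 1) mod (n + 1)}. k \<in># mset [0..<n + 1] #}. \<forall>u\<in>e. \<forall>w\<in>e. P u \<longrightarrow> P w"
    and v: "v < n + 1"
  have step: "P (k + 1)" if "k < n" "P k" for k
  proof -
    have "{k, (k + 1) mod (n + 1)} \<in># {# {k, (k + 1) mod (n + 1)}. k \<in># mset [0..<n + 1] #}"
      using that by (auto intro!: imageI)
    from cl[rule_format, OF this, of k "(k + 1) mod (n + 1)"] have "P ((k + 1) mod (n + 1))"
      using that(2) by simp
    then show ?thesis using that by simp
  qed
  show "P v" using v
  proof (induction v)
    case (Suc v)
    then show ?case using step[of v] by simp
  qed (rule P)
qed auto

lemma harmonic_D: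
  assumes n: "n \<ge> 4"
  shows "harmonic_diagram (n + 1)
     ({# {0, 2}, {1, 2} #} + {# {k, k + 1}. k \<in># mset [2..<n - 2] #} + {# {n - 2, n - 1}, {n - 2, n} #})
     (\<lambda>v. if v \<le> 1 \<or> n - 1 \<le> v then 1 else 2) 0" (is "harmonic_diagram _ (?E1 + ?E2 + ?E3) ?f 0")
  unfolding harmonic_diagram_def
proof (intro conjI allI impI)
  fix v assume v: "v < n + 1"
  have "(\<Sum>e\<in>#?E2. edge_weight ?f v e) = (\<Sum>k=2..<n - 2. edge_weight ?f v {k, k + 1})"
    by (rule sum_mset_upt)
  also have "\<dots> = (\<Sum>k=2..<n - 2. (if v = k then 2 else 0) + (if k = v - 1 then (if v = 0 then 0 else 2) else 0))"
  proof (intro sum.cong refl)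
    fix k assume k: "k \<in> {2..<n - 2}"
    then have "?f k = 2" "?f (k + 1) = 2" by auto
    with k show "edge_weight ?f v {k, k + 1} = (if v = k then 2 else 0) + (if k = v - 1 then (if v = 0 then 0 else 2) else 0)"
      by (subst edge_weight_pair) auto
  qed
  also have "\<dots> = (if v \<in> {2..<n - 2} then 2 else 0) + (if v - 1 \<in> {2..<n - 2} then (if v = 0 then 0 else 2) else 0)"
    by (simp add: sum.distrib)
  finally have E2: "(\<Sum>e\<in>#?E2. edge_weight ?f v e) = \<dots>" .
  have ne: "(0::nat) \<noteq> 2" "(1::nat) \<noteq> 2" "n - 2 \<noteq> n - 1" "n - 2 \<noteq> n" using n by auto
  have "(\<Sum>e\<in>#?E1. edge_weight ?f v e) = edge_weight ?f v {0, 2} + edge_weight ?f v {1, 2}"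
    by simp
  moreover have "(\<Sum>e\<in>#?E3. edge_weight ?f v e) = edge_weight ?f v {n - 2, n - 1} + edge_weight ?f v {n - 2, n}"
    by simp
  ultimately have sum: "(\<Sum>e\<in>#?E1 + ?E2 + ?E3. edge_weight ?f v e) =
      (edge_weight ?f v {0, 2} + edge_weight ?f v {1, 2})
      + ((if v \<in> {2..<n - 2} then 2 else 0) + (if v - 1 \<in> {2..<n - 2} then (if v = 0 then 0 else 2) else 0))
      + (edge_weight ?f v {n - 2, n - 1} + edge_weight ?f v {n - 2, n})"
    unfolding image_mset_union sum_mset.union E2 by (simp only:)
  \<comment> \<open>For \<open>n = 4\<close> the two forks meet in the single inner vertex 2, so
    this case is listed apart from the inner ends of a longer chain.\<close>
  have "v = 0 \<or> v = 1 \<or> v = n - 1 \<or> v = n \<or> (v = 2 \<and> n = 4) \<or> (v = 2 \<and> n > 4) \<or> (v = n - 2 \<and> n > 4)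
     \<or> (2 < v \<and> v < n - 2)"
    using v n by linarith
  then show "2 * ?f v = (\<Sum>e\<in>#?E1 + ?E2 + ?E3. edge_weight ?f v e)"
    unfolding sum edge_weight_pair[OF ne(1)] edge_weight_pair[OF ne(2)] edge_weight_pair[OF ne(3)]
      edge_weight_pair[OF ne(4)]
    using n by (elim disjE) auto
next
  fix P v
  assume P: "P 0" and cl: "\<forall>e\<in>#?E1 + ?E2 + ?E3. \<forall>u\<in>e. \<forall>w\<in>e. P u \<longrightarrow> P w" and v: "v < n + 1"
  have e: "{0, 2} \<in># ?E1 + ?E2 + ?E3" "{1, 2} \<in># ?E1 + ?E2 + ?E3"
    "{n - 2, n - 1} \<in># ?E1 + ?E2 + ?E3" "{n - 2, n} \<in># ?E1 + ?E2 + ?E3"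
    unfolding union_iff by (simp_all only: set_mset_add_mset_insert insert_iff simp_thms)
  have P2: "P 2" using cl[rule_format, OF e(1), of 0 2] P by simp
  have P1: "P 1" using cl[rule_format, OF e(2), of 2 1] P2 by simp
  have step: "P (k + 1)" if "k \<in> {2..<n - 2}" "P k" for k
  proof -
    have "{k, k + 1} \<in># ?E2"
      unfolding set_image_mset by (rule image_eqI[of _ _ k]) (use that in simp_all)
    then have "{k, k + 1} \<in># ?E1 + ?E2 + ?E3" by (simp only: union_iff simp_thms)
    from cl[rule_format, OF this, of k "k + 1"] show ?thesis using that(2) by simp
  qed
  have mid: "k \<le> n - 2 \<Longrightarrow> P k" if "2 \<le> k" for k
    using that
  proof (induction k rule: dec_induct)
    case (step k)
    then show ?case using \<open>\<And>k. k \<in> {2..<n - 2} \<Longrightarrow> P k \<Longrightarrow> P (k + 1)\<close>[of k] by auto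
  qed (simp add: P2)
  have "P (n - 2)" using mid[of "n - 2"] n by simp
  then have "P (n - 1)" "P n"
    using cl[rule_format, OF e(3), of "n - 2" "n - 1"] cl[rule_format, OF e(4), of "n - 2" n] by simp_all
  moreover have "v = 0 \<or> v = 1 \<or> v = n - 1 \<or> v = n \<or> (2 \<le> v \<and> v \<le> n - 2)" using v by linarith
  ultimately show "P v" using P P1 mid by (elim disjE) simp_all
qed auto

lemma all_less_numeral_nat:
  "(\<forall>v<numeral k. P v) \<longleftrightarrow> P (pred_numeral k) \<and> (\<forall>v<pred_numeral k. P v)" for P :: "nat \<Rightarrow> bool"
  by (auto simp: numeral_eq_Suc less_Suc_eq)

lemma all_less_one_nat: "(\<forall>v<Suc 0. P v) \<longleftrightarrow> P 0" by auto

text \<open>On each arm the weight falls linearly from the centre, reaching 0 one step beyond the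
  end, which is harmonicity on the arm. The last argument is an end point of weight 1.\<close>

lemma harmonic_E6: "harmonic_diagram 7 {# {0, 1}, {1, 2}, {0, 3}, {3, 4}, {0, 5}, {5, 6} #}
    (\<lambda>v. [3, 2, 1, 2, 1, 2, 1] ! v) 2"
  unfolding harmonic_diagram_def
  by (simp add: all_less_numeral_nat all_less_one_nat edge_weight_def insert_commute)

lemma harmonic_E7: "harmonic_diagram 8 {# {0, 1}, {1, 2}, {2, 3}, {0, 4}, {4, 5}, {5, 6}, {0, 7} #}
    (\<lambda>v. [4, 3, 2, 1, 3, 2, 1, 2] ! v) 3"
  unfolding harmonic_diagram_def
  by (simp add: all_less_numeral_nat all_less_one_nat edge_weight_def insert_commute)

lemma harmonic_E8: "harmonic_diagram 9 {# {0, 1}, {1, 2}, {2, 3}, {3, 4}, {4, 5}, {0, 6}, {6, 7}, {0, 8} #}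
    (\<lambda>v. [6, 5, 4, 3, 2, 1, 4, 2, 3] ! v) 5"
  unfolding harmonic_diagram_def
  by (simp add: all_less_numeral_nat all_less_one_nat edge_weight_def insert_commute)

text \<open>Edges with two end points exclude the one-vertex loop, the case \<open>n = 0\<close> of
  \<open>A\<close>; the other diagrams have the weights found above.\<close>

lemma extended_dynkin_harmonic:
  assumes "(N, E) \<in> extended_dynkin" and "\<forall>e\<in>#E. card e = 2"
  shows "\<exists>f v0. harmonic_diagram N E f v0"
  using assms
proof cases
  case (A n)
  have "n \<noteq> 0"
  proof
    assume "n = 0"
    then have "{0} \<in># E" using A by simp
    then show False using assms(2) by fastforce
  qed
  then show ?thesis using harmonic_A[of n] A by auto
next
  case (D n)
  then show ?thesis using harmonic_D[of n] by blast
qed (use harmonic_E6 harmonic_E7 harmonic_E8 in blast)+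

theorem affine_form_delta:
  fixes Q :: "('i::finite, 'e::finite) quiver"
  assumes "affine_quiver Q" and acyclic: "acyclic_quiver Q"
  shows "affine_form Q (delta Q)"
proof -
  obtain N E \<phi> where ND: "(N, E) \<in> extended_dynkin" and \<phi>: "bij_betw \<phi> (UNIV :: 'i set) {..<N}"
    and E: "{# {\<phi> (src Q a), \<phi> (tgt Q a)}. a \<in># mset_set (UNIV :: 'e set) #} = E"
    using assms(1) unfolding affine_quiver_def by blast
  have inj: "\<phi> i = \<phi> j \<longleftrightarrow> i = j" for i j using \<phi> by (auto simp: bij_betw_def inj_on_def)
  have lt: "\<phi> i < N" for i using \<phi> by (auto simp: bij_betw_def)
  have ne: "\<phi> (src Q a) \<noteq> \<phi> (tgt Q a)" for a using acyclic_no_loop[OF acyclic, of a] inj by simp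
  have Emem: "e \<in># E \<longleftrightarrow> (\<exists>a. e = {\<phi> (src Q a), \<phi> (tgt Q a)})" for e
    unfolding E[symmetric] by auto
  have "\<forall>e\<in>#E. card e = 2" using ne by (auto simp: Emem)
  then obtain f v0 where h: "harmonic_diagram N E f v0"
    using extended_dynkin_harmonic[OF ND] by blast
  have "v0 \<in> range \<phi>" using h \<phi> by (simp add: harmonic_diagram_def bij_betw_def)
  then obtain i0 where i0: "\<phi> i0 = v0" by blast
  define d where "d i = f (\<phi> i)" for i
  have d0: "d i0 = 1" using h by (simp add: d_def i0 harmonic_diagram_def)
  have "affine_form Q d"
  proof (rule affine_formI[OF acyclic])
    show "d i > 0" for i using h lt[of i] by (simp add: d_def harmonic_diagram_def)
    show "d i0 = 1" by (rule d0)
    show "2 * d i = (\<Sum>a | src Q a = i. d (tgt Q a)) + (\<Sum>a | tgt Q a = i. d (src Q a))" for i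
    proof -
      have "2 * d i = (\<Sum>e\<in>#E. edge_weight f (\<phi> i) e)"
        using h lt[of i] by (simp add: d_def harmonic_diagram_def)
      also have "\<dots> = (\<Sum>a\<in>UNIV. edge_weight f (\<phi> i) {\<phi> (src Q a), \<phi> (tgt Q a)})"
        unfolding E[symmetric] by (simp add: sum_unfold_sum_mset image_mset.compositionality comp_def)
      also have "\<dots> = (\<Sum>a\<in>UNIV. (if src Q a = i then d (tgt Q a) else 0) + (if tgt Q a = i then d (src Q a) else 0))"
        by (intro sum.cong refl) (simp add: edge_weight_pair[OF ne] inj d_def eq_commute)
      also have "\<dots> = (\<Sum>a | src Q a = i. d (tgt Q a)) + (\<Sum>a | tgt Q a = i. d (src Q a))"
        by (simp add: sum.distrib sum.If_cases)
      finally show ?thesis .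
    qed
    fix P :: "'i \<Rightarrow> bool" and i
    assume P0: "P i0" and cl: "\<And>a. P (src Q a) \<longleftrightarrow> P (tgt Q a)"
    let ?P = "\<lambda>v. \<exists>j. \<phi> j = v \<and> P j"
    have conn: "\<And>P. P v0 \<Longrightarrow> (\<forall>e\<in>#E. \<forall>u\<in>e. \<forall>w\<in>e. P u \<longrightarrow> P w) \<Longrightarrow> (\<forall>v<N. P v)"
      using h unfolding harmonic_diagram_def by blast
    have "\<forall>v<N. ?P v"
    proof (rule conn)
      show "?P v0" using i0 P0 by blast
      show "\<forall>e\<in>#E. \<forall>u\<in>e. \<forall>w\<in>e. ?P u \<longrightarrow> ?P w" using cl by (auto simp: Emem inj)
    qed
    then have "?P (\<phi> i)" using lt[of i] by blast
    then show "P i" by (simp add: inj)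
  qed
  moreover from affine_form.delta_eq[OF this d0] have "delta Q = d" .
  ultimately show ?thesis by simp
qed

section \<open>Linear maps on subspaces of a universal vector space\<close>

definition fscale :: "'k::field \<Rightarrow> (nat \<Rightarrow> 'k) \<Rightarrow> nat \<Rightarrow> 'k" where
  "fscale c v = (\<lambda>n. c * v n)"

interpretation fv: vector_space fscale
  by unfold_locales (auto simp: fscale_def fun_eq_iff algebra_simps)

interpretation fvp: vector_space_pair fscale fscale
  by unfold_locales

text \<open>Maps between subspaces are total functions with arbitrary values outside, so linearity
  is asked only on \<open>V\<close>.\<close>

definition lin_on :: "(nat \<Rightarrow> 'k::field) set \<Rightarrow> ((nat \<Rightarrow> 'k) \<Rightarrow> (nat \<Rightarrow> 'k)) \<Rightarrow> bool" where
  "lin_on V f \<longleftrightarrow> (\<forall>x\<in>V. \<forall>y\<in>V. f (x + y) = f x + f y) \<and> (\<forall>c. \<forall>x\<in>V. f (fscale c x) = fscale c (f x))"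

lemma lin_on_add: "lin_on V f \<Longrightarrow> x \<in> V \<Longrightarrow> y \<in> V \<Longrightarrow> f (x + y) = f x + f y"
  and lin_on_scale: "lin_on V f \<Longrightarrow> x \<in> V \<Longrightarrow> f (fscale c x) = fscale c (f x)"
  unfolding lin_on_def by blast+

lemma lin_onI:
  "(\<And>x y. x \<in> V \<Longrightarrow> y \<in> V \<Longrightarrow> f (x + y) = f x + f y) \<Longrightarrow>
   (\<And>c x. x \<in> V \<Longrightarrow> f (fscale c x) = fscale c (f x)) \<Longrightarrow> lin_on V f"
  unfolding lin_on_def by blast

lemma lin_on_zero:
  assumes "lin_on V f" "fv.subspace V"
  shows "f 0 = 0"
  using lin_on_scale[OF assms(1) fv.subspace_0[OF assms(2)], of 0] by simp

lemma lin_on_diff: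
  assumes "lin_on V f" "fv.subspace V" "x \<in> V" "y \<in> V"
  shows "f (x - y) = f x - f y"
proof -
  have "f (x - y) + f y = f ((x - y) + y)"
    by (rule lin_on_add[OF assms(1) fv.subspace_diff[OF assms(2-4)] assms(4), symmetric])
  then have "f (x - y) + f y = f x" by simp
  then show ?thesis by (simp only: eq_diff_eq)
qed

lemma lin_on_subset: "lin_on V f \<Longrightarrow> W \<subseteq> V \<Longrightarrow> lin_on W f"
  unfolding lin_on_def by blast

lemma lin_on_cong: "lin_on V f \<Longrightarrow> fv.subspace V \<Longrightarrow> (\<And>x. x \<in> V \<Longrightarrow> g x = f x) \<Longrightarrow> lin_on V g"
  unfolding lin_on_def by (simp add: fv.subspace_add fv.subspace_scale)

lemma lin_on_comp:
  assumes "lin_on V f" "f ` V \<subseteq> W" "lin_on W g"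
  shows "lin_on V (\<lambda>x. g (f x))"
  using assms unfolding lin_on_def by (simp add: image_subset_iff)

lemma lin_on_plus: "lin_on V f \<Longrightarrow> lin_on V g \<Longrightarrow> lin_on V (\<lambda>x. f x + g x)"
  unfolding lin_on_def by (simp add: fv.scale_right_distrib ac_simps)

lemma lin_on_minus: "lin_on V f \<Longrightarrow> lin_on V g \<Longrightarrow> lin_on V (\<lambda>x. f x - g x)"
  unfolding lin_on_def by (simp add: fv.scale_right_diff_distrib)

lemma lin_on_id: "lin_on V (\<lambda>x. x)"
  unfolding lin_on_def by simp

lemma lin_on_0: "lin_on V (\<lambda>x. 0)"
  unfolding lin_on_def by simp

lemma lin_on_image_subspace:
  assumes f: "lin_on V f" and V: "fv.subspace V"
  shows "fv.subspace (f ` V)"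
proof (rule fv.subspaceI)
  show "0 \<in> f ` V" using lin_on_zero[OF f V] fv.subspace_0[OF V] by force
  show "x + y \<in> f ` V" if xy: "x \<in> f ` V" "y \<in> f ` V" for x y
  proof -
    obtain u v where "u \<in> V" "v \<in> V" "x = f u" "y = f v" using xy by blast
    then show ?thesis using lin_on_add[OF f, of u v] fv.subspace_add[OF V, of u v]
      by (intro image_eqI[of _ _ "u + v"]) simp_all
  qed
  show "fscale c x \<in> f ` V" if x: "x \<in> f ` V" for c x
  proof -
    obtain u where "u \<in> V" "x = f u" using x by blast
    then show ?thesis using lin_on_scale[OF f, of u c] fv.subspace_scale[OF V, of u c]
      by (intro image_eqI[of _ _ "fscale c u"]) simp_all
  qed
qed

lemma lin_on_vimage_subspace:
  assumes f: "lin_on V f" and V: "fv.subspace V" and W: "fv.subspace W"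
  shows "fv.subspace {x \<in> V. f x \<in> W}"
proof (rule fv.subspaceI)
  show "0 \<in> {x \<in> V. f x \<in> W}" using lin_on_zero[OF f V] fv.subspace_0[OF V] fv.subspace_0[OF W] by simp
  show "x + y \<in> {x \<in> V. f x \<in> W}" if "x \<in> {x \<in> V. f x \<in> W}" "y \<in> {x \<in> V. f x \<in> W}" for x y
    using that lin_on_add[OF f, of x y] fv.subspace_add[OF V, of x y] fv.subspace_add[OF W, of "f x" "f y"] by simp
  show "fscale c x \<in> {x \<in> V. f x \<in> W}" if "x \<in> {x \<in> V. f x \<in> W}" for c x
    using that lin_on_scale[OF f, of x c] fv.subspace_scale[OF V, of x c] fv.subspace_scale[OF W, of "f x" c] by simp
qed

lemma lin_on_inj:
  assumes f: "lin_on V f" and V: "fv.subspace V" and ker: "\<And>x. x \<in> V \<Longrightarrow> f x = 0 \<Longrightarrow> x = 0"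
  shows "inj_on f V"
proof (rule inj_onI)
  fix x y assume xy: "x \<in> V" "y \<in> V" "f x = f y"
  have "f (x - y) = 0" using lin_on_diff[OF f V xy(1,2)] xy(3) by simp
  then have "x - y = 0" using ker[OF fv.subspace_diff[OF V xy(1,2)]] by simp
  then show "x = y" by simp
qed

lemma lin_on_inv_into:
  assumes f: "lin_on V f" and V: "fv.subspace V" and inj: "inj_on f V"
  shows "lin_on (f ` V) (inv_into V f)"
proof (rule lin_onI)
  fix x y assume "x \<in> f ` V" "y \<in> f ` V"
  then obtain u v where uv: "u \<in> V" "v \<in> V" "x = f u" "y = f v" by blast
  have "inv_into V f (x + y) = inv_into V f (f (u + v))" using lin_on_add[OF f uv(1,2)] uv by simp
  also have "\<dots> = u + v" by (rule inv_into_f_f[OF inj fv.subspace_add[OF V uv(1,2)]])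
  finally show "inv_into V f (x + y) = inv_into V f x + inv_into V f y"
    using uv inj by (simp add: inv_into_f_f)
next
  fix c x assume "x \<in> f ` V"
  then obtain u where u: "u \<in> V" "x = f u" by blast
  have "inv_into V f (fscale c x) = inv_into V f (f (fscale c u))" using lin_on_scale[OF f u(1)] u by simp
  also have "\<dots> = fscale c u" by (rule inv_into_f_f[OF inj fv.subspace_scale[OF V u(1)]])
  finally show "inv_into V f (fscale c x) = fscale c (inv_into V f x)"
    using u inj by (simp add: inv_into_f_f)
qed

lemma linear_lin_on: "Vector_Spaces.linear fscale fscale f \<Longrightarrow> lin_on V f"
  unfolding lin_on_def Vector_Spaces.linear_iff by blast

lemma projection_exists:
  fixes W :: "(nat \<Rightarrow> 'k::field) set"
  assumes "fv.subspace W"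
  obtains g where "\<And>V. lin_on V g" "\<And>x. g x \<in> W" "\<And>x. x \<in> W \<Longrightarrow> g x = x"
proof -
  obtain g where g: "g ` UNIV \<subseteq> W" "Vector_Spaces.linear fscale fscale g" "\<forall>v\<in>W. g (id v) = v"
    using fvp.linear_exists_left_inverse_on[OF fv.linear_id assms] by auto
  show ?thesis
    by (rule that[of g]) (use g in \<open>auto intro: linear_lin_on\<close>)
qed

text \<open>Subtracting a linear projection onto the kernel gives a map \<open>s\<close> that
  depends only on the image under \<open>p\<close>. It therefore descends to a linear right
  inverse.\<close>

lemma section_exists:
  assumes p: "lin_on V p" and V: "fv.subspace V"
  obtains r where "lin_on (p ` V) r" "\<And>y. y \<in> p ` V \<Longrightarrow> r y \<in> V" "\<And>y. y \<in> p ` V \<Longrightarrow> p (r y) = y"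
proof -
  let ?K = "{x \<in> V. p x \<in> {0}}"
  have K: "fv.subspace ?K" by (rule lin_on_vimage_subspace[OF p V fv.subspace_single_0])
  obtain g where g: "\<And>V. lin_on V g" "\<And>x. g x \<in> ?K" "\<And>x. x \<in> ?K \<Longrightarrow> g x = x"
    using projection_exists[OF K] by blast
  define s where "s x = x - g x" for x
  have gV: "g x \<in> V" "p (g x) = 0" for x using g(2)[of x] by auto
  have s: "lin_on V s" unfolding s_def by (rule lin_on_minus[OF lin_on_id g(1)])
  have sV: "s x \<in> V" if "x \<in> V" for x unfolding s_def by (rule fv.subspace_diff[OF V that gV(1)])
  have ps: "p (s x) = p x" if "x \<in> V" for x
    unfolding s_def using lin_on_diff[OF p V that gV(1)] gV(2) by simp
  have seq: "s x = s y" if xy: "x \<in> V" "y \<in> V" "p x = p y" for x y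
  proof -
    have "x - y \<in> ?K" using lin_on_diff[OF p V xy(1,2)] fv.subspace_diff[OF V xy(1,2)] xy(3) by simp
    then have "g (x - y) = x - y" by (rule g(3))
    then have "g x - g y = x - y" using lin_on_diff[OF g(1) V xy(1,2)] by simp
    then show ?thesis by (simp add: s_def algebra_simps)
  qed
  define r where "r y = s (inv_into V p y)" for y
  have rp: "r (p x) = s x" if "x \<in> V" for x
    unfolding r_def
    by (rule seq[OF inv_into_into[OF imageI[OF that]] that f_inv_into_f[OF imageI[OF that]]])
  show ?thesis
  proof (rule that[of r])
    show "lin_on (p ` V) r"
    proof (rule lin_onI)
      fix x y assume "x \<in> p ` V" "y \<in> p ` V"
      then obtain u v where uv: "u \<in> V" "v \<in> V" "x = p u" "y = p v" by blast
      have "r (x + y) = s (u + v)"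
        using rp[OF fv.subspace_add[OF V uv(1,2)]] lin_on_add[OF p uv(1,2)] uv by simp
      also have "\<dots> = r x + r y" using lin_on_add[OF s uv(1,2)] rp uv by simp
      finally show "r (x + y) = r x + r y" .
    next
      fix c x assume "x \<in> p ` V"
      then obtain u where u: "u \<in> V" "x = p u" by blast
      have "r (fscale c x) = s (fscale c u)"
        using rp[OF fv.subspace_scale[OF V u(1)]] lin_on_scale[OF p u(1)] u by simp
      also have "\<dots> = fscale c (r x)" using lin_on_scale[OF s u(1)] rp u by simp
      finally show "r (fscale c x) = fscale c (r x)" .
    qed
    show "r y \<in> V" if "y \<in> p ` V" for y using that rp sV by auto
    show "p (r y) = y" if "y \<in> p ` V" for y using that rp ps by auto
  qed
qed

text \<open>The fibres are translates of the kernel. Stated for additive maps of finite groups, so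
  that it yields rank-nullity for vertex spaces and also for the sets of families of maps counted
  below, which are not subspaces of the sequence space.\<close>

lemma card_additive_map:
  fixes f :: "'a::ab_group_add \<Rightarrow> 'b::ab_group_add"
  assumes fin: "finite A" and A0: "0 \<in> A" and Adiff: "\<And>x y. x \<in> A \<Longrightarrow> y \<in> A \<Longrightarrow> x - y \<in> A"
    and f: "\<And>x y. x \<in> A \<Longrightarrow> y \<in> A \<Longrightarrow> f (x - y) = f x - f y"
  shows "card A = card {x \<in> A. f x = 0} * card (f ` A)"
proof -
  have Aadd: "x + y \<in> A" if "x \<in> A" "y \<in> A" for x y
    using Adiff[OF that(1) Adiff[OF A0 that(2)]] by simp
  have fadd: "f (x + y) = f x + f y" if "x \<in> A" "y \<in> A" for x y
    using f[OF Aadd[OF that] that(2)] by simp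
  have "card A = (\<Sum>y\<in>f ` A. card {x \<in> A. f x = y})"
    using sum.image_gen[OF fin, of "\<lambda>_. 1::nat" f] by simp
  also have "\<dots> = (\<Sum>y\<in>f ` A. card {x \<in> A. f x = 0})"
  proof (rule sum.cong[OF refl])
    fix y assume "y \<in> f ` A"
    then obtain x0 where x0: "x0 \<in> A" "y = f x0" by blast
    have "bij_betw (\<lambda>x. x - x0) {x \<in> A. f x = y} {x \<in> A. f x = 0}"
      by (rule bij_betw_byWitness[where f' = "\<lambda>x. x + x0"]) (use x0 in \<open>auto simp: Adiff Aadd f fadd\<close>)
    then show "card {x \<in> A. f x = y} = card {x \<in> A. f x = 0}" by (rule bij_betw_same_card)
  qed
  finally show ?thesis by simp
qed

lemma card_span_independent:
  fixes B :: "(nat \<Rightarrow> 'k::{field,finite}) set"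
  assumes "finite B" "fv.independent B"
  shows "finite (fv.span B) \<and> card (fv.span B) = CARD('k) ^ card B"
  using assms
proof (induction B rule: finite_induct)
  case (insert b B)
  have ind: "fv.independent B" and b: "b \<notin> fv.span B"
    using insert.prems insert.hyps by (auto simp: fv.independent_insert)
  have IH: "finite (fv.span B)" "card (fv.span B) = CARD('k) ^ card B" using insert.IH[OF ind] by auto
  let ?f = "\<lambda>(k, y). fscale k b + y"
  have "fv.span (insert b B) = ?f ` (UNIV \<times> fv.span B)"
  proof (intro equalityI subsetI)
    fix x assume "x \<in> fv.span (insert b B)"
    then obtain k where "x - fscale k b \<in> fv.span B" by (auto simp: fv.span_insert)
    then show "x \<in> ?f ` (UNIV \<times> fv.span B)" by (intro image_eqI[of _ _ "(k, x - fscale k b)"]) auto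
  next
    fix x assume "x \<in> ?f ` (UNIV \<times> fv.span B)"
    then obtain k y where "y \<in> fv.span B" "x = fscale k b + y" by auto
    then have "x - fscale k b \<in> fv.span B" by simp
    then show "x \<in> fv.span (insert b B)" unfolding fv.span_insert by blast
  qed
  moreover have "inj_on ?f (UNIV \<times> fv.span B)"
  proof (rule inj_onI, clarify)
    fix k y k' y' assume y: "y \<in> fv.span B" "y' \<in> fv.span B" and eq: "fscale k b + y = fscale k' b + y'"
    have e: "fscale (k - k') b = y' - y" using eq by (simp add: fv.scale_left_diff_distrib algebra_simps)
    have "k = k'"
    proof (rule ccontr)
      assume ne: "k \<noteq> k'"
      have "fscale (k - k') b \<in> fv.span B" unfolding e by (rule fv.span_diff[OF y(2,1)])
      then have "fscale (inverse (k - k')) (fscale (k - k') b) \<in> fv.span B" by (rule fv.span_scale)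
      then show False using ne b by simp
    qed
    then show "k = k' \<and> y = y'" using eq by simp
  qed
  ultimately show ?case
    using IH insert.hyps by (simp add: card_image card_cartesian_product)
qed simp

lemma card_field_gt_1: "CARD('k::{field,finite}) > 1"
proof -
  have "card {0, 1 :: 'k} \<le> CARD('k)" by (intro card_mono) auto
  then show ?thesis by simp
qed

lemma subspace_basis:
  fixes V :: "(nat \<Rightarrow> 'k::{field,finite}) set"
  assumes V: "fv.subspace V" and fin: "finite V"
  obtains B where "B \<subseteq> V" "finite B" "fv.independent B" "fv.span B = V" "card B = fv.dim V"
proof -
  obtain B where B: "B \<subseteq> V" "fv.independent B" "V \<subseteq> fv.span B" "card B = fv.dim V"
    using fv.basis_exists by blast
  have "fv.span B = V" using fv.span_minimal[OF B(1) V] B(3) by blast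
  then show ?thesis using B finite_subset[OF B(1) fin] that by blast
qed

lemma card_subspace:
  fixes V :: "(nat \<Rightarrow> 'k::{field,finite}) set"
  assumes "fv.subspace V" "finite V"
  shows "card V = CARD('k) ^ fv.dim V"
  using subspace_basis[OF assms] card_span_independent by metis

lemma dim_eqI_card:
  fixes V :: "(nat \<Rightarrow> 'k::{field,finite}) set"
  assumes "fv.subspace V" "finite V" "card V = CARD('k) ^ n"
  shows "fv.dim V = n"
  using card_subspace[OF assms(1,2)] assms(3) card_field_gt_1[where 'k = 'k] by (simp add: power_inject_exp)

lemma lin_on_dim:
  fixes V :: "(nat \<Rightarrow> 'k::{field,finite}) set"
  assumes f: "lin_on V f" and V: "fv.subspace V" "finite V"
  shows "fv.dim V = fv.dim {x \<in> V. f x = 0} + fv.dim (f ` V)"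
proof -
  have K: "fv.subspace {x \<in> V. f x = 0}" using lin_on_vimage_subspace[OF f V(1) fv.subspace_single_0] by simp
  have "card V = card {x \<in> V. f x = 0} * card (f ` V)"
    by (rule card_additive_map) (use V fv.subspace_0[OF V(1)] fv.subspace_diff[OF V(1)] lin_on_diff[OF f V(1)] in auto)
  then have "card V = CARD('k) ^ (fv.dim {x \<in> V. f x = 0} + fv.dim (f ` V))"
    using card_subspace[OF K] card_subspace[OF lin_on_image_subspace[OF f V(1)]] V(2) by (simp add: power_add)
  then show ?thesis by (rule dim_eqI_card[OF V])
qed

lemma dim_subset_le:
  fixes V :: "(nat \<Rightarrow> 'k::{field,finite}) set"
  assumes "fv.subspace V" "finite V" "fv.subspace W" "W \<subseteq> V"
  shows "fv.dim W \<le> fv.dim V" and "fv.dim W = fv.dim V \<Longrightarrow> W = V"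
proof -
  have fW: "finite W" using assms(2,4) by (rule finite_subset[rotated])
  have "card W \<le> card V" by (rule card_mono[OF assms(2,4)])
  then have "CARD('k) ^ fv.dim W \<le> CARD('k) ^ fv.dim V"
    unfolding card_subspace[OF assms(1,2)] card_subspace[OF assms(3) fW] .
  then show "fv.dim W \<le> fv.dim V" by (rule power_le_imp_le_exp[OF card_field_gt_1])
  assume eq: "fv.dim W = fv.dim V"
  have "card W = card V" unfolding card_subspace[OF assms(1,2)] card_subspace[OF assms(3) fW] eq ..
  then show "W = V" by (rule card_subset_eq[OF assms(2,4)])
qed

lemma dim_zero_space [simp]: "fv.dim {0 :: nat \<Rightarrow> 'k::{field,finite}} = 0"
  by (rule dim_eqI_card) auto

text \<open>The value 0 outside \<open>V\<close> makes a map equal to its restriction, so that maps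
  can be counted.\<close>

definition Lin :: "(nat \<Rightarrow> 'k::field) set \<Rightarrow> (nat \<Rightarrow> 'k) set \<Rightarrow> ((nat \<Rightarrow> 'k) \<Rightarrow> (nat \<Rightarrow> 'k)) set" where
  "Lin V W = {f. lin_on V f \<and> f ` V \<subseteq> W \<and> (\<forall>x. x \<notin> V \<longrightarrow> f x = 0)}"

text \<open>Restriction to a basis of \<open>V\<close> is a bijection onto all functions from the
  basis to \<open>W\<close>.\<close>

lemma card_Lin:
  fixes V W :: "(nat \<Rightarrow> 'k::{field,finite}) set"
  assumes V: "fv.subspace V" "finite V" and W: "fv.subspace W" "finite W"
  shows "finite (Lin V W) \<and> card (Lin V W) = CARD('k) ^ (fv.dim V * fv.dim W)"
proof -
  obtain B where B: "B \<subseteq> V" "finite B" "fv.independent B" "fv.span B = V" "card B = fv.dim V"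
    by (rule subspace_basis[OF V])
  have "bij_betw (\<lambda>f. restrict f B) (Lin V W) (B \<rightarrow>\<^sub>E W)"
    unfolding bij_betw_def
  proof (intro conjI inj_onI equalityI subsetI)
    fix f g assume f: "f \<in> Lin V W" and g: "g \<in> Lin V W" and eq: "restrict f B = restrict g B"
    have fg: "lin_on V f" "lin_on V g" using f g by (auto simp: Lin_def)
    have "f x - g x = 0" if "x \<in> V" for x
    proof -
      have S: "fv.subspace {x \<in> V. f x - g x \<in> {0}}"
        by (rule lin_on_vimage_subspace[OF lin_on_minus[OF fg] V(1) fv.subspace_single_0])
      have "B \<subseteq> {x \<in> V. f x - g x \<in> {0}}"
        using B(1) eq by (auto simp: restrict_def fun_eq_iff) (metis)
      then have "fv.span B \<subseteq> {x \<in> V. f x - g x \<in> {0}}" by (rule fv.span_minimal[OF _ S])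
      then show ?thesis using that B(4) by auto
    qed
    then have "f x = g x" for x using f g by (cases "x \<in> V") (auto simp: Lin_def)
    then show "f = g" by (rule ext)
  next
    fix h assume "h \<in> (\<lambda>f. restrict f B) ` Lin V W"
    then show "h \<in> B \<rightarrow>\<^sub>E W" using B(1) by (auto simp: Lin_def image_subset_iff subset_iff)
  next
    fix h assume h: "h \<in> B \<rightarrow>\<^sub>E W"
    obtain g where g: "Vector_Spaces.linear fscale fscale g" "\<forall>x\<in>B. g x = h x"
      using fvp.linear_independent_extend[OF B(3)] by blast
    define f where "f x = (if x \<in> V then g x else 0)" for x
    have gl: "lin_on V g" by (rule linear_lin_on[OF g(1)])
    have S: "fv.subspace {x \<in> V. g x \<in> W}" by (rule lin_on_vimage_subspace[OF gl V(1) W(1)])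
    have "B \<subseteq> {x \<in> V. g x \<in> W}" using B(1) g(2) h by auto
    then have "fv.span B \<subseteq> {x \<in> V. g x \<in> W}" by (rule fv.span_minimal[OF _ S])
    then have gW: "g x \<in> W" if "x \<in> V" for x using that B(4) by auto
    have "lin_on V f" by (rule lin_on_cong[OF gl V(1)]) (simp add: f_def)
    then have "f \<in> Lin V W" using gW by (auto simp: Lin_def f_def)
    moreover have "h = restrict f B"
    proof
      fix x show "h x = restrict f B x"
        using h g(2) B(1) by (cases "x \<in> B") (auto simp: f_def)
    qed
    ultimately show "h \<in> (\<lambda>f. restrict f B) ` Lin V W" by blast
  qed
  note bij = this
  have fin: "finite (B \<rightarrow>\<^sub>E W)" using B(2) W(2) by (intro finite_PiE) auto
  have "card (B \<rightarrow>\<^sub>E W) = card W ^ card B" using B(2) by (simp add: card_PiE)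
  also have "\<dots> = CARD('k) ^ (fv.dim W * fv.dim V)"
    unfolding card_subspace[OF W] B(5) power_mult[symmetric] ..
  finally show ?thesis using bij_betw_finite[OF bij] bij_betw_same_card[OF bij] fin
    by (simp add: mult.commute)
qed

section \<open>Representations on subspaces of the universal vector space\<close>

text \<open>All vertex spaces live in the one vector space of sequences, so that subrepresentations and their
  complements have the type of the representation itself. The values of the arrows outside the vertex
  spaces are junk.\<close>

record ('i, 'e, 'k) frep =
  fV :: "'i \<Rightarrow> (nat \<Rightarrow> 'k) set"
  fA :: "'e \<Rightarrow> (nat \<Rightarrow> 'k) \<Rightarrow> nat \<Rightarrow> 'k"

definition is_frep :: "('i, 'e) quiver \<Rightarrow> ('i, 'e, 'k::field) frep \<Rightarrow> bool" where
  "is_frep Q M \<longleftrightarrow> (\<forall>i. fv.subspace (fV M i) \<and> finite (fV M i)) \<and>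
     (\<forall>a. lin_on (fV M (src Q a)) (fA M a) \<and> (\<forall>x\<in>fV M (src Q a). fA M a x \<in> fV M (tgt Q a)))"

lemma frep_sub: "is_frep Q M \<Longrightarrow> fv.subspace (fV M i)"
  and frep_fin: "is_frep Q M \<Longrightarrow> finite (fV M i)"
  and frep_lin: "is_frep Q M \<Longrightarrow> lin_on (fV M (src Q a)) (fA M a)"
  and frep_act: "is_frep Q M \<Longrightarrow> x \<in> fV M (src Q a) \<Longrightarrow> fA M a x \<in> fV M (tgt Q a)"
  unfolding is_frep_def by blast+

definition restr :: "('i, 'e, 'k) frep \<Rightarrow> ('i \<Rightarrow> (nat \<Rightarrow> 'k) set) \<Rightarrow> ('i, 'e, 'k) frep" where
  "restr M W = \<lparr>fV = W, fA = fA M\<rparr>"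

lemma restr_simps [simp]: "fV (restr M W) = W" "fA (restr M W) = fA M" "restr (restr M W) W' = restr M W'"
  "restr M (fV M) = M"
  by (simp_all add: restr_def)

definition fsub :: "('i, 'e) quiver \<Rightarrow> ('i, 'e, 'k::field) frep \<Rightarrow> ('i \<Rightarrow> (nat \<Rightarrow> 'k) set) \<Rightarrow> bool" where
  "fsub Q M W \<longleftrightarrow> (\<forall>i. fv.subspace (W i) \<and> W i \<subseteq> fV M i) \<and>
     (\<forall>a. \<forall>x\<in>W (src Q a). fA M a x \<in> W (tgt Q a))"

lemma fsub_subspace: "fsub Q M W \<Longrightarrow> fv.subspace (W i)"
  and fsub_le: "fsub Q M W \<Longrightarrow> W i \<subseteq> fV M i"
  and fsub_in: "fsub Q M W \<Longrightarrow> x \<in> W i \<Longrightarrow> x \<in> fV M i"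
  and fsub_act: "fsub Q M W \<Longrightarrow> x \<in> W (src Q a) \<Longrightarrow> fA M a x \<in> W (tgt Q a)"
  unfolding fsub_def by blast+

lemma fsub_frep: "is_frep Q M \<Longrightarrow> fsub Q M W \<Longrightarrow> is_frep Q (restr M W)"
  unfolding is_frep_def fsub_def restr_simps
  by (metis finite_subset lin_on_subset)

lemma fsub_zero: "is_frep Q M \<Longrightarrow> fsub Q M (\<lambda>i. {0})"
  unfolding fsub_def
  by (simp add: fv.subspace_0[OF frep_sub] lin_on_zero[OF frep_lin frep_sub])

lemma fsub_full: "is_frep Q M \<Longrightarrow> fsub Q M (fV M)"
  unfolding fsub_def is_frep_def by blast

lemma fsub_trans: "fsub Q M W \<Longrightarrow> fsub Q (restr M W) U \<Longrightarrow> fsub Q M U"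
  unfolding fsub_def restr_simps by blast

lemma fsub_eq_zero:
  assumes "fsub Q M W" "\<And>i x. x \<in> W i \<Longrightarrow> x = 0"
  shows "W = (\<lambda>i. {0})"
proof
  fix i
  have "0 \<in> W i" by (rule fv.subspace_0[OF fsub_subspace[OF assms(1)]])
  moreover have "W i \<subseteq> {0}" using assms(2)[of _ i] by (intro subsetI) simp
  ultimately show "W i = {0}" by (intro equalityI) simp_all
qed

section \<open>Homomorphisms, short exact sequences and quotients\<close>

definition fhom :: "('i, 'e) quiver \<Rightarrow> ('i, 'e, 'k::field) frep \<Rightarrow> ('i, 'e, 'k) frep \<Rightarrow>
    ('i \<Rightarrow> (nat \<Rightarrow> 'k) \<Rightarrow> nat \<Rightarrow> 'k) \<Rightarrow> bool" where
  "fhom Q M N \<phi> \<longleftrightarrow> (\<forall>i. lin_on (fV M i) (\<phi> i) \<and> (\<forall>x\<in>fV M i. \<phi> i x \<in> fV N i)) \<and>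
     (\<forall>a. \<forall>x\<in>fV M (src Q a). \<phi> (tgt Q a) (fA M a x) = fA N a (\<phi> (src Q a) x))"

lemma fhom_lin: "fhom Q M N \<phi> \<Longrightarrow> lin_on (fV M i) (\<phi> i)"
  and fhom_in: "fhom Q M N \<phi> \<Longrightarrow> x \<in> fV M i \<Longrightarrow> \<phi> i x \<in> fV N i"
  and fhom_comm: "fhom Q M N \<phi> \<Longrightarrow> x \<in> fV M (src Q a) \<Longrightarrow>
     \<phi> (tgt Q a) (fA M a x) = fA N a (\<phi> (src Q a) x)"
  unfolding fhom_def by blast+

lemma fhom_comp:
  assumes "fhom Q M N \<phi>" "fhom Q N L \<psi>"
  shows "fhom Q M L (\<lambda>i x. \<psi> i (\<phi> i x))"
  unfolding fhom_def
  using lin_on_comp[OF fhom_lin[OF assms(1)] _ fhom_lin[OF assms(2)]]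
    fhom_in[OF assms(1)] fhom_in[OF assms(2)] fhom_comm[OF assms(1)] fhom_comm[OF assms(2)]
  by (simp add: image_subset_iff)

lemma fhom_restrict: "fhom Q M N \<phi> \<Longrightarrow> fsub Q M W \<Longrightarrow> fhom Q (restr M W) N \<phi>"
  unfolding fhom_def fsub_def restr_simps by (meson lin_on_subset subset_iff)

lemma fhom_corestrict: "fhom Q M N \<phi> \<Longrightarrow> (\<And>i x. x \<in> fV M i \<Longrightarrow> \<phi> i x \<in> W i) \<Longrightarrow> fhom Q M (restr N W) \<phi>"
  unfolding fhom_def restr_simps by blast

lemma fhom_id: "fhom Q M M (\<lambda>i x. x)"
  unfolding fhom_def by (simp add: lin_on_id)

lemma fsub_vimage:
  assumes M: "is_frep Q M" and \<phi>: "fhom Q M N \<phi>" and W: "fsub Q N W"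
  shows "fsub Q M (\<lambda>i. {x \<in> fV M i. \<phi> i x \<in> W i})"
  unfolding fsub_def
  using lin_on_vimage_subspace[OF fhom_lin[OF \<phi>] frep_sub[OF M] fsub_subspace[OF W]]
    frep_act[OF M] fhom_comm[OF \<phi>] fsub_act[OF W]
  by auto

lemma fsub_image:
  assumes M: "is_frep Q M" and \<phi>: "fhom Q M N \<phi>" and W: "fsub Q M W"
  shows "fsub Q N (\<lambda>i. \<phi> i ` W i)"
  unfolding fsub_def
proof (intro conjI allI ballI)
  fix i
  show "fv.subspace (\<phi> i ` W i)"
    by (rule lin_on_image_subspace[OF lin_on_subset[OF fhom_lin[OF \<phi>] fsub_le[OF W]] fsub_subspace[OF W]])
  show "\<phi> i ` W i \<subseteq> fV N i" using fhom_in[OF \<phi>] fsub_le[OF W] by blast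
next
  fix a y assume "y \<in> \<phi> (src Q a) ` W (src Q a)"
  then obtain x where x: "x \<in> W (src Q a)" "y = \<phi> (src Q a) x" by blast
  have "fA N a y = \<phi> (tgt Q a) (fA M a x)"
    unfolding x(2) by (rule fhom_comm[OF \<phi>, symmetric]) (use x(1) fsub_le[OF W] in blast)
  then show "fA N a y \<in> \<phi> (tgt Q a) ` W (tgt Q a)" using fsub_act[OF W x(1)] by simp
qed

text \<open>A short exact sequence with sub \<open>W\<close>, middle \<open>M\<close> and quotient
  \<open>N\<close>. The kernel is recorded as a family of subspaces of \<open>M\<close>, so no
  inclusion map is carried along.\<close>

definition fepi :: "('i, 'e) quiver \<Rightarrow> ('i, 'e, 'k::field) frep \<Rightarrow> ('i, 'e, 'k) frep \<Rightarrow>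
    ('i \<Rightarrow> (nat \<Rightarrow> 'k) set) \<Rightarrow> ('i \<Rightarrow> (nat \<Rightarrow> 'k) \<Rightarrow> nat \<Rightarrow> 'k) \<Rightarrow> bool" where
  "fepi Q M N W \<phi> \<longleftrightarrow> fhom Q M N \<phi> \<and> (\<forall>i. \<phi> i ` fV M i = fV N i) \<and> (\<forall>i. W i = {x \<in> fV M i. \<phi> i x = 0})"

lemma fepi_hom: "fepi Q M N W \<phi> \<Longrightarrow> fhom Q M N \<phi>"
  and fepi_image: "fepi Q M N W \<phi> \<Longrightarrow> \<phi> i ` fV M i = fV N i"
  and fepi_ker: "fepi Q M N W \<phi> \<Longrightarrow> W i = {x \<in> fV M i. \<phi> i x = 0}"
  unfolding fepi_def by blast+

lemma fepi_sub:
  assumes M: "is_frep Q M" and N: "is_frep Q N" and \<phi>: "fepi Q M N W \<phi>"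
  shows "fsub Q M W"
proof -
  have "W = (\<lambda>i. {x \<in> fV M i. \<phi> i x \<in> {0}})" using fepi_ker[OF \<phi>] by (simp add: fun_eq_iff)
  then show ?thesis using fsub_vimage[OF M fepi_hom[OF \<phi>] fsub_zero[OF N]] by simp
qed

lemma fepi_dim:
  fixes M :: "('i, 'e, 'k::{field,finite}) frep"
  assumes M: "is_frep Q M" and \<phi>: "fepi Q M N W \<phi>"
  shows "fv.dim (fV M i) = fv.dim (W i) + fv.dim (fV N i)"
  using lin_on_dim[OF fhom_lin[OF fepi_hom[OF \<phi>]] frep_sub[OF M] frep_fin[OF M], of i]
  unfolding fepi_image[OF \<phi>] fepi_ker[OF \<phi>, symmetric] .

lemma fepi_onto_image:
  assumes "fhom Q M N \<phi>"
  shows "fepi Q M (restr N (\<lambda>i. \<phi> i ` fV M i)) (\<lambda>i. {x \<in> fV M i. \<phi> i x = 0}) \<phi>"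
  unfolding fepi_def by (auto intro: fhom_corestrict[OF assms])

lemma fam_projection:
  fixes W :: "'i \<Rightarrow> (nat \<Rightarrow> 'k::field) set"
  assumes "\<And>i. fv.subspace (W i)"
  obtains g where "\<And>i V. lin_on V (g i)" "\<And>i x. g i x \<in> W i" "\<And>i x. x \<in> W i \<Longrightarrow> g i x = x"
proof -
  have "\<forall>i. \<exists>g. (\<forall>V. lin_on V g) \<and> (\<forall>x. g x \<in> W i) \<and> (\<forall>x\<in>W i. g x = x)"
  proof
    fix i
    obtain g where "\<And>V. lin_on V g" "\<And>x. g x \<in> W i" "\<And>x. x \<in> W i \<Longrightarrow> g x = x"
      using projection_exists[OF assms[of i]] by blast
    then show "\<exists>g. (\<forall>V. lin_on V g) \<and> (\<forall>x. g x \<in> W i) \<and> (\<forall>x\<in>W i. g x = x)" by blast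
  qed
  from choice[OF this] obtain g where
    "\<forall>i. (\<forall>V. lin_on V (g i)) \<and> (\<forall>x. g i x \<in> W i) \<and> (\<forall>x\<in>W i. g i x = x)" ..
  then show ?thesis by (intro that[of g]) blast+
qed

lemma fam_section:
  fixes V :: "'i \<Rightarrow> (nat \<Rightarrow> 'k::field) set"
  assumes p: "\<And>i. lin_on (V i) (p i)" and V: "\<And>i. fv.subspace (V i)" and im: "\<And>i. p i ` V i = N i"
  obtains r where "\<And>i. lin_on (N i) (r i)" "\<And>i y. y \<in> N i \<Longrightarrow> r i y \<in> V i"
    "\<And>i y. y \<in> N i \<Longrightarrow> p i (r i y) = y"
proof -
  have "\<forall>i. \<exists>r. lin_on (N i) r \<and> (\<forall>y\<in>N i. r y \<in> V i) \<and> (\<forall>y\<in>N i. p i (r y) = y)"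
  proof
    fix i
    obtain r where "lin_on (p i ` V i) r" "\<And>y. y \<in> p i ` V i \<Longrightarrow> r y \<in> V i" "\<And>y. y \<in> p i ` V i \<Longrightarrow> p i (r y) = y"
      using section_exists[OF p[of i] V[of i]] by blast
    then show "\<exists>r. lin_on (N i) r \<and> (\<forall>y\<in>N i. r y \<in> V i) \<and> (\<forall>y\<in>N i. p i (r y) = y)"
      unfolding im by blast
  qed
  from choice[OF this] obtain r where
    "\<forall>i. lin_on (N i) (r i) \<and> (\<forall>y\<in>N i. r i y \<in> V i) \<and> (\<forall>y\<in>N i. p i (r i y) = y)" ..
  then show ?thesis by (intro that[of r]) blast+
qed

lemma fepi_section:
  assumes M: "is_frep Q M" and \<pi>: "fepi Q M N W \<pi>"
  obtains r where "\<And>i. lin_on (fV N i) (r i)" "\<And>i y. y \<in> fV N i \<Longrightarrow> r i y \<in> fV M i"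
    "\<And>i y. y \<in> fV N i \<Longrightarrow> \<pi> i (r i y) = y"
  using fam_section[of "fV M" \<pi> "fV N"] fhom_lin[OF fepi_hom[OF \<pi>]] frep_sub[OF M] fepi_image[OF \<pi>]
  by blast

text \<open>The quotient is realised inside \<open>M\<close>, on the image of \<open>p\<close>,
  which subtracts a projection onto \<open>W\<close>. This image is a vector space complement of
  \<open>W\<close>, and the arrows are compressed to it by \<open>p\<close>.\<close>

lemma quotient_exists:
  fixes M :: "('i, 'e, 'k::field) frep"
  assumes M: "is_frep Q M" and W: "fsub Q M W"
  obtains N \<phi> where "is_frep Q N" "fepi Q M N W \<phi>"
proof -
  obtain g where g: "\<And>i V. lin_on V (g i)" "\<And>i x. g i x \<in> W i" "\<And>i x. x \<in> W i \<Longrightarrow> g i x = x"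
    by (rule fam_projection[of W, OF fsub_subspace[OF W]]) blast
  define p where "p i x = x - g i x" for i x
  have p: "lin_on V (p i)" for V i unfolding p_def by (rule lin_on_minus[OF lin_on_id g(1)])
  have gV: "g i x \<in> fV M i" for i x using g(2) fsub_le[OF W] by blast
  have pV: "p i x \<in> fV M i" if "x \<in> fV M i" for i x
    unfolding p_def by (rule fv.subspace_diff[OF frep_sub[OF M] that gV])
  have pW: "p i x = 0" if "x \<in> W i" for i x using g(3)[OF that] by (simp add: p_def)
  \<comment> \<open>Arrows preserve \<open>W\<close>, so removing the component in \<open>W\<close>
    before the arrow changes nothing after \<open>p\<close>.\<close>
  have key: "p (tgt Q a) (fA M a (p (src Q a) x)) = p (tgt Q a) (fA M a x)" if x: "x \<in> fV M (src Q a)" for a x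
  proof -
    have "fA M a (p (src Q a) x) = fA M a x - fA M a (g (src Q a) x)"
      unfolding p_def by (rule lin_on_diff[OF frep_lin[OF M] frep_sub[OF M] x gV])
    moreover have "p (tgt Q a) (fA M a x - fA M a (g (src Q a) x))
        = p (tgt Q a) (fA M a x) - p (tgt Q a) (fA M a (g (src Q a) x))"
      by (rule lin_on_diff[OF p fv.subspace_UNIV]) auto
    moreover have "p (tgt Q a) (fA M a (g (src Q a) x)) = 0"
      by (rule pW[OF fsub_act[OF W g(2)]])
    ultimately show ?thesis by simp
  qed
  define N where "N = \<lparr>fV = (\<lambda>i. p i ` fV M i), fA = (\<lambda>a x. p (tgt Q a) (fA M a x))\<rparr>"
  have Nle: "p i ` fV M i \<subseteq> fV M i" for i using pV by blast
  have "is_frep Q N"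
    unfolding is_frep_def
  proof (intro conjI allI ballI)
    fix i show "fv.subspace (fV N i)" "finite (fV N i)"
      using lin_on_image_subspace[OF p frep_sub[OF M]] frep_fin[OF M] by (simp_all add: N_def)
  next
    fix a
    have "lin_on (fV M (src Q a)) (\<lambda>x. p (tgt Q a) (fA M a x))"
      by (rule lin_on_comp[OF frep_lin[OF M] subset_UNIV p])
    then show "lin_on (fV N (src Q a)) (fA N a)"
      using lin_on_subset[OF _ Nle] by (simp add: N_def)
    fix x assume "x \<in> fV N (src Q a)"
    then have "x \<in> fV M (src Q a)" using Nle by (auto simp: N_def)
    then show "fA N a x \<in> fV N (tgt Q a)" using frep_act[OF M] by (simp add: N_def)
  qed
  moreover have "fepi Q M N W p"
    unfolding fepi_def fhom_def
  proof (intro conjI allI ballI)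
    fix i
    show "W i = {x \<in> fV M i. p i x = 0}"
    proof (intro equalityI subsetI)
      fix x assume "x \<in> {x \<in> fV M i. p i x = 0}"
      then have "x = g i x" by (simp add: p_def)
      then show "x \<in> W i" using g(2)[of i x] by simp
    qed (use fsub_le[OF W] pW in auto)
  qed (use p key in \<open>auto simp: N_def\<close>)
  ultimately show ?thesis by (rule that)
qed

subsection \<open>Vanishing of extensions\<close>

definition cochain :: "('i, 'e, 'k::field) frep \<Rightarrow> ('i, 'e, 'k) frep \<Rightarrow> ('i \<Rightarrow> (nat \<Rightarrow> 'k) \<Rightarrow> nat \<Rightarrow> 'k) \<Rightarrow> bool" where
  "cochain X Y h \<longleftrightarrow> (\<forall>i. lin_on (fV X i) (h i) \<and> (\<forall>x\<in>fV X i. h i x \<in> fV Y i))"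

definition cocycle :: "('i, 'e) quiver \<Rightarrow> ('i, 'e, 'k::field) frep \<Rightarrow> ('i, 'e, 'k) frep \<Rightarrow>
    ('e \<Rightarrow> (nat \<Rightarrow> 'k) \<Rightarrow> nat \<Rightarrow> 'k) \<Rightarrow> bool" where
  "cocycle Q X Y z \<longleftrightarrow> (\<forall>a. lin_on (fV X (src Q a)) (z a) \<and> (\<forall>x\<in>fV X (src Q a). z a x \<in> fV Y (tgt Q a)))"

definition cob :: "('i, 'e) quiver \<Rightarrow> ('i, 'e, 'k::field) frep \<Rightarrow> ('i, 'e, 'k) frep \<Rightarrow>
    ('i \<Rightarrow> (nat \<Rightarrow> 'k) \<Rightarrow> nat \<Rightarrow> 'k) \<Rightarrow> 'e \<Rightarrow> (nat \<Rightarrow> 'k) \<Rightarrow> nat \<Rightarrow> 'k" where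
  "cob Q X Y h a x = h (tgt Q a) (fA X a x) - fA Y a (h (src Q a) x)"

text \<open>\<open>Ext^1(X, Y)\<close> is the cokernel of \<open>cob\<close>, by the standard
  resolution of length one. A cocycle is therefore any family of linear maps along the arrows; there
  is no further condition.\<close>

definition ext_vanish :: "('i, 'e) quiver \<Rightarrow> ('i, 'e, 'k::field) frep \<Rightarrow> ('i, 'e, 'k) frep \<Rightarrow> bool" where
  "ext_vanish Q X Y \<longleftrightarrow> (\<forall>z. cocycle Q X Y z \<longrightarrow>
     (\<exists>h. cochain X Y h \<and> (\<forall>a. \<forall>x\<in>fV X (src Q a). z a x = cob Q X Y h a x)))"

lemma ext_vanishD: "ext_vanish Q X Y \<Longrightarrow> cocycle Q X Y z \<Longrightarrow>
    \<exists>h. cochain X Y h \<and> (\<forall>a. \<forall>x\<in>fV X (src Q a). z a x = cob Q X Y h a x)"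
  unfolding ext_vanish_def by blast

lemma cochain_lin: "cochain X Y h \<Longrightarrow> lin_on (fV X i) (h i)"
  and cochain_in: "cochain X Y h \<Longrightarrow> x \<in> fV X i \<Longrightarrow> h i x \<in> fV Y i"
  unfolding cochain_def by blast+

lemma cocycle_lin: "cocycle Q X Y z \<Longrightarrow> lin_on (fV X (src Q a)) (z a)"
  and cocycle_in: "cocycle Q X Y z \<Longrightarrow> x \<in> fV X (src Q a) \<Longrightarrow> z a x \<in> fV Y (tgt Q a)"
  unfolding cocycle_def by blast+

lemma cochainI: "(\<And>i. lin_on (fV X i) (h i)) \<Longrightarrow> (\<And>i x. x \<in> fV X i \<Longrightarrow> h i x \<in> fV Y i) \<Longrightarrow> cochain X Y h"
  unfolding cochain_def by blast

lemma cocycleI: "(\<And>a. lin_on (fV X (src Q a)) (z a)) \<Longrightarrow>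
    (\<And>a x. x \<in> fV X (src Q a) \<Longrightarrow> z a x \<in> fV Y (tgt Q a)) \<Longrightarrow> cocycle Q X Y z"
  unfolding cocycle_def by blast

lemma cocycle_cob:
  assumes X: "is_frep Q X" and Y: "is_frep Q Y" and h: "cochain X Y h"
  shows "cocycle Q X Y (cob Q X Y h)"
proof (rule cocycleI)
  fix a
  show "lin_on (fV X (src Q a)) (cob Q X Y h a)"
    unfolding cob_def[abs_def]
  proof (rule lin_on_minus)
    show "lin_on (fV X (src Q a)) (\<lambda>x. h (tgt Q a) (fA X a x))"
      by (rule lin_on_comp[OF frep_lin[OF X] _ cochain_lin[OF h]]) (rule image_subsetI, rule frep_act[OF X])
    show "lin_on (fV X (src Q a)) (\<lambda>x. fA Y a (h (src Q a) x))"
      by (rule lin_on_comp[OF cochain_lin[OF h] _ frep_lin[OF Y]]) (rule image_subsetI, rule cochain_in[OF h])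
  qed
  fix x assume x: "x \<in> fV X (src Q a)"
  show "cob Q X Y h a x \<in> fV Y (tgt Q a)"
    unfolding cob_def
    by (rule fv.subspace_diff[OF frep_sub[OF Y] cochain_in[OF h frep_act[OF X x]]
          frep_act[OF Y cochain_in[OF h x]]])
qed

lemma cocycle_diff: "is_frep Q Y \<Longrightarrow> cocycle Q X Y z \<Longrightarrow> cocycle Q X Y w \<Longrightarrow> cocycle Q X Y (\<lambda>a x. z a x - w a x)"
  by (rule cocycleI)
    (simp_all add: lin_on_minus[OF cocycle_lin cocycle_lin] fv.subspace_diff[OF frep_sub cocycle_in cocycle_in])

text \<open>Right exactness in the first variable: a cocycle on \<open>X'\<close> extends to
  \<open>X\<close> by composing it with a linear projection.\<close>

lemma ext_vanish_sub:
  assumes X: "is_frep Q X" and X': "fsub Q X X'" and ext: "ext_vanish Q X Y"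
  shows "ext_vanish Q (restr X X') Y"
  unfolding ext_vanish_def
proof (intro allI impI)
  fix z assume z: "cocycle Q (restr X X') Y z"
  obtain g where g: "\<And>i V. lin_on V (g i)" "\<And>i x. g i x \<in> X' i" "\<And>i x. x \<in> X' i \<Longrightarrow> g i x = x"
    by (rule fam_projection[of X', OF fsub_subspace[OF X']]) blast
  have "cocycle Q X Y (\<lambda>a x. z a (g (src Q a) x))"
  proof (rule cocycleI)
    fix a
    have "lin_on (X' (src Q a)) (z a)" using cocycle_lin[OF z, of a] by simp
    then show "lin_on (fV X (src Q a)) (\<lambda>x. z a (g (src Q a) x))"
      by (rule lin_on_comp[OF g(1) image_subsetI[OF g(2)]])
    show "z a (g (src Q a) x) \<in> fV Y (tgt Q a)" for x
      using cocycle_in[OF z] g(2) by simp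
  qed
  from ext_vanishD[OF ext this] obtain h where h_conj: "cochain X Y h \<and>
      (\<forall>a. \<forall>x\<in>fV X (src Q a). z a (g (src Q a) x) = cob Q X Y h a x)" ..
  note h = conjunct1[OF h_conj] conjunct2[OF h_conj]
  have "cochain (restr X X') Y h"
    by (rule cochainI)
      (simp_all add: lin_on_subset[OF cochain_lin[OF h(1)] fsub_le[OF X']] cochain_in[OF h(1)] fsub_in[OF X'])
  moreover have "\<forall>a. \<forall>x\<in>fV (restr X X') (src Q a). z a x = cob Q (restr X X') Y h a x"
  proof (intro allI ballI)
    fix a x assume "x \<in> fV (restr X X') (src Q a)"
    then have x: "x \<in> X' (src Q a)" by simp
    show "z a x = cob Q (restr X X') Y h a x"
      using h(2)[rule_format, OF fsub_in[OF X' x]] g(3)[OF x] by (simp add: cob_def)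
  qed
  ultimately show "\<exists>h. cochain (restr X X') Y h \<and>
      (\<forall>a. \<forall>x\<in>fV (restr X X') (src Q a). z a x = cob Q (restr X X') Y h a x)" by blast
qed

text \<open>Right exactness in the second variable: a cocycle with values in the quotient lifts
  along a linear section.\<close>

lemma ext_vanish_quot:
  assumes Y: "is_frep Q Y" and \<pi>: "fepi Q Y N W \<pi>" and ext: "ext_vanish Q X Y" and X: "is_frep Q X"
  shows "ext_vanish Q X N"
  unfolding ext_vanish_def
proof (intro allI impI)
  fix z assume z: "cocycle Q X N z"
  obtain r where r: "\<And>i. lin_on (fV N i) (r i)" "\<And>i y. y \<in> fV N i \<Longrightarrow> r i y \<in> fV Y i"
    "\<And>i y. y \<in> fV N i \<Longrightarrow> \<pi> i (r i y) = y"
    by (rule fepi_section[OF Y \<pi>]) blast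
  have "cocycle Q X Y (\<lambda>a x. r (tgt Q a) (z a x))"
    using lin_on_comp[OF cocycle_lin[OF z] _ r(1)] cocycle_in[OF z] r(2)
    by (intro cocycleI) (simp_all add: image_subset_iff)
  from ext_vanishD[OF ext this] obtain h where h_conj: "cochain X Y h \<and>
      (\<forall>a. \<forall>x\<in>fV X (src Q a). r (tgt Q a) (z a x) = cob Q X Y h a x)" ..
  note h = conjunct1[OF h_conj] conjunct2[OF h_conj]
  note \<pi>h = fepi_hom[OF \<pi>]
  have "cochain X N (\<lambda>i x. \<pi> i (h i x))"
    using lin_on_comp[OF cochain_lin[OF h(1)] _ fhom_lin[OF \<pi>h]] cochain_in[OF h(1)] fhom_in[OF \<pi>h]
    by (intro cochainI) (simp_all add: image_subset_iff)
  moreover have "z a x = cob Q X N (\<lambda>i x. \<pi> i (h i x)) a x" if x: "x \<in> fV X (src Q a)" for a x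
  proof -
    have "z a x = \<pi> (tgt Q a) (cob Q X Y h a x)"
      using r(3)[OF cocycle_in[OF z x]] h(2)[rule_format, OF x] by simp
    also have "\<dots> = \<pi> (tgt Q a) (h (tgt Q a) (fA X a x)) - \<pi> (tgt Q a) (fA Y a (h (src Q a) x))"
      unfolding cob_def
      by (rule lin_on_diff[OF fhom_lin[OF \<pi>h] frep_sub[OF Y] cochain_in[OF h(1) frep_act[OF X x]]
            frep_act[OF Y cochain_in[OF h(1) x]]])
    also have "\<pi> (tgt Q a) (fA Y a (h (src Q a) x)) = fA N a (\<pi> (src Q a) (h (src Q a) x))"
      by (rule fhom_comm[OF \<pi>h cochain_in[OF h(1) x]])
    finally show ?thesis unfolding cob_def .
  qed
  ultimately show "\<exists>h. cochain X N h \<and> (\<forall>a. \<forall>x\<in>fV X (src Q a). z a x = cob Q X N h a x)" by blast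
qed

text \<open>The exact sequence of Ext^1 at the middle term, on cocycles: after subtracting a
  coboundary the cocycle vanishes on \<open>X'\<close>, so it is induced from a cocycle on
  \<open>N\<close>, which is again a coboundary.\<close>

lemma ext_vanish_extension_left:
  assumes X: "is_frep Q X" and Y: "is_frep Q Y" and N: "is_frep Q N" and \<pi>: "fepi Q X N X' \<pi>"
    and ext: "ext_vanish Q N Y" and ext': "ext_vanish Q (restr X X') Y"
  shows "ext_vanish Q X Y"
  unfolding ext_vanish_def
proof (intro allI impI)
  fix z assume z: "cocycle Q X Y z"
  have X': "fsub Q X X'" by (rule fepi_sub[OF X N \<pi>])
  note \<pi>h = fepi_hom[OF \<pi>]
  obtain g where g: "\<And>i V. lin_on V (g i)" "\<And>i x. g i x \<in> X' i" "\<And>i x. x \<in> X' i \<Longrightarrow> g i x = x"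
    by (rule fam_projection[of X', OF fsub_subspace[OF X']]) blast
  obtain r where r: "\<And>i. lin_on (fV N i) (r i)" "\<And>i y. y \<in> fV N i \<Longrightarrow> r i y \<in> fV X i"
    "\<And>i y. y \<in> fV N i \<Longrightarrow> \<pi> i (r i y) = y"
    by (rule fepi_section[OF X \<pi>]) blast
  have "cocycle Q (restr X X') Y z"
    by (rule cocycleI)
      (simp_all add: lin_on_subset[OF cocycle_lin[OF z] fsub_le[OF X']] cocycle_in[OF z] fsub_in[OF X'])
  from ext_vanishD[OF ext' this, unfolded restr_simps] obtain h' where h'_conj: "cochain (restr X X') Y h' \<and>
      (\<forall>a. \<forall>x\<in>X' (src Q a). z a x = cob Q (restr X X') Y h' a x)" ..
  note h' = conjunct1[OF h'_conj] conjunct2[OF h'_conj]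
  define h where "h i x = h' i (g i x)" for i x
  have h'lin: "lin_on (X' i) (h' i)" for i using cochain_lin[OF h'(1), of i] by simp
  have h: "cochain X Y h"
  proof (rule cochainI)
    show "lin_on (fV X i) (h i)" for i
      unfolding h_def[abs_def] by (rule lin_on_comp[OF g(1) image_subsetI[OF g(2)] h'lin])
    show "h i x \<in> fV Y i" for i x unfolding h_def using cochain_in[OF h'(1)] g(2) by simp
  qed
  define w where "w a x = z a x - cob Q X Y h a x" for a x
  have w: "cocycle Q X Y w" unfolding w_def[abs_def] by (rule cocycle_diff[OF Y z cocycle_cob[OF X Y h]])
  have w0: "w a x = 0" if x: "x \<in> X' (src Q a)" for a x
    using h'(2)[rule_format, OF x] g(3)[OF x] g(3)[OF fsub_act[OF X' x]] by (simp add: w_def cob_def h_def)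
  have "cocycle Q N Y (\<lambda>a y. w a (r (src Q a) y))"
    using lin_on_comp[OF r(1) _ cocycle_lin[OF w]] cocycle_in[OF w] r(2)
    by (intro cocycleI) (simp_all add: image_subset_iff)
  from ext_vanishD[OF ext this] obtain k where k_conj: "cochain N Y k \<and>
      (\<forall>a. \<forall>y\<in>fV N (src Q a). w a (r (src Q a) y) = cob Q N Y k a y)" ..
  note k = conjunct1[OF k_conj] conjunct2[OF k_conj]
  have wk: "w a x = k (tgt Q a) (\<pi> (tgt Q a) (fA X a x)) - fA Y a (k (src Q a) (\<pi> (src Q a) x))"
    if x: "x \<in> fV X (src Q a)" for a x
  proof -
    let ?y = "\<pi> (src Q a) x"
    have y: "?y \<in> fV N (src Q a)" by (rule fhom_in[OF \<pi>h x])
    have "\<pi> (src Q a) (x - r (src Q a) ?y) = 0"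
      using lin_on_diff[OF fhom_lin[OF \<pi>h] frep_sub[OF X] x r(2)[OF y]] r(3)[OF y] by simp
    then have "x - r (src Q a) ?y \<in> X' (src Q a)"
      unfolding fepi_ker[OF \<pi>] using fv.subspace_diff[OF frep_sub[OF X] x r(2)[OF y]] by simp
    then have "w a (x - r (src Q a) ?y) = 0" by (rule w0)
    then have "w a x = w a (r (src Q a) ?y)"
      using lin_on_diff[OF cocycle_lin[OF w] frep_sub[OF X] x r(2)[OF y]] by simp
    also have "\<dots> = cob Q N Y k a ?y" by (rule k(2)[rule_format, OF y])
    finally show ?thesis unfolding cob_def fhom_comm[OF \<pi>h x] .
  qed
  define H where "H i x = h i x + k i (\<pi> i x)" for i x
  have "cochain X Y H"
  proof (rule cochainI)
    fix i
    have "lin_on (fV X i) (\<lambda>x. k i (\<pi> i x))"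
      by (rule lin_on_comp[OF fhom_lin[OF \<pi>h] image_subsetI cochain_lin[OF k(1)]]) (rule fhom_in[OF \<pi>h])
    then show "lin_on (fV X i) (H i)" unfolding H_def[abs_def] by (rule lin_on_plus[OF cochain_lin[OF h]])
    show "H i x \<in> fV Y i" if x: "x \<in> fV X i" for x
      unfolding H_def
      by (rule fv.subspace_add[OF frep_sub[OF Y] cochain_in[OF h x] cochain_in[OF k(1) fhom_in[OF \<pi>h x]]])
  qed
  moreover have "z a x = cob Q X Y H a x" if x: "x \<in> fV X (src Q a)" for a x
  proof -
    have "fA Y a (H (src Q a) x) = fA Y a (h (src Q a) x) + fA Y a (k (src Q a) (\<pi> (src Q a) x))"
      unfolding H_def
      by (rule lin_on_add[OF frep_lin[OF Y] cochain_in[OF h x] cochain_in[OF k(1) fhom_in[OF \<pi>h x]]])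
    then show ?thesis using wk[OF x] by (simp add: w_def cob_def H_def algebra_simps)
  qed
  ultimately show "\<exists>h. cochain X Y h \<and> (\<forall>a. \<forall>x\<in>fV X (src Q a). z a x = cob Q X Y h a x)" by blast
qed

text \<open>The image of the cocycle in \<open>N\<close> is a coboundary. Lifting its cochain by a
  linear section and subtracting leaves a cocycle with values in \<open>Y'\<close>.\<close>

lemma ext_vanish_extension_right:
  assumes X: "is_frep Q X" and Y: "is_frep Q Y" and N: "is_frep Q N" and \<pi>: "fepi Q Y N Y' \<pi>"
    and ext: "ext_vanish Q X N" and ext': "ext_vanish Q X (restr Y Y')"
  shows "ext_vanish Q X Y"
  unfolding ext_vanish_def
proof (intro allI impI)
  fix z assume z: "cocycle Q X Y z"
  have Y': "fsub Q Y Y'" by (rule fepi_sub[OF Y N \<pi>])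
  note \<pi>h = fepi_hom[OF \<pi>]
  obtain r where r: "\<And>i. lin_on (fV N i) (r i)" "\<And>i y. y \<in> fV N i \<Longrightarrow> r i y \<in> fV Y i"
    "\<And>i y. y \<in> fV N i \<Longrightarrow> \<pi> i (r i y) = y"
    by (rule fepi_section[OF Y \<pi>]) blast
  have "cocycle Q X N (\<lambda>a x. \<pi> (tgt Q a) (z a x))"
    using lin_on_comp[OF cocycle_lin[OF z] _ fhom_lin[OF \<pi>h]] cocycle_in[OF z] fhom_in[OF \<pi>h]
    by (intro cocycleI) (simp_all add: image_subset_iff)
  from ext_vanishD[OF ext this] obtain k where k_conj: "cochain X N k \<and>
      (\<forall>a. \<forall>x\<in>fV X (src Q a). \<pi> (tgt Q a) (z a x) = cob Q X N k a x)" ..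
  note k = conjunct1[OF k_conj] conjunct2[OF k_conj]
  define h where "h i x = r i (k i x)" for i x
  have h: "cochain X Y h"
    unfolding h_def[abs_def]
    using lin_on_comp[OF cochain_lin[OF k(1)] _ r(1)] cochain_in[OF k(1)] r(2)
    by (intro cochainI) (simp_all add: image_subset_iff)
  have \<pi>hk: "\<pi> i (h i x) = k i x" if "x \<in> fV X i" for i x
    unfolding h_def by (rule r(3)[OF cochain_in[OF k(1) that]])
  define w where "w a x = z a x - cob Q X Y h a x" for a x
  have w: "cocycle Q X Y w" unfolding w_def[abs_def] by (rule cocycle_diff[OF Y z cocycle_cob[OF X Y h]])
  have "w a x \<in> Y' (tgt Q a)" if x: "x \<in> fV X (src Q a)" for a x
  proof -
    have c: "cob Q X Y h a x \<in> fV Y (tgt Q a)" by (rule cocycle_in[OF cocycle_cob[OF X Y h] x])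
    have "\<pi> (tgt Q a) (cob Q X Y h a x) =
        \<pi> (tgt Q a) (h (tgt Q a) (fA X a x)) - \<pi> (tgt Q a) (fA Y a (h (src Q a) x))"
      unfolding cob_def
      by (rule lin_on_diff[OF fhom_lin[OF \<pi>h] frep_sub[OF Y] cochain_in[OF h frep_act[OF X x]]
            frep_act[OF Y cochain_in[OF h x]]])
    also have "\<dots> = cob Q X N k a x"
      unfolding fhom_comm[OF \<pi>h cochain_in[OF h x]] \<pi>hk[OF x] \<pi>hk[OF frep_act[OF X x]] cob_def ..
    finally have "\<pi> (tgt Q a) (w a x) = 0"
      using lin_on_diff[OF fhom_lin[OF \<pi>h] frep_sub[OF Y] cocycle_in[OF z x] c] k(2)[rule_format, OF x]
      by (simp add: w_def)
    then show ?thesis unfolding fepi_ker[OF \<pi>] using cocycle_in[OF w x] by simp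
  qed
  then have "cocycle Q X (restr Y Y') w" using cocycle_lin[OF w] by (intro cocycleI) simp_all
  from ext_vanishD[OF ext' this] obtain h' where h'_conj: "cochain X (restr Y Y') h' \<and>
      (\<forall>a. \<forall>x\<in>fV X (src Q a). w a x = cob Q X (restr Y Y') h' a x)" ..
  note h' = conjunct1[OF h'_conj] conjunct2[OF h'_conj]
  have h'Y: "h' i x \<in> fV Y i" if "x \<in> fV X i" for i x
    using fsub_in[OF Y', of "h' i x" i] cochain_in[OF h'(1) that] by simp
  define H where "H i x = h i x + h' i x" for i x
  have "cochain X Y H"
  proof (rule cochainI)
    show "lin_on (fV X i) (H i)" for i
      unfolding H_def[abs_def] by (rule lin_on_plus[OF cochain_lin[OF h] cochain_lin[OF h'(1)]])
    show "H i x \<in> fV Y i" if x: "x \<in> fV X i" for i x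
      unfolding H_def by (rule fv.subspace_add[OF frep_sub[OF Y] cochain_in[OF h x] h'Y[OF x]])
  qed
  moreover have "z a x = cob Q X Y H a x" if x: "x \<in> fV X (src Q a)" for a x
  proof -
    have "fA Y a (H (src Q a) x) = fA Y a (h (src Q a) x) + fA Y a (h' (src Q a) x)"
      unfolding H_def by (rule lin_on_add[OF frep_lin[OF Y] cochain_in[OF h x] h'Y[OF x]])
    moreover have "w a x = h' (tgt Q a) (fA X a x) - fA Y a (h' (src Q a) x)"
      using h'(2)[rule_format, OF x] by (simp add: cob_def)
    ultimately show ?thesis by (simp add: w_def cob_def H_def algebra_simps)
  qed
  ultimately show "\<exists>h. cochain X Y h \<and> (\<forall>a. \<forall>x\<in>fV X (src Q a). z a x = cob Q X Y h a x)" by blast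
qed

text \<open>The splitting is the hom section \<open>\<lambda>y. r y + h y\<close>, where the coboundary of \<open>h\<close> measures the
  failure of the linear section \<open>r\<close> to commute with the arrows.\<close>

lemma ext_vanish_split:
  assumes M: "is_frep Q M" and N: "is_frep Q N" and \<pi>: "fepi Q M N W \<pi>"
    and ext: "ext_vanish Q N (restr M W)"
  obtains s where "fhom Q N M s" "\<And>i y. y \<in> fV N i \<Longrightarrow> \<pi> i (s i y) = y"
proof -
  have W: "fsub Q M W" by (rule fepi_sub[OF M N \<pi>])
  note \<pi>h = fepi_hom[OF \<pi>]
  obtain r where r: "\<And>i. lin_on (fV N i) (r i)" "\<And>i y. y \<in> fV N i \<Longrightarrow> r i y \<in> fV M i"
    "\<And>i y. y \<in> fV N i \<Longrightarrow> \<pi> i (r i y) = y"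
    by (rule fepi_section[OF M \<pi>]) blast
  have rc: "cochain N M r" using r(1,2) by (intro cochainI) blast+
  define z where "z a y = - cob Q N M r a y" for a y
  have "cocycle Q N (restr M W) z"
  proof (rule cocycleI)
    fix a
    have c: "cocycle Q N M (cob Q N M r)" by (rule cocycle_cob[OF N M rc])
    show "lin_on (fV N (src Q a)) (z a)"
      unfolding z_def[abs_def] using lin_on_minus[OF lin_on_0 cocycle_lin[OF c]] by simp
    fix y assume y: "y \<in> fV N (src Q a)"
    have "\<pi> (tgt Q a) (cob Q N M r a y) = \<pi> (tgt Q a) (r (tgt Q a) (fA N a y)) - \<pi> (tgt Q a) (fA M a (r (src Q a) y))"
      unfolding cob_def
      by (rule lin_on_diff[OF fhom_lin[OF \<pi>h] frep_sub[OF M] r(2)[OF frep_act[OF N y]] frep_act[OF M r(2)[OF y]]])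
    also have "\<dots> = 0" unfolding fhom_comm[OF \<pi>h r(2)[OF y]] r(3)[OF y] r(3)[OF frep_act[OF N y]] by simp
    finally have "cob Q N M r a y \<in> W (tgt Q a)" unfolding fepi_ker[OF \<pi>] using cocycle_in[OF c y] by simp
    then show "z a y \<in> fV (restr M W) (tgt Q a)"
      unfolding z_def using fv.subspace_neg[OF fsub_subspace[OF W]] by simp
  qed
  from ext_vanishD[OF ext this] obtain h where h_conj: "cochain N (restr M W) h \<and>
      (\<forall>a. \<forall>x\<in>fV N (src Q a). z a x = cob Q N (restr M W) h a x)" ..
  note h = conjunct1[OF h_conj] conjunct2[OF h_conj]
  have hW: "h i y \<in> W i" if "y \<in> fV N i" for i y using cochain_in[OF h(1) that] by simp
  have hM: "h i y \<in> fV M i" if "y \<in> fV N i" for i y by (rule fsub_in[OF W hW[OF that]])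
  define s where "s i y = r i y + h i y" for i y
  have "fhom Q N M s"
    unfolding fhom_def
  proof (intro conjI allI ballI)
    show "lin_on (fV N i) (s i)" for i unfolding s_def[abs_def] by (rule lin_on_plus[OF r(1) cochain_lin[OF h(1)]])
    show "s i y \<in> fV M i" if y: "y \<in> fV N i" for i y
      unfolding s_def by (rule fv.subspace_add[OF frep_sub[OF M] r(2)[OF y] hM[OF y]])
    fix a y assume y: "y \<in> fV N (src Q a)"
    have "fA M a (s (src Q a) y) = fA M a (r (src Q a) y) + fA M a (h (src Q a) y)"
      unfolding s_def by (rule lin_on_add[OF frep_lin[OF M] r(2)[OF y] hM[OF y]])
    moreover have "- (r (tgt Q a) (fA N a y) - fA M a (r (src Q a) y)) = h (tgt Q a) (fA N a y) - fA M a (h (src Q a) y)"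
      using h(2)[rule_format, OF y] by (simp add: z_def cob_def)
    ultimately show "s (tgt Q a) (fA N a y) = fA M a (s (src Q a) y)"
      by (simp add: s_def algebra_simps)
  qed
  moreover have "\<pi> i (s i y) = y" if y: "y \<in> fV N i" for i y
  proof -
    have "\<pi> i (h i y) = 0" using hW[OF y] unfolding fepi_ker[OF \<pi>] by simp
    then show ?thesis
      unfolding s_def using lin_on_add[OF fhom_lin[OF \<pi>h] r(2)[OF y] hM[OF y]] r(3)[OF y] by simp
  qed
  ultimately show ?thesis by (rule that)
qed

section \<open>The Euler form counts homomorphisms and extensions\<close>

definition fdim :: "('i \<Rightarrow> (nat \<Rightarrow> 'k::field) set) \<Rightarrow> 'i \<Rightarrow> int" where
  "fdim W = (\<lambda>i. int (fv.dim (W i)))"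

text \<open>Cochains that are 0 outside the vertex spaces, so that they form a finite set;
  \<open>trunc\<close> brings a cochain into this form.\<close>

definition C0 :: "('i, 'e, 'k::field) frep \<Rightarrow> ('i, 'e, 'k) frep \<Rightarrow> ('i \<Rightarrow> (nat \<Rightarrow> 'k) \<Rightarrow> nat \<Rightarrow> 'k) set" where
  "C0 X Y = {h. \<forall>i. h i \<in> Lin (fV X i) (fV Y i)}"

definition C1 :: "('i, 'e) quiver \<Rightarrow> ('i, 'e, 'k::field) frep \<Rightarrow> ('i, 'e, 'k) frep \<Rightarrow>
    ('e \<Rightarrow> (nat \<Rightarrow> 'k) \<Rightarrow> nat \<Rightarrow> 'k) set" where
  "C1 Q X Y = {z. \<forall>a. z a \<in> Lin (fV X (src Q a)) (fV Y (tgt Q a))}"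

definition dcob :: "('i, 'e) quiver \<Rightarrow> ('i, 'e, 'k::field) frep \<Rightarrow> ('i, 'e, 'k) frep \<Rightarrow>
    ('i \<Rightarrow> (nat \<Rightarrow> 'k) \<Rightarrow> nat \<Rightarrow> 'k) \<Rightarrow> 'e \<Rightarrow> (nat \<Rightarrow> 'k) \<Rightarrow> nat \<Rightarrow> 'k" where
  "dcob Q X Y h = (\<lambda>a x. if x \<in> fV X (src Q a) then cob Q X Y h a x else 0)"

definition trunc :: "('i \<Rightarrow> (nat \<Rightarrow> 'k::field) set) \<Rightarrow> ('i \<Rightarrow> (nat \<Rightarrow> 'k) \<Rightarrow> nat \<Rightarrow> 'k) \<Rightarrow> 'i \<Rightarrow> (nat \<Rightarrow> 'k) \<Rightarrow> nat \<Rightarrow> 'k" where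
  "trunc V h = (\<lambda>i x. if x \<in> V i then h i x else 0)"

lemma trunc_in [simp]: "x \<in> V i \<Longrightarrow> trunc V h i x = h i x"
  by (simp add: trunc_def)

lemma Lin_lin: "f \<in> Lin V W \<Longrightarrow> lin_on V f"
  and Lin_in: "f \<in> Lin V W \<Longrightarrow> x \<in> V \<Longrightarrow> f x \<in> W"
  and Lin_out: "f \<in> Lin V W \<Longrightarrow> x \<notin> V \<Longrightarrow> f x = 0"
  unfolding Lin_def by blast+

lemma LinI:
  assumes "lin_on V f" "\<And>x. x \<in> V \<Longrightarrow> f x \<in> W" "\<And>x. x \<notin> V \<Longrightarrow> f x = 0"
  shows "f \<in> Lin V W"
  unfolding Lin_def using assms by (simp add: image_subset_iff)

lemma Lin_minus:
  assumes "fv.subspace W" "f \<in> Lin V W" "g \<in> Lin V W"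
  shows "f - g \<in> Lin V W"
proof (rule LinI)
  show "lin_on V (f - g)"
    using lin_on_minus[OF Lin_lin[OF assms(2)] Lin_lin[OF assms(3)]] by (simp add: fun_diff_def)
  show "(f - g) x \<in> W" if "x \<in> V" for x
    using fv.subspace_diff[OF assms(1) Lin_in[OF assms(2) that] Lin_in[OF assms(3) that]] by simp
  show "(f - g) x = 0" if "x \<notin> V" for x
    using Lin_out[OF assms(2) that] Lin_out[OF assms(3) that] by simp
qed

lemma Lin_zero: "fv.subspace W \<Longrightarrow> 0 \<in> Lin V W"
  by (rule LinI) (simp_all add: lin_on_def fv.subspace_0)

lemma add_eq_add_imp_diff_eq: "a + b = c + d \<Longrightarrow> a - c = d - b" for a b c d :: "'a::ab_group_add"
  by (simp add: algebra_simps)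

lemma C0_Lin: "h \<in> C0 X Y \<Longrightarrow> h i \<in> Lin (fV X i) (fV Y i)"
  by (simp add: C0_def)

lemma C1_Lin: "z \<in> C1 Q X Y \<Longrightarrow> z a \<in> Lin (fV X (src Q a)) (fV Y (tgt Q a))"
  by (simp add: C1_def)

lemma C0_cochain: "h \<in> C0 X Y \<Longrightarrow> cochain X Y h"
  by (rule cochainI) (rule Lin_lin[OF C0_Lin] Lin_in[OF C0_Lin], assumption+)+

lemma C1_cocycle: "z \<in> C1 Q X Y \<Longrightarrow> cocycle Q X Y z"
  by (rule cocycleI) (rule Lin_lin[OF C1_Lin] Lin_in[OF C1_Lin], assumption+)+

lemma cochain_trunc:
  assumes X: "is_frep Q X" and h: "cochain X Y h"
  shows "trunc (fV X) h \<in> C0 X Y"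
  unfolding C0_def
proof (intro CollectI allI LinI)
  fix i
  show "lin_on (fV X i) (trunc (fV X) h i)"
    by (rule lin_on_cong[OF cochain_lin[OF h] frep_sub[OF X]]) simp
  show "trunc (fV X) h i x \<in> fV Y i" if "x \<in> fV X i" for x using cochain_in[OF h that] that by simp
  show "trunc (fV X) h i x = 0" if "x \<notin> fV X i" for x using that by (simp add: trunc_def)
qed

lemma cocycle_trunc:
  assumes X: "is_frep Q X" and z: "cocycle Q X Y z"
  shows "(\<lambda>a x. if x \<in> fV X (src Q a) then z a x else 0) \<in> C1 Q X Y"
  unfolding C1_def
proof (intro CollectI allI LinI)
  fix a
  show "lin_on (fV X (src Q a)) (\<lambda>x. if x \<in> fV X (src Q a) then z a x else 0)"
    by (rule lin_on_cong[OF cocycle_lin[OF z] frep_sub[OF X]]) simp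
qed (simp_all add: cocycle_in[OF z])

lemma dcob_C1:
  assumes X: "is_frep Q X" and Y: "is_frep Q Y" and h: "h \<in> C0 X Y"
  shows "dcob Q X Y h \<in> C1 Q X Y"
  unfolding dcob_def by (rule cocycle_trunc[OF X cocycle_cob[OF X Y C0_cochain[OF h]]])

lemma C0_diff: "is_frep Q Y \<Longrightarrow> h \<in> C0 X Y \<Longrightarrow> k \<in> C0 X Y \<Longrightarrow> h - k \<in> C0 X Y"
  by (simp add: C0_def Lin_minus[OF frep_sub])

lemma C1_diff: "is_frep Q Y \<Longrightarrow> z \<in> C1 Q X Y \<Longrightarrow> w \<in> C1 Q X Y \<Longrightarrow> z - w \<in> C1 Q X Y"
  by (simp add: C1_def Lin_minus[OF frep_sub])

lemma C0_zero: "is_frep Q Y \<Longrightarrow> 0 \<in> C0 X Y"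
  by (simp add: C0_def Lin_zero[OF frep_sub])

lemma C1_zero: "is_frep Q Y \<Longrightarrow> 0 \<in> C1 Q X Y"
  by (simp add: C1_def Lin_zero[OF frep_sub])

lemma dcob_diff:
  assumes X: "is_frep Q X" and Y: "is_frep Q Y" and h: "h \<in> C0 X Y" and k: "k \<in> C0 X Y"
  shows "dcob Q X Y (h - k) = dcob Q X Y h - dcob Q X Y k"
proof (intro ext)
  fix a x n
  have "cob Q X Y (h - k) a x = cob Q X Y h a x - cob Q X Y k a x" if x: "x \<in> fV X (src Q a)"
    unfolding cob_def
    using lin_on_diff[OF frep_lin[OF Y] frep_sub[OF Y] cochain_in[OF C0_cochain[OF h] x] cochain_in[OF C0_cochain[OF k] x]]
    by simp
  then show "dcob Q X Y (h - k) a x n = (dcob Q X Y h - dcob Q X Y k) a x n"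
    by (simp add: dcob_def)
qed

definition Hom0 :: "('i, 'e) quiver \<Rightarrow> ('i, 'e, 'k::field) frep \<Rightarrow> ('i, 'e, 'k) frep \<Rightarrow>
    ('i \<Rightarrow> (nat \<Rightarrow> 'k) \<Rightarrow> nat \<Rightarrow> 'k) set" where
  "Hom0 Q X Y = {h \<in> C0 X Y. dcob Q X Y h = 0}"

lemma Hom0_C0: "h \<in> Hom0 Q X Y \<Longrightarrow> h \<in> C0 X Y"
  by (simp add: Hom0_def)

lemma Hom0_fhom:
  assumes h: "h \<in> Hom0 Q X Y"
  shows "fhom Q X Y h"
  unfolding fhom_def
proof (intro conjI allI ballI)
  note hc = C0_cochain[OF Hom0_C0[OF h]]
  show "lin_on (fV X i) (h i)" for i by (rule cochain_lin[OF hc])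
  show "h i x \<in> fV Y i" if "x \<in> fV X i" for i x by (rule cochain_in[OF hc that])
  fix a x assume x: "x \<in> fV X (src Q a)"
  have "dcob Q X Y h a x = 0" using h by (simp add: Hom0_def)
  then have "cob Q X Y h a x = 0" using x by (simp add: dcob_def)
  then show "h (tgt Q a) (fA X a x) = fA Y a (h (src Q a) x)" unfolding cob_def by (simp only: right_minus_eq)
qed

lemma fhom_Hom0:
  assumes X: "is_frep Q X" and h: "fhom Q X Y h"
  shows "trunc (fV X) h \<in> Hom0 Q X Y"
proof -
  have "cochain X Y h" by (rule cochainI) (rule fhom_lin[OF h] fhom_in[OF h], assumption?)+
  then have "trunc (fV X) h \<in> C0 X Y" by (rule cochain_trunc[OF X])
  moreover have "dcob Q X Y (trunc (fV X) h) = 0"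
  proof (intro ext)
    fix a x n
    have "cob Q X Y (trunc (fV X) h) a x = 0" if x: "x \<in> fV X (src Q a)"
      unfolding cob_def using frep_act[OF X x] x fhom_comm[OF h x] by simp
    then show "dcob Q X Y (trunc (fV X) h) a x n = 0 a x n" by (simp add: dcob_def)
  qed
  ultimately show ?thesis by (simp add: Hom0_def)
qed

lemma Hom0_eq_zero:
  assumes h: "h \<in> C0 X Y" and "\<And>i x. x \<in> fV X i \<Longrightarrow> h i x = 0"
  shows "h = 0"
proof (intro ext)
  fix i x n
  have "h i x = 0" using assms(2) Lin_out[OF C0_Lin[OF h]] by (cases "x \<in> fV X i") simp_all
  then show "h i x n = 0 i x n" by simp
qed

lemma card_C0:
  fixes X :: "('i::finite, 'e, 'k::{field,finite}) frep"
  assumes "is_frep Q X" "is_frep Q Y"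
  shows "finite (C0 X Y) \<and> card (C0 X Y) = CARD('k) ^ (\<Sum>i\<in>UNIV. fv.dim (fV X i) * fv.dim (fV Y i))"
proof -
  note L = card_Lin[OF frep_sub[OF assms(1)] frep_fin[OF assms(1)] frep_sub[OF assms(2)] frep_fin[OF assms(2)]]
  have "C0 X Y = (\<Pi>\<^sub>E i\<in>UNIV. Lin (fV X i) (fV Y i))" by (auto simp: C0_def PiE_UNIV_domain)
  then show ?thesis using L by (simp add: finite_PiE card_PiE power_sum)
qed

lemma card_C1:
  fixes X :: "('i, 'e::finite, 'k::{field,finite}) frep"
  assumes "is_frep Q X" "is_frep Q Y"
  shows "finite (C1 Q X Y) \<and> card (C1 Q X Y) =
    CARD('k) ^ (\<Sum>a\<in>UNIV. fv.dim (fV X (src Q a)) * fv.dim (fV Y (tgt Q a)))"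
proof -
  note L = card_Lin[OF frep_sub[OF assms(1)] frep_fin[OF assms(1)] frep_sub[OF assms(2)] frep_fin[OF assms(2)]]
  have "C1 Q X Y = (\<Pi>\<^sub>E a\<in>UNIV. Lin (fV X (src Q a)) (fV Y (tgt Q a)))" by (auto simp: C1_def PiE_UNIV_domain)
  then show ?thesis using L by (simp add: finite_PiE card_PiE power_sum)
qed

lemma euler_form_fdim:
  "euler_form Q (fdim V) (fdim W) = int (\<Sum>i\<in>UNIV. fv.dim (V i) * fv.dim (W i))
     - int (\<Sum>a\<in>UNIV. fv.dim (V (src Q a)) * fv.dim (W (tgt Q a)))"
  by (simp add: euler_form_def fdim_def)

text \<open>Rank-nullity for the coboundary map in multiplicative form: its kernel consists of the
  homomorphisms.\<close>

lemma card_C0_Hom0: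
  fixes X :: "('i::finite, 'e::finite, 'k::{field,finite}) frep"
  assumes X: "is_frep Q X" and Y: "is_frep Q Y"
  shows "card (C0 X Y) = card (Hom0 Q X Y) * card (dcob Q X Y ` C0 X Y)"
  unfolding Hom0_def
  using card_C0[OF X Y] C0_zero[OF Y] C0_diff[OF Y] dcob_diff[OF X Y]
  by (intro card_additive_map) simp_all

lemma not_ext_vanish_C1:
  assumes X: "is_frep Q X" and "\<not> ext_vanish Q X Y"
  obtains z where "z \<in> C1 Q X Y" "z \<notin> dcob Q X Y ` C0 X Y"
proof -
  obtain z where z: "cocycle Q X Y z"
    and no: "\<And>h. cochain X Y h \<Longrightarrow> \<exists>a. \<exists>x\<in>fV X (src Q a). z a x \<noteq> cob Q X Y h a x"
    using assms(2) unfolding ext_vanish_def by blast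
  let ?z = "\<lambda>a x. if x \<in> fV X (src Q a) then z a x else 0"
  have "?z \<notin> dcob Q X Y ` C0 X Y"
  proof
    assume "?z \<in> dcob Q X Y ` C0 X Y"
    then obtain h where h: "h \<in> C0 X Y" "?z = dcob Q X Y h" ..
    obtain a x where ax: "x \<in> fV X (src Q a)" "z a x \<noteq> cob Q X Y h a x"
      using no[OF C0_cochain[OF h(1)]] by blast
    have "?z a x = dcob Q X Y h a x" by (rule fun_cong[OF fun_cong[OF h(2)]])
    then show False using ax by (simp add: dcob_def)
  qed
  then show ?thesis by (rule that[OF cocycle_trunc[OF X z]])
qed

lemma ext_vanish_C1:
  assumes X: "is_frep Q X" and Y: "is_frep Q Y" and "ext_vanish Q X Y"
  shows "dcob Q X Y ` C0 X Y = C1 Q X Y"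
proof (intro equalityI subsetI)
  fix z assume "z \<in> dcob Q X Y ` C0 X Y"
  then show "z \<in> C1 Q X Y" using dcob_C1[OF X Y] by blast
next
  fix z assume z: "z \<in> C1 Q X Y"
  from ext_vanishD[OF assms(3) C1_cocycle[OF z]] obtain h where
    h: "cochain X Y h \<and> (\<forall>a. \<forall>x\<in>fV X (src Q a). z a x = cob Q X Y h a x)" ..
  have "z = dcob Q X Y (trunc (fV X) h)"
  proof (intro ext)
    fix a x n
    have "z a x = dcob Q X Y (trunc (fV X) h) a x"
    proof (cases "x \<in> fV X (src Q a)")
      case True
      then have "z a x = cob Q X Y h a x" using h by blast
      also have "\<dots> = cob Q X Y (trunc (fV X) h) a x"
        unfolding cob_def using True frep_act[OF X True] by simp
      finally show ?thesis using True by (simp add: dcob_def)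
    next
      case False
      then show ?thesis using Lin_out[OF C1_Lin[OF z] False] by (simp add: dcob_def)
    qed
    then show "z a x n = dcob Q X Y (trunc (fV X) h) a x n" by simp
  qed
  then show "z \<in> dcob Q X Y ` C0 X Y" using cochain_trunc[OF X conjunct1[OF h]] by blast
qed

text \<open>Without homomorphisms the coboundary map is injective, and a non-trivial extension keeps
  it from filling \<open>C1\<close>. So \<open>C0\<close> has fewer elements than \<open>C1\<close>,
  and the Euler form is the difference of the two exponents.\<close>

lemma euler_form_neg:
  fixes X :: "('i::finite, 'e::finite, 'k::{field,finite}) frep"
  assumes X: "is_frep Q X" and Y: "is_frep Q Y" and nonext: "\<not> ext_vanish Q X Y"
    and hom: "\<And>\<phi> i x. fhom Q X Y \<phi> \<Longrightarrow> x \<in> fV X i \<Longrightarrow> \<phi> i x = 0"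
  shows "euler_form Q (fdim (fV X)) (fdim (fV Y)) < 0"
proof -
  have "Hom0 Q X Y = {0}"
  proof (intro equalityI subsetI)
    fix h assume h: "h \<in> Hom0 Q X Y"
    have "h = 0" by (rule Hom0_eq_zero[OF Hom0_C0[OF h]]) (rule hom[OF Hom0_fhom[OF h]])
    then show "h \<in> {0}" by simp
  next
    fix h :: "'i \<Rightarrow> (nat \<Rightarrow> 'k) \<Rightarrow> nat \<Rightarrow> 'k" assume "h \<in> {0}"
    moreover have "dcob Q X Y 0 = 0"
      using dcob_diff[OF X Y C0_zero[OF Y] C0_zero[OF Y]] by simp
    ultimately show "h \<in> Hom0 Q X Y" using C0_zero[OF Y] by (simp add: Hom0_def)
  qed
  then have "card (C0 X Y) = card (dcob Q X Y ` C0 X Y)" using card_C0_Hom0[OF X Y] by simp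
  also have "\<dots> < card (C1 Q X Y)"
  proof (rule psubset_card_mono)
    show "finite (C1 Q X Y)" using card_C1[OF X Y] by simp
    obtain z where "z \<in> C1 Q X Y" "z \<notin> dcob Q X Y ` C0 X Y" using not_ext_vanish_C1[OF X nonext] by blast
    then show "dcob Q X Y ` C0 X Y \<subset> C1 Q X Y" using dcob_C1[OF X Y] by blast
  qed
  finally have "CARD('k) ^ (\<Sum>i\<in>UNIV. fv.dim (fV X i) * fv.dim (fV Y i))
      < CARD('k) ^ (\<Sum>a\<in>UNIV. fv.dim (fV X (src Q a)) * fv.dim (fV Y (tgt Q a)))"
    using card_C0[OF X Y] card_C1[OF X Y] by simp
  then have "(\<Sum>i\<in>UNIV. fv.dim (fV X i) * fv.dim (fV Y i))
      < (\<Sum>a\<in>UNIV. fv.dim (fV X (src Q a)) * fv.dim (fV Y (tgt Q a)))"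
    by (rule power_less_imp_less_exp[OF card_field_gt_1])
  then show ?thesis unfolding euler_form_fdim by linarith
qed

text \<open>The endomorphism ring is zero or a division ring. The zero representation satisfies this
  too; where it must be excluded, being non-zero is a separate assumption.\<close>

definition fbrick :: "('i, 'e) quiver \<Rightarrow> ('i, 'e, 'k::field) frep \<Rightarrow> bool" where
  "fbrick Q Y \<longleftrightarrow> (\<forall>\<phi>. fhom Q Y Y \<phi> \<longrightarrow>
     (\<forall>i. \<forall>x\<in>fV Y i. \<phi> i x = 0) \<or> (\<forall>i. bij_betw (\<phi> i) (fV Y i) (fV Y i)))"

lemma fbrick_inverse:
  assumes Y: "is_frep Q Y" and brick: "fbrick Q Y" and \<phi>: "\<phi> \<in> Hom0 Q Y Y" "\<phi> \<noteq> 0"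
  obtains \<psi> where "\<psi> \<in> Hom0 Q Y Y" "\<And>i x. x \<in> fV Y i \<Longrightarrow> \<psi> i (\<phi> i x) = x"
proof -
  note h = Hom0_fhom[OF \<phi>(1)]
  have "\<not> (\<forall>i. \<forall>x\<in>fV Y i. \<phi> i x = 0)" using Hom0_eq_zero[OF Hom0_C0[OF \<phi>(1)]] \<phi>(2) by blast
  then have bij: "bij_betw (\<phi> i) (fV Y i) (fV Y i)" for i
    using brick h unfolding fbrick_def by blast
  have inj: "inj_on (\<phi> i) (fV Y i)" and im: "\<phi> i ` fV Y i = fV Y i" for i
    using bij[of i] by (simp_all add: bij_betw_def)
  define \<psi> where "\<psi> i = inv_into (fV Y i) (\<phi> i)" for i
  have inv: "\<psi> i (\<phi> i x) = x" if "x \<in> fV Y i" for i x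
    unfolding \<psi>_def by (rule inv_into_f_f[OF inj that])
  have "fhom Q Y Y \<psi>"
    unfolding fhom_def
  proof (intro conjI allI ballI)
    show "lin_on (fV Y i) (\<psi> i)" for i
      using lin_on_inv_into[OF fhom_lin[OF h] frep_sub[OF Y] inj, of i] by (simp add: im \<psi>_def)
    show "\<psi> i x \<in> fV Y i" if "x \<in> fV Y i" for i x
      unfolding \<psi>_def by (rule inv_into_into) (simp add: im that)
    fix a y assume "y \<in> fV Y (src Q a)"
    then have "y \<in> \<phi> (src Q a) ` fV Y (src Q a)" by (simp add: im)
    then obtain x where x: "x \<in> fV Y (src Q a)" "y = \<phi> (src Q a) x" by blast
    show "\<psi> (tgt Q a) (fA Y a y) = fA Y a (\<psi> (src Q a) y)"
      unfolding x(2) inv[OF x(1)] fhom_comm[OF h x(1), symmetric] by (rule inv[OF frep_act[OF Y x(1)]])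
  qed
  then have "trunc (fV Y) \<psi> \<in> Hom0 Q Y Y" by (rule fhom_Hom0[OF Y])
  moreover have "trunc (fV Y) \<psi> i (\<phi> i x) = x" if "x \<in> fV Y i" for i x
    using inv[OF that] fhom_in[OF h that] by simp
  ultimately show ?thesis by (rule that)
qed

lemma Hom0_diff:
  assumes X: "is_frep Q X" and Y: "is_frep Q Y" and "h \<in> Hom0 Q X Y" "k \<in> Hom0 Q X Y"
  shows "h - k \<in> Hom0 Q X Y"
  using assms C0_diff[OF Y] dcob_diff[OF X Y] by (simp add: Hom0_def)

text \<open>A non-zero class of extensions of a brick by itself generates a free module over the
  endomorphism division ring.\<close>

lemma brick_euler_form_nonpos:
  fixes Y :: "('i::finite, 'e::finite, 'k::{field,finite}) frep"
  assumes Y: "is_frep Q Y" and brick: "fbrick Q Y" and nonext: "\<not> ext_vanish Q Y Y"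
  shows "euler_form Q (fdim (fV Y)) (fdim (fV Y)) \<le> 0"
proof -
  obtain z where z: "z \<in> C1 Q Y Y" "z \<notin> dcob Q Y Y ` C0 Y Y" using not_ext_vanish_C1[OF Y nonext] by blast
  let ?B = "dcob Q Y Y ` C0 Y Y"
  \<comment> \<open>The endomorphism ring acts on cocycles by composition; \<open>m \<phi>\<close>
    is the multiple of the fixed non-trivial \<open>z\<close>.\<close>
  define m where "m \<phi> = (\<lambda>a x. \<phi> (tgt Q a) (z a x))" for \<phi> :: "'i \<Rightarrow> (nat \<Rightarrow> 'k) \<Rightarrow> nat \<Rightarrow> 'k"
  have mC1: "m \<phi> \<in> C1 Q Y Y" if \<phi>: "\<phi> \<in> Hom0 Q Y Y" for \<phi>
    unfolding C1_def
  proof (intro CollectI allI LinI)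
    fix a
    note h = Hom0_fhom[OF \<phi>]
    show "lin_on (fV Y (src Q a)) (m \<phi> a)"
      unfolding m_def
      by (rule lin_on_comp[OF Lin_lin[OF C1_Lin[OF z(1)]] image_subsetI fhom_lin[OF h]])
        (rule Lin_in[OF C1_Lin[OF z(1)]])
    show "m \<phi> a x \<in> fV Y (tgt Q a)" if "x \<in> fV Y (src Q a)" for x
      unfolding m_def by (rule fhom_in[OF h Lin_in[OF C1_Lin[OF z(1)] that]])
    show "m \<phi> a x = 0" if "x \<notin> fV Y (src Q a)" for x
      unfolding m_def Lin_out[OF C1_Lin[OF z(1)] that] by (rule lin_on_zero[OF fhom_lin[OF h] frep_sub[OF Y]])
  qed
  have Bdiff: "b - b' \<in> ?B" if b: "b \<in> ?B" "b' \<in> ?B" for b b'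
  proof -
    obtain h h' where h: "h \<in> C0 Y Y" "h' \<in> C0 Y Y" "b = dcob Q Y Y h" "b' = dcob Q Y Y h'" using b by blast
    show ?thesis unfolding h(3,4) dcob_diff[OF Y Y h(1,2), symmetric] by (rule imageI[OF C0_diff[OF Y h(1,2)]])
  qed
  \<comment> \<open>Composing with the inverse of \<open>\<phi>\<close> would make \<open>z\<close>
    itself a coboundary.\<close>
  have notB: "m \<phi> \<notin> ?B" if \<phi>: "\<phi> \<in> Hom0 Q Y Y" "\<phi> \<noteq> 0" for \<phi>
  proof
    assume "m \<phi> \<in> ?B"
    then obtain h where h: "h \<in> C0 Y Y" "m \<phi> = dcob Q Y Y h" by blast
    obtain \<psi> where \<psi>: "\<psi> \<in> Hom0 Q Y Y" "\<And>i x. x \<in> fV Y i \<Longrightarrow> \<psi> i (\<phi> i x) = x"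
      by (rule fbrick_inverse[OF Y brick \<phi>]) blast
    note \<psi>h = Hom0_fhom[OF \<psi>(1)]
    note hc = C0_cochain[OF h(1)]
    define k where "k i x = \<psi> i (h i x)" for i x
    have "k \<in> C0 Y Y"
      unfolding C0_def
    proof (intro CollectI allI LinI)
      fix i
      show "lin_on (fV Y i) (k i)"
        unfolding k_def[abs_def]
        by (rule lin_on_comp[OF cochain_lin[OF hc] image_subsetI fhom_lin[OF \<psi>h]]) (rule cochain_in[OF hc])
      show "k i x \<in> fV Y i" if "x \<in> fV Y i" for x
        unfolding k_def by (rule fhom_in[OF \<psi>h cochain_in[OF hc that]])
      show "k i x = 0" if "x \<notin> fV Y i" for x
        unfolding k_def Lin_out[OF C0_Lin[OF h(1)] that]
        by (rule lin_on_zero[OF fhom_lin[OF \<psi>h] frep_sub[OF Y]])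
    qed
    moreover have "z = dcob Q Y Y k"
    proof (intro ext)
      fix a x n
      have "z a x = dcob Q Y Y k a x"
      proof (cases "x \<in> fV Y (src Q a)")
        case True
        have "m \<phi> a x = dcob Q Y Y h a x" by (rule fun_cong[OF fun_cong[OF h(2)]])
        then have "\<phi> (tgt Q a) (z a x) = cob Q Y Y h a x" using True by (simp add: m_def dcob_def)
        then have "z a x = \<psi> (tgt Q a) (cob Q Y Y h a x)"
          using \<psi>(2)[OF Lin_in[OF C1_Lin[OF z(1)] True]] by simp
        also have "\<dots> = \<psi> (tgt Q a) (h (tgt Q a) (fA Y a x)) - \<psi> (tgt Q a) (fA Y a (h (src Q a) x))"
          unfolding cob_def
          by (rule lin_on_diff[OF fhom_lin[OF \<psi>h] frep_sub[OF Y] cochain_in[OF hc frep_act[OF Y True]]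
                frep_act[OF Y cochain_in[OF hc True]]])
        also have "\<dots> = cob Q Y Y k a x"
          unfolding fhom_comm[OF \<psi>h cochain_in[OF hc True]] cob_def k_def ..
        finally show ?thesis using True by (simp add: dcob_def)
      next
        case False
        then show ?thesis using Lin_out[OF C1_Lin[OF z(1)] False] by (simp add: dcob_def)
      qed
      then show "z a x n = dcob Q Y Y k a x n" by simp
    qed
    ultimately show False using z(2) by blast
  qed
  have mdiff: "m (\<phi> - \<phi>') = m \<phi> - m \<phi>'" for \<phi> \<phi>' by (intro ext) (simp add: m_def)
  \<comment> \<open>Multiples of \<open>z\<close> and coboundaries form a direct sum inside
    \<open>C1\<close>. Its size is |Hom| times the number of coboundaries, which is that of
    \<open>C0\<close>.\<close>
  let ?f = "\<lambda>(\<phi>, b). m \<phi> + b"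
  have "inj_on ?f (Hom0 Q Y Y \<times> ?B)"
  proof (rule inj_onI, clarify)
    fix \<phi> \<phi>' h h'
    assume \<phi>: "\<phi> \<in> Hom0 Q Y Y" "\<phi>' \<in> Hom0 Q Y Y" and h: "h \<in> C0 Y Y" "h' \<in> C0 Y Y"
      and eq: "m \<phi> + dcob Q Y Y h = m \<phi>' + dcob Q Y Y h'"
    have "m (\<phi> - \<phi>') = dcob Q Y Y h' - dcob Q Y Y h"
      unfolding mdiff by (rule add_eq_add_imp_diff_eq[OF eq])
    then have "m (\<phi> - \<phi>') \<in> ?B" using Bdiff[OF imageI[OF h(2)] imageI[OF h(1)]] by simp
    then have "\<phi> - \<phi>' = 0" using notB[OF Hom0_diff[OF Y Y \<phi>]] by blast
    then have "\<phi> = \<phi>'" by (simp only: right_minus_eq)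
    then show "\<phi> = \<phi>' \<and> dcob Q Y Y h = dcob Q Y Y h'" using eq by simp
  qed
  moreover have "?f ` (Hom0 Q Y Y \<times> ?B) \<subseteq> C1 Q Y Y"
  proof clarify
    fix \<phi> h assume \<phi>: "\<phi> \<in> Hom0 Q Y Y" and h: "h \<in> C0 Y Y"
    have "m \<phi> - (0 - dcob Q Y Y h) \<in> C1 Q Y Y"
      by (rule C1_diff[OF Y mC1[OF \<phi>] C1_diff[OF Y C1_zero[OF Y] dcob_C1[OF Y Y h]]])
    then show "m \<phi> + dcob Q Y Y h \<in> C1 Q Y Y" by simp
  qed
  ultimately have "card (Hom0 Q Y Y \<times> ?B) \<le> card (C1 Q Y Y)"
    using card_C1[OF Y Y] by (intro card_inj_on_le) auto
  then have "card (C0 Y Y) \<le> card (C1 Q Y Y)"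
    using card_C0_Hom0[OF Y Y] by (simp add: card_cartesian_product)
  then have "CARD('k) ^ (\<Sum>i\<in>UNIV. fv.dim (fV Y i) * fv.dim (fV Y i))
      \<le> CARD('k) ^ (\<Sum>a\<in>UNIV. fv.dim (fV Y (src Q a)) * fv.dim (fV Y (tgt Q a)))"
    using card_C0[OF Y Y] card_C1[OF Y Y] by simp
  then have "(\<Sum>i\<in>UNIV. fv.dim (fV Y i) * fv.dim (fV Y i))
      \<le> (\<Sum>a\<in>UNIV. fv.dim (fV Y (src Q a)) * fv.dim (fV Y (tgt Q a)))"
    by (rule power_le_imp_le_exp[OF card_field_gt_1])
  then show ?thesis unfolding euler_form_fdim by linarith
qed

text \<open>Each vertex space of a brick is a vector space over the endomorphism division ring.\<close>

lemma brick_card_space: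
  fixes Y :: "('i::finite, 'e::finite, 'k::{field,finite}) frep"
  assumes Y: "is_frep Q Y" and brick: "fbrick Q Y"
  shows "\<exists>k. card (fV Y i) = card (Hom0 Q Y Y) ^ k"
proof -
  let ?E = "Hom0 Q Y Y"
  \<comment> \<open>In place of a basis over the endomorphism ring, a maximal stable subgroup whose
    size is a power of the size of that ring is taken.\<close>
  define \<W> where "\<W> = {W. W \<subseteq> fV Y i \<and> 0 \<in> W \<and> (\<forall>x\<in>W. \<forall>y\<in>W. x - y \<in> W) \<and>
     (\<forall>\<phi>\<in>?E. \<forall>x\<in>W. \<phi> i x \<in> W) \<and> (\<exists>k. card W = card ?E ^ k)}"
  have fin: "finite \<W>" by (rule finite_subset[of _ "Pow (fV Y i)"]) (auto simp: \<W>_def frep_fin[OF Y])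
  have lin: "lin_on (fV Y i) (\<phi> i)" if "\<phi> \<in> ?E" for \<phi> by (rule fhom_lin[OF Hom0_fhom[OF that]])
  have inV: "\<phi> i x \<in> fV Y i" if "\<phi> \<in> ?E" "x \<in> fV Y i" for \<phi> x by (rule fhom_in[OF Hom0_fhom[OF that(1)] that(2)])
  have "{0} \<in> \<W>"
    using fv.subspace_0[OF frep_sub[OF Y]] lin_on_zero[OF lin frep_sub[OF Y]]
    by (auto simp: \<W>_def intro!: exI[of _ 0])
  from finite_has_maximal2[OF fin this] obtain W where W: "W \<in> \<W>"
    and max: "\<forall>U\<in>\<W>. W \<subseteq> U \<longrightarrow> W = U"
    by (elim bexE conjE) (rule that)
  have W1: "W \<subseteq> fV Y i" and W0: "0 \<in> W" and Wd: "\<And>x y. x \<in> W \<Longrightarrow> y \<in> W \<Longrightarrow> x - y \<in> W"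
    and WE: "\<And>\<phi> x. \<phi> \<in> ?E \<Longrightarrow> x \<in> W \<Longrightarrow> \<phi> i x \<in> W" and Wk: "\<exists>k. card W = card ?E ^ k"
    using W by (auto simp: \<W>_def)
  have "W = fV Y i"
  proof (rule ccontr)
    assume "W \<noteq> fV Y i"
    then obtain v where v: "v \<in> fV Y i" "v \<notin> W" using W1 by blast
    let ?f = "\<lambda>(\<phi>, w). \<phi> i v + w"
    \<comment> \<open>A vector \<open>v\<close> outside \<open>W\<close> allows the multiples of
      \<open>v\<close> to be adjoined. The sum is direct since non-zero endomorphisms are
      invertible, so the size is multiplied by that of the ring.\<close>
    define U where "U = ?f ` (?E \<times> W)"
    have E0: "0 \<in> ?E"
      using Hom0_diff[OF Y Y fhom_Hom0[OF Y fhom_id] fhom_Hom0[OF Y fhom_id]] by simp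
    have "inj_on ?f (?E \<times> W)"
    proof (rule inj_onI, clarify)
      fix \<phi> w \<phi>' w' assume \<phi>: "\<phi> \<in> ?E" "\<phi>' \<in> ?E" and w: "w \<in> W" "w' \<in> W" and eq: "\<phi> i v + w = \<phi>' i v + w'"
      have d: "\<phi> - \<phi>' \<in> ?E" by (rule Hom0_diff[OF Y Y \<phi>])
      have "\<phi> i v - \<phi>' i v = w' - w" by (rule add_eq_add_imp_diff_eq[OF eq])
      then have dW: "(\<phi> - \<phi>') i v \<in> W" using Wd[OF w(2,1)] by simp
      have "\<phi> - \<phi>' = 0"
      proof (rule ccontr)
        assume ne: "\<phi> - \<phi>' \<noteq> 0"
        obtain \<psi> where \<psi>: "\<psi> \<in> ?E" "\<And>i x. x \<in> fV Y i \<Longrightarrow> \<psi> i ((\<phi> - \<phi>') i x) = x"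
          by (rule fbrick_inverse[OF Y brick d ne]) blast
        have "\<psi> i ((\<phi> - \<phi>') i v) \<in> W" by (rule WE[OF \<psi>(1) dW])
        then show False using \<psi>(2)[OF v(1)] v(2) by simp
      qed
      then have "\<phi> = \<phi>'" by (simp only: right_minus_eq)
      then show "\<phi> = \<phi>' \<and> w = w'" using eq by simp
    qed
    then have cU: "card U = card ?E * card W" unfolding U_def by (simp add: card_image card_cartesian_product)
    have WU: "W \<subseteq> U"
    proof
      fix w assume "w \<in> W"
      then show "w \<in> U" unfolding U_def using E0 by (intro image_eqI[of _ _ "(0, w)"]) simp_all
    qed
    have "U \<in> \<W>"
      unfolding \<W>_def
    proof (intro CollectI conjI ballI)
      show "U \<subseteq> fV Y i"
        unfolding U_def using inV v(1) W1 fv.subspace_add[OF frep_sub[OF Y]] by (auto simp: subset_iff)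
      show "0 \<in> U" using WU W0 by blast
      show "\<exists>k. card U = card ?E ^ k"
      proof -
        obtain k where "card W = card ?E ^ k" using Wk ..
        then have "card U = card ?E ^ Suc k" using cU by simp
        then show ?thesis ..
      qed
    next
      fix x y assume "x \<in> U" "y \<in> U"
      then obtain \<phi> w \<phi>' w' where xy: "\<phi> \<in> ?E" "w \<in> W" "x = \<phi> i v + w" "\<phi>' \<in> ?E" "w' \<in> W" "y = \<phi>' i v + w'"
        unfolding U_def by auto
      have "x - y = (\<phi> - \<phi>') i v + (w - w')" unfolding xy by (simp add: algebra_simps)
      then show "x - y \<in> U"
        unfolding U_def using Hom0_diff[OF Y Y xy(1,4)] Wd[OF xy(2,5)]
        by (intro image_eqI[of _ _ "(\<phi> - \<phi>', w - w')"]) simp_all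
    next
      fix \<phi> x assume \<phi>: "\<phi> \<in> ?E" and "x \<in> U"
      then obtain \<phi>' w where x: "\<phi>' \<in> ?E" "w \<in> W" "x = \<phi>' i v + w" unfolding U_def by auto
      define \<chi> where "\<chi> = trunc (fV Y) (\<lambda>i x. \<phi> i (\<phi>' i x))"
      have "\<chi> \<in> ?E"
        unfolding \<chi>_def by (rule fhom_Hom0[OF Y fhom_comp[OF Hom0_fhom[OF x(1)] Hom0_fhom[OF \<phi>]]])
      moreover have "\<phi> i x = \<chi> i v + \<phi> i w"
      proof -
        have "w \<in> fV Y i" using x(2) W1 by blast
        then have "\<phi> i x = \<phi> i (\<phi>' i v) + \<phi> i w"
          unfolding x(3) by (rule lin_on_add[OF lin[OF \<phi>] inV[OF x(1) v(1)]])
        then show ?thesis using v(1) by (simp add: \<chi>_def)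
      qed
      ultimately show "\<phi> i x \<in> U"
        unfolding U_def using WE[OF \<phi> x(2)] by (intro image_eqI[of _ _ "(\<chi>, \<phi> i w)"]) simp_all
    qed
    then have "W = U" by (rule max[rule_format, OF _ WU])
    moreover have "v \<in> U"
      unfolding U_def using fhom_Hom0[OF Y fhom_id] W0 v(1)
      by (intro image_eqI[of _ _ "(trunc (fV Y) (\<lambda>i x. x), 0)"]) simp_all
    ultimately show False using v(2) by simp
  qed
  then show ?thesis using Wk by simp
qed

text \<open>The endomorphism ring has \<open>q^s\<close> elements with \<open>s = <y, y>\<close>,
  and it is not trivial, so \<open>s > 0\<close>. All vertex dimensions are divisible by
  \<open>s\<close>, hence \<open>s^2\<close> divides \<open>s\<close>, and
  \<open>s = 1\<close>.\<close>

lemma brick_euler_form_one: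
  fixes Y :: "('i::finite, 'e::finite, 'k::{field,finite}) frep"
  assumes Y: "is_frep Q Y" and brick: "fbrick Q Y" and ext: "ext_vanish Q Y Y"
    and nz: "fV Y \<noteq> (\<lambda>i. {0})"
  shows "euler_form Q (fdim (fV Y)) (fdim (fV Y)) = 1"
proof -
  let ?e = "card (Hom0 Q Y Y)" and ?q = "CARD('k)"
  define A where "A = (\<Sum>i\<in>UNIV. fv.dim (fV Y i) * fv.dim (fV Y i))"
  define B where "B = (\<Sum>a\<in>UNIV. fv.dim (fV Y (src Q a)) * fv.dim (fV Y (tgt Q a)))"
  have eu: "euler_form Q (fdim (fV Y)) (fdim (fV Y)) = int A - int B"
    unfolding euler_form_fdim A_def B_def ..
  have AB: "?q ^ A = ?e * ?q ^ B"
    using card_C0_Hom0[OF Y Y] card_C0[OF Y Y] card_C1[OF Y Y] ext_vanish_C1[OF Y Y ext]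
    by (simp add: A_def B_def)
  have finE: "finite (Hom0 Q Y Y)" using card_C0[OF Y Y] by (simp add: Hom0_def)
  obtain i x where ix: "x \<in> fV Y i" "x \<noteq> 0"
    using fsub_eq_zero[OF fsub_full[OF Y]] nz by blast
  let ?id = "trunc (fV Y) (\<lambda>i x. x)"
  have id: "?id \<in> Hom0 Q Y Y" by (rule fhom_Hom0[OF Y fhom_id])
  have "?id i x \<noteq> 0 i x" using ix by (simp add: zero_fun_def)
  then have "?id \<noteq> 0" by (rule contrapos_nn) simp
  moreover have "0 \<in> Hom0 Q Y Y" using Hom0_diff[OF Y Y id id] by simp
  ultimately have "card {0, ?id} \<le> ?e" using id finE by (intro card_mono) auto
  then have e2: "?e \<ge> 2" using \<open>?id \<noteq> 0\<close> by simp
  have q0: "?q ^ n > 0" for n using card_field_gt_1[where 'k = 'k] by simp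
  have "?q ^ B < ?e * ?q ^ B" using e2 q0[of B] by simp
  then have "?q ^ B < ?q ^ A" using AB by simp
  then have lt: "B < A" by (rule power_less_imp_less_exp[OF card_field_gt_1])
  define s where "s = A - B"
  have "?q ^ A = ?q ^ s * ?q ^ B" using lt by (simp add: s_def flip: power_add)
  then have e: "?e = ?q ^ s" using AB q0[of B] by simp
  have "\<exists>k. fv.dim (fV Y i) = s * k" for i
  proof -
    obtain k where "card (fV Y i) = ?e ^ k" using brick_card_space[OF Y brick] by blast
    then have "card (fV Y i) = ?q ^ (s * k)" unfolding e by (simp add: power_mult)
    then have "fv.dim (fV Y i) = s * k" by (rule dim_eqI_card[OF frep_sub[OF Y] frep_fin[OF Y]])
    then show ?thesis ..
  qed
  then have "\<forall>i. \<exists>k. fv.dim (fV Y i) = s * k" ..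
  from choice[OF this] obtain k where k: "\<forall>i. fv.dim (fV Y i) = s * k i" ..
  have "fdim (fV Y) = (\<lambda>i. int s * int (k i))" using k by (simp add: fdim_def)
  then have "euler_form Q (fdim (fV Y)) (fdim (fV Y)) = int s * (int s * euler_form Q (\<lambda>i. int (k i)) (\<lambda>i. int (k i)))"
    by (simp only: euler_form_scale_left euler_form_scale_right)
  moreover have es: "euler_form Q (fdim (fV Y)) (fdim (fV Y)) = int s" using eu lt by (simp add: s_def)
  ultimately have "int s * (int s * euler_form Q (\<lambda>i. int (k i)) (\<lambda>i. int (k i))) = int s * 1" by simp
  moreover have "int s \<noteq> 0" using lt by (simp add: s_def)
  ultimately have "int s * euler_form Q (\<lambda>i. int (k i)) (\<lambda>i. int (k i)) = 1" by (simp only: mult_cancel_left) simp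
  then have "int s = 1" by (auto simp: zmult_eq_1_iff)
  then show ?thesis using es by simp
qed

section \<open>The defect torsion pairs\<close>

definition rsize :: "('i::finite \<Rightarrow> (nat \<Rightarrow> 'k::field) set) \<Rightarrow> nat" where
  "rsize W = (\<Sum>i\<in>UNIV. fv.dim (W i))"

lemma fdim_zero [simp]: "fdim (\<lambda>i. {0 :: nat \<Rightarrow> 'k::{field,finite}}) = (\<lambda>i. 0)"
  by (simp add: fdim_def)

lemma rsize_zero [simp]: "rsize (\<lambda>i. {0 :: nat \<Rightarrow> 'k::{field,finite}}) = 0"
  by (simp add: rsize_def)

lemma fdim_fepi:
  fixes M :: "('i, 'e, 'k::{field,finite}) frep"
  assumes "is_frep Q M" "fepi Q M N W \<phi>"
  shows "fdim (fV M) = fdim W + fdim (fV N)"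
  by (rule ext) (simp add: fdim_def fepi_dim[OF assms])

lemma rsize_fepi:
  fixes M :: "('i::finite, 'e, 'k::{field,finite}) frep"
  assumes "is_frep Q M" "fepi Q M N W \<phi>"
  shows "rsize (fV M) = rsize W + rsize (fV N)"
  by (simp add: rsize_def fepi_dim[OF assms] sum.distrib)

lemma rsize_sub_le:
  fixes M :: "('i::finite, 'e, 'k::{field,finite}) frep"
  assumes M: "is_frep Q M" and W: "fsub Q M W"
  shows "rsize W \<le> rsize (fV M)"
  unfolding rsize_def
  by (intro sum_mono dim_subset_le(1)[OF frep_sub[OF M] frep_fin[OF M] fsub_subspace[OF W] fsub_le[OF W]])

lemma rsize_sub:
  fixes M :: "('i::finite, 'e, 'k::{field,finite}) frep"
  assumes M: "is_frep Q M" and W: "fsub Q M W" and ne: "W \<noteq> fV M"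
  shows "rsize W < rsize (fV M)"
proof -
  note le = dim_subset_le[OF frep_sub[OF M] frep_fin[OF M] fsub_subspace[OF W] fsub_le[OF W]]
  obtain i where "W i \<noteq> fV M i" using ne by blast
  then have "fv.dim (W i) \<noteq> fv.dim (fV M i)" using le(2)[of i] by blast
  then have "fv.dim (W i) < fv.dim (fV M i)" using le(1)[of i] by simp
  then show ?thesis unfolding rsize_def by (intro sum_strict_mono_ex1) (auto intro: le(1))
qed

lemma rsize_pos:
  fixes M :: "('i::finite, 'e, 'k::{field,finite}) frep"
  assumes M: "is_frep Q M" and W: "fsub Q M W" and ne: "W \<noteq> (\<lambda>i. {0})"
  shows "0 < rsize W"
  using rsize_sub[OF fsub_frep[OF M W] fsub_zero[OF fsub_frep[OF M W]]] ne by auto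

text \<open>The pullback of the sequence to \<open>U\<close> keeps its kernel. This makes defect and
  size of a preimage the sums of those of \<open>W\<close> and \<open>U\<close>.\<close>

lemma fepi_vimage:
  assumes M: "is_frep Q M" and \<pi>: "fepi Q M N W \<pi>" and U: "fsub Q N U"
  shows "fepi Q (restr M (\<lambda>i. {x \<in> fV M i. \<pi> i x \<in> U i})) (restr N U) W \<pi>"
  unfolding fepi_def restr_simps
proof (intro conjI allI)
  note \<pi>h = fepi_hom[OF \<pi>]
  show "fhom Q (restr M (\<lambda>i. {x \<in> fV M i. \<pi> i x \<in> U i})) (restr N U) \<pi>"
    using fhom_restrict[OF \<pi>h fsub_vimage[OF M \<pi>h U]] unfolding fhom_def restr_simps by simp
  fix i
  show "\<pi> i ` {x \<in> fV M i. \<pi> i x \<in> U i} = U i"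
  proof (intro equalityI subsetI)
    fix y assume y: "y \<in> U i"
    then have "y \<in> \<pi> i ` fV M i" unfolding fepi_image[OF \<pi>] by (rule fsub_in[OF U])
    then obtain x where "x \<in> fV M i" "y = \<pi> i x" by blast
    then show "y \<in> \<pi> i ` {x \<in> fV M i. \<pi> i x \<in> U i}" using y by simp
  qed blast
  show "W i = {x \<in> {x \<in> fV M i. \<pi> i x \<in> U i}. \<pi> i x = 0}"
    using fv.subspace_0[OF fsub_subspace[OF U, of i]] fepi_ker[OF \<pi>, of i] by auto
qed

section \<open>Torsion, torsion free representations and their extensions\<close>

context affine_form
begin

definition th :: "('i \<Rightarrow> (nat \<Rightarrow> 'k::field) set) \<Rightarrow> int" where
  "th W = euler_form Q d (fdim W)"

text \<open>The torsion pairs for \<open>t = 1\<close> and \<open>t = 0\<close>: every non-zero quotient of a torsion representation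
  has defect \<open>\<ge> t\<close>, and every non-zero subrepresentation of a torsion free one has defect \<open>< t\<close>.
  For \<open>t = 1\<close> torsion means preinjective, for \<open>t = 0\<close> torsion free means preprojective.\<close>

definition tors :: "int \<Rightarrow> ('i, 'e, 'k::field) frep \<Rightarrow> bool" where
  "tors t M \<longleftrightarrow> (\<forall>U. fsub Q M U \<and> U \<noteq> fV M \<longrightarrow> t \<le> th (fV M) - th U)"

definition tfree :: "int \<Rightarrow> ('i, 'e, 'k::field) frep \<Rightarrow> bool" where
  "tfree t M \<longleftrightarrow> (\<forall>U. fsub Q M U \<and> U \<noteq> (\<lambda>i. {0}) \<longrightarrow> th U < t)"

lemma torsD: "tors t M \<Longrightarrow> fsub Q M U \<Longrightarrow> U \<noteq> fV M \<Longrightarrow> t \<le> th (fV M) - th U"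
  and tfreeD: "tfree t M \<Longrightarrow> fsub Q M U \<Longrightarrow> U \<noteq> (\<lambda>i. {0}) \<Longrightarrow> th U < t"
  unfolding tors_def tfree_def by blast+

lemma th_zero [simp]: "th (\<lambda>i. {0 :: nat \<Rightarrow> 'k::{field,finite}}) = 0"
  by (simp add: th_def)

lemma th_fepi:
  fixes M :: "('i, 'e, 'k::{field,finite}) frep"
  assumes "is_frep Q M" "fepi Q M N W \<phi>"
  shows "th (fV M) = th W + th (fV N)"
  unfolding th_def fdim_fepi[OF assms] by (rule euler_form_add_right)

lemma tors_quotient:
  fixes M :: "('i, 'e, 'k::{field,finite}) frep"
  assumes M: "is_frep Q M" and \<pi>: "fepi Q M N W \<pi>" and t: "tors t M"
  shows "tors t N"
  unfolding tors_def
proof (intro allI impI, elim conjE)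
  fix U assume U: "fsub Q N U" and ne: "U \<noteq> fV N"
  let ?U = "\<lambda>i. {x \<in> fV M i. \<pi> i x \<in> U i}"
  have sub: "fsub Q M ?U" by (rule fsub_vimage[OF M fepi_hom[OF \<pi>] U])
  have e: "fepi Q (restr M ?U) (restr N U) W \<pi>" by (rule fepi_vimage[OF M \<pi> U])
  have "?U \<noteq> fV M"
  proof
    assume eq: "?U = fV M"
    have "U = fV N"
    proof
      fix i
      have "U i = \<pi> i ` ?U i" using fepi_image[OF e, of i] by simp
      also have "\<dots> = fV N i" using fun_cong[OF eq, of i] fepi_image[OF \<pi>, of i] by simp
      finally show "U i = fV N i" .
    qed
    then show False using ne by blast
  qed
  from torsD[OF t sub this] show "t \<le> th (fV N) - th U"
    using th_fepi[OF M \<pi>] th_fepi[OF fsub_frep[OF M sub] e] by simp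
qed

lemma tfree_sub: "tfree t M \<Longrightarrow> fsub Q M W \<Longrightarrow> tfree t (restr M W)"
  using fsub_trans[of Q M W] unfolding tfree_def by blast

lemma th_injective_image:
  fixes M :: "('i, 'e, 'k::{field,finite}) frep"
  assumes M: "is_frep Q M" and \<phi>: "fhom Q M N \<phi>" and inj: "\<forall>i. \<forall>x\<in>fV M i. \<phi> i x = 0 \<longrightarrow> x = 0"
    and U: "fsub Q M U"
  shows "th (\<lambda>i. \<phi> i ` U i) = th U" "(\<lambda>i. \<phi> i ` U i) = (\<lambda>i. {0}) \<Longrightarrow> U = (\<lambda>i. {0})"
proof -
  have M': "is_frep Q (restr M U)" by (rule fsub_frep[OF M U])
  have ker: "{x \<in> U i. \<phi> i x = 0} = {0}" for i
  proof -
    have "0 \<in> U i" by (rule fv.subspace_0[OF fsub_subspace[OF U]])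
    moreover have "\<phi> i 0 = 0" by (rule lin_on_zero[OF fhom_lin[OF \<phi>] frep_sub[OF M]])
    moreover have "x = 0" if "x \<in> U i" "\<phi> i x = 0" for x
      using inj[rule_format, OF fsub_in[OF U that(1)] that(2)] .
    ultimately show ?thesis by auto
  qed
  have "fepi Q (restr M U) (restr N (\<lambda>i. \<phi> i ` U i)) (\<lambda>i. {0}) \<phi>"
    using fepi_onto_image[OF fhom_restrict[OF \<phi> U]] by (simp add: ker)
  from th_fepi[OF M' this] show "th (\<lambda>i. \<phi> i ` U i) = th U" by simp
  assume z: "(\<lambda>i. \<phi> i ` U i) = (\<lambda>i. {0})"
  show "U = (\<lambda>i. {0})"
  proof (rule fsub_eq_zero[OF U])
    fix i x assume x: "x \<in> U i"
    then have "\<phi> i x \<in> {0}" using fun_cong[OF z, of i] by blast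
    then show "x = 0" using inj[rule_format, OF fsub_in[OF U x]] by simp
  qed
qed

lemma tfree_injective:
  fixes M :: "('i, 'e, 'k::{field,finite}) frep"
  assumes M: "is_frep Q M" and \<phi>: "fhom Q M N \<phi>" and inj: "\<forall>i. \<forall>x\<in>fV M i. \<phi> i x = 0 \<longrightarrow> x = 0"
    and t: "tfree t N"
  shows "tfree t M"
  unfolding tfree_def
proof (intro allI impI, elim conjE)
  fix U assume U: "fsub Q M U" and ne: "U \<noteq> (\<lambda>i. {0})"
  have "(\<lambda>i. \<phi> i ` U i) \<noteq> (\<lambda>i. {0})" using th_injective_image(2)[OF M \<phi> inj U] ne by blast
  then have "th (\<lambda>i. \<phi> i ` U i) < t" by (rule tfreeD[OF t fsub_image[OF M \<phi> U]])
  then show "th U < t" using th_injective_image(1)[OF M \<phi> inj U] by simp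
qed

lemma ext_vanish_zero_left:
  assumes X: "is_frep Q X" and Y: "is_frep Q Y" and z: "fV X = (\<lambda>i. {0})"
  shows "ext_vanish Q X Y"
  unfolding ext_vanish_def
proof (intro allI impI)
  fix c assume c: "cocycle Q X Y c"
  have "cochain X Y (\<lambda>i x. 0)" by (rule cochainI) (simp_all add: lin_on_0 fv.subspace_0[OF frep_sub[OF Y]])
  moreover have "c a x = cob Q X Y (\<lambda>i x. 0) a x" if "x \<in> fV X (src Q a)" for a x
  proof -
    have "x = 0" using that by (simp add: z)
    then show ?thesis
      using lin_on_zero[OF cocycle_lin[OF c, of a] frep_sub[OF X]] lin_on_zero[OF frep_lin[OF Y, of a] frep_sub[OF Y]]
      by (simp add: cob_def)
  qed
  ultimately show "\<exists>h. cochain X Y h \<and> (\<forall>a. \<forall>x\<in>fV X (src Q a). c a x = cob Q X Y h a x)" by blast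
qed

lemma ext_vanish_zero_right:
  assumes X: "is_frep Q X" and Y: "is_frep Q Y" and z: "fV Y = (\<lambda>i. {0})"
  shows "ext_vanish Q X Y"
  unfolding ext_vanish_def
proof (intro allI impI)
  fix c assume c: "cocycle Q X Y c"
  have "cochain X Y (\<lambda>i x. 0)" by (rule cochainI) (simp_all add: lin_on_0 z)
  moreover have "c a x = cob Q X Y (\<lambda>i x. 0) a x" if "x \<in> fV X (src Q a)" for a x
    using cocycle_in[OF c that] lin_on_zero[OF frep_lin[OF Y, of a] frep_sub[OF Y]] by (simp add: z cob_def)
  ultimately show "\<exists>h. cochain X Y h \<and> (\<forall>a. \<forall>x\<in>fV X (src Q a). c a x = cob Q X Y h a x)" by blast
qed

text \<open>This replaces Auslander--Reiten duality. In a minimal counterexample both representations are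
  bricks without homomorphisms from the first to the second: a non-zero one would give both
  self-extensions, hence dimension vectors in the radical of the form, and equal defects. So the
  dimension vectors \<open>x\<close>, \<open>y\<close> have \<open>q \<le> 1\<close> and \<open>\<langle>x, y\<rangle> < 0\<close>, which the Coxeter transformation
  excludes.\<close>

theorem ext_vanish_tfree_tors:
  fixes X Y :: "('i, 'e, 'k::{field,finite}) frep"
  assumes "is_frep Q X" "is_frep Q Y" "tfree t X" "tors t Y" and t: "t = 0 \<or> t = 1"
  shows "ext_vanish Q X Y"
  using assms(1-4)
proof (induction "rsize (fV X) + rsize (fV Y)" arbitrary: X Y rule: less_induct)
  case less
  note X = less.prems(1) and Y = less.prems(2) and XF = less.prems(3) and YT = less.prems(4)
  have IH: "ext_vanish Q X' Y'"
    if "rsize (fV X') + rsize (fV Y') < rsize (fV X) + rsize (fV Y)" "is_frep Q X'" "is_frep Q Y'"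
      "tfree t X'" "tors t Y'" for X' Y' :: "('i, 'e, 'k) frep"
    using less.hyps[of X' Y'] that by blast
  show ?case
  proof (rule ccontr)
    assume nonext: "\<not> ext_vanish Q X Y"
    have X0: "fV X \<noteq> (\<lambda>i. {0})" using ext_vanish_zero_left[OF X Y] nonext by blast
    have Y0: "fV Y \<noteq> (\<lambda>i. {0})" using ext_vanish_zero_right[OF X Y] nonext by blast
    \<comment> \<open>Subrepresentations of a torsion free one are torsion free and quotients of a
      torsion one are torsion, so minimality applies to \<open>X\<close> and \<open>Y\<close> cut
      down in these ways.\<close>
    have subX: "ext_vanish Q (restr X K) Y" if K: "fsub Q X K" "K \<noteq> fV X" for K
      by (rule IH) (use rsize_sub[OF X K] fsub_frep[OF X K(1)] Y tfree_sub[OF XF K(1)] YT in simp_all)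
    have quotY: "ext_vanish Q X N" if N: "is_frep Q N" "fepi Q Y N G \<pi>" and G: "G \<noteq> (\<lambda>i. {0})" for N G \<pi>
    proof (rule IH)
      have "0 < rsize G" by (rule rsize_pos[OF Y fepi_sub[OF Y N] G])
      then show "rsize (fV X) + rsize (fV N) < rsize (fV X) + rsize (fV Y)"
        using rsize_fepi[OF Y N(2)] by simp
    qed (use X N XF tors_quotient[OF Y N(2) YT] in simp_all)
    \<comment> \<open>Otherwise \<open>X\<close> is an extension of two smaller torsion free
      representations, both with vanishing Ext^1 into \<open>Y\<close>.\<close>
    have noX: "\<not> tfree t N" if K: "K \<noteq> (\<lambda>i. {0})" "K \<noteq> fV X" and N: "is_frep Q N" "fepi Q X N K \<pi>" for K N \<pi>
    proof
      assume NF: "tfree t N"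
      have KX: "fsub Q X K" by (rule fepi_sub[OF X N])
      have "rsize (fV N) < rsize (fV X)" using rsize_fepi[OF X N(2)] rsize_pos[OF X KX K(1)] by simp
      then have "ext_vanish Q N Y" by (intro IH) (use N Y NF YT in simp_all)
      then have "ext_vanish Q X Y" by (rule ext_vanish_extension_left[OF X Y N _ subX[OF KX K(2)]])
      then show False using nonext by blast
    qed
    \<comment> \<open>Dually, \<open>Y\<close> would be an extension of two smaller torsion
      representations.\<close>
    have noY: "\<not> tors t (restr Y G)" if G: "G \<noteq> (\<lambda>i. {0})" "G \<noteq> fV Y" "fsub Q Y G" for G
    proof
      assume GT: "tors t (restr Y G)"
      obtain N \<pi> where N: "is_frep Q N" "fepi Q Y N G \<pi>" using quotient_exists[OF Y G(3)] by blast
      have "ext_vanish Q X (restr Y G)"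
        by (rule IH) (use rsize_sub[OF Y G(3,2)] X fsub_frep[OF Y G(3)] XF GT in simp_all)
      then have "ext_vanish Q X Y" by (rule ext_vanish_extension_right[OF X Y N quotY[OF N G(1)]])
      then show False using nonext by blast
    qed
    have brickX: "fbrick Q X"
      unfolding fbrick_def
    proof (intro allI impI)
      fix \<phi> assume \<phi>: "fhom Q X X \<phi>"
      let ?K = "\<lambda>i. {x \<in> fV X i. \<phi> i x = 0}" and ?I = "\<lambda>i. \<phi> i ` fV X i"
      have e: "fepi Q X (restr X ?I) ?K \<phi>" by (rule fepi_onto_image[OF \<phi>])
      have I: "fsub Q X ?I" by (rule fsub_image[OF X \<phi> fsub_full[OF X]])
      \<comment> \<open>The image of an endomorphism lies in \<open>X\<close>, so it is torsion
        free; being the quotient by the kernel, it makes \<open>noX\<close> apply unless the kernel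
        is trivial.\<close>
      consider "?K = fV X" | "?K = (\<lambda>i. {0})"
        using noX[OF _ _ fsub_frep[OF X I] e] tfree_sub[OF XF I] by blast
      then show "(\<forall>i. \<forall>x\<in>fV X i. \<phi> i x = 0) \<or> (\<forall>i. bij_betw (\<phi> i) (fV X i) (fV X i))"
      proof cases
        case 1
        have "\<phi> i x = 0" if "x \<in> fV X i" for i x
        proof -
          have "x \<in> ?K i" unfolding fun_cong[OF 1, of i] by (rule that)
          then show ?thesis by simp
        qed
        then show ?thesis by blast
      next
        case 2
        have "bij_betw (\<phi> i) (fV X i) (fV X i)" for i
        proof -
          have "inj_on (\<phi> i) (fV X i)"
            by (rule lin_on_inj[OF fhom_lin[OF \<phi>] frep_sub[OF X]]) (use fun_cong[OF 2, of i] in blast)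
          moreover have "\<phi> i ` fV X i \<subseteq> fV X i" by (rule fsub_le[OF I])
          ultimately show ?thesis
            using endo_inj_surj[OF frep_fin[OF X]] by (simp add: bij_betw_def)
        qed
        then show ?thesis by blast
      qed
    qed
    have brickY: "fbrick Q Y"
      unfolding fbrick_def
    proof (intro allI impI)
      fix \<phi> assume \<phi>: "fhom Q Y Y \<phi>"
      let ?K = "\<lambda>i. {x \<in> fV Y i. \<phi> i x = 0}" and ?I = "\<lambda>i. \<phi> i ` fV Y i"
      have e: "fepi Q Y (restr Y ?I) ?K \<phi>" by (rule fepi_onto_image[OF \<phi>])
      have I: "fsub Q Y ?I" by (rule fsub_image[OF Y \<phi> fsub_full[OF Y]])
      \<comment> \<open>Here the image is used as a quotient of \<open>Y\<close>: it is torsion and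
        a subrepresentation, so by \<open>noY\<close> it is zero or all of \<open>Y\<close>.\<close>
      consider "?I = fV Y" | "?I = (\<lambda>i. {0})"
        using noY[OF _ _ I] tors_quotient[OF Y e YT] by blast
      then show "(\<forall>i. \<forall>x\<in>fV Y i. \<phi> i x = 0) \<or> (\<forall>i. bij_betw (\<phi> i) (fV Y i) (fV Y i))"
      proof cases
        case 1
        have "bij_betw (\<phi> i) (fV Y i) (fV Y i)" for i
        proof -
          have im: "\<phi> i ` fV Y i = fV Y i" by (rule fun_cong[OF 1])
          then have "inj_on (\<phi> i) (fV Y i)" by (intro eq_card_imp_inj_on[OF frep_fin[OF Y]]) simp
          then show ?thesis using im by (simp add: bij_betw_def)
        qed
        then show ?thesis by blast
      next
        case 2
        have "\<phi> i x = 0" if "x \<in> fV Y i" for i x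
          using imageI[OF that, of "\<phi> i"] fun_cong[OF 2, of i] by simp
        then show ?thesis by blast
      qed
    qed
    have thX: "th (fV X) < t" by (rule tfreeD[OF XF fsub_full[OF X] X0])
    have thY: "t \<le> th (fV Y)" using torsD[OF YT fsub_zero[OF Y]] Y0 by (simp add: eq_commute)
    have hom: "\<phi> i x = 0" if \<phi>: "fhom Q X Y \<phi>" and x: "x \<in> fV X i" for \<phi> i x
    proof (rule ccontr)
      assume nz: "\<phi> i x \<noteq> 0"
      let ?K = "\<lambda>i. {x \<in> fV X i. \<phi> i x = 0}" and ?I = "\<lambda>i. \<phi> i ` fV X i"
      have e: "fepi Q X (restr Y ?I) ?K \<phi>" by (rule fepi_onto_image[OF \<phi>])
      have I: "fsub Q Y ?I" by (rule fsub_image[OF X \<phi> fsub_full[OF X]])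
      have Ir: "is_frep Q (restr Y ?I)" by (rule fsub_frep[OF Y I])
      have K: "fsub Q X ?K" by (rule fepi_sub[OF X Ir e])
      have "?K \<noteq> fV X"
      proof
        assume "?K = fV X"
        then have "x \<in> ?K i" using x by (simp only: fun_cong[of ?K "fV X" i])
        then show False using nz by simp
      qed
      \<comment> \<open>Write \<open>I\<close> and \<open>K\<close> for image and kernel. From
        \<open>Ext^1(X, Y) /= 0\<close> and \<open>Ext^1(K, Y) = 0\<close> follows
        \<open>Ext^1(I, Y) /= 0\<close>, and as \<open>I\<close> is contained in \<open>Y\<close>
        also \<open>Ext^1(Y, Y) /= 0\<close>.\<close>
      then have "ext_vanish Q (restr X ?K) Y" by (rule subX[OF K])
      then have "\<not> ext_vanish Q (restr Y ?I) Y"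
        using ext_vanish_extension_left[OF X Y Ir e] nonext by blast
      then have YY: "\<not> ext_vanish Q Y Y" using ext_vanish_sub[OF Y I] by blast
      have "?I \<noteq> (\<lambda>i. {0})"
      proof
        assume z: "?I = (\<lambda>i. {0})"
        show False using imageI[OF x, of "\<phi> i"] nz fun_cong[OF z, of i] by simp
      qed
      moreover obtain N \<pi> where N: "is_frep Q N" "fepi Q Y N ?I \<pi>" using quotient_exists[OF Y I] by blast
      \<comment> \<open>On the other side \<open>Ext^1(X, Y/I) = 0\<close> forces
        \<open>Ext^1(X, I) /= 0\<close>, and as \<open>I\<close> is a quotient of \<open>X\<close>
        also \<open>Ext^1(X, X) /= 0\<close>.\<close>
      ultimately have "ext_vanish Q X N" by (intro quotY[OF N])
      then have "\<not> ext_vanish Q X (restr Y ?I)"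
        using ext_vanish_extension_right[OF X Y N] nonext by blast
      then have XX: "\<not> ext_vanish Q X X" using ext_vanish_quot[OF X e _ X] by blast
      have "euler_form Q (fdim (fV X)) (fdim (fV X)) = 0" "euler_form Q (fdim (fV Y)) (fdim (fV Y)) = 0"
        using brick_euler_form_nonpos[OF X brickX XX] brick_euler_form_nonpos[OF Y brickY YY] psd
        by (simp_all add: antisym)
      then obtain m n where mn: "fdim (fV X) = (\<lambda>i. m * d i)" "fdim (fV Y) = (\<lambda>i. n * d i)"
        using isotropic by meson
      have "th (fV X) = 0" "th (fV Y) = 0" unfolding th_def mn by (simp_all add: euler_form_scale_right)
      then show False using thX thY by simp
    qed
    have q: "euler_form Q (fdim (fV Z)) (fdim (fV Z)) \<le> 1"
      if "is_frep Q Z" "fbrick Q Z" "fV Z \<noteq> (\<lambda>i. {0})" for Z :: "('i, 'e, 'k) frep"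
      using brick_euler_form_one[OF that(1,2) _ that(3)] brick_euler_form_nonpos[OF that(1,2)] by fastforce
    have dim0: "fdim (fV Z) \<noteq> (\<lambda>i. 0)"
      if "is_frep Q Z" "fV Z \<noteq> (\<lambda>i. {0})" for Z :: "('i, 'e, 'k) frep"
    proof
      assume z: "fdim (fV Z) = (\<lambda>i. 0)"
      have "fv.dim (fV Z i) = 0" for i using fun_cong[OF z, of i] by (simp add: fdim_def)
      then show False using rsize_pos[OF that(1) fsub_full[OF that(1)] that(2)] by (simp add: rsize_def)
    qed
    have "euler_form Q (fdim (fV X)) (fdim (fV Y)) \<ge> 0"
      by (rule euler_form_nonneg[OF q[OF X brickX X0] _ dim0[OF X X0] q[OF Y brickY Y0] _ dim0[OF Y Y0] t
            thX[unfolded th_def] thY[unfolded th_def]]) (simp_all add: fdim_def)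
    moreover have "euler_form Q (fdim (fV X)) (fdim (fV Y)) < 0"
      by (rule euler_form_neg[OF X Y nonext]) (rule hom)
    ultimately show False by simp
  qed
qed

text \<open>The torsion part maximises the defect; ties are broken by the smallest size for \<open>t = 1\<close> and
  by the largest size for \<open>t = 0\<close>.\<close>

lemma torsion_decomposition:
  fixes M :: "('i, 'e, 'k::{field,finite}) frep"
  assumes M: "is_frep Q M" and t: "t = 0 \<or> t = 1"
  obtains W N \<pi> where "fsub Q M W" "tors t (restr M W)" "is_frep Q N" "fepi Q M N W \<pi>" "tfree t N"
proof -
  \<comment> \<open>\<open>L\<close> exceeds the size of every subrepresentation, so
    \<open>s\<close> orders lexicographically by defect and then by size. The factor
    \<open>1 - 2 * t\<close> is 1 for \<open>t = 0\<close> and -1 for \<open>t = 1\<close>, which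
    selects the tie-break.\<close>
  define L where "L = int (rsize (fV M)) + 1"
  define s where "s W = L * th W + (1 - 2 * t) * int (rsize W)" for W :: "'i \<Rightarrow> (nat \<Rightarrow> 'k) set"
  let ?S = "{W. fsub Q M W}"
  have "?S \<subseteq> (\<Pi>\<^sub>E i\<in>UNIV. Pow (fV M i))"
    using fsub_le by (fastforce simp: PiE_UNIV_domain)
  then have fin: "finite ?S"
    by (rule finite_subset) (intro finite_PiE, simp_all add: frep_fin[OF M])
  have ne: "?S \<noteq> {}" using fsub_full[OF M] by blast
  have "\<exists>W\<in>?S. \<forall>U\<in>?S. s U \<le> s W"
  proof -
    have "Max (s ` ?S) \<in> s ` ?S" using fin ne by (intro Max_in) simp_all
    then obtain W where "W \<in> ?S" "Max (s ` ?S) = s W" by blast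
    moreover have "s U \<le> Max (s ` ?S)" if "U \<in> ?S" for U using fin that by (intro Max_ge) simp_all
    ultimately show ?thesis by auto
  qed
  then obtain W where W: "fsub Q M W" and max: "\<And>U. fsub Q M U \<Longrightarrow> s U \<le> s W" by blast
  have sle: "int (rsize U) < L" if "fsub Q M U" for U using rsize_sub_le[OF M that] by (simp add: L_def)
  have L: "L > 0" by (simp add: L_def)
  \<comment> \<open>\<open>cmp\<close> and \<open>cmp'\<close> undo the lexicographic coding: a size
    difference \<open>y\<close> strictly between 0 and \<open>L\<close> decides whether the
    comparison of the defects is strict.\<close>
  have cmp: "t \<le> x" if "0 \<le> L * x + (1 - 2 * t) * y" "0 < y" "y < L" for x y
  proof -
    consider "t = 0" | "t = 1" using t by blast
    then show ?thesis
    proof cases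
      case 1
      then have "L * (- 1) < L * x" using that by simp
      then show ?thesis using L 1 by (simp only: mult_less_cancel_left_pos)
    next
      case 2
      then have "L * 0 < L * x" using that by simp
      then show ?thesis using L 2 by (simp only: mult_less_cancel_left_pos)
    qed
  qed
  have cmp': "x < t" if "L * x + (1 - 2 * t) * y \<le> 0" "0 < y" "y < L" for x y
  proof -
    consider "t = 0" | "t = 1" using t by blast
    then show ?thesis
    proof cases
      case 1
      then have "L * x < L * 0" using that by simp
      then show ?thesis using L 1 by (simp only: mult_less_cancel_left_pos)
    next
      case 2
      then have "L * x \<le> y" using that by simp
      then have "L * x < L * 1" using that by linarith
      then show ?thesis using L 2 by (simp only: mult_less_cancel_left_pos)
    qed
  qed
  have Wr: "is_frep Q (restr M W)" by (rule fsub_frep[OF M W])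
  have WT: "tors t (restr M W)"
    unfolding tors_def restr_simps
  proof (intro allI impI, elim conjE)
    fix U assume U: "fsub Q (restr M W) U" and ne: "U \<noteq> W"
    have UM: "fsub Q M U" by (rule fsub_trans[OF W U])
    have lt: "rsize U < rsize W" using rsize_sub[OF Wr U] ne by simp
    show "t \<le> th W - th U"
      by (rule cmp[of _ "int (rsize W) - int (rsize U)"])
        (use max[OF UM] lt sle[OF W] in \<open>simp_all add: s_def algebra_simps\<close>)
  qed
  obtain N \<pi> where N: "is_frep Q N" "fepi Q M N W \<pi>" using quotient_exists[OF M W] by blast
  have "tfree t N"
    unfolding tfree_def
  proof (intro allI impI, elim conjE)
    fix U assume U: "fsub Q N U" and ne: "U \<noteq> (\<lambda>i. {0})"
    let ?U = "\<lambda>i. {x \<in> fV M i. \<pi> i x \<in> U i}"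
    have UM: "fsub Q M ?U" by (rule fsub_vimage[OF M fepi_hom[OF N(2)] U])
    have e: "fepi Q (restr M ?U) (restr N U) W \<pi>" by (rule fepi_vimage[OF M N(2) U])
    have thU: "th ?U = th W + th U" and rU: "rsize ?U = rsize W + rsize U"
      using th_fepi[OF fsub_frep[OF M UM] e] rsize_fepi[OF fsub_frep[OF M UM] e] by simp_all
    have "0 < rsize U" by (rule rsize_pos[OF N(1) U ne])
    then show "th U < t"
      by (intro cmp'[of _ "int (rsize U)"])
        (use max[OF UM] sle[OF UM] thU rU in \<open>simp_all add: s_def algebra_simps\<close>)
  qed
  then show ?thesis by (rule that[OF W WT N])
qed

end

section \<open>Quotients, isomorphisms and associativity of Hall numbers\<close>

text \<open>Isomorphism of \<open>N\<close> with \<open>M/W\<close>, without singling out a model of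
  the quotient.\<close>

definition fquot :: "('i, 'e) quiver \<Rightarrow> ('i, 'e, 'k::field) frep \<Rightarrow> ('i \<Rightarrow> (nat \<Rightarrow> 'k) set) \<Rightarrow> ('i, 'e, 'k) frep \<Rightarrow> bool" where
  "fquot Q M W N \<longleftrightarrow> (\<exists>\<pi>. fepi Q M N W \<pi>)"

definition fiso :: "('i, 'e) quiver \<Rightarrow> ('i, 'e, 'k::field) frep \<Rightarrow> ('i, 'e, 'k) frep \<Rightarrow> bool" where
  "fiso Q M N \<longleftrightarrow> fquot Q M (\<lambda>i. {0}) N"

lemma fepi_comp:
  assumes \<pi>: "fepi Q M N W \<pi>" and \<rho>: "fepi Q N L U \<rho>"
  shows "fepi Q M L (\<lambda>i. {x \<in> fV M i. \<pi> i x \<in> U i}) (\<lambda>i x. \<rho> i (\<pi> i x))"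
  unfolding fepi_def
proof (intro conjI allI)
  show "fhom Q M L (\<lambda>i x. \<rho> i (\<pi> i x))" by (rule fhom_comp[OF fepi_hom[OF \<pi>] fepi_hom[OF \<rho>]])
  fix i
  have "(\<lambda>x. \<rho> i (\<pi> i x)) ` fV M i = \<rho> i ` (\<pi> i ` fV M i)" by (simp only: image_image)
  then show "(\<lambda>x. \<rho> i (\<pi> i x)) ` fV M i = fV L i" unfolding fepi_image[OF \<pi>] fepi_image[OF \<rho>] .
  show "{x \<in> fV M i. \<pi> i x \<in> U i} = {x \<in> fV M i. \<rho> i (\<pi> i x) = 0}"
    using fhom_in[OF fepi_hom[OF \<pi>], of _ i] unfolding fepi_ker[OF \<rho>] by auto
qed

text \<open>The factorisation is \<open>\<rho>\<close> after a linear section of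
  \<open>\<pi>\<close>. Another lift differs by an element of \<open>W\<close>, on which
  \<open>\<rho>\<close> vanishes, so this commutes with the arrows although the section need
  not.\<close>

lemma fepi_factor:
  assumes M: "is_frep Q M" and N: "is_frep Q N" and \<pi>: "fepi Q M N W \<pi>" and \<rho>: "fepi Q M L U \<rho>"
    and sub: "\<And>i. W i \<subseteq> U i"
  shows "fquot Q N (\<lambda>i. \<pi> i ` U i) L"
proof -
  note \<pi>h = fepi_hom[OF \<pi>] and \<rho>h = fepi_hom[OF \<rho>]
  obtain r where r: "\<And>i. lin_on (fV N i) (r i)" "\<And>i y. y \<in> fV N i \<Longrightarrow> r i y \<in> fV M i"
    "\<And>i y. y \<in> fV N i \<Longrightarrow> \<pi> i (r i y) = y"
    by (rule fepi_section[OF M \<pi>]) blast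
  define \<chi> where "\<chi> i y = \<rho> i (r i y)" for i y
  have \<chi>\<pi>: "\<chi> i (\<pi> i x) = \<rho> i x" if x: "x \<in> fV M i" for i x
  proof -
    have y: "\<pi> i x \<in> fV N i" by (rule fhom_in[OF \<pi>h x])
    have "\<pi> i (r i (\<pi> i x) - x) = 0"
      using lin_on_diff[OF fhom_lin[OF \<pi>h] frep_sub[OF M] r(2)[OF y] x] r(3)[OF y] by simp
    then have "r i (\<pi> i x) - x \<in> W i"
      unfolding fepi_ker[OF \<pi>] using fv.subspace_diff[OF frep_sub[OF M] r(2)[OF y] x] by simp
    then have "r i (\<pi> i x) - x \<in> U i" using sub by blast
    then have "\<rho> i (r i (\<pi> i x) - x) = 0" unfolding fepi_ker[OF \<rho>] by simp
    then show ?thesis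
      unfolding \<chi>_def using lin_on_diff[OF fhom_lin[OF \<rho>h] frep_sub[OF M] r(2)[OF y] x] by simp
  qed
  have N_eq: "\<exists>x\<in>fV M i. y = \<pi> i x" if "y \<in> fV N i" for i y
  proof -
    have "y \<in> \<pi> i ` fV M i" unfolding fepi_image[OF \<pi>] by (rule that)
    then show ?thesis by blast
  qed
  have "fepi Q N L (\<lambda>i. \<pi> i ` U i) \<chi>"
    unfolding fepi_def fhom_def
  proof (intro conjI allI ballI)
    fix i
    show "lin_on (fV N i) (\<chi> i)"
      unfolding \<chi>_def[abs_def] by (rule lin_on_comp[OF r(1) image_subsetI fhom_lin[OF \<rho>h]]) (rule r(2))
    show "\<chi> i y \<in> fV L i" if "y \<in> fV N i" for y
      unfolding \<chi>_def by (rule fhom_in[OF \<rho>h r(2)[OF that]])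
    have "\<chi> i ` fV N i = (\<lambda>x. \<chi> i (\<pi> i x)) ` fV M i"
      unfolding fepi_image[OF \<pi>, symmetric] by (simp only: image_image)
    also have "\<dots> = \<rho> i ` fV M i" by (rule image_cong[OF refl \<chi>\<pi>])
    finally show "\<chi> i ` fV N i = fV L i" unfolding fepi_image[OF \<rho>] .
    show "\<pi> i ` U i = {y \<in> fV N i. \<chi> i y = 0}"
    proof (intro equalityI subsetI)
      fix y assume "y \<in> \<pi> i ` U i"
      then obtain x where x: "x \<in> U i" "y = \<pi> i x" by blast
      then have "x \<in> fV M i" "\<rho> i x = 0" unfolding fepi_ker[OF \<rho>] by simp_all
      then show "y \<in> {y \<in> fV N i. \<chi> i y = 0}" using x(2) \<chi>\<pi> fhom_in[OF \<pi>h] by simp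
    next
      fix y assume y: "y \<in> {y \<in> fV N i. \<chi> i y = 0}"
      then obtain x where x: "x \<in> fV M i" "y = \<pi> i x" using N_eq by blast
      then have "\<rho> i x = 0" using y \<chi>\<pi>[OF x(1)] by simp
      then have "x \<in> U i" unfolding fepi_ker[OF \<rho>] using x(1) by simp
      then show "y \<in> \<pi> i ` U i" using x(2) by blast
    qed
  next
    fix a y assume "y \<in> fV N (src Q a)"
    then obtain x where x: "x \<in> fV M (src Q a)" "y = \<pi> (src Q a) x" using N_eq by blast
    show "\<chi> (tgt Q a) (fA N a y) = fA L a (\<chi> (src Q a) y)"
      unfolding x(2) \<chi>\<pi>[OF x(1)] fhom_comm[OF \<pi>h x(1), symmetric] \<chi>\<pi>[OF frep_act[OF M x(1)]]
      by (rule fhom_comm[OF \<rho>h x(1)])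
  qed
  then show ?thesis unfolding fquot_def by blast
qed

lemma fepi_image_ker:
  assumes "fepi Q M N W \<pi>" "is_frep Q M"
  shows "(\<lambda>i. \<pi> i ` W i) = (\<lambda>i. {0})"
proof
  fix i
  have "0 \<in> W i" unfolding fepi_ker[OF assms(1)]
    using fv.subspace_0[OF frep_sub[OF assms(2)]] lin_on_zero[OF fhom_lin[OF fepi_hom[OF assms(1)]] frep_sub[OF assms(2)]]
    by simp
  moreover have "\<pi> i x = 0" if "x \<in> W i" for x using that unfolding fepi_ker[OF assms(1)] by simp
  ultimately show "\<pi> i ` W i = {0}" by (force simp: image_iff)
qed

lemma fquot_unique:
  assumes "is_frep Q M" "is_frep Q N" "fquot Q M W N" "fquot Q M W L"
  shows "fiso Q N L"
proof -
  obtain \<pi> \<rho> where \<pi>: "fepi Q M N W \<pi>" and \<rho>: "fepi Q M L W \<rho>" using assms(3,4) unfolding fquot_def by blast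
  from fepi_factor[OF assms(1,2) \<pi> \<rho> subset_refl]
  show ?thesis unfolding fiso_def fepi_image_ker[OF \<pi> assms(1)] .
qed

lemma fquot_zero: "is_frep Q M \<Longrightarrow> fquot Q M (\<lambda>i. {0}) M"
  unfolding fquot_def fepi_def using fhom_id[of Q M]
  by (intro exI[of _ "\<lambda>i x. x"]) (auto simp: fv.subspace_0[OF frep_sub])

lemma fiso_sym: "is_frep Q M \<Longrightarrow> is_frep Q N \<Longrightarrow> fiso Q M N \<Longrightarrow> fiso Q N M"
  using fquot_unique[of Q M N "\<lambda>i. {0}" M] fquot_zero unfolding fiso_def by blast

lemma fquot_iso:
  assumes M: "is_frep Q M" and N: "is_frep Q N" and q: "fquot Q M W N" and iso: "fiso Q N L"
  shows "fquot Q M W L"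
proof -
  obtain \<pi> \<rho> where \<pi>: "fepi Q M N W \<pi>" and \<rho>: "fepi Q N L (\<lambda>i. {0}) \<rho>"
    using q iso unfolding fquot_def fiso_def by blast
  have "(\<lambda>i. {x \<in> fV M i. \<pi> i x \<in> {0}}) = W" by (rule ext) (simp add: fepi_ker[OF \<pi>])
  then show ?thesis using fepi_comp[OF \<pi> \<rho>] unfolding fquot_def by auto
qed

lemma fiso_trans: "is_frep Q M \<Longrightarrow> is_frep Q N \<Longrightarrow> fiso Q M N \<Longrightarrow> fiso Q N L \<Longrightarrow> fiso Q M L"
  unfolding fiso_def[of Q M] by (rule fquot_iso)

section \<open>Hall numbers and their associativity\<close>

definition fhall :: "('i, 'e) quiver \<Rightarrow> ('i, 'e, 'k::field) frep \<Rightarrow> ('i, 'e, 'k) frep \<Rightarrow> ('i, 'e, 'k) frep \<Rightarrow> nat" where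
  "fhall Q M A B = card {X. fsub Q M X \<and> fiso Q (restr M X) B \<and> fquot Q M X A}"

lemma finite_fsub:
  fixes M :: "('i::finite, 'e, 'k::field) frep"
  assumes M: "is_frep Q M"
  shows "finite {X. fsub Q M X}"
proof (rule finite_subset)
  show "{X. fsub Q M X} \<subseteq> (\<Pi>\<^sub>E i\<in>UNIV. Pow (fV M i))" using fsub_le by (fastforce simp: PiE_UNIV_domain)
  show "finite (\<Pi>\<^sub>E i\<in>UNIV. Pow (fV M i))" by (intro finite_PiE) (simp_all add: frep_fin[OF M])
qed

text \<open>The correspondence between the subrepresentations of \<open>M\<close> above
  \<open>W\<close> and those of \<open>M/W\<close>, together with
  \<open>M/X = (M/W)/(X/W)\<close>.\<close>

lemma fhall_quotient:
  assumes M: "is_frep Q M" and N: "is_frep Q N" and \<pi>: "fepi Q M N W \<pi>"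
  shows "card {X. fsub Q M X \<and> fsub Q (restr M X) W \<and> fquot Q (restr M X) W B \<and> fquot Q M X A} = fhall Q N A B"
  unfolding fhall_def
proof (rule bij_betw_same_card[OF bij_betw_byWitness[where f = "\<lambda>X i. \<pi> i ` X i" and f' = "\<lambda>Z i. {x \<in> fV M i. \<pi> i x \<in> Z i}"]])
  note \<pi>h = fepi_hom[OF \<pi>]
  let ?L = "{X. fsub Q M X \<and> fsub Q (restr M X) W \<and> fquot Q (restr M X) W B \<and> fquot Q M X A}"
  let ?R = "{Z. fsub Q N Z \<and> fiso Q (restr N Z) B \<and> fquot Q N Z A}"
  have W: "fsub Q M W" by (rule fepi_sub[OF M N \<pi>])
  show "\<forall>X\<in>?L. (\<lambda>i. {x \<in> fV M i. \<pi> i x \<in> \<pi> i ` X i}) = X"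
  proof (intro ballI ext equalityI subsetI)
    fix X i x assume "X \<in> ?L" and x: "x \<in> {x \<in> fV M i. \<pi> i x \<in> \<pi> i ` X i}"
    then have X: "fsub Q M X" and WX: "fsub Q (restr M X) W" by simp_all
    obtain y where y: "y \<in> X i" "\<pi> i x = \<pi> i y" using x by auto
    have xy: "x \<in> fV M i" "y \<in> fV M i" using x fsub_in[OF X y(1)] by simp_all
    have "\<pi> i (x - y) = 0" using lin_on_diff[OF fhom_lin[OF \<pi>h] frep_sub[OF M] xy] y(2) by simp
    then have "x - y \<in> W i" unfolding fepi_ker[OF \<pi>] using fv.subspace_diff[OF frep_sub[OF M] xy] by simp
    then have "x - y \<in> X i" using fsub_in[OF WX] by simp
    from fv.subspace_add[OF fsub_subspace[OF X] this y(1)] show "x \<in> X i" by simp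
  next
    fix X i x assume "X \<in> ?L" and x: "x \<in> X i"
    then have X: "fsub Q M X" by simp
    show "x \<in> {x \<in> fV M i. \<pi> i x \<in> \<pi> i ` X i}" using fsub_in[OF X x] x by simp
  qed
  show "\<forall>Z\<in>?R. (\<lambda>i. \<pi> i ` {x \<in> fV M i. \<pi> i x \<in> Z i}) = Z"
  proof (intro ballI ext)
    fix Z i assume "Z \<in> ?R"
    then have Z: "fsub Q N Z" by simp
    show "\<pi> i ` {x \<in> fV M i. \<pi> i x \<in> Z i} = Z i" using fepi_image[OF fepi_vimage[OF M \<pi> Z], of i] by simp
  qed
  show "(\<lambda>X i. \<pi> i ` X i) ` ?L \<subseteq> ?R"
  proof (rule image_subsetI)
    fix X assume "X \<in> ?L"
    then have X: "fsub Q M X" and WX: "fsub Q (restr M X) W" and B: "fquot Q (restr M X) W B" and A: "fquot Q M X A"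
      by simp_all
    have Xr: "is_frep Q (restr M X)" by (rule fsub_frep[OF M X])
    have Z: "fsub Q N (\<lambda>i. \<pi> i ` X i)" by (rule fsub_image[OF M \<pi>h X])
    have WX': "W i \<subseteq> X i" for i using fsub_le[OF WX, of i] by simp
    have ker: "(\<lambda>i. {x \<in> X i. \<pi> i x = 0}) = W"
    proof (intro ext equalityI subsetI)
      fix i x assume "x \<in> {x \<in> X i. \<pi> i x = 0}"
      then show "x \<in> W i" unfolding fepi_ker[OF \<pi>] using fsub_in[OF X, of x i] by simp
    next
      fix i x assume x: "x \<in> W i"
      then have "\<pi> i x = 0" unfolding fepi_ker[OF \<pi>] by simp
      then show "x \<in> {x \<in> X i. \<pi> i x = 0}" using x WX' by blast
    qed
    have "fquot Q (restr M X) W (restr N (\<lambda>i. \<pi> i ` X i))"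
      using fepi_onto_image[OF fhom_restrict[OF \<pi>h X]] unfolding fquot_def restr_simps ker by blast
    then have "fiso Q (restr N (\<lambda>i. \<pi> i ` X i)) B" by (rule fquot_unique[OF Xr fsub_frep[OF N Z] _ B])
    moreover have "fquot Q N (\<lambda>i. \<pi> i ` X i) A"
    proof -
      obtain \<rho> where "fepi Q M A X \<rho>" using A unfolding fquot_def ..
      from fepi_factor[OF M N \<pi> this WX'] show ?thesis .
    qed
    ultimately show "(\<lambda>i. \<pi> i ` X i) \<in> ?R" using Z by simp
  qed
  show "(\<lambda>Z i. {x \<in> fV M i. \<pi> i x \<in> Z i}) ` ?R \<subseteq> ?L"
  proof (rule image_subsetI)
    fix Z assume "Z \<in> ?R"
    then have Z: "fsub Q N Z" and B: "fiso Q (restr N Z) B" and A: "fquot Q N Z A" by simp_all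
    let ?X = "\<lambda>i. {x \<in> fV M i. \<pi> i x \<in> Z i}"
    have X: "fsub Q M ?X" by (rule fsub_vimage[OF M \<pi>h Z])
    have e: "fepi Q (restr M ?X) (restr N Z) W \<pi>" by (rule fepi_vimage[OF M \<pi> Z])
    have "fsub Q (restr M ?X) W" by (rule fepi_sub[OF fsub_frep[OF M X] fsub_frep[OF N Z] e])
    moreover have "fquot Q (restr M ?X) W B"
      by (rule fquot_iso[OF fsub_frep[OF M X] fsub_frep[OF N Z] _ B]) (use e in \<open>unfold fquot_def, blast\<close>)
    moreover have "fquot Q M ?X A"
    proof -
      obtain \<rho> where "fepi Q N A Z \<rho>" using A unfolding fquot_def ..
      from fepi_comp[OF \<pi> this] show ?thesis unfolding fquot_def by blast
    qed
    ultimately show "?X \<in> ?L" using X by simp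
  qed
qed

lemma fhall_cong:
  assumes M: "is_frep Q M" and N: "is_frep Q N" and iso: "fiso Q M N"
  shows "fhall Q M A B = fhall Q N A B"
proof -
  obtain \<pi> where \<pi>: "fepi Q M N (\<lambda>i. {0}) \<pi>" using iso unfolding fiso_def fquot_def ..
  have "{X. fsub Q M X \<and> fiso Q (restr M X) B \<and> fquot Q M X A} =
    {X. fsub Q M X \<and> fsub Q (restr M X) (\<lambda>i. {0}) \<and> fquot Q (restr M X) (\<lambda>i. {0}) B \<and> fquot Q M X A}"
    unfolding fiso_def using fsub_zero[OF fsub_frep[OF M]] by blast
  then show ?thesis using fhall_quotient[OF M N \<pi>] unfolding fhall_def by simp
qed

text \<open>Groups a sum by isomorphism type. The type is given by a relation to labels, of which
  exactly one fits each summand, so no classifying function has to be supplied.\<close>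

lemma sum_by_class:
  fixes g :: "'s \<Rightarrow> nat"
  assumes S: "finite S" and \<K>: "finite \<K>" and ex: "\<And>s. s \<in> S \<Longrightarrow> \<exists>c\<in>\<K>. R s c"
    and uniq: "\<And>s c c'. s \<in> S \<Longrightarrow> c \<in> \<K> \<Longrightarrow> c' \<in> \<K> \<Longrightarrow> R s c \<Longrightarrow> R s c' \<Longrightarrow> c = c'"
    and g: "\<And>s c. s \<in> S \<Longrightarrow> c \<in> \<K> \<Longrightarrow> R s c \<Longrightarrow> g s = h c"
  shows "(\<Sum>s\<in>S. g s) = (\<Sum>c\<in>\<K>. card {s \<in> S. R s c} * h c)"
proof -
  define k where "k s = (SOME c. c \<in> \<K> \<and> R s c)" for s
  have k: "k s \<in> \<K>" "R s (k s)" if "s \<in> S" for s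
  proof -
    have "\<exists>c. c \<in> \<K> \<and> R s c" using ex[OF that] by blast
    then have "k s \<in> \<K> \<and> R s (k s)" unfolding k_def by (rule someI_ex)
    then show "k s \<in> \<K>" "R s (k s)" by simp_all
  qed
  have "(\<Sum>s\<in>S. g s) = (\<Sum>c\<in>\<K>. \<Sum>s\<in>{s \<in> S. k s = c}. g s)"
    by (rule sum.group[symmetric, OF S \<K>]) (use k in blast)
  also have "\<dots> = (\<Sum>c\<in>\<K>. card {s \<in> S. R s c} * h c)"
  proof (rule sum.cong[OF refl])
    fix c assume c: "c \<in> \<K>"
    have "{s \<in> S. k s = c} = {s \<in> S. R s c}" using k uniq c by blast
    moreover have "(\<Sum>s\<in>{s \<in> S. R s c}. g s) = (\<Sum>s\<in>{s \<in> S. R s c}. h c)"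
      by (rule sum.cong[OF refl]) (use g c in blast)
    ultimately show "(\<Sum>s\<in>{s \<in> S. k s = c}. g s) = card {s \<in> S. R s c} * h c" by simp
  qed
  finally show ?thesis .
qed

text \<open>Both sides count the chains \<open>X\<^sub>0 \<subseteq> X\<^sub>1 \<subseteq> M\<close> with successive quotients \<open>C\<close>, \<open>B\<close>, \<open>A\<close>.\<close>

theorem fhall_assoc:
  fixes M :: "('i::finite, 'e, 'k::field) frep" and rep :: "'c \<Rightarrow> ('i, 'e, 'k) frep"
  assumes M: "is_frep Q M"
    and K: "finite \<K>" "\<And>c. c \<in> \<K> \<Longrightarrow> is_frep Q (rep c)"
    and inj: "\<And>c c'. c \<in> \<K> \<Longrightarrow> c' \<in> \<K> \<Longrightarrow> fiso Q (rep c) (rep c') \<Longrightarrow> c = c'"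
    and subs: "\<And>X. fsub Q M X \<Longrightarrow> \<exists>c\<in>\<K>. fiso Q (restr M X) (rep c)"
    and quots: "\<And>X. fsub Q M X \<Longrightarrow> \<exists>c\<in>\<K>. fquot Q M X (rep c)"
  shows "(\<Sum>c\<in>\<K>. fhall Q M A (rep c) * fhall Q (rep c) B C) = (\<Sum>c\<in>\<K>. fhall Q M (rep c) C * fhall Q (rep c) A B)"
proof -
  \<comment> \<open>\<open>?S1\<close> and \<open>?S0\<close> collect the possible upper and lower
    terms of a chain; \<open>?D1\<close> and \<open>?D0\<close> below collect the ways to complete
    it.\<close>
  let ?S1 = "{X. fsub Q M X \<and> fquot Q M X A}" and ?S0 = "{X. fsub Q M X \<and> fiso Q (restr M X) C}"
  have fin: "finite ?S1" "finite ?S0" using finite_fsub[OF M] by (auto intro: finite_subset[rotated])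
  let ?D1 = "\<lambda>X1. {X0. fsub Q (restr M X1) X0 \<and> fiso Q (restr (restr M X1) X0) C \<and> fquot Q (restr M X1) X0 B}"
  let ?D0 = "\<lambda>X0. {X1. fsub Q M X1 \<and> fsub Q (restr M X1) X0 \<and> fquot Q (restr M X1) X0 B \<and> fquot Q M X1 A}"
  have fin1: "finite (?D1 X)" if "X \<in> ?S1" for X
    using finite_fsub[OF fsub_frep[OF M, of X]] that by (auto intro: finite_subset[rotated])
  have fin0: "finite (?D0 X)" for X using finite_fsub[OF M] by (auto intro: finite_subset[rotated])
  have "card (SIGMA X1:?S1. ?D1 X1) = card (SIGMA X0:?S0. ?D0 X0)"
  proof (rule bij_betw_same_card[OF bij_betw_byWitness[where f = "\<lambda>(x, y). (y, x)" and f' = "\<lambda>(x, y). (y, x)"]])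
    show "(\<lambda>(x, y). (y, x)) ` (SIGMA X1:?S1. ?D1 X1) \<subseteq> (SIGMA X0:?S0. ?D0 X0)"
      using fsub_trans[of Q M] by auto
    show "(\<lambda>(x, y). (y, x)) ` (SIGMA X0:?S0. ?D0 X0) \<subseteq> (SIGMA X1:?S1. ?D1 X1)" by auto
  qed auto
  then have eq: "(\<Sum>X\<in>?S1. card (?D1 X)) = (\<Sum>X\<in>?S0. card (?D0 X))"
    using fin fin1 fin0 by (simp add: card_SigmaI)
  have "(\<Sum>X\<in>?S1. card (?D1 X)) = (\<Sum>c\<in>\<K>. card {X \<in> ?S1. fiso Q (restr M X) (rep c)} * fhall Q (rep c) B C)"
  proof (rule sum_by_class[OF fin(1) K(1)])
    fix X assume "X \<in> ?S1"
    then have X: "fsub Q M X" by simp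
    note Xr = fsub_frep[OF M X]
    show "\<exists>c\<in>\<K>. fiso Q (restr M X) (rep c)" by (rule subs[OF X])
    fix c assume c: "c \<in> \<K>" and iso: "fiso Q (restr M X) (rep c)"
    show "card (?D1 X) = fhall Q (rep c) B C"
      using fhall_cong[OF Xr K(2)[OF c] iso] unfolding fhall_def .
    fix c' assume c': "c' \<in> \<K>" and iso': "fiso Q (restr M X) (rep c')"
    show "c = c'"
      by (rule inj[OF c c' fiso_trans[OF K(2)[OF c] Xr fiso_sym[OF Xr K(2)[OF c] iso] iso']])
  qed
  moreover have "card {X \<in> ?S1. fiso Q (restr M X) (rep c)} = fhall Q M A (rep c)" for c
    unfolding fhall_def by (rule arg_cong[where f = card]) blast
  moreover have "(\<Sum>X\<in>?S0. card (?D0 X)) = (\<Sum>c\<in>\<K>. card {X \<in> ?S0. fquot Q M X (rep c)} * fhall Q (rep c) A B)"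
  proof (rule sum_by_class[OF fin(2) K(1)])
    fix X assume "X \<in> ?S0"
    then have X: "fsub Q M X" by simp
    show "\<exists>c\<in>\<K>. fquot Q M X (rep c)" by (rule quots[OF X])
    fix c assume c: "c \<in> \<K>" and q: "fquot Q M X (rep c)"
    obtain \<pi> where "fepi Q M (rep c) X \<pi>" using q unfolding fquot_def ..
    then show "card (?D0 X) = fhall Q (rep c) A B" by (rule fhall_quotient[OF M K(2)[OF c]])
    fix c' assume c': "c' \<in> \<K>" and q': "fquot Q M X (rep c')"
    show "c = c'" by (rule inj[OF c c' fquot_unique[OF M K(2)[OF c] q q']])
  qed
  moreover have "card {X \<in> ?S0. fquot Q M X (rep c)} = fhall Q M (rep c) C" for c
    unfolding fhall_def by (rule arg_cong[where f = card]) blast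
  ultimately show ?thesis using eq by simp
qed

section \<open>Direct sum decompositions\<close>

definition fdecomp :: "('i, 'e) quiver \<Rightarrow> ('i, 'e, 'k::field) frep \<Rightarrow> ('i \<Rightarrow> (nat \<Rightarrow> 'k) set) \<Rightarrow> ('i \<Rightarrow> (nat \<Rightarrow> 'k) set) \<Rightarrow> bool" where
  "fdecomp Q M W C \<longleftrightarrow> fsub Q M W \<and> fsub Q M C \<and> (\<forall>i. \<forall>x\<in>W i. x \<in> C i \<longrightarrow> x = 0) \<and>
     (\<forall>i. \<forall>x\<in>fV M i. \<exists>w\<in>W i. \<exists>c\<in>C i. x = w + c)"

lemma diff_diff_cancel_left: "(x - c) - (x - y) = y - c" for x y c :: "'a::ab_group_add"
  by simp

lemma fdecomp_sub1: "fdecomp Q M W C \<Longrightarrow> fsub Q M W"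
  and fdecomp_sub2: "fdecomp Q M W C \<Longrightarrow> fsub Q M C"
  and fdecomp_inter: "fdecomp Q M W C \<Longrightarrow> x \<in> W i \<Longrightarrow> x \<in> C i \<Longrightarrow> x = 0"
  and fdecomp_ex: "fdecomp Q M W C \<Longrightarrow> x \<in> fV M i \<Longrightarrow> \<exists>w\<in>W i. \<exists>c\<in>C i. x = w + c"
  unfolding fdecomp_def by blast+

lemma fdecomp_commute: "fdecomp Q M W C \<Longrightarrow> fdecomp Q M C W"
  unfolding fdecomp_def by (metis add.commute)

lemma fdecomp_zero: "is_frep Q M \<Longrightarrow> fdecomp Q M (fV M) (\<lambda>i. {0})"
  unfolding fdecomp_def using fsub_full[of Q M] fsub_zero[of Q M] by force

text \<open>The projection onto \<open>C\<close> along \<open>W\<close> exhibits \<open>C\<close> as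
  the quotient by \<open>W\<close>. It respects addition, scalars and arrows because the component
  in \<open>C\<close> is unique.\<close>

lemma fdecomp_fepi:
  assumes M: "is_frep Q M" and D: "fdecomp Q M W C"
  obtains q where "fepi Q M (restr M C) W q" "\<And>i c. c \<in> C i \<Longrightarrow> q i c = c" "\<And>i x. x \<in> fV M i \<Longrightarrow> x - q i x \<in> W i"
proof -
  note W = fdecomp_sub1[OF D] and C = fdecomp_sub2[OF D]
  define q where "q i x = (SOME c. c \<in> C i \<and> x - c \<in> W i)" for i x
  have q: "q i x \<in> C i" "x - q i x \<in> W i" if x: "x \<in> fV M i" for i x
  proof -
    obtain w c where "w \<in> W i" "c \<in> C i" "x = w + c" using fdecomp_ex[OF D x] by blast
    then have "c \<in> C i \<and> x - c \<in> W i" by simp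
    then have "q i x \<in> C i \<and> x - q i x \<in> W i"
      unfolding q_def by (rule someI[of "\<lambda>c. c \<in> C i \<and> x - c \<in> W i"])
    then show "q i x \<in> C i" "x - q i x \<in> W i" by simp_all
  qed
  have uniq: "q i x = c" if x: "x \<in> fV M i" and c: "c \<in> C i" "x - c \<in> W i" for i x c
  proof -
    have "(x - c) - (x - q i x) \<in> W i" by (rule fv.subspace_diff[OF fsub_subspace[OF W] c(2) q(2)[OF x]])
    then have "q i x - c \<in> W i" unfolding diff_diff_cancel_left .
    moreover have "q i x - c \<in> C i" by (rule fv.subspace_diff[OF fsub_subspace[OF C] q(1)[OF x] c(1)])
    ultimately have "q i x - c = 0" by (rule fdecomp_inter[OF D])
    then show ?thesis by (simp only: right_minus_eq)
  qed
  have Wz: "0 \<in> W i" for i by (rule fv.subspace_0[OF fsub_subspace[OF W]])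
  have Cz: "0 \<in> C i" for i by (rule fv.subspace_0[OF fsub_subspace[OF C]])
  have qc: "q i c = c" if "c \<in> C i" for i c
    by (rule uniq[OF fsub_in[OF C that] that]) (simp add: Wz)
  have "fepi Q M (restr M C) W q"
    unfolding fepi_def fhom_def restr_simps
  proof (intro conjI allI ballI)
    fix i
    show "lin_on (fV M i) (q i)"
    proof (rule lin_onI)
      fix x y assume xy: "x \<in> fV M i" "y \<in> fV M i"
      have "(x - q i x) + (y - q i y) \<in> W i" by (rule fv.subspace_add[OF fsub_subspace[OF W] q(2)[OF xy(1)] q(2)[OF xy(2)]])
      moreover have "(x - q i x) + (y - q i y) = (x + y) - (q i x + q i y)" by (simp add: algebra_simps)
      ultimately have "(x + y) - (q i x + q i y) \<in> W i" by simp
      then show "q i (x + y) = q i x + q i y"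
        by (rule uniq[OF fv.subspace_add[OF frep_sub[OF M] xy] fv.subspace_add[OF fsub_subspace[OF C] q(1)[OF xy(1)] q(1)[OF xy(2)]]])
    next
      fix k x assume x: "x \<in> fV M i"
      have "fscale k (x - q i x) \<in> W i" by (rule fv.subspace_scale[OF fsub_subspace[OF W] q(2)[OF x]])
      then have "fscale k x - fscale k (q i x) \<in> W i" by (simp only: fv.scale_right_diff_distrib)
      then show "q i (fscale k x) = fscale k (q i x)"
        by (rule uniq[OF fv.subspace_scale[OF frep_sub[OF M] x] fv.subspace_scale[OF fsub_subspace[OF C] q(1)[OF x]]])
    qed
    show "q i x \<in> C i" if "x \<in> fV M i" for x by (rule q(1)[OF that])
    show "q i ` fV M i = C i"
    proof (intro equalityI subsetI)
      fix c assume c: "c \<in> C i"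
      show "c \<in> q i ` fV M i" using qc[OF c] fsub_in[OF C c] by (intro image_eqI[of c "q i" c]) simp_all
    qed (use q(1) in blast)
    show "W i = {x \<in> fV M i. q i x = 0}"
    proof (intro equalityI subsetI)
      fix x assume x: "x \<in> W i"
      have "q i x = 0" by (rule uniq[OF fsub_in[OF W x] Cz]) (simp add: x)
      then show "x \<in> {x \<in> fV M i. q i x = 0}" using fsub_in[OF W x] by simp
    next
      fix x assume "x \<in> {x \<in> fV M i. q i x = 0}"
      then show "x \<in> W i" using q(2)[of x i] by simp
    qed
  next
    fix a x assume x: "x \<in> fV M (src Q a)"
    have xM: "q (src Q a) x \<in> fV M (src Q a)" by (rule fsub_in[OF C q(1)[OF x]])
    have "fA M a (x - q (src Q a) x) \<in> W (tgt Q a)" by (rule fsub_act[OF W q(2)[OF x]])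
    then have "fA M a x - fA M a (q (src Q a) x) \<in> W (tgt Q a)"
      using lin_on_diff[OF frep_lin[OF M] frep_sub[OF M] x xM] by simp
    then show "q (tgt Q a) (fA M a x) = fA M a (q (src Q a) x)"
      by (rule uniq[OF frep_act[OF M x] fsub_act[OF C q(1)[OF x]]])
  qed
  then show ?thesis by (rule that) (rule qc q(2), assumption)+
qed

lemma fdecomp_section:
  assumes M: "is_frep Q M" and N: "is_frep Q N" and \<pi>: "fepi Q M N W \<pi>" and s: "fhom Q N M s"
    and sec: "\<And>i y. y \<in> fV N i \<Longrightarrow> \<pi> i (s i y) = y"
  shows "fdecomp Q M W (\<lambda>i. s i ` fV N i)" and "fiso Q N (restr M (\<lambda>i. s i ` fV N i))"
proof -
  note \<pi>h = fepi_hom[OF \<pi>]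
  have W: "fsub Q M W" by (rule fepi_sub[OF M N \<pi>])
  have C: "fsub Q M (\<lambda>i. s i ` fV N i)" by (rule fsub_image[OF N s fsub_full[OF N]])
  have s0: "s i 0 = 0" for i by (rule lin_on_zero[OF fhom_lin[OF s] frep_sub[OF N]])
  show "fdecomp Q M W (\<lambda>i. s i ` fV N i)"
    unfolding fdecomp_def
  proof (intro conjI allI ballI impI W C)
    fix i x assume x: "x \<in> W i" and "x \<in> s i ` fV N i"
    then obtain y where y: "y \<in> fV N i" "x = s i y" by blast
    have "\<pi> i x = 0" using x unfolding fepi_ker[OF \<pi>] by simp
    then have "y = 0" using sec[OF y(1)] y(2) by simp
    then show "x = 0" using y(2) s0 by simp
  next
    fix i x assume x: "x \<in> fV M i"
    have y: "\<pi> i x \<in> fV N i" by (rule fhom_in[OF \<pi>h x])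
    have "\<pi> i (x - s i (\<pi> i x)) = 0"
      using lin_on_diff[OF fhom_lin[OF \<pi>h] frep_sub[OF M] x fhom_in[OF s y]] sec[OF y] by simp
    then have "x - s i (\<pi> i x) \<in> W i"
      unfolding fepi_ker[OF \<pi>] using fv.subspace_diff[OF frep_sub[OF M] x fhom_in[OF s y]] by simp
    moreover have "x = (x - s i (\<pi> i x)) + s i (\<pi> i x)" by simp
    ultimately show "\<exists>w\<in>W i. \<exists>c\<in>s i ` fV N i. x = w + c" using imageI[OF y, of "s i"] by blast
  qed
  have "(\<lambda>i. {y \<in> fV N i. s i y = 0}) = (\<lambda>i. {0})"
  proof (intro ext equalityI subsetI)
    fix i y assume y: "y \<in> {y \<in> fV N i. s i y = 0}"
    then have "y = \<pi> i 0" using sec[of y i] by simp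
    also have "\<dots> = 0" by (rule lin_on_zero[OF fhom_lin[OF \<pi>h] frep_sub[OF M]])
    finally show "y \<in> {0}" by simp
  qed (simp add: s0 fv.subspace_0[OF frep_sub[OF N]])
  then show "fiso Q N (restr M (\<lambda>i. s i ` fV N i))"
    using fepi_onto_image[OF s] unfolding fiso_def fquot_def by auto
qed

lemma fiso_decomp:
  assumes M: "is_frep Q M" and M': "is_frep Q M'" and D: "fdecomp Q M W C" and D': "fdecomp Q M' W' C'"
    and isoW: "fiso Q (restr M W) (restr M' W')" and isoC: "fiso Q (restr M C) (restr M' C')"
  shows "fiso Q M M'"
proof -
  note W = fdecomp_sub1[OF D] and C = fdecomp_sub2[OF D] and W' = fdecomp_sub1[OF D'] and C' = fdecomp_sub2[OF D']
  obtain q where q: "fepi Q M (restr M C) W q" "\<And>i c. c \<in> C i \<Longrightarrow> q i c = c"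
    by (rule fdecomp_fepi[OF M D]) blast
  obtain p where p: "fepi Q M (restr M W) C p" "\<And>i w. w \<in> W i \<Longrightarrow> p i w = w" "\<And>i x. x \<in> fV M i \<Longrightarrow> x - p i x \<in> C i"
    by (rule fdecomp_fepi[OF M fdecomp_commute[OF D]]) blast
  obtain \<alpha> where \<alpha>: "fepi Q (restr M W) (restr M' W') (\<lambda>i. {0}) \<alpha>" using isoW unfolding fiso_def fquot_def ..
  obtain \<beta> where \<beta>: "fepi Q (restr M C) (restr M' C') (\<lambda>i. {0}) \<beta>" using isoC unfolding fiso_def fquot_def ..
  note ph = fepi_hom[OF p(1)] and qh = fepi_hom[OF q(1)]
  define u where "u i x = \<alpha> i (p i x)" for i x
  define v where "v i x = \<beta> i (q i x)" for i x
  have uh: "fhom Q M (restr M' W') u" unfolding u_def[abs_def] by (rule fhom_comp[OF ph fepi_hom[OF \<alpha>]])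
  have vh: "fhom Q M (restr M' C') v" unfolding v_def[abs_def] by (rule fhom_comp[OF qh fepi_hom[OF \<beta>]])
  have uW: "u i x \<in> W' i" and vC: "v i x \<in> C' i" if "x \<in> fV M i" for i x
    using fhom_in[OF uh that] fhom_in[OF vh that] by simp_all
  have p0: "p i c = 0" if "c \<in> C i" for i c using that unfolding fepi_ker[OF p(1)] by simp
  have q0: "q i w = 0" if "w \<in> W i" for i w using that unfolding fepi_ker[OF q(1)] by simp
  have \<alpha>0: "\<alpha> i 0 = 0" and \<beta>0: "\<beta> i 0 = 0" for i
    using lin_on_zero[OF fhom_lin[OF fepi_hom[OF \<alpha>]] frep_sub[OF fsub_frep[OF M W]], of i]
      lin_on_zero[OF fhom_lin[OF fepi_hom[OF \<beta>]] frep_sub[OF fsub_frep[OF M C]], of i] by simp_all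
  have \<alpha>inj: "w = 0" if "w \<in> W i" "\<alpha> i w = 0" for i w
    using fepi_ker[OF \<alpha>, of i] that by auto
  have \<beta>inj: "c = 0" if "c \<in> C i" "\<beta> i c = 0" for i c
    using fepi_ker[OF \<beta>, of i] that by auto
  define \<phi> where "\<phi> i x = u i x + v i x" for i x
  have \<phi>h: "fhom Q M M' \<phi>"
    unfolding fhom_def
  proof (intro conjI allI ballI)
    show "lin_on (fV M i) (\<phi> i)" for i
      unfolding \<phi>_def[abs_def] by (rule lin_on_plus[OF fhom_lin[OF uh] fhom_lin[OF vh]])
    show "\<phi> i x \<in> fV M' i" if "x \<in> fV M i" for i x
      unfolding \<phi>_def
      by (rule fv.subspace_add[OF frep_sub[OF M'] fsub_in[OF W' uW[OF that]] fsub_in[OF C' vC[OF that]]])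
    fix a x assume x: "x \<in> fV M (src Q a)"
    have "fA M' a (\<phi> (src Q a) x) = fA M' a (u (src Q a) x) + fA M' a (v (src Q a) x)"
      unfolding \<phi>_def by (rule lin_on_add[OF frep_lin[OF M'] fsub_in[OF W' uW[OF x]] fsub_in[OF C' vC[OF x]]])
    then show "\<phi> (tgt Q a) (fA M a x) = fA M' a (\<phi> (src Q a) x)"
      using fhom_comm[OF uh x] fhom_comm[OF vh x] by (simp add: \<phi>_def)
  qed
  have ker: "(\<lambda>i. {x \<in> fV M i. \<phi> i x = 0}) = (\<lambda>i. {0})"
  proof (intro ext equalityI subsetI)
    fix i x assume "x \<in> {x \<in> fV M i. \<phi> i x = 0}"
    then have x: "x \<in> fV M i" and z: "u i x + v i x = 0" by (simp_all add: \<phi>_def)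
    have "u i x = - v i x" using z by (simp only: eq_neg_iff_add_eq_0)
    then have "u i x \<in> C' i" using fv.subspace_neg[OF fsub_subspace[OF C'] vC[OF x]] by simp
    then have u0: "u i x = 0" by (rule fdecomp_inter[OF D' uW[OF x]])
    then have v0: "v i x = 0" using z by simp
    have pW: "p i x \<in> W i" and qC: "q i x \<in> C i" using fhom_in[OF ph x] fhom_in[OF qh x] by simp_all
    have "p i x = 0" by (rule \<alpha>inj[OF pW]) (use u0 in \<open>simp add: u_def\<close>)
    then have "x \<in> C i" using p(3)[OF x] by simp
    then have "x = q i x" using q(2) by simp
    also have "\<dots> = 0" by (rule \<beta>inj[OF qC]) (use v0 in \<open>simp add: v_def\<close>)
    finally show "x \<in> {0}" by simp
  next
    fix i and x :: "nat \<Rightarrow> 'c" assume "x \<in> {0}"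
    then show "x \<in> {x \<in> fV M i. \<phi> i x = 0}"
      using fv.subspace_0[OF frep_sub[OF M]] lin_on_zero[OF fhom_lin[OF \<phi>h] frep_sub[OF M]] by simp
  qed
  have im: "\<phi> i ` fV M i = fV M' i" for i
  proof (intro equalityI subsetI)
    fix y assume "y \<in> fV M' i"
    then obtain w' c' where y: "w' \<in> W' i" "c' \<in> C' i" "y = w' + c'" using fdecomp_ex[OF D'] by blast
    have "w' \<in> \<alpha> i ` W i" "c' \<in> \<beta> i ` C i"
      using fepi_image[OF \<alpha>, of i] fepi_image[OF \<beta>, of i] y by simp_all
    then obtain w c where wc: "w \<in> W i" "w' = \<alpha> i w" "c \<in> C i" "c' = \<beta> i c" by blast
    have wM: "w \<in> fV M i" and cM: "c \<in> fV M i" by (rule fsub_in[OF W wc(1)], rule fsub_in[OF C wc(3)])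
    have "\<phi> i (w + c) = \<phi> i w + \<phi> i c" by (rule lin_on_add[OF fhom_lin[OF \<phi>h] wM cM])
    also have "\<phi> i w = w'" unfolding \<phi>_def u_def v_def p(2)[OF wc(1)] q0[OF wc(1)] \<beta>0 wc(2) by simp
    also have "\<phi> i c = c'" unfolding \<phi>_def u_def v_def q(2)[OF wc(3)] p0[OF wc(3)] \<alpha>0 wc(4) by simp
    finally have "\<phi> i (w + c) = w' + c'" .
    with y(3) have "y = \<phi> i (w + c)" by (simp only:)
    then show "y \<in> \<phi> i ` fV M i" using fv.subspace_add[OF frep_sub[OF M] wM cM] by blast
  qed (use fhom_in[OF \<phi>h] in blast)
  have "fepi Q M M' (\<lambda>i. {0}) \<phi>" unfolding fepi_def using \<phi>h im fun_cong[OF ker] by simp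
  then show ?thesis unfolding fiso_def fquot_def by blast
qed

text \<open>Makes a summand of a summand a summand of \<open>M\<close>, with \<open>B + C\<close> as
  its complement.\<close>

lemma fdecomp_refine:
  assumes M: "is_frep Q M" and D: "fdecomp Q M W C" and D': "fdecomp Q (restr M W) A B"
  shows "fdecomp Q M A (\<lambda>i. {b + c |b c. b \<in> B i \<and> c \<in> C i})" (is "fdecomp Q M A ?S")
proof -
  note W = fdecomp_sub1[OF D] and C = fdecomp_sub2[OF D]
  have A: "fsub Q M A" and B: "fsub Q M B"
    by (rule fsub_trans[OF W fdecomp_sub1[OF D']], rule fsub_trans[OF W fdecomp_sub2[OF D']])
  have AW: "x \<in> W i" if "x \<in> A i" for x i using fsub_in[OF fdecomp_sub1[OF D'] that] by simp
  have BW: "x \<in> W i" if "x \<in> B i" for x i using fsub_in[OF fdecomp_sub2[OF D'] that] by simp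
  have S: "fsub Q M ?S"
    unfolding fsub_def
  proof (intro conjI allI ballI)
    fix i
    show "fv.subspace (?S i)" using fv.subspace_sums[OF fsub_subspace[OF B] fsub_subspace[OF C]] by blast
    show "?S i \<subseteq> fV M i"
      using fv.subspace_add[OF frep_sub[OF M] fsub_in[OF B] fsub_in[OF C]] by blast
  next
    fix a x assume "x \<in> ?S (src Q a)"
    then obtain b c where bc: "b \<in> B (src Q a)" "c \<in> C (src Q a)" "x = b + c" by blast
    have "fA M a x = fA M a b + fA M a c"
      unfolding bc(3) by (rule lin_on_add[OF frep_lin[OF M] fsub_in[OF B bc(1)] fsub_in[OF C bc(2)]])
    then show "fA M a x \<in> ?S (tgt Q a)" using fsub_act[OF B bc(1)] fsub_act[OF C bc(2)] by blast
  qed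
  show ?thesis
    unfolding fdecomp_def
  proof (intro conjI allI ballI impI A S)
    fix i x assume x: "x \<in> A i" and "x \<in> ?S i"
    then obtain b c where bc: "b \<in> B i" "c \<in> C i" "x = b + c" by blast
    have "x - b \<in> W i" by (rule fv.subspace_diff[OF fsub_subspace[OF W] AW[OF x] BW[OF bc(1)]])
    then have "c \<in> W i" using bc(3) by simp
    then have "c = 0" by (rule fdecomp_inter[OF D _ bc(2)])
    then have "x \<in> B i" using bc by simp
    then show "x = 0" by (rule fdecomp_inter[OF D' x])
  next
    fix i x assume "x \<in> fV M i"
    then obtain w c where wc: "w \<in> W i" "c \<in> C i" "x = w + c" using fdecomp_ex[OF D] by blast
    have "w \<in> fV (restr M W) i" using wc(1) by simp
    then obtain a b where ab: "a \<in> A i" "b \<in> B i" "w = a + b" using fdecomp_ex[OF D'] by blast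
    have "x = a + (b + c)" unfolding wc(3) ab(3) by (rule add.assoc)
    then show "\<exists>w\<in>A i. \<exists>c\<in>?S i. x = w + c" using ab wc(2) by blast
  qed
qed

definition findec :: "('i, 'e) quiver \<Rightarrow> ('i, 'e, 'k::field) frep \<Rightarrow> bool" where
  "findec Q M \<longleftrightarrow> fV M \<noteq> (\<lambda>i. {0}) \<and> (\<forall>W C. fdecomp Q M W C \<longrightarrow> W = (\<lambda>i. {0}) \<or> C = (\<lambda>i. {0}))"

text \<open>A non-zero summand of least size cannot be decomposed further, since its parts would
  again be summands of \<open>M\<close>.\<close>

lemma findec_summand:
  fixes M :: "('i::finite, 'e, 'k::{field,finite}) frep"
  assumes M: "is_frep Q M" and nz: "fV M \<noteq> (\<lambda>i. {0})"
  obtains W C where "fdecomp Q M W C" "findec Q (restr M W)"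
proof -
  define P where "P W \<longleftrightarrow> W \<noteq> (\<lambda>i. {0}) \<and> (\<exists>C. fdecomp Q M W C)" for W
  have "P (fV M)" unfolding P_def using nz fdecomp_zero[OF M] by blast
  define W where "W = arg_min rsize P"
  have PW: "P W" unfolding W_def by (rule arg_min_natI[of P "fV M"]) (rule \<open>P (fV M)\<close>)
  have min: "rsize W \<le> rsize U" if "P U" for U unfolding W_def by (rule arg_min_nat_le[of P U]) (rule that)
  obtain C where W0: "W \<noteq> (\<lambda>i. {0})" and D: "fdecomp Q M W C" using PW unfolding P_def by blast
  note W = fdecomp_sub1[OF D]
  have Wr: "is_frep Q (restr M W)" by (rule fsub_frep[OF M W])
  have "findec Q (restr M W)"
    unfolding findec_def
  proof (intro conjI allI impI)
    show "fV (restr M W) \<noteq> (\<lambda>i. {0})" using W0 by simp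
    fix A B assume D': "fdecomp Q (restr M W) A B"
    show "A = (\<lambda>i. {0}) \<or> B = (\<lambda>i. {0})"
    proof (rule ccontr)
      assume ne: "\<not> (A = (\<lambda>i. {0}) \<or> B = (\<lambda>i. {0}))"
      have "P A" unfolding P_def using ne fdecomp_refine[OF M D D'] by blast
      then have le: "rsize W \<le> rsize A" by (rule min)
      note A = fdecomp_sub1[OF D'] and B = fdecomp_sub2[OF D']
      have AW: "A = W"
      proof (rule ccontr)
        assume "A \<noteq> W"
        then have "rsize A < rsize W" using rsize_sub[OF Wr A] by simp
        then show False using le by simp
      qed
      have "B = (\<lambda>i. {0})"
      proof (rule fsub_eq_zero[OF B])
        fix i x assume x: "x \<in> B i"
        have "x \<in> A i" using fsub_in[OF B x] by (simp add: AW)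
        then show "x = 0" by (rule fdecomp_inter[OF D' _ x])
      qed
      with ne show False by simp
    qed
  qed
  with D show ?thesis by (rule that)
qed

section \<open>Splitting of extensions\<close>

context affine_form
begin

lemma th_fdecomp:
  fixes M :: "('i, 'e, 'k::{field,finite}) frep"
  assumes M: "is_frep Q M" and D: "fdecomp Q M W C"
  shows "th (fV M) = th W + th C"
proof -
  obtain q where "fepi Q M (restr M C) W q" by (rule fdecomp_fepi[OF M D]) blast
  from th_fepi[OF M this] show ?thesis by simp
qed

lemma fdecomp_full:
  assumes D: "fdecomp Q M W C" and C: "C = fV M"
  shows "W = (\<lambda>i. {0})"
proof (rule fsub_eq_zero[OF fdecomp_sub1[OF D]])
  fix i x assume x: "x \<in> W i"
  have "x \<in> C i" unfolding C by (rule fsub_in[OF fdecomp_sub1[OF D] x])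
  then show "x = 0" by (rule fdecomp_inter[OF D x])
qed

lemma tors_summand:
  fixes M :: "('i, 'e, 'k::{field,finite}) frep"
  assumes M: "is_frep Q M" and D: "fdecomp Q M W C" and t: "tors t M" and W: "W \<noteq> (\<lambda>i. {0})"
  shows "t \<le> th W"
proof -
  have "C \<noteq> fV M" using fdecomp_full[OF D] W by blast
  from torsD[OF t fdecomp_sub2[OF D] this] show ?thesis using th_fdecomp[OF M D] by simp
qed

lemma tors_iso:
  fixes M :: "('i, 'e, 'k::{field,finite}) frep"
  shows "is_frep Q M \<Longrightarrow> fiso Q M N \<Longrightarrow> tors t M \<Longrightarrow> tors t N"
  unfolding fiso_def fquot_def using tors_quotient by blast

lemma tfree_iso:
  fixes M :: "('i, 'e, 'k::{field,finite}) frep"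
  assumes M: "is_frep Q M" and iso: "fiso Q M N" and t: "tfree t N"
  shows "tfree t M"
proof -
  obtain \<phi> where \<phi>: "fepi Q M N (\<lambda>i. {0}) \<phi>" using iso unfolding fiso_def fquot_def ..
  have "\<forall>i. \<forall>x\<in>fV M i. \<phi> i x = 0 \<longrightarrow> x = 0" using fepi_ker[OF \<phi>] by blast
  then show ?thesis by (rule tfree_injective[OF M fepi_hom[OF \<phi>] _ t])
qed

lemma th_iso:
  fixes M :: "('i, 'e, 'k::{field,finite}) frep"
  assumes M: "is_frep Q M" and iso: "fiso Q M N"
  shows "th (fV M) = th (fV N)"
  using iso th_fepi[OF M] unfolding fiso_def fquot_def by fastforce

lemma extension_splits:
  fixes M :: "('i, 'e, 'k::{field,finite}) frep"
  assumes M: "is_frep Q M" and N: "is_frep Q N" and W: "fsub Q M W" and \<pi>: "fquot Q M W N"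
    and t: "t = 0 \<or> t = 1" "tors t (restr M W)" "tfree t N"
  obtains C where "fdecomp Q M W C" "fiso Q N (restr M C)"
proof -
  obtain \<rho> where \<rho>: "fepi Q M N W \<rho>" using \<pi> unfolding fquot_def ..
  have "ext_vanish Q N (restr M W)" by (rule ext_vanish_tfree_tors[OF N fsub_frep[OF M W] t(3,2,1)])
  then obtain s where s: "fhom Q N M s" "\<And>i y. y \<in> fV N i \<Longrightarrow> \<rho> i (s i y) = y"
    using ext_vanish_split[OF M N \<rho>] by blast
  show ?thesis by (rule that[OF fdecomp_section(1,2)[OF M N \<rho> s]])
qed

text \<open>Both sequences split, so both middle terms are the direct sum of \<open>N\<close> and
  \<open>L\<close>. This is what leaves a single class in the coassociativity sums.\<close>

lemma extension_unique:
  fixes M :: "('i, 'e, 'k::{field,finite}) frep"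
  assumes M: "is_frep Q M" and M': "is_frep Q M'" and N: "is_frep Q N" and L: "is_frep Q L"
    and W: "fsub Q M W" "fquot Q M W N" "fiso Q (restr M W) L"
    and W': "fsub Q M' W'" "fquot Q M' W' N" "fiso Q (restr M' W') L"
    and t: "t = 0 \<or> t = 1" "tors t L" "tfree t N"
  shows "fiso Q M M'"
proof -
  note Wr = fsub_frep[OF M W(1)] and Wr' = fsub_frep[OF M' W'(1)]
  have T: "tors t (restr M W)" by (rule tors_iso[OF L fiso_sym[OF Wr L W(3)] t(2)])
  have T': "tors t (restr M' W')" by (rule tors_iso[OF L fiso_sym[OF Wr' L W'(3)] t(2)])
  obtain C where C: "fdecomp Q M W C" "fiso Q N (restr M C)" by (rule extension_splits[OF M N W(1,2) t(1) T t(3)]) blast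
  obtain C' where C': "fdecomp Q M' W' C'" "fiso Q N (restr M' C')"
    by (rule extension_splits[OF M' N W'(1,2) t(1) T' t(3)]) blast
  have Cr: "is_frep Q (restr M C)" by (rule fsub_frep[OF M fdecomp_sub2[OF C(1)]])
  show ?thesis
    by (rule fiso_decomp[OF M M' C(1) C'(1) fiso_trans[OF Wr L W(3) fiso_sym[OF Wr' L W'(3)]]
          fiso_trans[OF Cr N fiso_sym[OF N Cr C(2)] C'(2)]])
qed

end

section \<open>Matrix representations inside the universal vector space\<close>

definition fcoords :: "nat \<Rightarrow> (nat \<Rightarrow> 'k::field) set" where
  "fcoords n = {f. \<forall>j\<ge>n. f j = 0}"

definition vemb :: "'k::field vec \<Rightarrow> nat \<Rightarrow> 'k" where
  "vemb v = (\<lambda>j. if j < dim_vec v then v $ j else 0)"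

definition emb :: "('i, 'e) quiver \<Rightarrow> ('i, 'e, 'k::field) rep \<Rightarrow> ('i, 'e, 'k) frep" where
  "emb Q M = \<lparr>fV = (\<lambda>i. fcoords (rdim M i)),
     fA = (\<lambda>a f. vemb (rmat M a *\<^sub>v vec (rdim M (src Q a)) f))\<rparr>"

lemma emb_simps [simp]:
  "fV (emb Q M) = (\<lambda>i. fcoords (rdim M i))"
  "fA (emb Q M) a f = vemb (rmat M a *\<^sub>v vec (rdim M (src Q a)) f)"
  by (simp_all add: emb_def)

lemma fcoordsD: "f \<in> fcoords n \<Longrightarrow> n \<le> j \<Longrightarrow> f j = 0"
  by (simp add: fcoords_def)

lemma subspace_fcoords: "fv.subspace (fcoords n)"
  by (rule fv.subspaceI) (simp_all add: fcoords_def fscale_def)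

lemma card_fcoords: "finite (fcoords n :: (nat \<Rightarrow> 'k::{field,finite}) set) \<and> card (fcoords n :: (nat \<Rightarrow> 'k) set) = CARD('k) ^ n"
proof -
  have "bij_betw (\<lambda>f. restrict f {..<n}) (fcoords n :: (nat \<Rightarrow> 'k) set) ({..<n} \<rightarrow>\<^sub>E UNIV)"
  proof (rule bij_betw_byWitness[where f' = "\<lambda>f j. if j < n then f j else 0"])
    show "\<forall>f\<in>fcoords n. (\<lambda>j. if j < n then restrict f {..<n} j else 0) = f"
      by (auto simp: fcoords_def fun_eq_iff)
    show "\<forall>f\<in>{..<n} \<rightarrow>\<^sub>E UNIV. restrict (\<lambda>j. if j < n then f j else (0::'k)) {..<n} = f"
    proof (intro ballI ext)
      fix f :: "nat \<Rightarrow> 'k" and j assume "f \<in> {..<n} \<rightarrow>\<^sub>E UNIV"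
      then show "restrict (\<lambda>j. if j < n then f j else 0) {..<n} j = f j"
        by (cases "j < n") (auto simp: PiE_def extensional_def)
    qed
  qed (simp_all add: fcoords_def image_subset_iff)
  moreover have "finite ({..<n} \<rightarrow>\<^sub>E (UNIV :: 'k set))" by (intro finite_PiE) auto
  moreover have "card ({..<n} \<rightarrow>\<^sub>E (UNIV :: 'k set)) = CARD('k) ^ n" by (simp add: card_PiE)
  ultimately show ?thesis by (simp add: bij_betw_finite bij_betw_same_card)
qed

lemma dim_fcoords [simp]: "fv.dim (fcoords n :: (nat \<Rightarrow> 'k::{field,finite}) set) = n"
  using card_fcoords by (intro dim_eqI_card[OF subspace_fcoords]) auto

lemma vemb_vec [simp]: "f \<in> fcoords n \<Longrightarrow> vemb (vec n f) = f"
  by (auto simp: vemb_def fcoords_def fun_eq_iff)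

lemma vec_vemb [simp]: "v \<in> carrier_vec n \<Longrightarrow> vec n (vemb v) = v"
  by (intro eq_vecI) (auto simp: vemb_def)

lemma vemb_fcoords: "v \<in> carrier_vec n \<Longrightarrow> vemb v \<in> fcoords n"
  by (auto simp: vemb_def fcoords_def)

lemma vec_add: "vec n (f + g) = vec n f + vec n g"
  by (intro eq_vecI) auto

lemma vec_scale: "vec n (fscale c f) = c \<cdot>\<^sub>v vec n f"
  by (intro eq_vecI) (auto simp: fscale_def)

lemma vemb_add: "v \<in> carrier_vec n \<Longrightarrow> w \<in> carrier_vec n \<Longrightarrow> vemb (v + w) = vemb v + vemb w"
  by (auto simp: vemb_def fun_eq_iff)

lemma vemb_scale: "vemb (c \<cdot>\<^sub>v v) = fscale c (vemb v)"
  by (auto simp: vemb_def fun_eq_iff fscale_def)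

lemma vec_bij: "bij_betw (vec n) (fcoords n) (carrier_vec n)"
  by (rule bij_betw_byWitness[where f' = vemb]) (auto intro: vemb_fcoords)

lemma rep_mat: "is_rep Q M \<Longrightarrow> rmat M a \<in> carrier_mat (rdim M (tgt Q a)) (rdim M (src Q a))"
  by (simp add: is_rep_def)

lemma emb_act_in:
  assumes "is_rep Q M"
  shows "vemb (rmat M a *\<^sub>v vec (rdim M (src Q a)) f) \<in> fcoords (rdim M (tgt Q a))"
  by (rule vemb_fcoords[OF mult_mat_vec_carrier[OF rep_mat[OF assms]]]) simp

lemma is_frep_emb:
  fixes M :: "('i, 'e, 'k::{field,finite}) rep"
  assumes M: "is_rep Q M"
  shows "is_frep Q (emb Q M)"
  unfolding is_frep_def emb_simps
proof (intro conjI allI ballI)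
  fix a
  note A = rep_mat[OF M, of a]
  let ?g = "\<lambda>f. vemb (rmat M a *\<^sub>v vec (rdim M (src Q a)) f)"
  show "lin_on (fcoords (rdim M (src Q a))) ?g"
  proof (rule lin_onI)
    fix x y :: "nat \<Rightarrow> 'k"
    show "?g (x + y) = ?g x + ?g y"
      unfolding vec_add mult_add_distrib_mat_vec[OF A vec_carrier vec_carrier]
      by (rule vemb_add[OF mult_mat_vec_carrier[OF A vec_carrier] mult_mat_vec_carrier[OF A vec_carrier]])
  next
    fix c and x :: "nat \<Rightarrow> 'k"
    show "?g (fscale c x) = fscale c (?g x)"
      unfolding vec_scale mult_mat_vec[OF A vec_carrier] by (rule vemb_scale)
  qed
  show "vemb (rmat M a *\<^sub>v vec (rdim M (src Q a)) x) \<in> fcoords (rdim M (tgt Q a))" for x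
    by (rule emb_act_in[OF M])
qed (use subspace_fcoords card_fcoords in auto)

lemma fdim_emb:
  fixes M :: "('i, 'e, 'k::{field,finite}) rep"
  shows "fdim (fV (emb Q M)) = dim_vector M"
  by (simp add: fdim_def dim_vector_def fun_eq_iff)

lemma fcoords_zero_iff: "fcoords n = {0 :: nat \<Rightarrow> 'k::{field,finite}} \<longleftrightarrow> n = 0"
proof
  assume "fcoords n = {0 :: nat \<Rightarrow> 'k}"
  then have "fv.dim (fcoords n :: (nat \<Rightarrow> 'k) set) = 0" by simp
  then show "n = 0" by simp
qed (auto simp: fcoords_def fun_eq_iff)

lemma is_zero_rep_emb:
  fixes M :: "('i, 'e, 'k::{field,finite}) rep"
  shows "is_zero_rep M \<longleftrightarrow> fV (emb Q M) = (\<lambda>i. {0})"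
  by (simp add: is_zero_rep_def fun_eq_iff fcoords_zero_iff)

lemma fiso_iff_bij:
  assumes M: "is_frep Q M"
  shows "fiso Q M N \<longleftrightarrow> (\<exists>\<psi>. fhom Q M N \<psi> \<and> (\<forall>i. bij_betw (\<psi> i) (fV M i) (fV N i)))"
proof
  assume "fiso Q M N"
  then obtain \<psi> where \<psi>: "fepi Q M N (\<lambda>i. {0}) \<psi>" unfolding fiso_def fquot_def ..
  have "bij_betw (\<psi> i) (fV M i) (fV N i)" for i
  proof -
    have "inj_on (\<psi> i) (fV M i)"
      by (rule lin_on_inj[OF fhom_lin[OF fepi_hom[OF \<psi>]] frep_sub[OF M]]) (use fepi_ker[OF \<psi>, of i] in blast)
    then show ?thesis using fepi_image[OF \<psi>] by (simp add: bij_betw_def)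
  qed
  then show "\<exists>\<psi>. fhom Q M N \<psi> \<and> (\<forall>i. bij_betw (\<psi> i) (fV M i) (fV N i))" using fepi_hom[OF \<psi>] by blast
next
  assume "\<exists>\<psi>. fhom Q M N \<psi> \<and> (\<forall>i. bij_betw (\<psi> i) (fV M i) (fV N i))"
  then obtain \<psi> where \<psi>: "fhom Q M N \<psi>" and bij: "\<And>i. bij_betw (\<psi> i) (fV M i) (fV N i)" by blast
  have "fepi Q M N (\<lambda>i. {0}) \<psi>"
    unfolding fepi_def
  proof (intro conjI allI \<psi>)
    fix i
    show "\<psi> i ` fV M i = fV N i" using bij[of i] by (simp add: bij_betw_def)
    have z: "0 \<in> fV M i" "\<psi> i 0 = 0"
      by (rule fv.subspace_0[OF frep_sub[OF M]], rule lin_on_zero[OF fhom_lin[OF \<psi>] frep_sub[OF M]])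
    have "x = 0" if "x \<in> fV M i" "\<psi> i x = 0" for x
      using inj_onD[OF bij_betw_imp_inj_on[OF bij[of i]], of x 0] that z by simp
    then show "{0} = {x \<in> fV M i. \<psi> i x = 0}" using z by blast
  qed
  then show "fiso Q M N" unfolding fiso_def fquot_def by blast
qed

text \<open>\<open>F\<close> transports the structure of \<open>M\<close> to \<open>A\<close>. One
  notion serves matrix representations, their subrepresentations and their coset quotients, whose
  carrier types differ, and it asks for no module axioms on \<open>A\<close>.\<close>

definition models :: "('i, 'e) quiver \<Rightarrow> ('i, 'e, 'k::field, 'v) linrep \<Rightarrow> ('i, 'e, 'k) frep \<Rightarrow>
    ('i \<Rightarrow> (nat \<Rightarrow> 'k) \<Rightarrow> 'v) \<Rightarrow> bool" where
  "models Q A M F \<longleftrightarrow>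
     (\<forall>i. bij_betw (F i) (fV M i) (carrier (space A i))) \<and>
     (\<forall>i. \<forall>x\<in>fV M i. \<forall>y\<in>fV M i. F i (x + y) = F i x \<oplus>\<^bsub>space A i\<^esub> F i y) \<and>
     (\<forall>i c. \<forall>x\<in>fV M i. F i (fscale c x) = c \<odot>\<^bsub>space A i\<^esub> F i x) \<and>
     (\<forall>a. \<forall>x\<in>fV M (src Q a). F (tgt Q a) (fA M a x) = act A a (F (src Q a) x))"

lemma isomorphic_reps_iff_fiso:
  fixes A :: "('i, 'e, 'k::field, 'v) linrep" and B :: "('i, 'e, 'k, 'w) linrep"
  assumes M: "is_frep Q M" and N: "is_frep Q N" and F: "models Q A M F" and G: "models Q B N G"
  shows "isomorphic_reps Q A B \<longleftrightarrow> fiso Q M N"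
proof -
  have Fbij: "bij_betw (F i) (fV M i) (carrier (space A i))"
    and Fadd: "x \<in> fV M i \<Longrightarrow> y \<in> fV M i \<Longrightarrow> F i (x + y) = F i x \<oplus>\<^bsub>space A i\<^esub> F i y"
    and Fsm: "x \<in> fV M i \<Longrightarrow> F i (fscale c x) = c \<odot>\<^bsub>space A i\<^esub> F i x"
    and Fact: "z \<in> fV M (src Q a) \<Longrightarrow> F (tgt Q a) (fA M a z) = act A a (F (src Q a) z)" for i x y c a z
    using F unfolding models_def by blast+
  have Gbij: "bij_betw (G i) (fV N i) (carrier (space B i))"
    and Gadd: "x \<in> fV N i \<Longrightarrow> y \<in> fV N i \<Longrightarrow> G i (x + y) = G i x \<oplus>\<^bsub>space B i\<^esub> G i y"
    and Gsm: "x \<in> fV N i \<Longrightarrow> G i (fscale c x) = c \<odot>\<^bsub>space B i\<^esub> G i x"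
    and Gact: "z \<in> fV N (src Q a) \<Longrightarrow> G (tgt Q a) (fA N a z) = act B a (G (src Q a) z)" for i x y c a z
    using G unfolding models_def by blast+
  have Fin: "F i x \<in> carrier (space A i)" if "x \<in> fV M i" for i x by (rule bij_betwE[OF Fbij, rule_format, OF that])
  have Gin: "G i x \<in> carrier (space B i)" if "x \<in> fV N i" for i x by (rule bij_betwE[OF Gbij, rule_format, OF that])
  have Ginj: "x = y" if "G i x = G i y" "x \<in> fV N i" "y \<in> fV N i" for i x y
    by (rule inj_onD[OF bij_betw_imp_inj_on[OF Gbij] that])
  show ?thesis
  proof
    assume "isomorphic_reps Q A B"
    then obtain \<phi> where "\<phi> \<in> rep_isos Q A B" by (auto simp: isomorphic_reps_def)
    then have \<phi>: "\<And>i. \<phi> i \<in> LinearCombinations.module_hom class_ring (space A i) (space B i)"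
        "\<And>i. bij_betw (\<phi> i) (carrier (space A i)) (carrier (space B i))"
        "\<And>a v. v \<in> carrier (space A (src Q a)) \<Longrightarrow> \<phi> (tgt Q a) (act A a v) = act B a (\<phi> (src Q a) v)"
      unfolding rep_isos_def by blast+
    define g where "g i = inv_into (fV N i) (G i)" for i
    define \<psi> where "\<psi> i x = g i (\<phi> i (F i x))" for i x
    have gbij: "bij_betw (g i) (carrier (space B i)) (fV N i)" for i unfolding g_def by (rule bij_betw_inv_into[OF Gbij])
    have \<psi>bij: "bij_betw (\<psi> i) (fV M i) (fV N i)" for i
      using bij_betw_trans[OF bij_betw_trans[OF Fbij \<phi>(2)] gbij, of i] by (simp add: \<psi>_def[abs_def] comp_def)
    have \<psi>in: "\<psi> i x \<in> fV N i" if "x \<in> fV M i" for i x by (rule bij_betwE[OF \<psi>bij, rule_format, OF that])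
    have G\<psi>: "G i (\<psi> i x) = \<phi> i (F i x)" if "x \<in> fV M i" for i x
      unfolding \<psi>_def g_def
      by (rule bij_betw_inv_into_right[OF Gbij bij_betwE[OF \<phi>(2), rule_format, OF Fin[OF that]]])
    have "fhom Q M N \<psi>"
      unfolding fhom_def
    proof (intro conjI allI ballI)
      fix i
      show "lin_on (fV M i) (\<psi> i)"
      proof (rule lin_onI)
        fix x y assume xy: "x \<in> fV M i" "y \<in> fV M i"
        have s: "x + y \<in> fV M i" by (rule fv.subspace_add[OF frep_sub[OF M] xy])
        have "G i (\<psi> i (x + y)) = \<phi> i (F i x \<oplus>\<^bsub>space A i\<^esub> F i y)" unfolding G\<psi>[OF s] Fadd[OF xy] ..
        also have "\<dots> = \<phi> i (F i x) \<oplus>\<^bsub>space B i\<^esub> \<phi> i (F i y)"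
          by (rule LinearCombinations.module_hom_add[OF \<phi>(1) Fin[OF xy(1)] Fin[OF xy(2)]])
        also have "\<dots> = G i (\<psi> i x + \<psi> i y)"
          unfolding Gadd[OF \<psi>in[OF xy(1)] \<psi>in[OF xy(2)]] G\<psi>[OF xy(1)] G\<psi>[OF xy(2)] ..
        finally show "\<psi> i (x + y) = \<psi> i x + \<psi> i y"
          by (rule Ginj[OF _ \<psi>in[OF s] fv.subspace_add[OF frep_sub[OF N] \<psi>in[OF xy(1)] \<psi>in[OF xy(2)]]])
      next
        fix c x assume x: "x \<in> fV M i"
        have s: "fscale c x \<in> fV M i" by (rule fv.subspace_scale[OF frep_sub[OF M] x])
        have "G i (\<psi> i (fscale c x)) = \<phi> i (c \<odot>\<^bsub>space A i\<^esub> F i x)" unfolding G\<psi>[OF s] Fsm[OF x] ..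
        also have "\<dots> = c \<odot>\<^bsub>space B i\<^esub> \<phi> i (F i x)"
          by (rule LinearCombinations.module_hom_smult[OF \<phi>(1) _ Fin[OF x]]) (simp add: class_ring_simps)
        also have "\<dots> = G i (fscale c (\<psi> i x))" unfolding Gsm[OF \<psi>in[OF x]] G\<psi>[OF x] ..
        finally show "\<psi> i (fscale c x) = fscale c (\<psi> i x)"
          by (rule Ginj[OF _ \<psi>in[OF s] fv.subspace_scale[OF frep_sub[OF N] \<psi>in[OF x]]])
      qed
      show "\<psi> i x \<in> fV N i" if "x \<in> fV M i" for x by (rule \<psi>in[OF that])
    next
      fix a x assume x: "x \<in> fV M (src Q a)"
      have "G (tgt Q a) (\<psi> (tgt Q a) (fA M a x)) = act B a (\<phi> (src Q a) (F (src Q a) x))"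
        unfolding G\<psi>[OF frep_act[OF M x]] Fact[OF x] by (rule \<phi>(3)[OF Fin[OF x]])
      also have "\<dots> = G (tgt Q a) (fA N a (\<psi> (src Q a) x))" unfolding Gact[OF \<psi>in[OF x]] G\<psi>[OF x] ..
      finally show "\<psi> (tgt Q a) (fA M a x) = fA N a (\<psi> (src Q a) x)"
        by (rule Ginj[OF _ \<psi>in[OF frep_act[OF M x]] frep_act[OF N \<psi>in[OF x]]])
    qed
    then show "fiso Q M N" unfolding fiso_iff_bij[OF M] using \<psi>bij by blast
  next
    assume "fiso Q M N"
    then obtain \<psi> where \<psi>: "fhom Q M N \<psi>" and bij: "\<And>i. bij_betw (\<psi> i) (fV M i) (fV N i)"
      unfolding fiso_iff_bij[OF M] by blast
    define h where "h i = inv_into (fV M i) (F i)" for i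
    have hbij: "bij_betw (h i) (carrier (space A i)) (fV M i)" for i unfolding h_def by (rule bij_betw_inv_into[OF Fbij])
    have hF: "h i (F i x) = x" if "x \<in> fV M i" for i x
      unfolding h_def by (rule bij_betw_inv_into_left[OF Fbij that])
    define \<phi> where "\<phi> i = restrict (\<lambda>v. G i (\<psi> i (h i v))) (carrier (space A i))" for i
    have \<phi>F: "\<phi> i (F i x) = G i (\<psi> i x)" if "x \<in> fV M i" for i x
      using Fin[OF that] hF[OF that] by (simp add: \<phi>_def)
    have carrA: "\<exists>x\<in>fV M i. v = F i x" if "v \<in> carrier (space A i)" for i v
      using that bij_betw_imp_surj_on[OF Fbij, of i] by blast
    have "\<phi> \<in> rep_isos Q A B"
      unfolding rep_isos_def
    proof (intro CollectI conjI allI ballI)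
      fix i
      show "\<phi> i \<in> extensional (carrier (space A i))" by (simp add: \<phi>_def)
      have "bij_betw (\<lambda>v. G i (\<psi> i (h i v))) (carrier (space A i)) (carrier (space B i))"
        using bij_betw_trans[OF bij_betw_trans[OF hbij bij] Gbij, of i] by (simp add: comp_def)
      then show "bij_betw (\<phi> i) (carrier (space A i)) (carrier (space B i))"
        by (rule bij_betw_cong[THEN iffD1, rotated]) (simp add: \<phi>_def)
      show "\<phi> i \<in> LinearCombinations.module_hom class_ring (space A i) (space B i)"
        unfolding LinearCombinations.module_hom_def
      proof (intro CollectI conjI allI impI)
        show "\<phi> i \<in> carrier (space A i) \<rightarrow> carrier (space B i)"
          using carrA \<phi>F Gin fhom_in[OF \<psi>] by (intro funcsetI) metis
      next
        fix v w assume "v \<in> carrier (space A i) \<and> w \<in> carrier (space A i)"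
        then obtain x y where xy: "x \<in> fV M i" "y \<in> fV M i" "v = F i x" "w = F i y" using carrA by blast
        show "\<phi> i (v \<oplus>\<^bsub>space A i\<^esub> w) = \<phi> i v \<oplus>\<^bsub>space B i\<^esub> \<phi> i w"
          unfolding xy(3,4) Fadd[OF xy(1,2), symmetric] \<phi>F[OF xy(1)] \<phi>F[OF xy(2)]
            \<phi>F[OF fv.subspace_add[OF frep_sub[OF M] xy(1,2)]] lin_on_add[OF fhom_lin[OF \<psi>] xy(1,2)]
          by (rule Gadd[OF fhom_in[OF \<psi> xy(1)] fhom_in[OF \<psi> xy(2)]])
      next
        fix c v assume "c \<in> carrier (class_ring :: 'k ring) \<and> v \<in> carrier (space A i)"
        then obtain x where x: "x \<in> fV M i" "v = F i x" using carrA by blast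
        show "\<phi> i (c \<odot>\<^bsub>space A i\<^esub> v) = c \<odot>\<^bsub>space B i\<^esub> \<phi> i v"
          unfolding x(2) Fsm[OF x(1), symmetric] \<phi>F[OF x(1)]
            \<phi>F[OF fv.subspace_scale[OF frep_sub[OF M] x(1)]] lin_on_scale[OF fhom_lin[OF \<psi>] x(1)]
          by (rule Gsm[OF fhom_in[OF \<psi> x(1)]])
      qed
    next
      fix a v assume "v \<in> carrier (space A (src Q a))"
      then obtain x where x: "x \<in> fV M (src Q a)" "v = F (src Q a) x" using carrA by blast
      show "\<phi> (tgt Q a) (act A a v) = act B a (\<phi> (src Q a) v)"
        unfolding x(2) Fact[OF x(1), symmetric] \<phi>F[OF x(1)] \<phi>F[OF frep_act[OF M x(1)]] fhom_comm[OF \<psi> x(1)]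
        by (rule Gact[OF fhom_in[OF \<psi> x(1)]])
    qed
    then show "isomorphic_reps Q A B" by (auto simp: isomorphic_reps_def)
  qed
qed

lemma linrep_of_simps:
  "carrier (space (linrep_of M) i) = carrier_vec (rdim M i)"
  "x \<oplus>\<^bsub>space (linrep_of M) i\<^esub> y = x + y"
  "c \<odot>\<^bsub>space (linrep_of M) i\<^esub> x = c \<cdot>\<^sub>v x"
  "act (linrep_of M) a v = rmat M a *\<^sub>v v"
  by (simp_all add: linrep_of_def module_vec_simps)

lemma models_linrep_of:
  assumes M: "is_rep Q M"
  shows "models Q (linrep_of M) (emb Q M) (\<lambda>i. vec (rdim M i))"
  unfolding models_def linrep_of_simps emb_simps
proof (intro conjI allI ballI)
  show "vec (rdim M (tgt Q a)) (vemb (rmat M a *\<^sub>v vec (rdim M (src Q a)) x)) = rmat M a *\<^sub>v vec (rdim M (src Q a)) x" for a x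
    by (rule vec_vemb[OF mult_mat_vec_carrier[OF rep_mat[OF M]]]) simp
qed (simp_all add: vec_bij vec_add vec_scale)

lemma models_sub_linrep:
  assumes M: "is_rep Q M" and W: "fsub Q (emb Q M) W"
  shows "models Q (sub_linrep (linrep_of M) (\<lambda>i. vec (rdim M i) ` W i)) (restr (emb Q M) W) (\<lambda>i. vec (rdim M i))"
  unfolding models_def restr_simps
proof (intro conjI allI ballI)
  fix i
  have "W i \<subseteq> fcoords (rdim M i)" using fsub_le[OF W, of i] by simp
  then show "bij_betw (vec (rdim M i)) (W i) (carrier (space (sub_linrep (linrep_of M) (\<lambda>i. vec (rdim M i) ` W i)) i))"
    using bij_betw_subset[OF vec_bij _ refl] by (simp add: sub_linrep_def)
next
  fix a x assume "x \<in> W (src Q a)"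
  show "vec (rdim M (tgt Q a)) (fA (emb Q M) a x) = act (sub_linrep (linrep_of M) (\<lambda>i. vec (rdim M i) ` W i)) a (vec (rdim M (src Q a)) x)"
    unfolding emb_simps
    by (subst vec_vemb[OF mult_mat_vec_carrier[OF rep_mat[OF M]]]) (simp_all add: sub_linrep_def linrep_of_simps)
qed (simp_all add: sub_linrep_def linrep_of_def module_vec_simps vec_add vec_scale)

text \<open>A coset of the subrepresentation is a fibre of \<open>\<pi>\<close>, so the points of
  \<open>N\<close> index the cosets.\<close>

lemma models_quotient_linrep:
  fixes M :: "('i, 'e, 'k::{field,finite}) rep"
  assumes M: "is_rep Q M" and N: "is_frep Q N" and \<pi>: "fepi Q (emb Q M) N W \<pi>"
  shows "models Q (quotient_linrep Q (linrep_of M) (\<lambda>i. vec (rdim M i) ` W i)) N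
    (\<lambda>i y. {v \<in> carrier_vec (rdim M i). \<pi> i (vemb v) = y})"
proof -
  let ?X = "\<lambda>i. vec (rdim M i) ` W i"
  let ?V = "\<lambda>i. module_vec TYPE('k) (rdim M i)"
  let ?Q = "quotient_linrep Q (linrep_of M) ?X"
  define F where "F i y = {v \<in> carrier_vec (rdim M i). \<pi> i (vemb v) = y}" for i y
  note \<pi>h = fepi_hom[OF \<pi>]
  have Mf: "is_frep Q (emb Q M)" by (rule is_frep_emb[OF M])
  have vE: "vemb v \<in> fV (emb Q M) i" if "v \<in> carrier_vec (rdim M i)" for i v using vemb_fcoords[OF that] by simp
  have p_add: "\<pi> i (vemb (v + w)) = \<pi> i (vemb v) + \<pi> i (vemb w)"
    if "v \<in> carrier_vec (rdim M i)" "w \<in> carrier_vec (rdim M i)" for i v w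
    unfolding vemb_add[OF that] by (rule lin_on_add[OF fhom_lin[OF \<pi>h] vE[OF that(1)] vE[OF that(2)]])
  have p_sm: "\<pi> i (vemb (c \<cdot>\<^sub>v v)) = fscale c (\<pi> i (vemb v))" if "v \<in> carrier_vec (rdim M i)" for i c v
    unfolding vemb_scale by (rule lin_on_scale[OF fhom_lin[OF \<pi>h] vE[OF that]])
  have p_act: "\<pi> (tgt Q a) (vemb (rmat M a *\<^sub>v v)) = fA N a (\<pi> (src Q a) (vemb v))"
    if "v \<in> carrier_vec (rdim M (src Q a))" for a v
    using fhom_comm[OF \<pi>h vE[OF that]] that by simp
  have Xiff: "v \<in> ?X i \<longleftrightarrow> v \<in> carrier_vec (rdim M i) \<and> \<pi> i (vemb v) = 0" for i v
  proof
    assume "v \<in> ?X i"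
    then obtain f where f: "f \<in> W i" "v = vec (rdim M i) f" by blast
    then have "f \<in> fV (emb Q M) i" "\<pi> i f = 0" unfolding fepi_ker[OF \<pi>] by simp_all
    then show "v \<in> carrier_vec (rdim M i) \<and> \<pi> i (vemb v) = 0" using f(2) by simp
  next
    assume v: "v \<in> carrier_vec (rdim M i) \<and> \<pi> i (vemb v) = 0"
    then have "vemb v \<in> W i" unfolding fepi_ker[OF \<pi>] using vE by simp
    then show "v \<in> ?X i" using v by (intro image_eqI[of _ _ "vemb v"]) simp_all
  qed
  have coset: "?X i +>\<^bsub>?V i\<^esub> v = F i (\<pi> i (vemb v))" if v: "v \<in> carrier_vec (rdim M i)" for i v
  proof -
    have "?X i +>\<^bsub>?V i\<^esub> v = {x + v | x. x \<in> ?X i}" by (auto simp: a_r_coset_def r_coset_def module_vec_simps)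
    also have "\<dots> = F i (\<pi> i (vemb v))"
    proof (intro equalityI subsetI)
      fix u assume "u \<in> {x + v | x. x \<in> ?X i}"
      then obtain x where x: "x \<in> ?X i" "u = x + v" by blast
      then have xc: "x \<in> carrier_vec (rdim M i)" "\<pi> i (vemb x) = 0" unfolding Xiff by simp_all
      then show "u \<in> F i (\<pi> i (vemb v))" unfolding F_def x(2) using v p_add[OF xc(1) v] by simp
    next
      fix u assume "u \<in> F i (\<pi> i (vemb v))"
      then have u: "u \<in> carrier_vec (rdim M i)" "\<pi> i (vemb u) = \<pi> i (vemb v)" by (simp_all add: F_def)
      have uv: "u - v \<in> carrier_vec (rdim M i)" using u(1) v by simp
      have eq: "u = (u - v) + v" using u(1) v by (intro eq_vecI) auto
      have "\<pi> i (vemb u) = \<pi> i (vemb (u - v)) + \<pi> i (vemb v)" using p_add[OF uv v] eq by simp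
      then have "\<pi> i (vemb (u - v)) = 0" unfolding u(2) by simp
      then have "u - v \<in> ?X i" unfolding Xiff using uv by simp
      then show "u \<in> {x + v | x. x \<in> ?X i}" using eq by blast
    qed
    finally show ?thesis .
  qed
  have surj: "\<exists>v\<in>carrier_vec (rdim M i). \<pi> i (vemb v) = y" if "y \<in> fV N i" for i y
  proof -
    have "y \<in> \<pi> i ` fV (emb Q M) i" unfolding fepi_image[OF \<pi>] by (rule that)
    then obtain f where "f \<in> fcoords (rdim M i)" "y = \<pi> i f" by auto
    then show ?thesis by (intro bexI[of _ "vec (rdim M i) f"]) simp_all
  qed
  have pN: "\<pi> i (vemb v) \<in> fV N i" if "v \<in> carrier_vec (rdim M i)" for i v by (rule fhom_in[OF \<pi>h vE[OF that]])
  have carr: "carrier (space ?Q i) = F i ` fV N i" for i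
  proof -
    have "carrier (space ?Q i) = {?X i +>\<^bsub>?V i\<^esub> v | v. v \<in> carrier_vec (rdim M i)}"
      by (auto simp: quotient_linrep_def quotient_space_def linrep_of_def A_RCOSETS_def RCOSETS_def
          a_r_coset_def module_vec_simps)
    also have "\<dots> = F i ` fV N i"
    proof (intro equalityI subsetI)
      fix S assume "S \<in> {?X i +>\<^bsub>?V i\<^esub> v | v. v \<in> carrier_vec (rdim M i)}"
      then obtain v where v: "v \<in> carrier_vec (rdim M i)" "S = ?X i +>\<^bsub>?V i\<^esub> v" by blast
      show "S \<in> F i ` fV N i" unfolding v(2) coset[OF v(1)] by (rule imageI[OF pN[OF v(1)]])
    next
      fix S assume "S \<in> F i ` fV N i"
      then obtain y where y: "y \<in> fV N i" "S = F i y" by blast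
      obtain v where v: "v \<in> carrier_vec (rdim M i)" "\<pi> i (vemb v) = y" using surj[OF y(1)] by blast
      have "S = ?X i +>\<^bsub>?V i\<^esub> v" unfolding coset[OF v(1)] v(2) y(2) ..
      then show "S \<in> {?X i +>\<^bsub>?V i\<^esub> v | v. v \<in> carrier_vec (rdim M i)}" using v(1) by blast
    qed
    finally show ?thesis .
  qed
  \<comment> \<open>Operations on cosets are unions over all representatives. All of them give the
    same coset, and a fibre is not empty, so the union is that coset.\<close>
  have UN: "(\<Union>s\<in>F i y. F j (h s)) = F j z" if y: "y \<in> fV N i" and h: "\<And>s. s \<in> F i y \<Longrightarrow> h s = z" for i j y h z
  proof -
    have "F i y \<noteq> {}" using surj[OF y] by (auto simp: F_def)
    then show ?thesis using h by auto
  qed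
  have "models Q ?Q N F"
    unfolding models_def
  proof (intro conjI allI ballI)
    fix i
    show "bij_betw (F i) (fV N i) (carrier (space ?Q i))"
      unfolding carr
    proof (rule inj_on_imp_bij_betw, rule inj_onI)
      fix x y assume x: "x \<in> fV N i" and y: "y \<in> fV N i" and eq: "F i x = F i y"
      obtain v where v: "v \<in> carrier_vec (rdim M i)" "\<pi> i (vemb v) = x" using surj[OF x] by blast
      have "v \<in> F i x" unfolding F_def using v by simp
      with eq have "v \<in> F i y" by (simp only:)
      then have "\<pi> i (vemb v) = y" unfolding F_def by simp
      with v(2) show "x = y" by (simp only:)
    qed
    fix y assume y: "y \<in> fV N i"
    show "F i (fscale c y) = c \<odot>\<^bsub>space ?Q i\<^esub> F i y" for c
    proof -
      have "c \<odot>\<^bsub>space ?Q i\<^esub> F i y = (\<Union>s\<in>F i y. ?X i +>\<^bsub>?V i\<^esub> (c \<cdot>\<^sub>v s))"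
        by (simp add: quotient_linrep_def quotient_space_def linrep_of_def module_vec_simps)
      also have "\<dots> = (\<Union>s\<in>F i y. F i (\<pi> i (vemb (c \<cdot>\<^sub>v s))))"
        by (rule SUP_cong[OF refl], rule coset) (simp add: F_def)
      also have "\<dots> = F i (fscale c y)" by (rule UN[OF y]) (simp add: F_def p_sm)
      finally show ?thesis ..
    qed
    fix x assume x: "x \<in> fV N i"
    show "F i (y + x) = F i y \<oplus>\<^bsub>space ?Q i\<^esub> F i x"
    proof -
      have "F i y \<oplus>\<^bsub>space ?Q i\<^esub> F i x = {s + t | s t. s \<in> F i y \<and> t \<in> F i x}"
        by (auto simp: quotient_linrep_def quotient_space_def linrep_of_def set_add_def set_mult_def module_vec_simps)
      also have "\<dots> = F i (y + x)"
      proof (intro equalityI subsetI)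
        fix u assume "u \<in> {s + t | s t. s \<in> F i y \<and> t \<in> F i x}"
        then obtain s t where "s \<in> F i y" "t \<in> F i x" "u = s + t" by blast
        then show "u \<in> F i (y + x)" using p_add by (simp add: F_def)
      next
        fix u assume u: "u \<in> F i (y + x)"
        then have uc: "u \<in> carrier_vec (rdim M i)" by (simp add: F_def)
        obtain s where s: "s \<in> carrier_vec (rdim M i)" "\<pi> i (vemb s) = y" using surj[OF y] by blast
        have us: "u - s \<in> carrier_vec (rdim M i)" using uc s(1) by simp
        have eq: "u = s + (u - s)" using uc s(1) by (intro eq_vecI) auto
        have "\<pi> i (vemb u) = y + \<pi> i (vemb (u - s))" using p_add[OF s(1) us] eq s(2) by simp
        then have "y + x = y + \<pi> i (vemb (u - s))" using u by (simp add: F_def)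
        then have "u - s \<in> F i x" using us by (simp only: add_left_cancel) (simp add: F_def)
        moreover have "s \<in> F i y" using s by (simp add: F_def)
        ultimately show "u \<in> {s + t | s t. s \<in> F i y \<and> t \<in> F i x}" using eq by blast
      qed
      finally show ?thesis ..
    qed
  next
    fix a y assume y: "y \<in> fV N (src Q a)"
    have "act ?Q a (F (src Q a) y) = (\<Union>s\<in>F (src Q a) y. ?X (tgt Q a) +>\<^bsub>?V (tgt Q a)\<^esub> (rmat M a *\<^sub>v s))"
      by (simp add: quotient_linrep_def linrep_of_def)
    also have "\<dots> = (\<Union>s\<in>F (src Q a) y. F (tgt Q a) (\<pi> (tgt Q a) (vemb (rmat M a *\<^sub>v s))))"
      by (rule SUP_cong[OF refl], rule coset, rule mult_mat_vec_carrier[OF rep_mat[OF M]]) (simp add: F_def)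
    also have "\<dots> = F (tgt Q a) (fA N a y)" by (rule UN[OF y]) (simp add: F_def p_act)
    finally show "F (tgt Q a) (fA N a y) = act ?Q a (F (src Q a) y)" ..
  qed
  then show ?thesis unfolding F_def .
qed

lemma rep_iso_iff_fiso:
  fixes M N :: "('i, 'e, 'k::{field,finite}) rep"
  assumes "is_rep Q M" "is_rep Q N"
  shows "rep_iso Q M N \<longleftrightarrow> fiso Q (emb Q M) (emb Q N)"
  by (rule isomorphic_reps_iff_fiso[OF is_frep_emb[OF assms(1)] is_frep_emb[OF assms(2)]
        models_linrep_of[OF assms(1)] models_linrep_of[OF assms(2)]])

lemma subrep_iff:
  fixes R :: "('i, 'e, 'k::{field,finite}) rep"
  assumes R: "is_rep Q R" and W: "\<And>i. W i \<subseteq> fcoords (rdim R i)"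
  shows "subrep Q (linrep_of R) (\<lambda>i. vec (rdim R i) ` W i) \<longleftrightarrow> fsub Q (emb Q R) W"
proof -
  let ?v = "\<lambda>i. vec (rdim R i) :: (nat \<Rightarrow> 'k) \<Rightarrow> 'k vec"
  have mem: "?v i f \<in> ?v i ` W i \<longleftrightarrow> f \<in> W i" if "f \<in> fcoords (rdim R i)" for i f
    by (rule inj_on_image_mem_iff[OF bij_betw_imp_inj_on[OF vec_bij] that W])
  have WE: "f \<in> fcoords (rdim R i)" if "f \<in> W i" for i f using W that by blast
  have sub: "VectorSpace.subspace class_ring (?v i ` W i) (space (linrep_of R) i) \<longleftrightarrow> fv.subspace (W i)" for i
  proof
    assume "VectorSpace.subspace class_ring (?v i ` W i) (space (linrep_of R) i)"
    then have sm: "LinearCombinations.submodule class_ring (?v i ` W i) (module_vec TYPE('k) (rdim R i))"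
      by (simp add: VectorSpace.subspace_def linrep_of_def)
    show "fv.subspace (W i)"
    proof (rule fv.subspaceI)
      have "0\<^sub>v (rdim R i) \<in> ?v i ` W i"
        using LinearCombinations.submodule.zero_closed[OF sm] by (simp add: module_vec_simps)
      moreover have "0\<^sub>v (rdim R i) = ?v i 0" by (intro eq_vecI) auto
      ultimately have "?v i 0 \<in> ?v i ` W i" by simp
      then show "0 \<in> W i" unfolding mem[OF fv.subspace_0[OF subspace_fcoords]] .
    next
      fix x y assume xy: "x \<in> W i" "y \<in> W i"
      have "?v i x + ?v i y \<in> ?v i ` W i"
        using LinearCombinations.submodule.m_closed[OF sm imageI[OF xy(1)] imageI[OF xy(2)]] by (simp add: module_vec_simps)
      then show "x + y \<in> W i"
        unfolding vec_add[symmetric] mem[OF fv.subspace_add[OF subspace_fcoords WE[OF xy(1)] WE[OF xy(2)]]] .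
    next
      fix c x assume x: "x \<in> W i"
      have "c \<cdot>\<^sub>v ?v i x \<in> ?v i ` W i"
        using LinearCombinations.submodule.smult_closed[OF sm _ imageI[OF x], of c] by (simp add: module_vec_simps class_ring_simps)
      then show "fscale c x \<in> W i"
        unfolding vec_scale[symmetric] mem[OF fv.subspace_scale[OF subspace_fcoords WE[OF x]]] .
    qed
  next
    assume S: "fv.subspace (W i)"
    have "LinearCombinations.submodule class_ring (?v i ` W i) (module_vec TYPE('k) (rdim R i))"
      unfolding LinearCombinations.submodule_def module_vec_simps
    proof (intro conjI allI impI)
      show "?v i ` W i \<subseteq> carrier_vec (rdim R i)" by auto
      show "0\<^sub>v (rdim R i) \<in> ?v i ` W i"
        by (rule image_eqI[OF _ fv.subspace_0[OF S]]) (intro eq_vecI, auto)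
      fix v w assume "v \<in> ?v i ` W i" "w \<in> ?v i ` W i"
      then obtain x y where "x \<in> W i" "y \<in> W i" "v = ?v i x" "w = ?v i y" by blast
      then show "v + w \<in> ?v i ` W i"
        using fv.subspace_add[OF S, of x y] by (intro image_eqI[of _ _ "x + y"]) (simp_all only: vec_add)
    next
      fix c v assume "v \<in> ?v i ` W i"
      then obtain x where "x \<in> W i" "v = ?v i x" by blast
      then show "c \<cdot>\<^sub>v v \<in> ?v i ` W i"
        using fv.subspace_scale[OF S, of x c] by (intro image_eqI[of _ _ "fscale c x"]) (simp_all only: vec_scale)
    qed (rule vec_module)
    then show "VectorSpace.subspace class_ring (?v i ` W i) (space (linrep_of R) i)"
      by (simp add: VectorSpace.subspace_def linrep_of_def vec_vs)
  qed
  have act: "(act (linrep_of R) a ` ?v (src Q a) ` W (src Q a) \<subseteq> ?v (tgt Q a) ` W (tgt Q a)) \<longleftrightarrow>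
     (\<forall>x\<in>W (src Q a). fA (emb Q R) a x \<in> W (tgt Q a))" for a
  proof -
    have "rmat R a *\<^sub>v ?v (src Q a) x \<in> ?v (tgt Q a) ` W (tgt Q a) \<longleftrightarrow> fA (emb Q R) a x \<in> W (tgt Q a)" for x
    proof -
      have "rmat R a *\<^sub>v ?v (src Q a) x = ?v (tgt Q a) (fA (emb Q R) a x)"
        unfolding emb_simps by (rule vec_vemb[OF mult_mat_vec_carrier[OF rep_mat[OF R]], symmetric]) simp
      then show ?thesis using mem[of "fA (emb Q R) a x" "tgt Q a"] emb_act_in[OF R] by simp
    qed
    then show ?thesis by (simp add: linrep_of_simps image_subset_iff)
  qed
  show ?thesis
    unfolding subrep_def fsub_def using sub act W by simp
qed

lemma hall_number_eq_fhall:
  fixes R M N :: "('i, 'e, 'k::{field,finite}) rep"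
  assumes R: "is_rep Q R" and M: "is_rep Q M" and N: "is_rep Q N"
  shows "hall_number Q R M N = fhall Q (emb Q R) (emb Q M) (emb Q N)"
  unfolding hall_number_def fhall_def
proof (rule bij_betw_same_card[symmetric])
  let ?b = "\<lambda>W i. vec (rdim R i) ` W i"
  let ?L = "{W. fsub Q (emb Q R) W \<and> fiso Q (restr (emb Q R) W) (emb Q N) \<and> fquot Q (emb Q R) W (emb Q M)}"
  let ?R = "{X. subrep Q (linrep_of R) X \<and> isomorphic_reps Q (sub_linrep (linrep_of R) X) (linrep_of N) \<and>
    isomorphic_reps Q (quotient_linrep Q (linrep_of R) X) (linrep_of M)}"
  have Rf: "is_frep Q (emb Q R)" by (rule is_frep_emb[OF R])
  have iff: "?b W \<in> ?R \<longleftrightarrow> W \<in> ?L" if W: "fsub Q (emb Q R) W" for W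
  proof -
    have 1: "subrep Q (linrep_of R) (?b W)" using subrep_iff[OF R, of W] W fsub_le[OF W] by simp
    have 2: "isomorphic_reps Q (sub_linrep (linrep_of R) (?b W)) (linrep_of N) \<longleftrightarrow> fiso Q (restr (emb Q R) W) (emb Q N)"
      by (rule isomorphic_reps_iff_fiso[OF fsub_frep[OF Rf W] is_frep_emb[OF N] models_sub_linrep[OF R W] models_linrep_of[OF N]])
    \<comment> \<open>Any model \<open>L\<close> of the quotient translates the condition on the
      coset quotient into one on \<open>fquot\<close>.\<close>
    obtain L \<pi> where L: "is_frep Q L" "fepi Q (emb Q R) L W \<pi>" using quotient_exists[OF Rf W] by blast
    note mq = models_quotient_linrep[OF R L] and mM = models_linrep_of[OF M]
    have "isomorphic_reps Q (quotient_linrep Q (linrep_of R) (?b W)) (linrep_of M) \<longleftrightarrow> fiso Q L (emb Q M)"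
      using isomorphic_reps_iff_fiso[OF L(1) is_frep_emb[OF M] mq mM] .
    also have "\<dots> \<longleftrightarrow> fquot Q (emb Q R) W (emb Q M)"
    proof
      have q: "fquot Q (emb Q R) W L" using L(2) unfolding fquot_def by blast
      show "fiso Q L (emb Q M) \<Longrightarrow> fquot Q (emb Q R) W (emb Q M)" by (rule fquot_iso[OF Rf L(1) q])
      show "fquot Q (emb Q R) W (emb Q M) \<Longrightarrow> fiso Q L (emb Q M)" by (rule fquot_unique[OF Rf L(1) q])
    qed
    finally show ?thesis using 1 2 W by simp
  qed
  show "bij_betw ?b ?L ?R"
    unfolding bij_betw_def
  proof (intro conjI inj_onI equalityI subsetI)
    fix W U assume "W \<in> ?L" "U \<in> ?L" and eq: "?b W = ?b U"
    then have WU: "fsub Q (emb Q R) W" "fsub Q (emb Q R) U" by simp_all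
    show "W = U"
    proof
      fix i
      have "W i \<subseteq> fcoords (rdim R i)" "U i \<subseteq> fcoords (rdim R i)"
        using fsub_le[OF WU(1), of i] fsub_le[OF WU(2), of i] by simp_all
      then show "W i = U i"
        using inj_on_image_eq_iff[OF bij_betw_imp_inj_on[OF vec_bij]] fun_cong[OF eq, of i] by blast
    qed
  next
    fix X assume "X \<in> ?b ` ?L"
    then show "X \<in> ?R" using iff by blast
  next
    fix X assume X: "X \<in> ?R"
    then have sX: "subrep Q (linrep_of R) X" by blast
    have Xc: "X i \<subseteq> carrier_vec (rdim R i)" for i
    proof -
      have "LinearCombinations.submodule class_ring (X i) (module_vec TYPE('k) (rdim R i))"
        using sX by (simp add: subrep_def VectorSpace.subspace_def linrep_of_def)
      from LinearCombinations.submodule.subset[OF this] show ?thesis by (simp add: module_vec_simps)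
    qed
    define W where "W i = vemb ` X i" for i
    have bW: "?b W = X"
    proof
      fix i
      have "vec (rdim R i) ` W i = (\<lambda>v. v) ` X i"
        unfolding W_def image_image by (rule image_cong[OF refl]) (use Xc in \<open>simp add: subset_iff\<close>)
      then show "?b W i = X i" by simp
    qed
    have "W i \<subseteq> fcoords (rdim R i)" for i unfolding W_def using Xc vemb_fcoords by blast
    then have "fsub Q (emb Q R) W" using subrep_iff[OF R, of W] sX bW by simp
    then have "W \<in> ?L" using iff[of W] X bW by simp
    then show "X \<in> ?b ` ?L" using bW by blast
  qed
qed

section \<open>Coordinates and matrices\<close>

lemma lin_on_sum:
  assumes g: "lin_on V g" and V: "fv.subspace V" and S: "finite S" and f: "\<And>s. s \<in> S \<Longrightarrow> f s \<in> V"
  shows "g (\<Sum>s\<in>S. f s) = (\<Sum>s\<in>S. g (f s))"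
  using S f
proof (induction S rule: finite_induct)
  case empty
  show ?case unfolding sum.empty by (rule lin_on_zero[OF g V])
next
  case (insert s S)
  have "(\<Sum>s\<in>S. f s) \<in> V" using insert.prems by (intro fv.subspace_sum[OF V]) simp
  then have "g (f s + (\<Sum>s\<in>S. f s)) = g (f s) + g (\<Sum>s\<in>S. f s)"
    using insert.prems by (intro lin_on_add[OF g]) simp_all
  moreover have "g (\<Sum>s\<in>S. f s) = (\<Sum>s\<in>S. g (f s))"
    by (rule insert.IH) (rule insert.prems, simp)
  ultimately show ?case unfolding sum.insert[OF insert.hyps] by (simp only:)
qed

lemma sum_fun_apply: "(\<Sum>s\<in>S. f s) x = (\<Sum>s\<in>S. f s x)" for f :: "'s \<Rightarrow> 'x \<Rightarrow> 'c::comm_monoid_add"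
  by (induction S rule: infinite_finite_induct) simp_all

definition unit_coord :: "nat \<Rightarrow> nat \<Rightarrow> 'k::field" where
  "unit_coord j = (\<lambda>p. if p = j then 1 else 0)"

lemma unit_coord_fcoords: "j < n \<Longrightarrow> unit_coord j \<in> fcoords n"
  by (simp add: unit_coord_def fcoords_def)

lemma fcoords_expand:
  assumes "f \<in> fcoords n"
  shows "f = (\<Sum>j<n. fscale (f j) (unit_coord j))"
proof
  fix p
  have "(\<Sum>j<n. fscale (f j) (unit_coord j)) p = (\<Sum>j<n. if p = j then f j else 0)"
    unfolding sum_fun_apply by (intro sum.cong refl) (simp add: fscale_def unit_coord_def)
  also have "\<dots> = f p" using fcoordsD[OF assms, of p] by simp
  finally show "f p = (\<Sum>j<n. fscale (f j) (unit_coord j)) p" ..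
qed

lemma lin_on_fcoords_matrix:
  fixes g :: "(nat \<Rightarrow> 'k::field) \<Rightarrow> nat \<Rightarrow> 'k"
  assumes g: "lin_on (fcoords n) g" and f: "f \<in> fcoords n" and gf: "g f \<in> fcoords m"
  shows "vemb (mat m n (\<lambda>(p, j). g (unit_coord j) p) *\<^sub>v vec n f) = g f"
proof
  fix p
  have "g f = g (\<Sum>j<n. fscale (f j) (unit_coord j))" by (rule arg_cong[OF fcoords_expand[OF f]])
  also have "\<dots> = (\<Sum>j<n. g (fscale (f j) (unit_coord j)))"
    by (rule lin_on_sum[OF g subspace_fcoords finite_lessThan])
      (simp add: fv.subspace_scale[OF subspace_fcoords] unit_coord_fcoords)
  also have "\<dots> = (\<Sum>j<n. fscale (f j) (g (unit_coord j)))"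
    by (intro sum.cong refl lin_on_scale[OF g]) (simp add: unit_coord_fcoords)
  finally have gp: "g f p = (\<Sum>j<n. f j * g (unit_coord j) p)"
    by (simp add: sum_fun_apply fscale_def)
  show "vemb (mat m n (\<lambda>(p, j). g (unit_coord j) p) *\<^sub>v vec n f) p = g f p"
  proof (cases "p < m")
    case True
    then show ?thesis unfolding gp
      by (simp add: vemb_def scalar_prod_def lessThan_atLeast0 mult.commute)
  next
    case False
    then show ?thesis using fcoordsD[OF gf, of p] by (simp add: vemb_def)
  qed
qed

lemma subspace_coordinates:
  fixes V :: "(nat \<Rightarrow> 'k::{field,finite}) set"
  assumes V: "fv.subspace V" "finite V"
  obtains b where "lin_on (fcoords (fv.dim V)) b" "bij_betw b (fcoords (fv.dim V)) V"
proof -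
  let ?n = "fv.dim V"
  obtain B where B: "B \<subseteq> V" "finite B" "fv.span B = V" "card B = ?n"
    using subspace_basis[OF V] by metis
  obtain e where e: "bij_betw e {..<?n} B"
    using ex_bij_betw_nat_finite[OF B(2)] B(4) by (auto simp: lessThan_atLeast0)
  define b where "b f = (\<Sum>j<?n. fscale (f j) (e j))" for f
  have add: "b (f + g) = b f + b g" for f g
    by (simp add: b_def fv.scale_left_distrib sum.distrib)
  have sm: "b (fscale c f) = fscale c (b f)" for c f
  proof -
    have "b (fscale c f) = (\<Sum>j<?n. fscale c (fscale (f j) (e j)))" unfolding b_def by (simp add: fscale_def mult.assoc)
    then show ?thesis unfolding b_def by (simp only: fv.scale_sum_right)
  qed
  have eV: "e j \<in> V" if "j < ?n" for j using bij_betwE[OF e] that B(1) by auto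
  have bV: "b f \<in> V" for f
    unfolding b_def by (intro fv.subspace_sum[OF V(1)] fv.subspace_scale[OF V(1)]) (simp add: eV)
  have "V \<subseteq> b ` fcoords ?n"
  proof
    fix x assume "x \<in> V"
    then have "x \<in> range (\<lambda>u. \<Sum>v\<in>B. fscale (u v) v)" using fv.span_finite[OF B(2)] B(3) by simp
    then obtain u where u: "x = (\<Sum>v\<in>B. fscale (u v) v)" by blast
    let ?f = "\<lambda>j. if j < ?n then u (e j) else 0"
    have "b ?f = (\<Sum>j<?n. fscale (u (e j)) (e j))" unfolding b_def by (intro sum.cong refl) simp
    also have "\<dots> = x" unfolding u by (rule sum.reindex_bij_betw[OF e])
    finally show "x \<in> b ` fcoords ?n" by (intro image_eqI[of _ _ ?f]) (simp_all add: fcoords_def)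
  qed
  then have im: "b ` fcoords ?n = V" using bV by blast
  \<comment> \<open>A surjection between finite sets of equal size.\<close>
  have "inj_on b (fcoords ?n)"
    by (rule eq_card_imp_inj_on) (use card_fcoords[where 'k = 'k] card_subspace[OF V] im in simp_all)
  then have "bij_betw b (fcoords ?n) V" using im by (simp add: bij_betw_def)
  moreover have "lin_on (fcoords ?n) b" by (rule lin_onI) (simp_all add: add sm)
  ultimately show ?thesis using that by blast
qed

text \<open>Bases of the vertex spaces turn the arrows into matrices. This assigns isomorphism
  classes of matrix representations to subrepresentations and quotients.\<close>

lemma frep_emb_exists:
  fixes M :: "('i, 'e, 'k::{field,finite}) frep"
  assumes M: "is_frep Q M"
  obtains N where "is_rep Q N" "fiso Q (emb Q N) M"
proof -
  let ?n = "\<lambda>i. fv.dim (fV M i)"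
  have "\<forall>i. \<exists>b. lin_on (fcoords (?n i)) b \<and> bij_betw b (fcoords (?n i)) (fV M i)"
  proof
    fix i
    show "\<exists>b. lin_on (fcoords (?n i)) b \<and> bij_betw b (fcoords (?n i)) (fV M i)"
      using subspace_coordinates[OF frep_sub[OF M] frep_fin[OF M], of i] by metis
  qed
  from choice[OF this] obtain b where b: "\<forall>i. lin_on (fcoords (?n i)) (b i) \<and> bij_betw (b i) (fcoords (?n i)) (fV M i)" ..
  have lin: "lin_on (fcoords (?n i)) (b i)" and bij: "bij_betw (b i) (fcoords (?n i)) (fV M i)" for i using b by blast+
  have im: "b i ` fcoords (?n i) = fV M i" for i by (rule bij_betw_imp_surj_on[OF bij])
  define c where "c i = inv_into (fcoords (?n i)) (b i)" for i
  have clin: "lin_on (fV M i) (c i)" for i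
    using lin_on_inv_into[OF lin subspace_fcoords bij_betw_imp_inj_on[OF bij], of i] by (simp add: im c_def)
  have cin: "c i x \<in> fcoords (?n i)" if "x \<in> fV M i" for i x
    unfolding c_def by (rule inv_into_into) (simp add: im that)
  have bc: "b i (c i x) = x" if "x \<in> fV M i" for i x
    unfolding c_def by (rule bij_betw_inv_into_right[OF bij that])
  have bin: "b i f \<in> fV M i" if "f \<in> fcoords (?n i)" for i f by (rule bij_betwE[OF bij, rule_format, OF that])
  define g where "g a f = c (tgt Q a) (fA M a (b (src Q a) f))" for a f
  have glin: "lin_on (fcoords (?n (src Q a))) (g a)" for a
  proof -
    have "lin_on (fcoords (?n (src Q a))) (\<lambda>f. fA M a (b (src Q a) f))"
      by (rule lin_on_comp[OF lin image_subsetI frep_lin[OF M]]) (rule bin)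
    then show ?thesis unfolding g_def[abs_def]
      by (rule lin_on_comp[OF _ image_subsetI clin]) (rule frep_act[OF M bin])
  qed
  have gin: "g a f \<in> fcoords (?n (tgt Q a))" if "f \<in> fcoords (?n (src Q a))" for a f
    unfolding g_def by (rule cin[OF frep_act[OF M bin[OF that]]])
  define N where "N = \<lparr>rdim = ?n, rmat = (\<lambda>a. mat (?n (tgt Q a)) (?n (src Q a)) (\<lambda>(p, j). g a (unit_coord j) p))\<rparr>"
  have N: "is_rep Q N" by (simp add: is_rep_def N_def)
  have act: "fA (emb Q N) a f = g a f" if "f \<in> fcoords (?n (src Q a))" for a f
    using lin_on_fcoords_matrix[OF glin that gin[OF that]] by (simp add: N_def)
  have "fhom Q (emb Q N) M b"
    unfolding fhom_def
  proof (intro conjI allI ballI)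
    fix i
    show "lin_on (fV (emb Q N) i) (b i)" using lin by (simp add: N_def)
    show "b i x \<in> fV M i" if "x \<in> fV (emb Q N) i" for x using bin that by (simp add: N_def)
  next
    fix a x assume "x \<in> fV (emb Q N) (src Q a)"
    then have x: "x \<in> fcoords (?n (src Q a))" by (simp add: N_def)
    show "b (tgt Q a) (fA (emb Q N) a x) = fA M a (b (src Q a) x)"
      unfolding act[OF x] g_def by (rule bc[OF frep_act[OF M bin[OF x]]])
  qed
  moreover have "bij_betw (b i) (fV (emb Q N) i) (fV M i)" for i using bij by (simp add: N_def)
  ultimately have "fiso Q (emb Q N) M" unfolding fiso_iff_bij[OF is_frep_emb[OF N]] by blast
  then show ?thesis by (rule that[OF N])
qed

section \<open>Direct sums of matrix representations\<close>

lemma is_rep_sum: "is_rep Q A \<Longrightarrow> is_rep Q B \<Longrightarrow> is_rep Q (rep_sum Q A B)"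
  by (simp add: is_rep_def rep_sum_def)

definition fshift :: "nat \<Rightarrow> (nat \<Rightarrow> 'k::field) \<Rightarrow> nat \<Rightarrow> 'k" where
  "fshift a f = (\<lambda>j. if a \<le> j then f (j - a) else 0)"

lemma fshift_fcoords: "f \<in> fcoords b \<Longrightarrow> fshift a f \<in> fcoords (a + b)"
  by (simp add: fshift_def fcoords_def)

lemma emb_rep_sum_act:
  fixes A B :: "('i, 'e, 'k::{field,finite}) rep"
  assumes A: "is_rep Q A" and B: "is_rep Q B"
    and x: "x \<in> fcoords (rdim A (src Q a))" and y: "y \<in> fcoords (rdim B (src Q a))"
  shows "fA (emb Q (rep_sum Q A B)) a (x + fshift (rdim A (src Q a)) y)
     = fA (emb Q A) a x + fshift (rdim A (tgt Q a)) (fA (emb Q B) a y)"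
proof -
  let ?as = "rdim A (src Q a)" and ?bs = "rdim B (src Q a)" and ?at = "rdim A (tgt Q a)" and ?bt = "rdim B (tgt Q a)"
  note a = rep_mat[OF A, of a] and b = rep_mat[OF B, of a]
  have v: "vec (?as + ?bs) (x + fshift ?as y) = vec ?as x @\<^sub>v vec ?bs y"
    using fcoordsD[OF x] by (intro eq_vecI) (auto simp: fshift_def)
  have zm: "0\<^sub>m n m *\<^sub>v vec m f = 0\<^sub>v n" for n m and f :: "nat \<Rightarrow> 'k"
    by (intro eq_vecI) (auto simp: scalar_prod_def)
  have "four_block_mat (rmat A a) (0\<^sub>m ?at ?bs) (0\<^sub>m ?bt ?as) (rmat B a) *\<^sub>v (vec ?as x @\<^sub>v vec ?bs y)
      = (rmat A a *\<^sub>v vec ?as x) @\<^sub>v (rmat B a *\<^sub>v vec ?bs y)"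
    using four_block_mat_mult_vec[OF a zero_carrier_mat zero_carrier_mat b vec_carrier vec_carrier, of x y]
      mult_mat_vec_carrier[OF a vec_carrier, of x] mult_mat_vec_carrier[OF b vec_carrier, of y]
    by (simp add: zm)
  then have "fA (emb Q (rep_sum Q A B)) a (x + fshift ?as y)
      = vemb ((rmat A a *\<^sub>v vec ?as x) @\<^sub>v (rmat B a *\<^sub>v vec ?bs y))"
    unfolding emb_simps by (simp only: rep_sum_def rep.simps v)
  also have "\<dots> = vemb (rmat A a *\<^sub>v vec ?as x) + fshift ?at (vemb (rmat B a *\<^sub>v vec ?bs y))"
    using a b by (auto simp: vemb_def fshift_def fun_eq_iff)
  finally show ?thesis by simp
qed

lemma emb_rep_sum:
  fixes A B :: "('i, 'e, 'k::{field,finite}) rep"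
  assumes A: "is_rep Q A" and B: "is_rep Q B"
  obtains W C where "fdecomp Q (emb Q (rep_sum Q A B)) W C"
    "fiso Q (emb Q A) (restr (emb Q (rep_sum Q A B)) W)" "fiso Q (emb Q B) (restr (emb Q (rep_sum Q A B)) C)"
proof -
  let ?S = "emb Q (rep_sum Q A B)"
  note Af = is_frep_emb[OF A] and Bf = is_frep_emb[OF B] and Sf = is_frep_emb[OF is_rep_sum[OF A B]]
  have SV: "fV ?S i = fcoords (rdim A i + rdim B i)" for i by (simp add: rep_sum_def)
  have AV: "fV (emb Q A) i = fcoords (rdim A i)" and BV: "fV (emb Q B) i = fcoords (rdim B i)" for i by simp_all
  define \<alpha> where "\<alpha> = (\<lambda>(i::'i) (x::nat \<Rightarrow> 'k). x)"
  define \<beta> where "\<beta> = (\<lambda>i. fshift (rdim A i) :: (nat \<Rightarrow> 'k) \<Rightarrow> nat \<Rightarrow> 'k)"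
  have sh0: "fshift n (0 :: nat \<Rightarrow> 'k) = 0" for n by (simp add: fshift_def fun_eq_iff)
  have z: "0 \<in> (fcoords n :: (nat \<Rightarrow> 'k) set)" for n by (rule fv.subspace_0[OF subspace_fcoords])
  have act0: "fA (emb Q M) a 0 = 0" if "is_rep Q M" for M :: "('i, 'e, 'k) rep" and a
    by (rule lin_on_zero[OF frep_lin[OF is_frep_emb[OF that]] frep_sub[OF is_frep_emb[OF that]]])
  have \<alpha>h: "fhom Q (emb Q A) ?S \<alpha>"
    unfolding fhom_def
  proof (intro conjI allI ballI)
    fix i
    show "lin_on (fV (emb Q A) i) (\<alpha> i)" unfolding \<alpha>_def by (rule lin_on_id)
    show "\<alpha> i x \<in> fV ?S i" if "x \<in> fV (emb Q A) i" for x
      using that unfolding SV AV by (simp add: \<alpha>_def fcoords_def)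
  next
    fix a x assume "x \<in> fV (emb Q A) (src Q a)"
    then have x: "x \<in> fcoords (rdim A (src Q a))" by simp
    show "\<alpha> (tgt Q a) (fA (emb Q A) a x) = fA ?S a (\<alpha> (src Q a) x)"
      using emb_rep_sum_act[OF A B x z] unfolding sh0 act0[OF B] \<alpha>_def add_0_right ..
  qed
  have \<beta>h: "fhom Q (emb Q B) ?S \<beta>"
    unfolding fhom_def
  proof (intro conjI allI ballI)
    fix i
    show "lin_on (fV (emb Q B) i) (\<beta> i)"
      by (rule lin_onI) (auto simp: \<beta>_def fshift_def fscale_def fun_eq_iff)
    show "\<beta> i x \<in> fV ?S i" if "x \<in> fV (emb Q B) i" for x
      using that unfolding SV BV \<beta>_def by (rule fshift_fcoords)
  next
    fix a x assume "x \<in> fV (emb Q B) (src Q a)"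
    then have x: "x \<in> fcoords (rdim B (src Q a))" by simp
    show "\<beta> (tgt Q a) (fA (emb Q B) a x) = fA ?S a (\<beta> (src Q a) x)"
      using emb_rep_sum_act[OF A B z x] unfolding act0[OF A] \<beta>_def add_0_left ..
  qed
  let ?W = "\<lambda>i. \<alpha> i ` fV (emb Q A) i" and ?C = "\<lambda>i. \<beta> i ` fV (emb Q B) i"
  have W: "fsub Q ?S ?W" by (rule fsub_image[OF Af \<alpha>h fsub_full[OF Af]])
  have C: "fsub Q ?S ?C" by (rule fsub_image[OF Bf \<beta>h fsub_full[OF Bf]])
  have "fdecomp Q ?S ?W ?C"
    unfolding fdecomp_def
  proof (intro conjI allI ballI impI W C)
    fix i x assume "x \<in> ?W i" "x \<in> ?C i"
    then obtain y where x: "x \<in> fcoords (rdim A i)" and y: "x = fshift (rdim A i) y"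
      by (auto simp: \<alpha>_def \<beta>_def)
    show "x = 0"
    proof
      fix j show "x j = 0 j" using fcoordsD[OF x, of j] by (cases "j < rdim A i") (simp_all add: y fshift_def)
    qed
  next
    fix i x assume "x \<in> fV ?S i"
    then have x: "x \<in> fcoords (rdim A i + rdim B i)" unfolding SV .
    let ?w = "\<lambda>j. if j < rdim A i then x j else 0" and ?c = "\<lambda>j. x (j + rdim A i)"
    have "?w \<in> ?W i" by (simp add: \<alpha>_def fcoords_def)
    moreover have "fshift (rdim A i) ?c \<in> ?C i"
      unfolding \<beta>_def using fcoordsD[OF x] by (intro imageI) (simp add: fcoords_def)
    moreover have "x = ?w + fshift (rdim A i) ?c" by (rule ext) (simp add: fshift_def)
    ultimately show "\<exists>w\<in>?W i. \<exists>c\<in>?C i. x = w + c" by blast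
  qed
  moreover have "fiso Q (emb Q A) (restr ?S ?W)"
  proof -
    have "(\<lambda>i. {x \<in> fV (emb Q A) i. \<alpha> i x = 0}) = (\<lambda>i. {0})" using z by (auto simp: \<alpha>_def fun_eq_iff)
    then show ?thesis using fepi_onto_image[OF \<alpha>h] unfolding fiso_def fquot_def by auto
  qed
  moreover have "fiso Q (emb Q B) (restr ?S ?C)"
  proof -
    have inj: "x = 0" if "fshift n x = 0" for n and x :: "nat \<Rightarrow> 'k"
    proof
      fix j show "x j = 0 j" using fun_cong[OF that, of "j + n"] by (simp add: fshift_def)
    qed
    have "{x \<in> fV (emb Q B) i. \<beta> i x = 0} = {0}" for i
    proof (intro equalityI subsetI)
      fix x assume "x \<in> {x \<in> fV (emb Q B) i. \<beta> i x = 0}"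
      then have "fshift (rdim A i) x = 0" unfolding \<beta>_def by blast
      then show "x \<in> {0}" unfolding singleton_iff by (rule inj)
    next
      fix x assume "x \<in> {0 :: nat \<Rightarrow> 'k}"
      then show "x \<in> {x \<in> fV (emb Q B) i. \<beta> i x = 0}"
        unfolding singleton_iff BV mem_Collect_eq \<beta>_def using z sh0 by (simp only: simp_thms)
    qed
    then have "(\<lambda>i. {x \<in> fV (emb Q B) i. \<beta> i x = 0}) = (\<lambda>i. {0})" by (rule ext)
    then show ?thesis using fepi_onto_image[OF \<beta>h] unfolding fiso_def fquot_def by auto
  qed
  ultimately show ?thesis by (rule that)
qed

lemma fdecomp_iso:
  assumes M: "is_frep Q M" and N: "is_frep Q N" and iso: "fiso Q M N" and D: "fdecomp Q M W C"
  obtains W' C' where "fdecomp Q N W' C'" "fiso Q (restr M W) (restr N W')" "fiso Q (restr M C) (restr N C')"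
proof -
  obtain \<phi> where \<phi>: "fepi Q M N (\<lambda>i. {0}) \<phi>" using iso unfolding fiso_def fquot_def ..
  note h = fepi_hom[OF \<phi>] and W = fdecomp_sub1[OF D] and C = fdecomp_sub2[OF D]
  have inj: "x = 0" if "x \<in> fV M i" "\<phi> i x = 0" for i x using fepi_ker[OF \<phi>, of i] that by auto
  have z: "\<phi> i 0 = 0" for i by (rule lin_on_zero[OF fhom_lin[OF h] frep_sub[OF M]])
  have sub: "fiso Q (restr M U) (restr N (\<lambda>i. \<phi> i ` U i))" if U: "fsub Q M U" for U
  proof -
    have "(\<lambda>i. {x \<in> U i. \<phi> i x = 0}) = (\<lambda>i. {0})"
    proof (intro ext equalityI subsetI)
      fix i x assume "x \<in> {x \<in> U i. \<phi> i x = 0}"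
      then have "x \<in> U i" "\<phi> i x = 0" by simp_all
      then show "x \<in> {0}" using inj[OF fsub_in[OF U]] by simp
    qed (simp add: z fv.subspace_0[OF fsub_subspace[OF U]])
    then show ?thesis
      using fepi_onto_image[OF fhom_restrict[OF h U]] unfolding fiso_def fquot_def restr_simps by auto
  qed
  have "fdecomp Q N (\<lambda>i. \<phi> i ` W i) (\<lambda>i. \<phi> i ` C i)"
    unfolding fdecomp_def
  proof (intro conjI allI ballI impI fsub_image[OF M h W] fsub_image[OF M h C])
    fix i x assume "x \<in> \<phi> i ` W i" "x \<in> \<phi> i ` C i"
    then obtain w c where wc: "w \<in> W i" "c \<in> C i" "x = \<phi> i w" "x = \<phi> i c" by blast
    have wM: "w \<in> fV M i" and cM: "c \<in> fV M i" by (rule fsub_in[OF W wc(1)], rule fsub_in[OF C wc(2)])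
    have "\<phi> i (w - c) = 0" using lin_on_diff[OF fhom_lin[OF h] frep_sub[OF M] wM cM] wc(3,4) by simp
    then have "w - c = 0" by (rule inj[OF fv.subspace_diff[OF frep_sub[OF M] wM cM]])
    then have "w = c" by (simp only: right_minus_eq)
    then have "w = 0" using fdecomp_inter[OF D wc(1)] wc(2) by simp
    then show "x = 0" using wc(3) z by simp
  next
    fix i y assume "y \<in> fV N i"
    then have "y \<in> \<phi> i ` fV M i" unfolding fepi_image[OF \<phi>] .
    then obtain x where x: "x \<in> fV M i" "y = \<phi> i x" by blast
    obtain w c where wc: "w \<in> W i" "c \<in> C i" "x = w + c" using fdecomp_ex[OF D x(1)] by blast
    have "y = \<phi> i w + \<phi> i c"
      unfolding x(2) wc(3) by (rule lin_on_add[OF fhom_lin[OF h] fsub_in[OF W wc(1)] fsub_in[OF C wc(2)]])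
    then show "\<exists>w\<in>\<phi> i ` W i. \<exists>c\<in>\<phi> i ` C i. y = w + c" 
      by (intro bexI[of _ "\<phi> i w"] bexI[of _ "\<phi> i c"] imageI wc)
  qed
  then show ?thesis using sub[OF W] sub[OF C] by (rule that)
qed

text \<open>Translates the block sums in the definitions of \<open>indecomposable\<close> and
  \<open>direct_summand\<close> into internal decompositions.\<close>

lemma rep_iso_rep_sum:
  fixes M A B :: "('i, 'e, 'k::{field,finite}) rep"
  assumes M: "is_rep Q M" and A: "is_rep Q A" and B: "is_rep Q B"
  shows "rep_iso Q M (rep_sum Q A B) \<longleftrightarrow>
    (\<exists>W C. fdecomp Q (emb Q M) W C \<and> fiso Q (emb Q A) (restr (emb Q M) W) \<and> fiso Q (emb Q B) (restr (emb Q M) C))"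
proof -
  note Mf = is_frep_emb[OF M] and Af = is_frep_emb[OF A] and Bf = is_frep_emb[OF B]
    and Sf = is_frep_emb[OF is_rep_sum[OF A B]]
  obtain U D where U: "fdecomp Q (emb Q (rep_sum Q A B)) U D"
    "fiso Q (emb Q A) (restr (emb Q (rep_sum Q A B)) U)" "fiso Q (emb Q B) (restr (emb Q (rep_sum Q A B)) D)"
    using emb_rep_sum[OF A B] by blast
  show ?thesis
    unfolding rep_iso_iff_fiso[OF M is_rep_sum[OF A B]]
  proof
    assume "fiso Q (emb Q M) (emb Q (rep_sum Q A B))"
    then have "fiso Q (emb Q (rep_sum Q A B)) (emb Q M)" by (rule fiso_sym[OF Mf Sf])
    then obtain W C where "fdecomp Q (emb Q M) W C"
      "fiso Q (restr (emb Q (rep_sum Q A B)) U) (restr (emb Q M) W)"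
      "fiso Q (restr (emb Q (rep_sum Q A B)) D) (restr (emb Q M) C)"
      using fdecomp_iso[OF Sf Mf _ U(1)] by blast
    moreover have "is_frep Q (restr (emb Q (rep_sum Q A B)) U)" "is_frep Q (restr (emb Q (rep_sum Q A B)) D)"
      by (rule fsub_frep[OF Sf fdecomp_sub1[OF U(1)]], rule fsub_frep[OF Sf fdecomp_sub2[OF U(1)]])
    ultimately show "\<exists>W C. fdecomp Q (emb Q M) W C \<and> fiso Q (emb Q A) (restr (emb Q M) W) \<and> fiso Q (emb Q B) (restr (emb Q M) C)"
      using fiso_trans[OF Af _ U(2)] fiso_trans[OF Bf _ U(3)] by blast
  next
    assume "\<exists>W C. fdecomp Q (emb Q M) W C \<and> fiso Q (emb Q A) (restr (emb Q M) W) \<and> fiso Q (emb Q B) (restr (emb Q M) C)"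
    then obtain W C where D: "fdecomp Q (emb Q M) W C" and iW: "fiso Q (emb Q A) (restr (emb Q M) W)"
      and iC: "fiso Q (emb Q B) (restr (emb Q M) C)" by blast
    have Wf: "is_frep Q (restr (emb Q M) W)" and Cf: "is_frep Q (restr (emb Q M) C)"
      by (rule fsub_frep[OF Mf fdecomp_sub1[OF D]], rule fsub_frep[OF Mf fdecomp_sub2[OF D]])
    show "fiso Q (emb Q M) (emb Q (rep_sum Q A B))"
      by (rule fiso_decomp[OF Mf Sf D U(1) fiso_trans[OF Wf Af fiso_sym[OF Af Wf iW] U(2)]
            fiso_trans[OF Cf Bf fiso_sym[OF Bf Cf iC] U(3)]])
  qed
qed

lemma fiso_zero_iff:
  fixes M :: "('i::finite, 'e, 'k::{field,finite}) frep"
  assumes M: "is_frep Q M" and N: "is_frep Q N" and iso: "fiso Q M N"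
  shows "fV M = (\<lambda>i. {0}) \<longleftrightarrow> fV N = (\<lambda>i. {0})"
proof -
  have "fV L = (\<lambda>i. {0}) \<longleftrightarrow> rsize (fV L) = 0" if "is_frep Q L" for L :: "('i, 'e, 'k) frep"
  proof
    assume "fV L = (\<lambda>i. {0})"
    then show "rsize (fV L) = 0" by (simp only: rsize_zero)
  next
    assume z: "rsize (fV L) = 0"
    show "fV L = (\<lambda>i. {0})"
    proof (rule ccontr)
      assume "fV L \<noteq> (\<lambda>i. {0})"
      from rsize_pos[OF that fsub_full[OF that] this] z show False by simp
    qed
  qed
  moreover have "rsize (fV M) = rsize (fV N)"
    using iso rsize_fepi[OF M] unfolding fiso_def fquot_def by fastforce
  ultimately show ?thesis using M N by simp
qed

lemma findec_imp_indecomposable: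
  fixes M :: "('i::finite, 'e, 'k::{field,finite}) rep"
  assumes M: "is_rep Q M" and N: "is_frep Q N" and iso: "fiso Q (emb Q M) N" and ind: "findec Q N"
  shows "indecomposable Q M"
  unfolding indecomposable_def
proof (intro conjI allI impI M)
  note Mf = is_frep_emb[OF M]
  show "\<not> is_zero_rep M"
    using ind fiso_zero_iff[OF Mf N iso] unfolding findec_def is_zero_rep_emb[of M Q] by blast
  fix A B assume "is_rep Q A \<and> is_rep Q B \<and> rep_iso Q M (rep_sum Q A B)"
  then have A: "is_rep Q A" and B: "is_rep Q B" and "rep_iso Q M (rep_sum Q A B)" by blast+
  then obtain W C where D: "fdecomp Q (emb Q M) W C" "fiso Q (emb Q A) (restr (emb Q M) W)"
    "fiso Q (emb Q B) (restr (emb Q M) C)" using rep_iso_rep_sum[OF M A B] by blast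
  obtain W' C' where D': "fdecomp Q N W' C'" "fiso Q (restr (emb Q M) W) (restr N W')"
    "fiso Q (restr (emb Q M) C) (restr N C')" using fdecomp_iso[OF Mf N iso D(1)] by blast
  have Wf: "is_frep Q (restr (emb Q M) W)" and Cf: "is_frep Q (restr (emb Q M) C)"
    by (rule fsub_frep[OF Mf fdecomp_sub1[OF D(1)]], rule fsub_frep[OF Mf fdecomp_sub2[OF D(1)]])
  have Wf': "is_frep Q (restr N W')" and Cf': "is_frep Q (restr N C')"
    by (rule fsub_frep[OF N fdecomp_sub1[OF D'(1)]], rule fsub_frep[OF N fdecomp_sub2[OF D'(1)]])
  have "W' = (\<lambda>i. {0}) \<or> C' = (\<lambda>i. {0})" using ind D'(1) unfolding findec_def by blast
  then show "is_zero_rep A \<or> is_zero_rep B"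
    using fiso_zero_iff[OF is_frep_emb[OF A] Wf D(2)] fiso_zero_iff[OF Wf Wf' D'(2)]
      fiso_zero_iff[OF is_frep_emb[OF B] Cf D(3)] fiso_zero_iff[OF Cf Cf' D'(3)]
    unfolding is_zero_rep_emb[of A Q] is_zero_rep_emb[of B Q] by simp
qed

section \<open>Regular representations are the semistable ones\<close>

text \<open>With \<open>delta Q\<close> for \<open>d\<close>, the function \<open>th\<close> becomes
  the defect of the definitions.\<close>

locale affine_rep = affine_form Q "delta Q" for Q :: "('i::finite, 'e::finite) quiver"
begin

lemma th_emb:
  fixes M :: "('i, 'e, 'k::{field,finite}) rep"
  shows "th (fV (emb Q M)) = defect Q M"
  unfolding th_def defect_def fdim_emb ..

lemma direct_summand_fdecomp:
  fixes M :: "('i, 'e, 'k::{field,finite}) rep"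
  assumes M: "is_rep Q M" and N: "indecomposable Q N" and D: "direct_summand Q N M"
  obtains W C where "fdecomp Q (emb Q M) W C" "W \<noteq> (\<lambda>i. {0})" "th W = defect Q N"
proof -
  have Nr: "is_rep Q N" and Nz: "\<not> is_zero_rep N" using N unfolding indecomposable_def by blast+
  obtain N' where "is_rep Q N'" "rep_iso Q M (rep_sum Q N N')" using D unfolding direct_summand_def by blast
  then obtain W C where D: "fdecomp Q (emb Q M) W C" and iso: "fiso Q (emb Q N) (restr (emb Q M) W)"
    using rep_iso_rep_sum[OF M Nr] by blast
  note Nf = is_frep_emb[OF Nr] and Wf = fsub_frep[OF is_frep_emb[OF M] fdecomp_sub1[OF D]]
  have "W \<noteq> (\<lambda>i. {0})"
    using fiso_zero_iff[OF Nf Wf iso] Nz unfolding is_zero_rep_emb[of N Q] restr_simps by blast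
  moreover have "th W = defect Q N" using th_iso[OF Nf iso] unfolding th_emb restr_simps by simp
  ultimately show ?thesis by (rule that[OF D])
qed

lemma tors_preinjective:
  fixes M :: "('i, 'e, 'k::{field,finite}) rep"
  assumes M: "is_rep Q M" and t: "tors 1 (emb Q M)"
  shows "preinjective Q M"
  unfolding preinjective_def
proof (intro conjI allI impI M, elim conjE)
  fix N assume "indecomposable Q N" "direct_summand Q N M"
  then obtain W C where D: "fdecomp Q (emb Q M) W C" "W \<noteq> (\<lambda>i. {0})" "th W = defect Q N"
    using direct_summand_fdecomp[OF M] by blast
  from tors_summand[OF is_frep_emb[OF M] D(1) t D(2)] show "defect Q N > 0" unfolding D(3) by simp
qed

lemma tfree_preprojective:
  fixes M :: "('i, 'e, 'k::{field,finite}) rep"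
  assumes M: "is_rep Q M" and t: "tfree 0 (emb Q M)"
  shows "preprojective Q M"
  unfolding preprojective_def
proof (intro conjI allI impI M, elim conjE)
  fix N assume "indecomposable Q N" "direct_summand Q N M"
  then obtain W C where D: "fdecomp Q (emb Q M) W C" "W \<noteq> (\<lambda>i. {0})" "th W = defect Q N"
    using direct_summand_fdecomp[OF M] by blast
  from tfreeD[OF t fdecomp_sub1[OF D(1)] D(2)] show "defect Q N < 0" unfolding D(3) .
qed

text \<open>Semistability with respect to the defect, as the overlap of the two torsion
  pairs.\<close>

definition semi :: "('i, 'e, 'k::field) frep \<Rightarrow> bool" where
  "semi M \<longleftrightarrow> tors 0 M \<and> tfree 1 M"

lemma semi_regular:
  fixes M :: "('i, 'e, 'k::{field,finite}) rep"
  assumes M: "is_rep Q M" and s: "semi (emb Q M)"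
  shows "regular Q M"
  unfolding regular_def
proof (intro conjI allI impI M, elim conjE)
  fix N assume "indecomposable Q N" "direct_summand Q N M"
  then obtain W C where D: "fdecomp Q (emb Q M) W C" "W \<noteq> (\<lambda>i. {0})" "th W = defect Q N"
    using direct_summand_fdecomp[OF M] by blast
  have "0 \<le> th W" using tors_summand[OF is_frep_emb[OF M] D(1) _ D(2)] s unfolding semi_def by blast
  moreover have "th W < 1" using tfreeD[OF _ fdecomp_sub1[OF D(1)] D(2)] s unfolding semi_def by blast
  ultimately show "defect Q N = 0" unfolding D(3)[symmetric] by simp
qed

text \<open>The way in which regularity, a condition on indecomposable summands, is used: every
  non-zero summand contains an indecomposable one, which is a summand of \<open>M\<close> and so has
  defect 0.\<close>

lemma regular_summand:
  fixes M :: "('i, 'e, 'k::{field,finite}) rep"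
  assumes reg: "regular Q M" and D: "fdecomp Q (emb Q M) W C" and W: "W \<noteq> (\<lambda>i. {0})"
  obtains U V where "fdecomp Q (restr (emb Q M) W) U V" "U \<noteq> (\<lambda>i. {0})" "th U = 0"
proof -
  have M: "is_rep Q M" using reg unfolding regular_def by blast
  note Mf = is_frep_emb[OF M]
  have Wf: "is_frep Q (restr (emb Q M) W)" by (rule fsub_frep[OF Mf fdecomp_sub1[OF D]])
  obtain U V where UV: "fdecomp Q (restr (emb Q M) W) U V" "findec Q (restr (restr (emb Q M) W) U)"
    using findec_summand[OF Wf] W unfolding restr_simps by metis
  let ?V = "\<lambda>i. {b + c |b c. b \<in> V i \<and> c \<in> C i}"
  have D': "fdecomp Q (emb Q M) U ?V" by (rule fdecomp_refine[OF Mf D UV(1)])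
  have Uf: "is_frep Q (restr (emb Q M) U)" and Vf: "is_frep Q (restr (emb Q M) ?V)"
    by (rule fsub_frep[OF Mf fdecomp_sub1[OF D']], rule fsub_frep[OF Mf fdecomp_sub2[OF D']])
  obtain N where N: "is_rep Q N" "fiso Q (emb Q N) (restr (emb Q M) U)" by (rule frep_emb_exists[OF Uf]) blast
  obtain N' where N': "is_rep Q N'" "fiso Q (emb Q N') (restr (emb Q M) ?V)" by (rule frep_emb_exists[OF Vf]) blast
  have "direct_summand Q N M"
    unfolding direct_summand_def using N N' D' rep_iso_rep_sum[OF M N(1) N'(1)] by blast
  moreover have fi: "findec Q (restr (emb Q M) U)" using UV(2) by simp
  then have "indecomposable Q N" by (rule findec_imp_indecomposable[OF N(1) Uf N(2)])
  ultimately have "defect Q N = 0" using reg unfolding regular_def by blast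
  then have "th U = 0" using th_iso[OF is_frep_emb[OF N(1)] N(2)] unfolding th_emb restr_simps by simp
  moreover have "U \<noteq> (\<lambda>i. {0})" using fi unfolding findec_def restr_simps by blast
  ultimately show ?thesis using that[OF UV(1)] by blast
qed

lemma fquot_full:
  assumes D: "fdecomp Q M W C" and C: "C = (\<lambda>i. {0})"
  shows "W = fV M"
proof (intro ext equalityI subsetI)
  fix i x assume "x \<in> W i" then show "x \<in> fV M i" by (rule fsub_in[OF fdecomp_sub1[OF D]])
next
  fix i x assume "x \<in> fV M i"
  then obtain w c where "w \<in> W i" "c \<in> C i" "x = w + c" using fdecomp_ex[OF D] by blast
  then show "x \<in> W i" by (simp add: C)
qed

text \<open>The torsion part for \<open>t = 1\<close> splits off; if it were not zero, it would have
  a summand of defect 0, yet its non-zero summands have defect at least 1. For \<open>t = 0\<close>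
  the torsion free part is removed in the same way.\<close>

lemma regular_semi:
  fixes M :: "('i, 'e, 'k::{field,finite}) rep"
  assumes reg: "regular Q M"
  shows "semi (emb Q M)"
proof -
  have M: "is_rep Q M" using reg unfolding regular_def by blast
  note Mf = is_frep_emb[OF M]
  have "tfree 1 (emb Q M)"
  proof -
    obtain W N \<pi> where W: "fsub Q (emb Q M) W" "tors 1 (restr (emb Q M) W)"
      and N: "is_frep Q N" "fepi Q (emb Q M) N W \<pi>" "tfree 1 N"
      using torsion_decomposition[OF Mf, of 1] by auto
    have q: "fquot Q (emb Q M) W N" using N(2) unfolding fquot_def by blast
    have "W = (\<lambda>i. {0})"
    proof (rule ccontr)
      assume ne: "W \<noteq> (\<lambda>i. {0})"
      obtain C where C: "fdecomp Q (emb Q M) W C"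
        using extension_splits[OF Mf N(1) W(1) q _ W(2) N(3)] by auto
      obtain U V where U: "fdecomp Q (restr (emb Q M) W) U V" "U \<noteq> (\<lambda>i. {0})" "th U = 0"
        by (rule regular_summand[OF reg C ne]) blast
      have "1 \<le> th U" by (rule tors_summand[OF fsub_frep[OF Mf W(1)] U(1) W(2) U(2)])
      then show False using U(3) by simp
    qed
    then have "fiso Q (emb Q M) N" using q unfolding fiso_def by simp
    then show ?thesis by (rule tfree_iso[OF Mf _ N(3)])
  qed
  moreover have "tors 0 (emb Q M)"
  proof -
    obtain W N \<pi> where W: "fsub Q (emb Q M) W" "tors 0 (restr (emb Q M) W)"
      and N: "is_frep Q N" "fepi Q (emb Q M) N W \<pi>" "tfree 0 N"
      using torsion_decomposition[OF Mf, of 0] by auto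
    have q: "fquot Q (emb Q M) W N" using N(2) unfolding fquot_def by blast
    obtain C where C: "fdecomp Q (emb Q M) W C" "fiso Q N (restr (emb Q M) C)"
      using extension_splits[OF Mf N(1) W(1) q _ W(2) N(3)] by auto
    have Cf: "is_frep Q (restr (emb Q M) C)" by (rule fsub_frep[OF Mf fdecomp_sub2[OF C(1)]])
    have CF: "tfree 0 (restr (emb Q M) C)" by (rule tfree_iso[OF Cf fiso_sym[OF N(1) Cf C(2)] N(3)])
    have "C = (\<lambda>i. {0})"
    proof (rule ccontr)
      assume ne: "C \<noteq> (\<lambda>i. {0})"
      obtain U V where U: "fdecomp Q (restr (emb Q M) C) U V" "U \<noteq> (\<lambda>i. {0})" "th U = 0"
        by (rule regular_summand[OF reg fdecomp_commute[OF C(1)] ne]) blast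
      have "th U < 0" by (rule tfreeD[OF CF fdecomp_sub1[OF U(1)] U(2)])
      then show False using U(3) by simp
    qed
    then have "W = fV (emb Q M)" by (rule fquot_full[OF C(1)])
    then show ?thesis using W(2) by (simp only: restr_simps)
  qed
  ultimately show ?thesis unfolding semi_def by blast
qed

lemma semi_iso:
  fixes M :: "('i, 'e, 'k::{field,finite}) frep"
  assumes M: "is_frep Q M" and N: "is_frep Q N" and iso: "fiso Q M N" and s: "semi M"
  shows "semi N"
  using tors_iso[OF M iso] tfree_iso[OF N fiso_sym[OF M N iso]] s unfolding semi_def by blast

lemma semi_sub_le:
  fixes M :: "('i, 'e, 'k::{field,finite}) frep"
  assumes "semi M" "fsub Q M U"
  shows "th U \<le> 0"
proof (cases "U = (\<lambda>i. {0})")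
  case True
  then show ?thesis by (simp only: th_zero)
next
  case False
  then have "th U < 1" using tfreeD[OF _ assms(2) False] assms(1) unfolding semi_def by blast
  then show ?thesis by simp
qed

lemma semi_th:
  fixes M :: "('i, 'e, 'k::{field,finite}) frep"
  assumes M: "is_frep Q M" and s: "semi M"
  shows "th (fV M) = 0"
proof (cases "fV M = (\<lambda>i. {0})")
  case True
  then show ?thesis by (simp only: th_zero)
next
  case False
  have t: "tors 0 M" using s unfolding semi_def by blast
  have "0 \<le> th (fV M) - th (\<lambda>i. {0} :: (nat \<Rightarrow> 'k) set)"
    using torsD[OF t fsub_zero[OF M]] False by metis
  then show ?thesis using semi_sub_le[OF s fsub_full[OF M]] by simp
qed

text \<open>Additivity gives the kernel defect 0. Its subrepresentations are subrepresentations of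
  \<open>M\<close> and have defect at most 0, so its quotients have defect at least 0.\<close>

lemma semi_kernel:
  fixes M :: "('i, 'e, 'k::{field,finite}) frep"
  assumes M: "is_frep Q M" and A: "is_frep Q A" and s: "semi M" "semi A" and q: "fquot Q M X A"
  shows "semi (restr M X)"
proof -
  obtain \<pi> where \<pi>: "fepi Q M A X \<pi>" using q unfolding fquot_def ..
  have X: "fsub Q M X" by (rule fepi_sub[OF M A \<pi>])
  have "th X = 0" using th_fepi[OF M \<pi>] semi_th[OF M s(1)] semi_th[OF A s(2)] by simp
  then have "tors 0 (restr M X)"
    unfolding tors_def restr_simps using semi_sub_le[OF s(1) fsub_trans[OF X]] by fastforce
  moreover have "tfree 1 (restr M X)" using tfree_sub[OF _ X] s(1) unfolding semi_def by blast
  ultimately show ?thesis unfolding semi_def by blast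
qed

text \<open>A subrepresentation of the quotient has the same defect as its preimage in
  \<open>M\<close>, because the kernel has defect 0.\<close>

lemma semi_cokernel:
  fixes M :: "('i, 'e, 'k::{field,finite}) frep"
  assumes M: "is_frep Q M" and K: "is_frep Q K" and s: "semi M" "semi (restr M X)" and q: "fquot Q M X K"
  shows "semi K"
proof -
  obtain \<pi> where \<pi>: "fepi Q M K X \<pi>" using q unfolding fquot_def ..
  have X: "fsub Q M X" by (rule fepi_sub[OF M K \<pi>])
  have thX: "th X = 0" using semi_th[OF fsub_frep[OF M X] s(2)] by simp
  have "th U < 1" if U: "fsub Q K U" for U
  proof -
    have V: "fsub Q M (\<lambda>i. {x \<in> fV M i. \<pi> i x \<in> U i})" by (rule fsub_vimage[OF M fepi_hom[OF \<pi>] U])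
    have "th (\<lambda>i. {x \<in> fV M i. \<pi> i x \<in> U i}) = th X + th U"
      using th_fepi[OF fsub_frep[OF M V] fepi_vimage[OF M \<pi> U]] by simp
    then show ?thesis using semi_sub_le[OF s(1) V] thX by simp
  qed
  then have "tfree 1 K" unfolding tfree_def by blast
  moreover have "tors 0 K" using tors_quotient[OF M \<pi>] s(1) unfolding semi_def by blast
  ultimately show ?thesis unfolding semi_def by blast
qed

end

section \<open>Isomorphism classes\<close>

definition cemb :: "('i, 'e) quiver \<Rightarrow> ('i, 'e, 'k::field) rep set \<Rightarrow> ('i, 'e, 'k) frep" where
  "cemb Q C = emb Q (representative C)"

lemma cemb_frep:
  fixes C :: "('i, 'e, 'k::{field,finite}) rep set"
  shows "C \<in> iso_classes Q \<Longrightarrow> is_frep Q (cemb Q C)"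
  unfolding cemb_def by (rule is_frep_emb[OF iso_class_representative(1)])

lemma cemb_inj:
  fixes C D :: "('i, 'e, 'k::{field,finite}) rep set"
  assumes C: "C \<in> iso_classes Q" and D: "D \<in> iso_classes Q" and iso: "fiso Q (cemb Q C) (cemb Q D)"
  shows "C = D"
proof -
  note rC = iso_class_representative[OF C] and rD = iso_class_representative[OF D]
  have "rep_iso Q (representative C) (representative D)"
    using iso unfolding cemb_def rep_iso_iff_fiso[OF rC(1) rD(1)] .
  from iso_class_eqI[OF rC(1) rD(1) this] show ?thesis unfolding rC(2) rD(2) .
qed

lemma cemb_iso_class:
  fixes M :: "('i, 'e, 'k::{field,finite}) rep"
  assumes M: "is_rep Q M"
  shows "iso_class Q M \<in> iso_classes Q" "fiso Q (emb Q M) (cemb Q (iso_class Q M))"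
proof -
  show c: "iso_class Q M \<in> iso_classes Q" unfolding iso_classes_def using M by blast
  have "M \<in> iso_class Q M" unfolding iso_class_def using M isomorphic_reps_refl[OF closed_linrep_of[OF M]] by simp
  then have "representative (iso_class Q M) \<in> iso_class Q M" unfolding representative_def by (rule someI)
  then show "fiso Q (emb Q M) (cemb Q (iso_class Q M))"
    unfolding cemb_def using rep_iso_iff_fiso[OF M iso_class_representative(1)[OF c]] unfolding iso_class_def by simp
qed

lemma cemb_exists:
  fixes M :: "('i, 'e, 'k::{field,finite}) frep"
  assumes M: "is_frep Q M"
  obtains C where "C \<in> iso_classes Q" "fiso Q M (cemb Q C)"
proof -
  obtain N where N: "is_rep Q N" "fiso Q (emb Q N) M" by (rule frep_emb_exists[OF M]) blast
  have "fiso Q M (emb Q N)" by (rule fiso_sym[OF is_frep_emb[OF N(1)] M N(2)])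
  then have "fiso Q M (cemb Q (iso_class Q N))"
    by (rule fiso_trans[OF M is_frep_emb[OF N(1)] _ cemb_iso_class(2)[OF N(1)]])
  then show ?thesis by (rule that[OF cemb_iso_class(1)[OF N(1)]])
qed

lemma hall_number_cemb:
  fixes U V R :: "('i, 'e, 'k::{field,finite}) rep set"
  assumes "R \<in> iso_classes Q" "U \<in> iso_classes Q" "V \<in> iso_classes Q"
  shows "hall_number Q (representative R) (representative U) (representative V) = fhall Q (cemb Q R) (cemb Q U) (cemb Q V)"
  unfolding cemb_def
  by (rule hall_number_eq_fhall[OF iso_class_representative(1)[OF assms(1)] iso_class_representative(1)[OF assms(2)]
        iso_class_representative(1)[OF assms(3)]])

text \<open>The classes that can contribute to the associativity sums for \<open>M\<close>; this
  makes sums over all classes finite.\<close>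

definition factor_classes :: "('i, 'e) quiver \<Rightarrow> ('i, 'e, 'k::field) frep \<Rightarrow> ('i, 'e, 'k) rep set set" where
  "factor_classes Q M = {C \<in> iso_classes Q. \<exists>X. fsub Q M X \<and> (fiso Q (restr M X) (cemb Q C) \<or> fquot Q M X (cemb Q C))}"

lemma finite_factor_classes:
  fixes M :: "('i::finite, 'e, 'k::{field,finite}) frep"
  assumes M: "is_frep Q M"
  shows "finite (factor_classes Q M)"
proof -
  define g where "g X = (SOME C. C \<in> iso_classes Q \<and> fiso Q (restr M X) (cemb Q C))" for X
  define h where "h X = (SOME C. C \<in> iso_classes Q \<and> fquot Q M X (cemb Q C))" for X
  have "factor_classes Q M \<subseteq> g ` {X. fsub Q M X} \<union> h ` {X. fsub Q M X}"
  proof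
    fix C assume "C \<in> factor_classes Q M"
    then obtain X where C: "C \<in> iso_classes Q" and X: "fsub Q M X"
      and or: "fiso Q (restr M X) (cemb Q C) \<or> fquot Q M X (cemb Q C)" unfolding factor_classes_def by blast
    note Xf = fsub_frep[OF M X]
    from or show "C \<in> g ` {X. fsub Q M X} \<union> h ` {X. fsub Q M X}"
    proof
      assume iso: "fiso Q (restr M X) (cemb Q C)"
      have "g X \<in> iso_classes Q \<and> fiso Q (restr M X) (cemb Q (g X))"
        unfolding g_def by (rule someI[of _ C]) (use C iso in blast)
      then have "C = g X"
        using cemb_inj[OF C _ fiso_trans[OF cemb_frep[OF C] Xf fiso_sym[OF Xf cemb_frep[OF C] iso]]] by blast
      then show ?thesis using X by blast
    next
      assume q: "fquot Q M X (cemb Q C)"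
      have "h X \<in> iso_classes Q \<and> fquot Q M X (cemb Q (h X))"
        unfolding h_def by (rule someI[of _ C]) (use C q in blast)
      then have "C = h X" using cemb_inj[OF C _ fquot_unique[OF M cemb_frep[OF C] q]] by blast
      then show ?thesis using X by blast
    qed
  qed
  then show ?thesis by (rule finite_subset) (simp add: finite_fsub[OF M])
qed

lemma fhall_assoc_classes:
  fixes M :: "('i::finite, 'e, 'k::{field,finite}) frep"
  assumes M: "is_frep Q M" and \<K>: "finite \<K>" "\<K> \<subseteq> iso_classes Q" "factor_classes Q M \<subseteq> \<K>"
  shows "(\<Sum>K\<in>\<K>. fhall Q M A (cemb Q K) * fhall Q (cemb Q K) B C)
       = (\<Sum>K\<in>\<K>. fhall Q M (cemb Q K) C * fhall Q (cemb Q K) A B)"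
proof (rule fhall_assoc[OF M \<K>(1)])
  show "is_frep Q (cemb Q c)" if "c \<in> \<K>" for c using that \<K>(2) cemb_frep by blast
  show "c = c'" if "c \<in> \<K>" "c' \<in> \<K>" "fiso Q (cemb Q c) (cemb Q c')" for c c'
    using that \<K>(2) cemb_inj by blast
  fix X assume X: "fsub Q M X"
  show "\<exists>c\<in>\<K>. fiso Q (restr M X) (cemb Q c)"
  proof -
    obtain C where "C \<in> iso_classes Q" "fiso Q (restr M X) (cemb Q C)" by (rule cemb_exists[OF fsub_frep[OF M X]]) blast
    then have "C \<in> factor_classes Q M" "fiso Q (restr M X) (cemb Q C)" using X unfolding factor_classes_def by blast+
    then show ?thesis using \<K>(3) by blast
  qed
  show "\<exists>c\<in>\<K>. fquot Q M X (cemb Q c)"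
  proof -
    obtain N \<pi> where N: "is_frep Q N" "fepi Q M N X \<pi>" using quotient_exists[OF M X] by blast
    obtain C where C: "C \<in> iso_classes Q" "fiso Q N (cemb Q C)" by (rule cemb_exists[OF N(1)]) blast
    have "fquot Q M X (cemb Q C)"
      by (rule fquot_iso[OF M N(1) _ C(2)]) (use N(2) in \<open>unfold fquot_def, blast\<close>)
    moreover from this have "C \<in> factor_classes Q M" using X C(1) unfolding factor_classes_def by blast
    ultimately show ?thesis using \<K>(3) by blast
  qed
qed

lemma fhall_nonzero:
  fixes M :: "('i::finite, 'e, 'k::{field,finite}) frep"
  assumes "fhall Q M A B \<noteq> 0"
  obtains X where "fsub Q M X" "fiso Q (restr M X) B" "fquot Q M X A"
proof -
  have "{X. fsub Q M X \<and> fiso Q (restr M X) B \<and> fquot Q M X A} \<noteq> {}"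
    using assms unfolding fhall_def by (metis card.empty)
  then show ?thesis using that by blast
qed

lemma fhall_nonzeroI:
  fixes M :: "('i::finite, 'e, 'k::{field,finite}) frep"
  assumes M: "is_frep Q M" and X: "fsub Q M X" "fiso Q (restr M X) B" "fquot Q M X A"
  shows "fhall Q M A B \<noteq> 0"
proof -
  have "finite {X. fsub Q M X \<and> fiso Q (restr M X) B \<and> fquot Q M X A}"
    using finite_fsub[OF M] by (rule finite_subset[rotated]) blast
  then show ?thesis unfolding fhall_def using X by (metis (mono_tags, lifting) card_0_eq empty_iff mem_Collect_eq)
qed

section \<open>Coefficients of the comultiplication\<close>

lemma lookup_hall_scale: "Poly_Mapping.lookup (hall_scale c f) x = c * Poly_Mapping.lookup f x"
  unfolding hall_scale_def by (simp add: Poly_Mapping.map.rep_eq when_def)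

lemma lookup_sum_single:
  assumes "finite S"
  shows "Poly_Mapping.lookup (\<Sum>x\<in>S. Poly_Mapping.single x (g x)) y = (if y \<in> S then g y else 0)"
  using assms by (simp add: lookup_sum lookup_single when_def)

lemma lookup_hall_tensor:
  "Poly_Mapping.lookup (f \<otimes>\<^sub>H g) (x, y) = Poly_Mapping.lookup f x * Poly_Mapping.lookup g y"
proof -
  have "f \<otimes>\<^sub>H g = (\<Sum>p\<in>Poly_Mapping.keys f \<times> Poly_Mapping.keys g.
      Poly_Mapping.single p (Poly_Mapping.lookup f (fst p) * Poly_Mapping.lookup g (snd p)))"
    unfolding hall_tensor_def sum.cartesian_product by (intro sum.cong) auto
  then have "Poly_Mapping.lookup (f \<otimes>\<^sub>H g) (x, y) =
      (if (x, y) \<in> Poly_Mapping.keys f \<times> Poly_Mapping.keys g then Poly_Mapping.lookup f x * Poly_Mapping.lookup g y else 0)"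
    by (simp add: lookup_sum_single)
  then show ?thesis by (auto simp: in_keys_iff)
qed

text \<open>The coefficient of \<open>[A] \<otimes> [B]\<close> with the power of \<nu> and the
  factors \<open>a_A\<close>, \<open>a_B\<close> removed. Vanishing is not affected, and
  coassociativity holds for it without a twist.\<close>

definition comult_coeff :: "('i::finite, 'e::finite) quiver \<Rightarrow> ('i, 'e, 'k::{field,finite}) hall \<Rightarrow>
    ('i, 'e, 'k) frep \<Rightarrow> ('i, 'e, 'k) frep \<Rightarrow> complex" where
  "comult_coeff Q f A B = (\<Sum>M\<in>Poly_Mapping.keys f.
     Poly_Mapping.lookup f M / of_nat (aut_count Q (representative M)) * of_nat (fhall Q (cemb Q M) A B))"

lemma aut_count_nonzero:
  fixes M :: "('i::finite, 'e::finite, 'k::{field,finite}) rep"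
  assumes M: "is_rep Q M"
  shows "aut_count Q M \<noteq> 0"
proof -
  have fc: "finite (carrier_vec n :: 'k vec set)" for n
    using bij_betw_finite[OF vec_bij, of n] card_fcoords[of n, where 'k = 'k] by blast
  have "rep_isos Q (linrep_of M) (linrep_of M) \<subseteq>
      (\<Pi>\<^sub>E i\<in>UNIV. \<Pi>\<^sub>E v\<in>carrier_vec (rdim M i). carrier_vec (rdim M i))"
  proof
    fix \<phi> assume \<phi>: "\<phi> \<in> rep_isos Q (linrep_of M) (linrep_of M)"
    have "\<phi> i \<in> (\<Pi>\<^sub>E v\<in>carrier_vec (rdim M i). carrier_vec (rdim M i))" for i
    proof -
      have "\<phi> i \<in> extensional (carrier_vec (rdim M i))" "bij_betw (\<phi> i) (carrier_vec (rdim M i)) (carrier_vec (rdim M i))"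
        using \<phi> unfolding rep_isos_def linrep_of_simps by blast+
      then show ?thesis unfolding PiE_def using bij_betwE by blast
    qed
    then show "\<phi> \<in> (\<Pi>\<^sub>E i\<in>UNIV. \<Pi>\<^sub>E v\<in>carrier_vec (rdim M i). carrier_vec (rdim M i))"
      by (simp add: PiE_UNIV_domain)
  qed
  then have "finite (rep_isos Q (linrep_of M) (linrep_of M))"
    by (rule finite_subset) (intro finite_PiE finite fc)
  moreover have "rep_isos Q (linrep_of M) (linrep_of M) \<noteq> {}"
    using isomorphic_reps_refl[OF closed_linrep_of[OF M]] unfolding isomorphic_reps_def .
  ultimately show ?thesis unfolding aut_count_def by (simp add: card_0_eq)
qed

lemma lookup_hall_comult:
  fixes f :: "('i::finite, 'e::finite, 'k::{field,finite}) hall"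
  assumes f: "Poly_Mapping.keys f \<subseteq> iso_classes Q"
  shows "Poly_Mapping.lookup (hall_comult Q f) (U, V) = (if U \<in> iso_classes Q \<and> V \<in> iso_classes Q
     then hall_nu TYPE('k) powi euler_form Q (dim_vector (representative U)) (dim_vector (representative V))
        * (of_nat (aut_count Q (representative U)) * of_nat (aut_count Q (representative V)))
        * comult_coeff Q f (cemb Q U) (cemb Q V) else 0)"
proof -
  let ?nu = "\<lambda>U V. hall_nu TYPE('k) powi euler_form Q (dim_vector (representative U)) (dim_vector (representative V))"
  let ?a = "\<lambda>U. of_nat (aut_count Q (representative U)) :: complex"
  let ?F = "\<lambda>M U V. of_nat (hall_number Q (representative M) (representative U) (representative V)) :: complex"
  have rep: "Poly_Mapping.lookup (hall_comult_rep Q (representative M)) (U, V) =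
      (if U \<in> iso_classes Q \<and> V \<in> iso_classes Q then ?nu U V * ?F M U V * (?a U * ?a V / ?a M) else 0)"
    if M: "M \<in> iso_classes Q" for M
  proof -
    have fin: "finite (hall_pairs Q (representative M))"
      by (rule finite_hall_pairs[OF iso_class_representative(1)[OF M]])
    have "hall_comult_rep Q (representative M) = (\<Sum>p\<in>hall_pairs Q (representative M).
        Poly_Mapping.single p (?nu (fst p) (snd p) * ?F M (fst p) (snd p) * (?a (fst p) * ?a (snd p) / ?a M)))"
      unfolding hall_comult_rep_def by (intro sum.cong refl) (auto simp: Let_def)
    then have "Poly_Mapping.lookup (hall_comult_rep Q (representative M)) (U, V) =
        (if (U, V) \<in> hall_pairs Q (representative M) then ?nu U V * ?F M U V * (?a U * ?a V / ?a M) else 0)"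
      by (simp add: lookup_sum_single[OF fin])
    then show ?thesis by (auto simp: hall_pairs_def)
  qed
  have "Poly_Mapping.lookup (hall_comult Q f) (U, V) = (\<Sum>M\<in>Poly_Mapping.keys f. Poly_Mapping.lookup f M *
      Poly_Mapping.lookup (hall_comult_rep Q (representative M)) (U, V))"
    unfolding hall_comult_def by (simp add: lookup_sum lookup_hall_scale)
  also have "\<dots> = (\<Sum>M\<in>Poly_Mapping.keys f. Poly_Mapping.lookup f M *
      (if U \<in> iso_classes Q \<and> V \<in> iso_classes Q then ?nu U V * ?F M U V * (?a U * ?a V / ?a M) else 0))"
    by (rule sum.cong[OF refl]) (use rep f in \<open>simp add: subset_iff\<close>)
  finally have lk: "Poly_Mapping.lookup (hall_comult Q f) (U, V) = (\<Sum>M\<in>Poly_Mapping.keys f. Poly_Mapping.lookup f M *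
      (if U \<in> iso_classes Q \<and> V \<in> iso_classes Q then ?nu U V * ?F M U V * (?a U * ?a V / ?a M) else 0))" .
  show ?thesis
  proof (cases "U \<in> iso_classes Q \<and> V \<in> iso_classes Q")
    case True
    have "(\<Sum>M\<in>Poly_Mapping.keys f. Poly_Mapping.lookup f M * (?nu U V * ?F M U V * (?a U * ?a V / ?a M)))
        = ?nu U V * (?a U * ?a V) * comult_coeff Q f (cemb Q U) (cemb Q V)"
      unfolding comult_coeff_def sum_distrib_left
    proof (rule sum.cong[OF refl])
      fix M assume "M \<in> Poly_Mapping.keys f"
      then have "?F M U V = of_nat (fhall Q (cemb Q M) (cemb Q U) (cemb Q V))"
        using hall_number_cemb[of M Q U V] True f by (simp add: subset_iff)
      then show "Poly_Mapping.lookup f M * (?nu U V * ?F M U V * (?a U * ?a V / ?a M)) = ?nu U V * (?a U * ?a V) *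
          (Poly_Mapping.lookup f M / ?a M * of_nat (fhall Q (cemb Q M) (cemb Q U) (cemb Q V)))" by simp
    qed
    then show ?thesis unfolding lk using True by (simp only: if_True simp_thms)
  next
    case False
    then have "(U \<in> iso_classes Q \<and> V \<in> iso_classes Q) = False" by blast
    then show ?thesis unfolding lk by (simp only: if_False) simp
  qed
qed

lemma hall_nu_powi_nonzero: "hall_nu TYPE('k::{field,finite}) powi n \<noteq> 0"
  using card_field_gt_1[where 'k = 'k] by (simp add: hall_nu_def power_int_eq_0_iff)

text \<open>Coassociativity, obtained by summing associativity of Hall numbers over the support of
  \<open>f\<close>. The set \<K> is chosen to contain a prescribed class, which is singled out in
  the applications.\<close>

lemma comult_coeff_assoc:
  fixes f :: "('i::finite, 'e::finite, 'k::{field,finite}) hall"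
  assumes f: "Poly_Mapping.keys f \<subseteq> iso_classes Q" and U: "U \<in> iso_classes Q"
  obtains \<K> where "finite \<K>" "\<K> \<subseteq> iso_classes Q" "U \<in> \<K>"
    "\<And>A B C. (\<Sum>K\<in>\<K>. comult_coeff Q f A (cemb Q K) * of_nat (fhall Q (cemb Q K) B C))
       = (\<Sum>K\<in>\<K>. comult_coeff Q f (cemb Q K) C * of_nat (fhall Q (cemb Q K) A B))"
proof -
  define \<K> where "\<K> = insert U (\<Union>M\<in>Poly_Mapping.keys f. factor_classes Q (cemb Q M))"
  have fin: "finite \<K>" unfolding \<K>_def
  proof (intro finite.insertI finite_UN_I finite_keys)
    fix M assume "M \<in> Poly_Mapping.keys f"
    then show "finite (factor_classes Q (cemb Q M))" using f by (intro finite_factor_classes cemb_frep) blast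
  qed
  have sub: "\<K> \<subseteq> iso_classes Q" unfolding \<K>_def factor_classes_def using U by blast
  have "(\<Sum>K\<in>\<K>. comult_coeff Q f A (cemb Q K) * of_nat (fhall Q (cemb Q K) B C))
       = (\<Sum>K\<in>\<K>. comult_coeff Q f (cemb Q K) C * of_nat (fhall Q (cemb Q K) A B))" for A B C
  proof -
    let ?w = "\<lambda>M. Poly_Mapping.lookup f M / of_nat (aut_count Q (representative M))"
    have "(\<Sum>K\<in>\<K>. comult_coeff Q f A (cemb Q K) * of_nat (fhall Q (cemb Q K) B C))
       = (\<Sum>M\<in>Poly_Mapping.keys f. \<Sum>K\<in>\<K>. ?w M * of_nat (fhall Q (cemb Q M) A (cemb Q K)) * of_nat (fhall Q (cemb Q K) B C))"
      unfolding comult_coeff_def sum_distrib_right by (rule sum.swap)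
    also have "\<dots> = (\<Sum>M\<in>Poly_Mapping.keys f. ?w M * of_nat (\<Sum>K\<in>\<K>. fhall Q (cemb Q M) A (cemb Q K) * fhall Q (cemb Q K) B C))"
      by (simp add: sum_distrib_left mult.assoc)
    also have "\<dots> = (\<Sum>M\<in>Poly_Mapping.keys f. ?w M * of_nat (\<Sum>K\<in>\<K>. fhall Q (cemb Q M) (cemb Q K) C * fhall Q (cemb Q K) A B))"
    proof (rule sum.cong[OF refl])
      fix M assume M: "M \<in> Poly_Mapping.keys f"
      have "(\<Sum>K\<in>\<K>. fhall Q (cemb Q M) A (cemb Q K) * fhall Q (cemb Q K) B C)
          = (\<Sum>K\<in>\<K>. fhall Q (cemb Q M) (cemb Q K) C * fhall Q (cemb Q K) A B)"
        by (rule fhall_assoc_classes[OF cemb_frep fin sub]) (use M f in \<open>auto simp: \<K>_def\<close>)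
      then show "?w M * of_nat (\<Sum>K\<in>\<K>. fhall Q (cemb Q M) A (cemb Q K) * fhall Q (cemb Q K) B C)
          = ?w M * of_nat (\<Sum>K\<in>\<K>. fhall Q (cemb Q M) (cemb Q K) C * fhall Q (cemb Q K) A B)" by (simp only:)
    qed
    also have "\<dots> = (\<Sum>M\<in>Poly_Mapping.keys f. \<Sum>K\<in>\<K>. ?w M * of_nat (fhall Q (cemb Q M) (cemb Q K) C) * of_nat (fhall Q (cemb Q K) A B))"
      by (simp add: sum_distrib_left mult.assoc)
    also have "\<dots> = (\<Sum>K\<in>\<K>. comult_coeff Q f (cemb Q K) C * of_nat (fhall Q (cemb Q K) A B))"
      unfolding comult_coeff_def sum_distrib_right by (rule sum.swap)
    finally show ?thesis .
  qed
  then show ?thesis using that[OF fin sub] unfolding \<K>_def by blast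
qed

lemma comult_coeff_nonzero:
  fixes f :: "('i::finite, 'e::finite, 'k::{field,finite}) hall"
  assumes "comult_coeff Q f A B \<noteq> 0"
  obtains M X where "M \<in> Poly_Mapping.keys f" "fsub Q (cemb Q M) X" "fiso Q (restr (cemb Q M) X) B" "fquot Q (cemb Q M) X A"
proof -
  obtain M where M: "M \<in> Poly_Mapping.keys f"
    "Poly_Mapping.lookup f M / of_nat (aut_count Q (representative M)) * of_nat (fhall Q (cemb Q M) A B) \<noteq> 0"
    using assms unfolding comult_coeff_def by (meson sum.neutral)
  then have "fhall Q (cemb Q M) A B \<noteq> 0" by auto
  then show ?thesis using fhall_nonzero that[OF M(1)] by metis
qed

section \<open>Cuspidal functions\<close>

lemma zero_rep_rep: "is_rep Q (zero_rep :: ('i, 'e, 'k::{field,finite}) rep)"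
  unfolding is_rep_def zero_rep_def by simp

lemma zero_rep_class:
  fixes C :: "('i::finite, 'e, 'k::{field,finite}) rep set"
  assumes "C \<in> iso_classes Q" "C = iso_class Q zero_rep"
  shows "fV (cemb Q C) = (\<lambda>i. {0})"
proof -
  have "fV (emb Q (zero_rep :: ('i, 'e, 'k) rep)) = (\<lambda>i. {0})"
    unfolding is_zero_rep_emb[symmetric] by (simp add: is_zero_rep_def zero_rep_def)
  then show ?thesis
    using fiso_zero_iff[OF is_frep_emb[OF zero_rep_rep] cemb_frep[OF assms(1)]] cemb_iso_class(2)[OF zero_rep_rep]
    unfolding assms(2) by blast
qed

lemma regular_classes_sub: "regular_classes Q \<subseteq> iso_classes Q"
  unfolding regular_classes_def iso_classes_def regular_def by blast

text \<open>Neither class is that of the zero representation, so the primitive part has no such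
  term; on pairs of regular classes the full and the regular comultiplication agree.\<close>

lemma cuspidal_coeff:
  fixes f :: "('i::finite, 'e::finite, 'k::{field,finite}) hall"
  assumes f: "regular_cuspidal Q f" and A: "A \<in> regular_classes Q" "fV (cemb Q A) \<noteq> (\<lambda>i. {0})"
    and B: "B \<in> regular_classes Q" "fV (cemb Q B) \<noteq> (\<lambda>i. {0})"
  shows "comult_coeff Q f (cemb Q A) (cemb Q B) = 0"
proof -
  have keys: "Poly_Mapping.keys f \<subseteq> iso_classes Q"
    using f regular_classes_sub unfolding regular_cuspidal_def hall_regular_def by blast
  have AB: "A \<in> iso_classes Q" "B \<in> iso_classes Q" using A B regular_classes_sub by blast+
  have z: "A \<noteq> iso_class Q zero_rep" "B \<noteq> iso_class Q zero_rep"
    using A(2) B(2) zero_rep_class[OF AB(1)] zero_rep_class[OF AB(2)] by blast+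
  have "Poly_Mapping.lookup (hall_comult_regular Q f) (A, B) = Poly_Mapping.lookup (hall_comult Q f) (A, B)"
    unfolding hall_comult_regular_def using A(1) B(1)
    by (subst lookup_sum_single) (auto simp: in_keys_iff)
  moreover have "Poly_Mapping.lookup (hall_comult_regular Q f) (A, B) = 0"
    using f z unfolding regular_cuspidal_def
    by (simp add: lookup_add lookup_hall_tensor hall_one_def hall_basis_def lookup_single when_def)
  ultimately have "Poly_Mapping.lookup (hall_comult Q f) (A, B) = 0" by (rule trans[OF sym])
  then show ?thesis unfolding lookup_hall_comult[OF keys]
    using AB hall_nu_powi_nonzero[of 1, where 'k = 'k]
      aut_count_nonzero[OF iso_class_representative(1)[OF AB(1)]] aut_count_nonzero[OF iso_class_representative(1)[OF AB(2)]]
    by simp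
qed

lemma fquot_nonzero:
  fixes M :: "('i::finite, 'e, 'k::{field,finite}) frep"
  assumes M: "is_frep Q M" and N: "is_frep Q N" and q: "fquot Q M W N" and ne: "fV N \<noteq> (\<lambda>i. {0})"
  shows "fV M \<noteq> (\<lambda>i. {0})"
proof
  assume z: "fV M = (\<lambda>i. {0})"
  have W: "fsub Q M W" using q fepi_sub[OF M N] unfolding fquot_def by blast
  have "W = (\<lambda>i. {0})" by (rule fsub_eq_zero[OF W]) (use fsub_in[OF W] z in simp)
  then have "fiso Q M N" using q unfolding fiso_def by simp
  then show False using fiso_zero_iff[OF M N] z ne by blast
qed

section \<open>The factors of a term of the comultiplication\<close>

context affine_rep
begin

lemma fepi_zero_kernel:
  assumes \<pi>: "fepi Q M N W \<pi>" and z: "fV N = (\<lambda>i. {0})"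
  shows "W = fV M"
proof (intro ext equalityI subsetI)
  fix i x assume "x \<in> W i"
  then show "x \<in> fV M i" unfolding fepi_ker[OF \<pi>] by blast
next
  fix i x assume x: "x \<in> fV M i"
  then have "\<pi> i x \<in> fV N i" by (rule fhom_in[OF fepi_hom[OF \<pi>]])
  then have "\<pi> i x = 0" unfolding z by simp
  then show "x \<in> W i" unfolding fepi_ker[OF \<pi>] using x by blast
qed

lemma semi_iff_regular_class:
  fixes C :: "('i, 'e, 'k::{field,finite}) rep set"
  assumes C: "C \<in> iso_classes Q"
  shows "semi (cemb Q C) \<longleftrightarrow> C \<in> regular_classes Q"
proof
  note r = iso_class_representative[OF C]
  assume "semi (cemb Q C)"
  then have "regular Q (representative C)" unfolding cemb_def by (rule semi_regular[OF r(1)])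
  then show "C \<in> regular_classes Q" unfolding regular_classes_def using r(2) by blast
next
  assume "C \<in> regular_classes Q"
  then obtain M where M: "regular Q M" "C = iso_class Q M" unfolding regular_classes_def by blast
  then have Mr: "is_rep Q M" unfolding regular_def by blast
  show "semi (cemb Q C)"
    using semi_iso[OF is_frep_emb[OF Mr] cemb_frep[OF C] _ regular_semi[OF M(1)]] cemb_iso_class(2)[OF Mr]
    unfolding M(2) by blast
qed

text \<open>Some regular \<open>M\<close> in the support of \<open>f\<close> has sub
  \<open>B\<close> and quotient \<open>A\<close>. Kernels and cokernels between regular
  representations being regular, one factor is regular exactly when the other is.\<close>

lemma regular_factor:
  fixes f :: "('i, 'e, 'k::{field,finite}) hall"
  assumes f: "Poly_Mapping.keys f \<subseteq> regular_classes Q" and A: "is_frep Q A" and B: "is_frep Q B"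
    and nz: "comult_coeff Q f A B \<noteq> 0"
  shows "tors 0 A" "tfree 1 B" "th (fV A) + th (fV B) = 0" "semi A \<longleftrightarrow> semi B"
proof -
  obtain M X where M: "M \<in> Poly_Mapping.keys f" and X: "fsub Q (cemb Q M) X" "fiso Q (restr (cemb Q M) X) B"
    "fquot Q (cemb Q M) X A" by (rule comult_coeff_nonzero[OF nz]) blast
  have Mc: "M \<in> iso_classes Q" using M f regular_classes_sub by blast
  note Mf = cemb_frep[OF Mc]
  note Xf = fsub_frep[OF Mf X(1)]
  have s: "semi (cemb Q M)" using semi_iff_regular_class[OF Mc] M f by blast
  obtain \<pi> where \<pi>: "fepi Q (cemb Q M) A X \<pi>" using X(3) unfolding fquot_def ..
  show "tors 0 A" using tors_quotient[OF Mf \<pi>] s unfolding semi_def by blast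
  have "tfree 1 (restr (cemb Q M) X)" using tfree_sub[OF _ X(1)] s unfolding semi_def by blast
  then show "tfree 1 B" by (rule tfree_iso[OF B fiso_sym[OF Xf B X(2)]])
  have "th X = th (fV B)" using th_iso[OF Xf X(2)] unfolding restr_simps .
  then show "th (fV A) + th (fV B) = 0" using th_fepi[OF Mf \<pi>] semi_th[OF Mf s] by simp
  show "semi A \<longleftrightarrow> semi B"
  proof
    assume "semi A"
    then have "semi (restr (cemb Q M) X)" by (rule semi_kernel[OF Mf A s _ X(3)])
    then show "semi B" by (rule semi_iso[OF Xf B X(2)])
  next
    assume "semi B"
    then have "semi (restr (cemb Q M) X)" by (rule semi_iso[OF B Xf fiso_sym[OF Xf B X(2)]])
    then show "semi A" by (rule semi_cokernel[OF Mf A s _ X(3)])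
  qed
qed

lemma fhall_nonzero_unique:
  fixes U :: "('i, 'e, 'k::{field,finite}) frep"
  assumes U: "is_frep Q U" and K: "is_frep Q K" and A: "is_frep Q A" and B: "is_frep Q B"
    and t: "t = 0 \<or> t = 1" "tors t B" "tfree t A"
    and "fhall Q U A B \<noteq> 0" "fhall Q K A B \<noteq> 0"
  shows "fiso Q U K"
proof -
  obtain X where X: "fsub Q U X" "fiso Q (restr U X) B" "fquot Q U X A" using fhall_nonzero[OF assms(8)] by blast
  obtain Y where Y: "fsub Q K Y" "fiso Q (restr K Y) B" "fquot Q K Y A" using fhall_nonzero[OF assms(9)] by blast
  show ?thesis by (rule extension_unique[OF U K A B X(1,3,2) Y(1,3,2) t])
qed

text \<open>Regularity of one factor suffices: a non-zero coefficient would make the other one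
  regular too.\<close>

lemma cuspidal_coeff_zero:
  fixes f :: "('i, 'e, 'k::{field,finite}) hall"
  assumes f: "regular_cuspidal Q f" and A: "A \<in> iso_classes Q" "semi (cemb Q A) \<or> semi (cemb Q B)"
    and B: "B \<in> iso_classes Q" and nz: "fV (cemb Q A) \<noteq> (\<lambda>i. {0})" "fV (cemb Q B) \<noteq> (\<lambda>i. {0})"
  shows "comult_coeff Q f (cemb Q A) (cemb Q B) = 0"
proof (rule ccontr)
  assume ne: "comult_coeff Q f (cemb Q A) (cemb Q B) \<noteq> 0"
  have "Poly_Mapping.keys f \<subseteq> regular_classes Q" using f unfolding regular_cuspidal_def hall_regular_def by blast
  from regular_factor(4)[OF this cemb_frep[OF A(1)] cemb_frep[OF B] ne]
  have "A \<in> regular_classes Q" "B \<in> regular_classes Q"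
    using A(2) semi_iff_regular_class[OF A(1)] semi_iff_regular_class[OF B] by blast+
  from cuspidal_coeff[OF f this(1) nz(1) this(2) nz(2)] ne show False by blast
qed

lemma left_factor:
  fixes f :: "('i, 'e, 'k::{field,finite}) hall"
  assumes f: "regular_cuspidal Q f" and U: "U \<in> iso_classes Q" and V: "V \<in> iso_classes Q"
    and nz: "comult_coeff Q f (cemb Q U) (cemb Q V) \<noteq> 0"
  shows "semi (cemb Q U) \<or> tors 1 (cemb Q U)"
proof (rule ccontr)
  assume no: "\<not> (semi (cemb Q U) \<or> tors 1 (cemb Q U))"
  have keys: "Poly_Mapping.keys f \<subseteq> regular_classes Q" using f unfolding regular_cuspidal_def hall_regular_def by blast
  note Uf = cemb_frep[OF U] and Vf = cemb_frep[OF V]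
  note facts = regular_factor[OF keys Uf Vf nz]
  obtain W N \<pi> where W: "fsub Q (cemb Q U) W" "tors 1 (restr (cemb Q U) W)"
    and N: "is_frep Q N" "fepi Q (cemb Q U) N W \<pi>" "tfree 1 N"
    using torsion_decomposition[OF Uf, of 1] by auto
  note Wf = fsub_frep[OF Uf W(1)]
  have q: "fquot Q (cemb Q U) W N" using N(2) unfolding fquot_def by blast
  \<comment> \<open>As a quotient of \<open>U\<close>, itself a quotient of a regular
    representation, \<open>N\<close> is torsion for \<open>t = 0\<close>; so its torsion freeness
    for \<open>t = 1\<close> makes it regular.\<close>
  have Ns: "semi N" unfolding semi_def using N(3) tors_quotient[OF Uf N(2) facts(1)] by blast
  have Wne: "W \<noteq> (\<lambda>i. {0})"
  proof
    assume "W = (\<lambda>i. {0})"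
    then have "fiso Q (cemb Q U) N" using q unfolding fiso_def by simp
    then have "semi (cemb Q U)" by (rule semi_iso[OF N(1) Uf fiso_sym[OF Uf N(1)] Ns])
    then show False using no by blast
  qed
  have Nne: "fV N \<noteq> (\<lambda>i. {0})"
  proof
    assume z: "fV N = (\<lambda>i. {0})"
    have "W = fV (cemb Q U)" by (rule fepi_zero_kernel[OF N(2) z])
    then have "tors 1 (cemb Q U)" using W(2) by (simp only: restr_simps)
    then show False using no by blast
  qed
  obtain A where A: "A \<in> iso_classes Q" "fiso Q N (cemb Q A)" by (rule cemb_exists[OF N(1)]) blast
  obtain B where B: "B \<in> iso_classes Q" "fiso Q (restr (cemb Q U) W) (cemb Q B)" by (rule cemb_exists[OF Wf]) blast
  note Af = cemb_frep[OF A(1)] and Bf = cemb_frep[OF B(1)]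
  have As: "semi (cemb Q A)" by (rule semi_iso[OF N(1) Af A(2) Ns])
  have Ane: "fV (cemb Q A) \<noteq> (\<lambda>i. {0})" using fiso_zero_iff[OF N(1) Af A(2)] Nne by blast
  have Bne: "fV (cemb Q B) \<noteq> (\<lambda>i. {0})" using fiso_zero_iff[OF Wf Bf B(2)] Wne unfolding restr_simps by blast
  have Bt: "tors 1 (cemb Q B)" by (rule tors_iso[OF Wf B(2) W(2)])
  have At: "tfree 1 (cemb Q A)" using As unfolding semi_def by blast
  have qA: "fquot Q (cemb Q U) W (cemb Q A)" by (rule fquot_iso[OF Uf N(1) q A(2)])
  have UAB: "fhall Q (cemb Q U) (cemb Q A) (cemb Q B) \<noteq> 0" by (rule fhall_nonzeroI[OF Uf W(1) B(2) qA])
  obtain \<K> where fin: "finite \<K>" and \<K>: "\<K> \<subseteq> iso_classes Q" "U \<in> \<K>"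
    and assoc: "\<And>A B C. (\<Sum>K\<in>\<K>. comult_coeff Q f A (cemb Q K) * of_nat (fhall Q (cemb Q K) B C))
       = (\<Sum>K\<in>\<K>. comult_coeff Q f (cemb Q K) C * of_nat (fhall Q (cemb Q K) A B))"
    by (rule comult_coeff_assoc[OF subset_trans[OF keys regular_classes_sub] U], rule that)
  \<comment> \<open>Each contributing \<open>K\<close> has the non-zero quotient \<open>B\<close>,
    so cuspidality kills the coefficient of \<open>[A] \<otimes> [K]\<close> with \<open>A\<close>
    regular and non-zero.\<close>
  have "(\<Sum>K\<in>\<K>. comult_coeff Q f (cemb Q A) (cemb Q K) * of_nat (fhall Q (cemb Q K) (cemb Q B) (cemb Q V))) = 0"
  proof (rule sum.neutral, rule ballI)
    fix K assume "K \<in> \<K>"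
    then have K: "K \<in> iso_classes Q" using \<K>(1) by blast
    show "comult_coeff Q f (cemb Q A) (cemb Q K) * of_nat (fhall Q (cemb Q K) (cemb Q B) (cemb Q V)) = 0"
    proof (cases "fhall Q (cemb Q K) (cemb Q B) (cemb Q V) = 0")
      case False
      then obtain X where X: "fquot Q (cemb Q K) X (cemb Q B)" by (rule fhall_nonzero) blast
      have "fV (cemb Q K) \<noteq> (\<lambda>i. {0})" using fquot_nonzero[OF cemb_frep[OF K] Bf X Bne] .
      from cuspidal_coeff_zero[OF f A(1) disjI1[OF As] K Ane this] show ?thesis by simp
    qed simp
  qed
  also have "(\<Sum>K\<in>\<K>. comult_coeff Q f (cemb Q A) (cemb Q K) * of_nat (fhall Q (cemb Q K) (cemb Q B) (cemb Q V)))
      = (\<Sum>K\<in>\<K>. comult_coeff Q f (cemb Q K) (cemb Q V) * of_nat (fhall Q (cemb Q K) (cemb Q A) (cemb Q B)))"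
    by (rule assoc)
  \<comment> \<open>Every extension of \<open>A\<close> by \<open>B\<close> is isomorphic to
    \<open>U\<close>, so the other side of coassociativity has one term, a product of non-zero
    numbers.\<close>
  also have "\<dots> = (\<Sum>K\<in>{U}. comult_coeff Q f (cemb Q K) (cemb Q V) * of_nat (fhall Q (cemb Q K) (cemb Q A) (cemb Q B)))"
  proof (rule sum.mono_neutral_right[OF fin])
    show "{U} \<subseteq> \<K>" using \<K>(2) by blast
    show "\<forall>K\<in>\<K> - {U}. comult_coeff Q f (cemb Q K) (cemb Q V) * of_nat (fhall Q (cemb Q K) (cemb Q A) (cemb Q B)) = 0"
    proof
      fix K assume K: "K \<in> \<K> - {U}"
      then have Kc: "K \<in> iso_classes Q" using \<K>(1) by blast
      have "fhall Q (cemb Q K) (cemb Q A) (cemb Q B) = 0"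
      proof (rule ccontr)
        assume "fhall Q (cemb Q K) (cemb Q A) (cemb Q B) \<noteq> 0"
        with UAB have "fiso Q (cemb Q U) (cemb Q K)"
          by (rule fhall_nonzero_unique[OF Uf cemb_frep[OF Kc] Af Bf disjI2[OF refl] Bt At])
        then have "U = K" by (rule cemb_inj[OF U Kc])
        then show False using K by blast
      qed
      then show "comult_coeff Q f (cemb Q K) (cemb Q V) * of_nat (fhall Q (cemb Q K) (cemb Q A) (cemb Q B)) = 0" by simp
    qed
  qed
  finally show False using nz UAB by simp
qed

text \<open>The mirror image of \<open>left_factor\<close>: the torsion pair for
  \<open>t = 0\<close> splits \<open>V\<close> into a regular sub \<open>C\<close> and a torsion
  free quotient \<open>B\<close>, and coassociativity is read at
  \<open>[U] \<otimes> [B] \<otimes> [C]\<close>.\<close>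

lemma right_factor:
  fixes f :: "('i, 'e, 'k::{field,finite}) hall"
  assumes f: "regular_cuspidal Q f" and U: "U \<in> iso_classes Q" and V: "V \<in> iso_classes Q"
    and nz: "comult_coeff Q f (cemb Q U) (cemb Q V) \<noteq> 0"
  shows "semi (cemb Q V) \<or> tfree 0 (cemb Q V)"
proof (rule ccontr)
  assume no: "\<not> (semi (cemb Q V) \<or> tfree 0 (cemb Q V))"
  have keys: "Poly_Mapping.keys f \<subseteq> regular_classes Q" using f unfolding regular_cuspidal_def hall_regular_def by blast
  note Uf = cemb_frep[OF U] and Vf = cemb_frep[OF V]
  note facts = regular_factor[OF keys Uf Vf nz]
  obtain W N \<pi> where W: "fsub Q (cemb Q V) W" "tors 0 (restr (cemb Q V) W)"
    and N: "is_frep Q N" "fepi Q (cemb Q V) N W \<pi>" "tfree 0 N"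
    using torsion_decomposition[OF Vf, of 0] by auto
  note Wf = fsub_frep[OF Vf W(1)]
  have q: "fquot Q (cemb Q V) W N" using N(2) unfolding fquot_def by blast
  have Ws: "semi (restr (cemb Q V) W)" unfolding semi_def using W(2) tfree_sub[OF facts(2) W(1)] by blast
  have Wne: "W \<noteq> (\<lambda>i. {0})"
  proof
    assume "W = (\<lambda>i. {0})"
    then have "fiso Q (cemb Q V) N" using q unfolding fiso_def by simp
    then have "tfree 0 (cemb Q V)" by (rule tfree_iso[OF Vf _ N(3)])
    then show False using no by blast
  qed
  have Nne: "fV N \<noteq> (\<lambda>i. {0})"
  proof
    assume z: "fV N = (\<lambda>i. {0})"
    have "W = fV (cemb Q V)" by (rule fepi_zero_kernel[OF N(2) z])
    then have "semi (cemb Q V)" using Ws by (simp only: restr_simps)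
    then show False using no by blast
  qed
  obtain B where B: "B \<in> iso_classes Q" "fiso Q N (cemb Q B)" by (rule cemb_exists[OF N(1)]) blast
  obtain C where C: "C \<in> iso_classes Q" "fiso Q (restr (cemb Q V) W) (cemb Q C)" by (rule cemb_exists[OF Wf]) blast
  note Bf = cemb_frep[OF B(1)] and Cf = cemb_frep[OF C(1)]
  have Cs: "semi (cemb Q C)" by (rule semi_iso[OF Wf Cf C(2) Ws])
  have Bne: "fV (cemb Q B) \<noteq> (\<lambda>i. {0})" using fiso_zero_iff[OF N(1) Bf B(2)] Nne by blast
  have Cne: "fV (cemb Q C) \<noteq> (\<lambda>i. {0})" using fiso_zero_iff[OF Wf Cf C(2)] Wne unfolding restr_simps by blast
  have Ct: "tors 0 (cemb Q C)" using Cs unfolding semi_def by blast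
  have Bt: "tfree 0 (cemb Q B)" by (rule tfree_iso[OF Bf fiso_sym[OF N(1) Bf B(2)] N(3)])
  have qB: "fquot Q (cemb Q V) W (cemb Q B)" by (rule fquot_iso[OF Vf N(1) q B(2)])
  have VBC: "fhall Q (cemb Q V) (cemb Q B) (cemb Q C) \<noteq> 0" by (rule fhall_nonzeroI[OF Vf W(1) C(2) qB])
  obtain \<K> where fin: "finite \<K>" and \<K>: "\<K> \<subseteq> iso_classes Q" "V \<in> \<K>"
    and assoc: "\<And>A B C. (\<Sum>K\<in>\<K>. comult_coeff Q f A (cemb Q K) * of_nat (fhall Q (cemb Q K) B C))
       = (\<Sum>K\<in>\<K>. comult_coeff Q f (cemb Q K) C * of_nat (fhall Q (cemb Q K) A B))"
    by (rule comult_coeff_assoc[OF subset_trans[OF keys regular_classes_sub] V], rule that)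
  \<comment> \<open>Here \<open>K\<close> is non-zero because it contains a copy of
    \<open>B\<close>, and \<open>C\<close> is the regular factor to which cuspidality
    applies.\<close>
  have "(\<Sum>K\<in>\<K>. comult_coeff Q f (cemb Q K) (cemb Q C) * of_nat (fhall Q (cemb Q K) (cemb Q U) (cemb Q B))) = 0"
  proof (rule sum.neutral, rule ballI)
    fix K assume "K \<in> \<K>"
    then have K: "K \<in> iso_classes Q" using \<K>(1) by blast
    show "comult_coeff Q f (cemb Q K) (cemb Q C) * of_nat (fhall Q (cemb Q K) (cemb Q U) (cemb Q B)) = 0"
    proof (cases "fhall Q (cemb Q K) (cemb Q U) (cemb Q B) = 0")
      case False
      then obtain X where X: "fsub Q (cemb Q K) X" "fiso Q (restr (cemb Q K) X) (cemb Q B)" by (rule fhall_nonzero) blast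
      have Xne: "X \<noteq> (\<lambda>i. {0})"
        using fiso_zero_iff[OF fsub_frep[OF cemb_frep[OF K] X(1)] Bf X(2)] Bne unfolding restr_simps by blast
      have "fV (cemb Q K) \<noteq> (\<lambda>i. {0})"
      proof
        assume z: "fV (cemb Q K) = (\<lambda>i. {0})"
        have "X = (\<lambda>i. {0})" by (rule fsub_eq_zero[OF X(1)]) (use fsub_in[OF X(1)] z in simp)
        then show False using Xne by blast
      qed
      from cuspidal_coeff_zero[OF f K disjI2[OF Cs] C(1) this Cne] show ?thesis by simp
    qed simp
  qed
  also have "(\<Sum>K\<in>\<K>. comult_coeff Q f (cemb Q K) (cemb Q C) * of_nat (fhall Q (cemb Q K) (cemb Q U) (cemb Q B)))
      = (\<Sum>K\<in>\<K>. comult_coeff Q f (cemb Q U) (cemb Q K) * of_nat (fhall Q (cemb Q K) (cemb Q B) (cemb Q C)))"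
    by (rule assoc[symmetric])
  also have "\<dots> = (\<Sum>K\<in>{V}. comult_coeff Q f (cemb Q U) (cemb Q K) * of_nat (fhall Q (cemb Q K) (cemb Q B) (cemb Q C)))"
  proof (rule sum.mono_neutral_right[OF fin])
    show "{V} \<subseteq> \<K>" using \<K>(2) by blast
    show "\<forall>K\<in>\<K> - {V}. comult_coeff Q f (cemb Q U) (cemb Q K) * of_nat (fhall Q (cemb Q K) (cemb Q B) (cemb Q C)) = 0"
    proof
      fix K assume K: "K \<in> \<K> - {V}"
      then have Kc: "K \<in> iso_classes Q" using \<K>(1) by blast
      have "fhall Q (cemb Q K) (cemb Q B) (cemb Q C) = 0"
      proof (rule ccontr)
        assume "fhall Q (cemb Q K) (cemb Q B) (cemb Q C) \<noteq> 0"
        with VBC have "fiso Q (cemb Q V) (cemb Q K)"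
          by (rule fhall_nonzero_unique[OF Vf cemb_frep[OF Kc] Bf Cf disjI1[OF refl] Ct Bt])
        then have "V = K" by (rule cemb_inj[OF V Kc])
        then show False using K by blast
      qed
      then show "comult_coeff Q f (cemb Q U) (cemb Q K) * of_nat (fhall Q (cemb Q K) (cemb Q B) (cemb Q C)) = 0" by simp
    qed
  qed
  finally show False using nz VBC by simp
qed

text \<open>The two factors are regular together, so outside the pairs of regular classes neither
  is, and the other alternatives of \<open>left_factor\<close> and \<open>right_factor\<close>
  hold.\<close>

lemma mixed_factors:
  fixes f :: "('i, 'e, 'k::{field,finite}) hall"
  assumes f: "regular_cuspidal Q f" and U: "U \<in> iso_classes Q" and V: "V \<in> iso_classes Q"
    and nz: "comult_coeff Q f (cemb Q U) (cemb Q V) \<noteq> 0"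
    and nonreg: "(U, V) \<notin> regular_classes Q \<times> regular_classes Q"
  shows "preinjective Q (representative U)" "preprojective Q (representative V)"
proof -
  have keys: "Poly_Mapping.keys f \<subseteq> regular_classes Q" using f unfolding regular_cuspidal_def hall_regular_def by blast
  have "\<not> semi (cemb Q U)" "\<not> semi (cemb Q V)"
    using nonreg regular_factor(4)[OF keys cemb_frep[OF U] cemb_frep[OF V] nz]
      semi_iff_regular_class[OF U] semi_iff_regular_class[OF V] by blast+
  then have "tors 1 (cemb Q U)" "tfree 0 (cemb Q V)" using left_factor[OF f U V nz] right_factor[OF f U V nz] by blast+
  then show "preinjective Q (representative U)" "preprojective Q (representative V)"
    unfolding cemb_def
    using tors_preinjective[OF iso_class_representative(1)[OF U]] tfree_preprojective[OF iso_class_representative(1)[OF V]]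
    by blast+
qed

end

theorem theorem7p1:
  fixes Q :: "('i::finite, 'e::finite) quiver"
    and f :: "('i, 'e, 'k::{field,finite}) hall"
  assumes "affine_quiver Q" and "acyclic_quiver Q"
    and "regular_cuspidal Q f"
  shows "\<exists>(S :: (('i, 'e, 'k) rep \<times> ('i, 'e, 'k) rep) set) c.
           finite S \<and>
           (\<forall>(I, P)\<in>S. preinjective Q I \<and> preprojective Q P) \<and>
           hall_comult Q f =
             (f \<otimes>\<^sub>H hall_one Q + hall_one Q \<otimes>\<^sub>H f)
             + (\<Sum>(I, P)\<in>S. hall_scale (c I P) (hall_basis Q I \<otimes>\<^sub>H hall_basis Q P))"
proof -
  interpret affine_rep Q by (rule affine_rep.intro[OF affine_form_delta[OF assms(1,2)]])
  have keys: "Poly_Mapping.keys f \<subseteq> iso_classes Q"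
    using assms(3) regular_classes_sub unfolding regular_cuspidal_def hall_regular_def by blast
  \<comment> \<open>The terms that the regular comultiplication drops; the others form the primitive
    part by cuspidality.\<close>
  define T where "T = Poly_Mapping.keys (hall_comult Q f) - regular_classes Q \<times> regular_classes Q"
  \<comment> \<open>The terms are indexed by classes, the claim by representations. Choosing
    representatives is injective because each determines its class.\<close>
  define r where "r = (\<lambda>p :: ('i, 'e, 'k) rep set \<times> ('i, 'e, 'k) rep set. (representative (fst p), representative (snd p)))"
  define c where "c = (\<lambda>I P. Poly_Mapping.lookup (hall_comult Q f) (iso_class Q I, iso_class Q P))"
  have finT: "finite T" unfolding T_def by simp
  have T: "U \<in> iso_classes Q \<and> V \<in> iso_classes Q \<and> comult_coeff Q f (cemb Q U) (cemb Q V) \<noteq> 0" if "(U, V) \<in> T" for U V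
  proof -
    have "Poly_Mapping.lookup (hall_comult Q f) (U, V) \<noteq> 0" using that unfolding T_def by (simp add: in_keys_iff)
    then show ?thesis unfolding lookup_hall_comult[OF keys] by (simp split: if_splits)
  qed
  have cls: "iso_class Q (fst (r p)) = fst p \<and> iso_class Q (snd (r p)) = snd p" if "p \<in> T" for p
  proof -
    have "fst p \<in> iso_classes Q" "snd p \<in> iso_classes Q" using T[of "fst p" "snd p"] that by auto
    then show ?thesis unfolding r_def by (simp only: fst_conv snd_conv iso_class_representative(2) simp_thms)
  qed
  have inj: "inj_on r T"
  proof (rule inj_onI)
    fix p p' assume p: "p \<in> T" "p' \<in> T" "r p = r p'"
    show "p = p'" by (rule prod_eqI) (use cls[OF p(1)] cls[OF p(2)] p(3) in auto)
  qed
  have "(\<Sum>(I, P)\<in>r ` T. hall_scale (c I P) (hall_basis Q I \<otimes>\<^sub>H hall_basis Q P))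
      = (\<Sum>p\<in>T. Poly_Mapping.single p (Poly_Mapping.lookup (hall_comult Q f) p))"
    unfolding sum.reindex[OF inj] o_def
  proof (rule sum.cong[OF refl])
    fix p assume p: "p \<in> T"
    have "hall_scale (c (fst (r p)) (snd (r p))) (hall_basis Q (fst (r p)) \<otimes>\<^sub>H hall_basis Q (snd (r p)))
        = Poly_Mapping.single p (Poly_Mapping.lookup (hall_comult Q f) p)"
    proof (rule poly_mapping_eqI)
      fix x
      show "Poly_Mapping.lookup (hall_scale (c (fst (r p)) (snd (r p))) (hall_basis Q (fst (r p)) \<otimes>\<^sub>H hall_basis Q (snd (r p)))) x
          = Poly_Mapping.lookup (Poly_Mapping.single p (Poly_Mapping.lookup (hall_comult Q f) p)) x"
        using cls[OF p] by (cases x; cases p)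
          (auto simp: lookup_hall_scale lookup_hall_tensor hall_basis_def lookup_single when_def c_def)
    qed
    then show "(case r p of (I, P) \<Rightarrow> hall_scale (c I P) (hall_basis Q I \<otimes>\<^sub>H hall_basis Q P))
        = Poly_Mapping.single p (Poly_Mapping.lookup (hall_comult Q f) p)" by (simp only: case_prod_beta)
  qed
  moreover have "hall_comult Q f = hall_comult_regular Q f
      + (\<Sum>p\<in>T. Poly_Mapping.single p (Poly_Mapping.lookup (hall_comult Q f) p))"
    by (rule poly_mapping_eqI)
      (auto simp: hall_comult_regular_def lookup_add lookup_sum_single[OF finT] lookup_sum_single T_def in_keys_iff)
  moreover have "hall_comult_regular Q f = f \<otimes>\<^sub>H hall_one Q + hall_one Q \<otimes>\<^sub>H f"
    using assms(3) unfolding regular_cuspidal_def by blast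
  ultimately have "hall_comult Q f = (f \<otimes>\<^sub>H hall_one Q + hall_one Q \<otimes>\<^sub>H f)
      + (\<Sum>(I, P)\<in>r ` T. hall_scale (c I P) (hall_basis Q I \<otimes>\<^sub>H hall_basis Q P))" by (simp only:)
  moreover have "\<forall>(I, P)\<in>r ` T. preinjective Q I \<and> preprojective Q P"
  proof -
    have "preinjective Q (representative U) \<and> preprojective Q (representative V)" if "(U, V) \<in> T" for U V
      using mixed_factors[OF assms(3), of U V] T[OF that] that unfolding T_def by blast
    then show ?thesis unfolding r_def by auto
  qed
  ultimately show ?thesis using finite_imageI[OF finT, of r] by (intro exI[of _ "r ` T"] exI[of _ c] conjI)
qed

end
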